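(* Let $q,r\ge2$. If $\alpha=1/2$, then the Martin compactification of $\mathrm{DL}(q,r)$ with respect to $P=P_{1/2}$ is the geometric compactification $\widehat{\mathrm{DL}}(q,r)$. The extension of the Martin kernel to the boundary $$\bigl(\partial^*\mathbb T_q\times\{\omega_2\}\bigr)\cup\bigl(\{\omega_1\}\times\partial^*\mathbb T_r\bigr)\cup\{\omega_1\omega_2\}\cup\bigl(\mathbb T_q\times\{\omega_2\}\bigr)\cup\bigl(\{\omega_1\}\times\mathbb T_r\bigr)$$ is given, for $x_1x_2\in \mathrm{DL}(q,r)$, by (i) $K(x_1x_2,\xi_1\omega_2)=K_1(x_1,\xi_1)$ for $\xi_1\in\partial^*\mathbb T_q$; (ii) $K(x_1x_2,\omega_1\xi_2)=K_2(x_2,\xi_2)$ for $\xi_2\in\partial^*\mathbb T_r$; (iii) $K(x_1x_2,\omega_1\omega_2)=1$; (iv) $K(x_1x_2,y_1\omega_2)=\dfrac{\phi_{\frac12,q}(x_1,y_1)}{\phi_{\frac12,q}(o_1,y_1)}$ for $y_1\in\mathbb T_q$; (v) $K(x_1x_2,\omega_1y_2)=\dfrac{\phi_{\frac12,r}(x_2,y_2)}{\phi_{\frac12,r}(o_2,y_2)}$ for $y_2\in\mathbb T_r$. Each of the kernels in (i), (ii), (iii) is a minimal harmonic function for $P$, while the ones in (iv) and (v) are non-minimal harmonic functions.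
   Context: Trees. For an integer $p\ge2$, $\mathbb T_p$ is the homogeneous tree in which every vertex has $p+1$ neighbours. An end is an equivalence class of one-sided infinite geodesic rays, two rays being equivalent if their symmetric difference is finite; $\partial\mathbb T_p$ is the set of ends and $\widehat{\mathbb T}_p=\mathbb T_p\cup\partial\mathbb T_p$. For distinct $w,z\in\widehat{\mathbb T}_p$, $\overline{w\,z}$ is the geodesic connecting them. The end topology on $\widehat{\mathbb T}_p$ has as basis the cones $\{w\in\widehat{\mathbb T}_p: y\in\overline{x\,w}\}$ with $x\ne y$ vertices; it makes $\widehat{\mathbb T}_p$ compact Hausdorff with $\mathbb T_p$ discrete and dense. Fix a root $o$ and a reference end $\omega$; put $\partial^*\mathbb T_p=\partial\mathbb T_p\setminus\{\omega\}$. The confluent $w\wedge z$ with respect to $o$ is defined by $\overline{o\,w}\cap\overline{o\,z}=\overline{o\,c}$, $c=w\wedge z$. For vertices $x,y$, $x\curlywedge y$ is the vertex $b$ with $\overline{x\,\omega}\cap\overline{y\,\omega}=\overline{b\,\omega}$. Put $\mathfrak u(x,y)=d(x,x\curlywedge y)$, $\mathfrak d(x,y)=d(y,x\curlywedge y)$, and $\mathfrak h(x)=\mathfrak d(o,x)-\mathfrak u(o,x)$. Each vertex $x$ has exactly one neighbour $x^-$ with $\mathfrak h(x^-)=\mathfrak h(x)-1$; its $p$ other neighbours (successors) $y$ satisfy $y^-=x$. Diestel-Leader graph. Let $\mathbb T_q,\mathbb T_r$ have roots $o_1,o_2$ and reference ends $\omega_1,\omega_2$. The vertex set is $\mathrm{DL}(q,r)=\{x_1x_2\in\mathbb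 T_q\times\mathbb T_r:\mathfrak h(x_1)+\mathfrak h(x_2)=0\}$, with $x_1x_2\sim y_1y_2$ iff $x_1\sim y_1$ and $x_2\sim y_2$; reference point $o=o_1o_2$. The geometric compactification $\widehat{\mathrm{DL}}(q,r)$ is the closure of $\mathrm{DL}(q,r)$ in $\widehat{\mathbb T}_q\times\widehat{\mathbb T}_r$. Random walks. $P_\alpha$ on $\mathrm{DL}(q,r)$ has transition probabilities $p_\alpha(x,y)=\alpha/q$ if $y_1^-=x_1$ and $y_2=x_2^-$; $(1-\alpha)/r$ if $y_1=x_1^-$ and $y_2^-=x_2$; and $0$ otherwise. For $a\in(0,1)$, $P_{a,p}$ on $\mathbb T_p$ moves from $v$ to each of its $p$ successors with probability $a/p$ and to $v^-$ with probability $1-a$. The projections of $P_\alpha$ on the two trees are $P_1=P_{\alpha,q}$ on $\mathbb T_q$ and $P_2=P_{1-\alpha,r}$ on $\mathbb T_r$ (here $\alpha=1/2$). Martin theory. For a transient irreducible transition matrix $P$ with reference point $o$, $G(x,y)=\sum_{n\ge0}p^{(n)}(x,y)$ and $K(x,y)=G(x,y)/G(o,y)$. The Martin compactification is the smallest metrizable compactification of the state space $X$ containing $X$ as a discrete dense subset to which all functions $K(x,\cdot)$, $x\in X$, extend continuously; the extension is again denoted $K$. Compactifications of $X$ are identified when the identity on $X$ extends to a homeomorphism. A function $h$ is harmonic if $Ph=h$; a positive harmonic $h$ is minimal if $h(o)=1$ and every positive harmonic $h_1\le h$ is a constant multiple of $h$. $K_1,K_2$ are the extended Martin kernels of $P_1,P_2$: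 with $F_i(v,w)$ the probability that the $P_i$-walk started at $v$ ever hits $w$, one has for an end $\xi_i$ of the $i$-th tree $K_i(x_i,\xi_i)=F_i(x_i,c_i)/F_i(o_i,c_i)$, where $c_i=x_i\wedge\xi_i$. Spherical functions at $\alpha=1/2$: for $p\ge2$ and vertices $x,y$ of $\mathbb T_p$, $\phi_{\frac12,p}(x,y)=p^{-\mathfrak d(x,y)}\left(\frac{p+1}{p-1}+d(x,y)\right)$, where $d(x,y)=\mathfrak u(x,y)+\mathfrak d(x,y)$ is the graph distance. *)

theory Defs
  imports "HOL-Probability.Probability"
begin

text \<open>The vertices of a tree are all elements of its vertex type. The reference end is an
  equivalence class of rays, see \<open>ends\<close> below.\<close>

record 'a pointed_tree =
  adj :: "'a \<Rightarrow> 'a \<Rightarrow> bool"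
  base :: 'a
  ref_end :: "(nat \<Rightarrow> 'a) set"

definition graph_dist :: "('a \<Rightarrow> 'a \<Rightarrow> bool) \<Rightarrow> 'a \<Rightarrow> 'a \<Rightarrow> nat" where
  "graph_dist E x y = (LEAST n. (E ^^ n) x y)"

definition is_tree :: "('a \<Rightarrow> 'a \<Rightarrow> bool) \<Rightarrow> bool" where
  "is_tree E \<longleftrightarrow> symp E \<and> irreflp E \<and> (\<forall>x y. E\<^sup>*\<^sup>* x y) \<and>
     \<not> (\<exists>xs. length xs \<ge> 3 \<and> distinct xs \<and> successively E xs \<and> E (last xs) (hd xs))"

definition is_geodesic :: "('a \<Rightarrow> 'a \<Rightarrow> bool) \<Rightarrow> nat set \<Rightarrow> (nat \<Rightarrow> 'a) \<Rightarrow> bool" where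
  "is_geodesic E I \<gamma> \<longleftrightarrow> (\<forall>i\<in>I. \<forall>j\<in>I. int (graph_dist E (\<gamma> i) (\<gamma> j)) = \<bar>int i - int j\<bar>)"

definition rays :: "('a \<Rightarrow> 'a \<Rightarrow> bool) \<Rightarrow> (nat \<Rightarrow> 'a) set" where
  "rays E = {\<gamma>. is_geodesic E UNIV \<gamma>}"

definition ray_equiv :: "('a \<Rightarrow> 'a \<Rightarrow> bool) \<Rightarrow> ((nat \<Rightarrow> 'a) \<times> (nat \<Rightarrow> 'a)) set" where
  "ray_equiv E = {(\<gamma>, \<gamma>'). \<gamma> \<in> rays E \<and> \<gamma>' \<in> rays E \<and>
     finite ((range \<gamma> - range \<gamma>') \<union> (range \<gamma>' - range \<gamma>))}"

definition ends :: "('a \<Rightarrow> 'a \<Rightarrow> bool) \<Rightarrow> (nat \<Rightarrow> 'a) set set" where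
  "ends E = rays E // ray_equiv E"

definition homogeneous_tree :: "nat \<Rightarrow> 'a pointed_tree \<Rightarrow> bool" where
  "homogeneous_tree p T \<longleftrightarrow> is_tree (adj T) \<and> (\<forall>x. card {y. adj T x y} = p + 1) \<and>
     ref_end T \<in> ends (adj T)"

datatype 'a tree_point = Vertex 'a | End "(nat \<Rightarrow> 'a) set"

definition tree_hat :: "('a \<Rightarrow> 'a \<Rightarrow> bool) \<Rightarrow> 'a tree_point set" where
  "tree_hat E = range Vertex \<union> End ` ends E"

text \<open>The set of vertices on the geodesic from a vertex to a vertex or to an end (the end
  itself is not included).\<close>

fun geod :: "('a \<Rightarrow> 'a \<Rightarrow> bool) \<Rightarrow> 'a \<Rightarrow> 'a tree_point \<Rightarrow> 'a set" where
  "geod E x (Vertex y) =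
     {v. \<exists>\<gamma> n. is_geodesic E {..n} \<gamma> \<and> \<gamma> 0 = x \<and> \<gamma> n = y \<and> v \<in> \<gamma> ` {..n}}"
| "geod E x (End \<xi>) = {v. \<exists>\<gamma>\<in>\<xi>. \<gamma> 0 = x \<and> v \<in> range \<gamma>}"

definition cone :: "('a \<Rightarrow> 'a \<Rightarrow> bool) \<Rightarrow> 'a \<Rightarrow> 'a \<Rightarrow> 'a tree_point set" where
  "cone E x y = {w \<in> tree_hat E. y \<in> geod E x w}"

text \<open>Finite intersections of cones are formed here: a singleton vertex is open as the
  intersection of the cones based at its neighbours, although it is not itself a cone.\<close>

definition end_topology :: "('a \<Rightarrow> 'a \<Rightarrow> bool) \<Rightarrow> 'a tree_point topology" where
  "end_topology E = topology_generated_by {cone E x y | x y. x \<noteq> y}"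

text \<open>The confluent with respect to the root, for the case where it is a vertex (that is, unless
  both arguments are the same end).\<close>

definition confluent :: "'a pointed_tree \<Rightarrow> 'a tree_point \<Rightarrow> 'a tree_point \<Rightarrow> 'a" where
  "confluent T w z =
     (THE c. geod (adj T) (base T) w \<inter> geod (adj T) (base T) z = geod (adj T) (base T) (Vertex c))"

definition meet :: "'a pointed_tree \<Rightarrow> 'a \<Rightarrow> 'a \<Rightarrow> 'a" where
  "meet T x y = (THE b. geod (adj T) x (End (ref_end T)) \<inter> geod (adj T) y (End (ref_end T))
                          = geod (adj T) b (End (ref_end T)))"

definition up :: "'a pointed_tree \<Rightarrow> 'a \<Rightarrow> 'a \<Rightarrow> nat" where
  "up T x y = graph_dist (adj T) x (meet T x y)"

definition down :: "'a pointed_tree \<Rightarrow> 'a \<Rightarrow> 'a \<Rightarrow> nat" where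
  "down T x y = graph_dist (adj T) y (meet T x y)"

definition height :: "'a pointed_tree \<Rightarrow> 'a \<Rightarrow> int" where
  "height T x = int (down T (base T) x) - int (up T (base T) x)"

definition pred_vertex :: "'a pointed_tree \<Rightarrow> 'a \<Rightarrow> 'a" where
  "pred_vertex T x = (THE y. adj T x y \<and> height T y = height T x - 1)"

definition proper_ends :: "'a pointed_tree \<Rightarrow> (nat \<Rightarrow> 'a) set set" where
  "proper_ends T = ends (adj T) - {ref_end T}"

definition spherical_half :: "nat \<Rightarrow> 'a pointed_tree \<Rightarrow> 'a \<Rightarrow> 'a \<Rightarrow> real" where
  "spherical_half p T x y =
     real p powi (- int (down T x y)) *
       ((real p + 1) / (real p - 1) + real (graph_dist (adj T) x y))"

definition DL :: "'a pointed_tree \<Rightarrow> 'b pointed_tree \<Rightarrow> ('a \<times> 'b) set" where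
  "DL T1 T2 = {(x1, x2). height T1 x1 + height T2 x2 = 0}"

definition dl_embed :: "'a \<times> 'b \<Rightarrow> 'a tree_point \<times> 'b tree_point" where
  "dl_embed x = (Vertex (fst x), Vertex (snd x))"

definition DL_hat ::
  "'a pointed_tree \<Rightarrow> 'b pointed_tree \<Rightarrow> ('a tree_point \<times> 'b tree_point) topology" where
  "DL_hat T1 T2 =
     (let Z = prod_topology (end_topology (adj T1)) (end_topology (adj T2))
      in subtopology Z (Z closure_of (dl_embed ` DL T1 T2)))"

text \<open>The walk on \<open>DL T1 T2\<close>; the values off this set play no role.\<close>

definition dl_step ::
  "real \<Rightarrow> nat \<Rightarrow> nat \<Rightarrow> 'a pointed_tree \<Rightarrow> 'b pointed_tree \<Rightarrow> 'a \<times> 'b \<Rightarrow> 'a \<times> 'b \<Rightarrow> real" where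
  "dl_step \<alpha> q r T1 T2 x y =
     (if pred_vertex T1 (fst y) = fst x \<and> snd y = pred_vertex T2 (snd x) then \<alpha> / real q
      else if fst y = pred_vertex T1 (fst x) \<and> pred_vertex T2 (snd y) = snd x then (1 - \<alpha>) / real r
      else 0)"

definition tree_step :: "real \<Rightarrow> nat \<Rightarrow> 'a pointed_tree \<Rightarrow> 'a \<Rightarrow> 'a \<Rightarrow> real" where
  "tree_step a p T v w =
     (if pred_vertex T w = v then a / real p
      else if w = pred_vertex T v then 1 - a
      else 0)"

definition transition_matrix :: "'s set \<Rightarrow> ('s \<Rightarrow> 's \<Rightarrow> real) \<Rightarrow> bool" where
  "transition_matrix X P \<longleftrightarrow> (\<forall>x\<in>X. (\<forall>y\<in>X. P x y \<ge> 0) \<and> (P x has_sum 1) X)"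

primrec nstep :: "'s set \<Rightarrow> ('s \<Rightarrow> 's \<Rightarrow> real) \<Rightarrow> nat \<Rightarrow> 's \<Rightarrow> 's \<Rightarrow> real" where
  "nstep X P 0 x y = (if x = y then 1 else 0)"
| "nstep X P (Suc n) x y = (\<Sum>\<^sub>\<infinity>z\<in>X. P x z * nstep X P n z y)"

definition irreducible_chain :: "'s set \<Rightarrow> ('s \<Rightarrow> 's \<Rightarrow> real) \<Rightarrow> bool" where
  "irreducible_chain X P \<longleftrightarrow> (\<forall>x\<in>X. \<forall>y\<in>X. \<exists>n. nstep X P n x y > 0)"

definition transient_chain :: "'s set \<Rightarrow> ('s \<Rightarrow> 's \<Rightarrow> real) \<Rightarrow> bool" where
  "transient_chain X P \<longleftrightarrow> (\<forall>x\<in>X. \<forall>y\<in>X. summable (\<lambda>n. nstep X P n x y))"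

definition green :: "'s set \<Rightarrow> ('s \<Rightarrow> 's \<Rightarrow> real) \<Rightarrow> 's \<Rightarrow> 's \<Rightarrow> real" where
  "green X P x y = (\<Sum>n. nstep X P n x y)"

definition martin_kernel :: "'s set \<Rightarrow> ('s \<Rightarrow> 's \<Rightarrow> real) \<Rightarrow> 's \<Rightarrow> 's \<Rightarrow> 's \<Rightarrow> real" where
  "martin_kernel X P ref x y = green X P x y / green X P ref y"

text \<open>The law on trajectory space of the chain started at \<open>v\<close>, for a transition matrix on a whole
  countable type; it is determined by the probabilities of cylinder sets.\<close>

definition path_law :: "('s \<Rightarrow> 's \<Rightarrow> real) \<Rightarrow> 's \<Rightarrow> (nat \<Rightarrow> 's) measure" where
  "path_law P v =
     (THE M. prob_space M \<and> sets M = sets (\<Pi>\<^sub>M i\<in>UNIV. count_space UNIV) \<and>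
        (\<forall>n s. measure M {\<omega>. \<forall>i\<le>n. \<omega> i = s i} =
                 (if s 0 = v then \<Prod>i<n. P (s i) (s (Suc i)) else 0)))"

definition hit_prob :: "('s \<Rightarrow> 's \<Rightarrow> real) \<Rightarrow> 's \<Rightarrow> 's \<Rightarrow> real" where
  "hit_prob P v w = measure (path_law P v) {\<omega>. \<exists>n. \<omega> n = w}"

definition tree_end_kernel ::
  "'a pointed_tree \<Rightarrow> ('a \<Rightarrow> 'a \<Rightarrow> real) \<Rightarrow> 'a \<Rightarrow> (nat \<Rightarrow> 'a) set \<Rightarrow> real" where
  "tree_end_kernel T P x \<xi> =
     (let c = confluent T (Vertex x) (End \<xi>) in hit_prob P x c / hit_prob P (base T) c)"

definition metrizable_compactification :: "'s set \<Rightarrow> 'z topology \<Rightarrow> ('s \<Rightarrow> 'z) \<Rightarrow> bool" where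
  "metrizable_compactification X Z \<iota> \<longleftrightarrow>
     compact_space Z \<and> metrizable_space Z \<and> inj_on \<iota> X \<and> \<iota> ` X \<subseteq> topspace Z \<and>
     subtopology Z (\<iota> ` X) = discrete_topology (\<iota> ` X) \<and> Z closure_of (\<iota> ` X) = topspace Z"

definition kernel_extension ::
  "'s set \<Rightarrow> ('s \<Rightarrow> 's \<Rightarrow> real) \<Rightarrow> 's \<Rightarrow> 'z topology \<Rightarrow> ('s \<Rightarrow> 'z) \<Rightarrow> 's \<Rightarrow> ('z \<Rightarrow> real) \<Rightarrow> bool" where
  "kernel_extension X P ref Z \<iota> x g \<longleftrightarrow>
     continuous_map Z euclideanreal g \<and> (\<forall>y\<in>X. g (\<iota> y) = martin_kernel X P ref x y)"

definition kernel_compactification ::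
  "'s set \<Rightarrow> ('s \<Rightarrow> 's \<Rightarrow> real) \<Rightarrow> 's \<Rightarrow> 'z topology \<Rightarrow> ('s \<Rightarrow> 'z) \<Rightarrow> bool" where
  "kernel_compactification X P ref Z \<iota> \<longleftrightarrow>
     metrizable_compactification X Z \<iota> \<and> (\<forall>x\<in>X. \<exists>g. kernel_extension X P ref Z \<iota> x g)"

text \<open>\<open>Z\<close> is the smallest compactification to which the kernels extend: it is the image of every
  other one under a continuous map that is the identity on \<open>X\<close>. The competitors live on
  the type \<open>'y\<close>, which is an explicit parameter so that it can be universally quantified in
  theorems. This determines \<open>Z\<close> up to a homeomorphism extending the identity on \<open>X\<close>.\<close>

definition is_martin_compactification ::
  "'y itself \<Rightarrow> 's set \<Rightarrow> ('s \<Rightarrow> 's \<Rightarrow> real) \<Rightarrow> 's \<Rightarrow> 'z topology \<Rightarrow> ('s \<Rightarrow> 'z) \<Rightarrow> bool" where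
  "is_martin_compactification TYPE('y) X P ref Z \<iota> \<longleftrightarrow>
     transition_matrix X P \<and> irreducible_chain X P \<and> transient_chain X P \<and>
     kernel_compactification X P ref Z \<iota> \<and>
     (\<forall>(Y :: 'y topology) j. kernel_compactification X P ref Y j \<longrightarrow>
        (\<exists>f. continuous_map Y Z f \<and> (\<forall>x\<in>X. f (j x) = \<iota> x)))"

definition extended_kernel ::
  "'s set \<Rightarrow> ('s \<Rightarrow> 's \<Rightarrow> real) \<Rightarrow> 's \<Rightarrow> 'z topology \<Rightarrow> ('s \<Rightarrow> 'z) \<Rightarrow> 's \<Rightarrow> 'z \<Rightarrow> real" where
  "extended_kernel X P ref Z \<iota> x =
     (THE g. g \<in> extensional (topspace Z) \<and> kernel_extension X P ref Z \<iota> x g)"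

definition positive_harmonic :: "'s set \<Rightarrow> ('s \<Rightarrow> 's \<Rightarrow> real) \<Rightarrow> ('s \<Rightarrow> real) \<Rightarrow> bool" where
  "positive_harmonic X P h \<longleftrightarrow>
     (\<forall>x\<in>X. h x > 0 \<and> ((\<lambda>y. P x y * h y) has_sum h x) X)"

definition minimal_harmonic :: "'s set \<Rightarrow> ('s \<Rightarrow> 's \<Rightarrow> real) \<Rightarrow> 's \<Rightarrow> ('s \<Rightarrow> real) \<Rightarrow> bool" where
  "minimal_harmonic X P ref h \<longleftrightarrow> positive_harmonic X P h \<and> h ref = 1 \<and>
     (\<forall>h1. positive_harmonic X P h1 \<and> (\<forall>x\<in>X. h1 x \<le> h x) \<longrightarrow> (\<exists>c. \<forall>x\<in>X. h1 x = c * h x))"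

end

theory Submission
  imports Defs
begin

text \<open>The reference end turns each tree into a forest order: a vertex is coded by the chain of its
  ancestors, an end by the increasing union of the chains along a ray, and the end topology becomes
  pointwise convergence of chains. Project a walk on the product to heights: inside the strip between
  the \<open>i\<close>-th ancestor in the first tree and the \<open>j\<close>-th ancestor in the second it is a simple random
  walk killed on leaving an interval. Weighting the Green functions of these intervals by averages
  over descendants gives a series for the Green function on the product, and summation by parts
  turns it into \<open>q\<close> and \<open>r\<close> powers times a double geometric series of explicit rational terms, from
  which all limits of the Martin kernel are read off. It is the Green function because bounded
  harmonic functions are constant and the difference of the two takes arbitrarily small values.

  The limit kernels together with the indicators of the points of the product separate the points of
  the geometric compactification: for two siblings \<open>v, v'\<close> the kernel is larger at \<open>v\<close> than at \<open>v'\<close>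
  exactly if \<open>v\<close> lies on the chain of the boundary point. Hence every compactification with these
  continuous functions maps onto it.

  For minimality, a harmonic function below a kernel of an end is independent of the other
  coordinate, by coupling, and hence harmonic on one tree; it is constant on the branches off the
  chain of the end by a convexity argument, and then a multiple of the kernel. The kernel of a
  vertex \<open>y\<close> is not minimal because it dominates a multiple of the kernel of the predecessor of \<open>y\<close>.\<close>

section \<open>Trees and the Busemann function of an end\<close>

text \<open>Given the height path, the first coordinate is uniform among the descendants, at the
  current level, of the ancestor at the lowest level visited so far; the second coordinate behaves
  likewise with the highest level. So the probability of standing at \<open>y\<close> depends only
  on these two extremes: if they lie \<open>i\<close> below and \<open>j\<close> above the height of
  \<open>y\<close>, it is \<open>1 / (q^i * r^j)\<close> or \<open>0\<close>. This is the form of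
  the series with \<open>visits\<close>. Its terms are positive and elementary and yield the bounds
  and the limits, but a single term does not solve the Poisson equation with a source on the level
  of \<open>y\<close>. The terms with \<open>piece\<close> do, since each belongs to one fixed
  strip. This is why two forms of the series are kept and proved equal. The probabilistic argument
  itself is not carried out: the series is checked through the Poisson equation, and the same
  equation bounds the partial sums of the Green function, which gives transience.\<close>

lemma relpowp_sym:
  assumes "symp E" shows "(E ^^ n) x y \<Longrightarrow> (E ^^ n) y x"
proof (induction n arbitrary: x y)
  case (Suc n)
  then obtain z where "(E ^^ n) x z" "E z y" by auto
  then have "(E ^^ n) z x" "E y z" using Suc assms by (auto dest: sympD)
  then show ?case by (rule relpowp_Suc_I2[rotated])
qed simp

section \<open>The graph metric, and neighbours closer to a given vertex\<close>

locale connected_graph =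
  fixes E :: "'a \<Rightarrow> 'a \<Rightarrow> bool"
  assumes sym: "symp E" and conn: "E\<^sup>*\<^sup>* x y"
begin

abbreviation "gd \<equiv> graph_dist E"

lemma graph_dist_walk: "(E ^^ gd x y) x y"
  using conn[of x y] unfolding graph_dist_def rtranclp_is_Sup_relpowp
  by (auto intro: LeastI)

lemma graph_dist_le: "(E ^^ n) x y \<Longrightarrow> gd x y \<le> n"
  unfolding graph_dist_def by (rule Least_le)

lemma graph_dist_commute: "gd x y = gd y x"
  by (meson graph_dist_walk graph_dist_le relpowp_sym[OF sym] antisym)

lemma graph_dist_eq_0: "gd x y = 0 \<longleftrightarrow> x = y"
  using graph_dist_walk[of x y] graph_dist_le[of 0 x y] by (cases "gd x y") auto

lemma graph_dist_triangle: "gd x z \<le> gd x y + gd y z"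
  by (rule graph_dist_le) (auto simp: relpowp_add intro: graph_dist_walk)

lemma graph_dist_adj: "E x y \<Longrightarrow> gd x y \<le> 1"
  by (rule graph_dist_le) auto

lemma graph_dist_closer:
  assumes "gd x z = Suc n" obtains a where "E x a" "gd a z = n"
proof -
  have "(E ^^ Suc n) x z" using graph_dist_walk[of x z] assms by simp
  then obtain a where a: "E x a" "(E ^^ n) a z" by (rule relpowp_Suc_E2)
  have "gd a z \<le> n" using a graph_dist_le by auto
  moreover have "gd x z \<le> 1 + gd a z" using graph_dist_triangle[of x z a] graph_dist_adj[OF a(1)] by simp
  ultimately show ?thesis using a assms that by auto
qed

lemma shortest_path:
  "gd x z = n \<Longrightarrow> \<exists>xs. xs \<noteq> [] \<and> hd xs = x \<and> last xs = z \<and> successively E xs \<and> distinct xs \<and>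
     (\<forall>v\<in>set xs. gd v z \<le> n)"
proof (induction n arbitrary: x)
  case 0
  then have "x = z" using graph_dist_eq_0 by auto
  then show ?case by (intro exI[of _ "[x]"]) (use 0 in auto)
next
  case (Suc n)
  obtain a where a: "E x a" "gd a z = n" using graph_dist_closer[OF Suc.prems] .
  obtain xs where xs: "xs \<noteq> []" "hd xs = a" "last xs = z" "successively E xs" "distinct xs"
      "\<forall>v\<in>set xs. gd v z \<le> n" using Suc.IH[OF a(2)] by blast
  show ?case
    by (rule exI[of _ "x # xs"]) (use xs a Suc.prems in \<open>auto simp: successively_Cons\<close>)
qed

end

text \<open>Two simple paths with the same endpoints and different first steps close up to a cycle at
  the first vertex of one of them that lies on the other.\<close>

lemma cycle_of_two_paths:
  assumes sym: "symp E"
    and xs: "successively E (x # xs)" "distinct (x # xs)"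
    and ys: "successively E (x # ys)" "distinct (x # ys)"
    and "xs \<noteq> []" "ys \<noteq> []" "last xs = last ys" "hd xs \<noteq> hd ys"
  shows "\<exists>cs. length cs \<ge> 3 \<and> distinct cs \<and> successively E cs \<and> E (last cs) (hd cs)"
proof -
  have "\<exists>v\<in>set xs. v \<in> set ys" using assms last_in_set by metis
  then obtain xs1 v xs2 where v: "xs = xs1 @ v # xs2" "v \<in> set ys" "\<forall>w\<in>set xs1. w \<notin> set ys"
    by (rule split_list_first_propE) blast
  obtain ys1 ys2 where y: "ys = ys1 @ v # ys2" using v(2) by (auto simp: in_set_conv_decomp)
  let ?cs = "x # xs1 @ v # rev ys1"
  have r: "(\<lambda>x y. E y x) = E" using sym by (auto simp: fun_eq_iff dest: sympD)
  have "successively E (x # xs1 @ [v])" using xs(1) unfolding v(1)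
    by (metis append.assoc append_Cons append_Nil successively_append_iff)
  moreover have "successively E (v # rev ys1)"
  proof -
    have "successively E (ys1 @ [v])" using ys(1) unfolding y
      by (metis append.assoc append_Cons append_Nil successively_append_iff successively_Cons)
    then have "successively E (rev (ys1 @ [v]))" by (simp only: successively_rev r)
    then show ?thesis by simp
  qed
  ultimately have "successively E ?cs"
    using successively_append_iff[of E "x # xs1" "v # rev ys1"] successively_append_iff[of E "x # xs1" "[v]"]
    by simp
  moreover have "distinct ?cs" using xs ys v(3) unfolding v(1) y by auto
  moreover have "E (last ?cs) (hd ?cs)"
    using ys(1) sym unfolding y by (cases ys1) (auto simp: successively_Cons dest: sympD)
  moreover have "length ?cs \<ge> 3"
  proof (rule ccontr)
    assume "\<not> ?thesis"
    then have "xs1 = []" "ys1 = []" by (auto simp: not_le less_Suc_eq)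
    then show False using assms by (simp add: v(1) y)
  qed
  ultimately show ?thesis by blast
qed

locale tree_graph = connected_graph E for E :: "'a \<Rightarrow> 'a \<Rightarrow> bool" +
  assumes irrefl: "irreflp E"
    and acyclic: "\<not> (\<exists>xs. length xs \<ge> 3 \<and> distinct xs \<and> successively E xs \<and> E (last xs) (hd xs))"
begin

lemma tree_path_unique_step:
  assumes "E x a" "E x b" and p: "successively E as" "distinct as" "hd as = a" "as \<noteq> []" "x \<notin> set as"
    and "successively E bs" "distinct bs" "hd bs = b" "bs \<noteq> []" "x \<notin> set bs"
    and "last as = last bs"
  shows "a = b"
proof (rule ccontr)
  assume "a \<noteq> b"
  then show False
    using cycle_of_two_paths[OF sym, of x as bs] acyclic assms by (auto simp: successively_Cons)
qed

lemma closer_neighbour_unique: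
  assumes "E x a" "E x b" "gd a z < gd x z" "gd b z < gd x z"
  shows "a = b"
proof -
  obtain as where as: "as \<noteq> []" "hd as = a" "last as = z" "successively E as" "distinct as"
     "\<forall>v\<in>set as. gd v z \<le> gd a z" using shortest_path[of a z] by blast
  obtain bs where bs: "bs \<noteq> []" "hd bs = b" "last bs = z" "successively E bs" "distinct bs"
     "\<forall>v\<in>set bs. gd v z \<le> gd b z" using shortest_path[of b z] by blast
  show ?thesis
    by (rule tree_path_unique_step[of x a b as bs]) (use as bs assms in auto)
qed

text \<open>Trees are bipartite. If \<open>x\<close> and \<open>y\<close> were equally far from
  \<open>z\<close>, a shortest path from \<open>y\<close>, and the edge to \<open>x\<close> followed
  by a shortest path from \<open>x\<close>, would leave \<open>y\<close> in different directions and
  end in the same vertex.\<close>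

lemma graph_dist_adj_ne:
  assumes "E x y" shows "gd x z \<noteq> gd y z"
proof
  assume eq: "gd x z = gd y z"
  have ne: "x \<noteq> y" using assms irrefl by (auto dest: irreflpD)
  then obtain n where n: "gd x z = Suc n" "gd y z = Suc n"
    using eq graph_dist_eq_0 by (metis not0_implies_Suc)
  obtain a where a: "E x a" "gd a z = n" using graph_dist_closer[OF n(1)] .
  obtain b where b: "E y b" "gd b z = n" using graph_dist_closer[OF n(2)] .
  obtain as where as: "as \<noteq> []" "hd as = a" "last as = z" "successively E as" "distinct as"
     "\<forall>v\<in>set as. gd v z \<le> n" using shortest_path[of a z] a by blast
  obtain bs where bs: "bs \<noteq> []" "hd bs = b" "last bs = z" "successively E bs" "distinct bs"
     "\<forall>v\<in>set bs. gd v z \<le> n" using shortest_path[of b z] b by blast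
  have "x = b"
    by (rule tree_path_unique_step[of y x b "x # as" bs])
      (use as bs a b n assms sym ne in \<open>auto simp: successively_Cons dest: sympD\<close>)
  then show False using b n by simp
qed

lemma graph_dist_adj_cases:
  assumes "E x y" shows "gd x z = Suc (gd y z) \<or> gd y z = Suc (gd x z)"
  using graph_dist_adj_ne[OF assms, of z] graph_dist_triangle[of x z y] graph_dist_triangle[of y z x]
    graph_dist_adj[OF assms] graph_dist_commute[of x y] by linarith

end

lemma tree_graph_iff: "tree_graph E \<longleftrightarrow> is_tree E"
  by (auto simp: tree_graph_def tree_graph_axioms_def connected_graph_def is_tree_def)

section \<open>The horofunction of a ray and the parent map\<close>

locale tree_ray = tree_graph E for E :: "'a \<Rightarrow> 'a \<Rightarrow> bool" +
  fixes \<gamma> :: "nat \<Rightarrow> 'a"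
  assumes ray: "\<gamma> \<in> rays E" and fin: "finite {y. E x y}"
begin

definition bus :: "nat \<Rightarrow> 'a \<Rightarrow> int" where "bus n x = int (gd x (\<gamma> n)) - int n"

definition busemann :: "'a \<Rightarrow> int" where
  "busemann x = (THE b. \<forall>\<^sub>F n in sequentially. bus n x = b)"

lemma gd_ray: "int (gd (\<gamma> i) (\<gamma> j)) = \<bar>int i - int j\<bar>"
  using ray by (simp add: rays_def is_geodesic_def)

lemma ray_adj: "E (\<gamma> n) (\<gamma> (Suc n))"
proof -
  have "gd (\<gamma> n) (\<gamma> (Suc n)) = 1" using gd_ray[of n "Suc n"] by simp
  then show ?thesis using graph_dist_walk[of "\<gamma> n" "\<gamma> (Suc n)"] by (simp add: eq_OO)
qed

lemma bus_antimono: "m \<le> n \<Longrightarrow> bus n x \<le> bus m x"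
  using graph_dist_triangle[of x "\<gamma> n" "\<gamma> m"] gd_ray[of m n] by (simp add: bus_def)

lemma bus_lower: "bus n x \<ge> - int (gd x (\<gamma> 0))"
  using graph_dist_triangle[of "\<gamma> 0" "\<gamma> n" x] gd_ray[of 0 n] graph_dist_commute[of x "\<gamma> 0"]
  by (simp add: bus_def)

text \<open>An integral sequence that is nonincreasing and bounded below is constant from any index
  on where it is minimal. Adding the lower bound turns it into natural numbers, where a minimiser
  exists.\<close>

lemma eventually_bus_const: "\<exists>b. \<forall>\<^sub>F n in sequentially. bus n x = b"
proof -
  define f where "f n = nat (bus n x + int (gd x (\<gamma> 0)))" for n
  define m where "m = (ARG_MIN f n. True)"
  have min: "f m \<le> f n" for n unfolding m_def by (rule arg_min_nat_le) simp
  have "bus n x = bus m x" if "n \<ge> m" for n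
    using min[of n] bus_antimono[OF that, of x] bus_lower[of x n] bus_lower[of x m]
    by (auto simp: f_def)
  then show ?thesis by (auto simp: eventually_sequentially)
qed

lemma eventually_busemann: "\<forall>\<^sub>F n in sequentially. bus n x = busemann x"
proof -
  obtain b where b: "\<forall>\<^sub>F n in sequentially. bus n x = b" using eventually_bus_const by blast
  have "\<exists>!b. \<forall>\<^sub>F n in sequentially. bus n x = b"
  proof (rule ex1I[of _ b])
    show "\<forall>\<^sub>F n in sequentially. bus n x = b" by (rule b)
  next
    fix c assume "\<forall>\<^sub>F n in sequentially. bus n x = c"
    with b have "\<forall>\<^sub>F n in sequentially. b = c" by eventually_elim simp
    then show "c = b" by simp
  qed
  from theI'[OF this] show ?thesis unfolding busemann_def .
qed

lemma busemann_le: "busemann x \<le> bus n x"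
proof -
  have "\<forall>\<^sub>F k in sequentially. bus k x = busemann x \<and> k \<ge> n"
    using eventually_busemann eventually_ge_at_top by (rule eventually_conj)
  then obtain k where "bus k x = busemann x" "k \<ge> n" by (auto simp: eventually_sequentially)
  then show ?thesis using bus_antimono by metis
qed

lemma busemann_ray: "busemann (\<gamma> n) = - int n"
proof -
  have "\<forall>\<^sub>F k in sequentially. bus k (\<gamma> n) = - int n"
    using eventually_ge_at_top[of n] by eventually_elim (simp add: bus_def gd_ray)
  then have "\<forall>\<^sub>F k in sequentially. busemann (\<gamma> n) = - int n"
    using eventually_busemann[of "\<gamma> n"] by eventually_elim simp
  then show ?thesis by simp
qed

lemma busemann_adj:
  assumes "E x y" shows "busemann x = busemann y + 1 \<or> busemann y = busemann x + 1"
proof -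
  have "\<forall>\<^sub>F n in sequentially. busemann x = busemann y + 1 \<or> busemann y = busemann x + 1"
    using eventually_busemann[of x] eventually_busemann[of y]
  proof eventually_elim
    case (elim n)
    then show ?case using graph_dist_adj_cases[OF assms, of "\<gamma> n"] by (auto simp: bus_def)
  qed
  then show ?thesis by simp
qed

text \<open>Local finiteness gives a single index \<open>n\<close> at which \<open>bus n\<close> has
  reached its final value at \<open>x\<close> and at all neighbours. There a lower value means being
  closer to \<open>\<gamma> n\<close>, and a tree has only one closer neighbour. The third condition
  on \<open>n\<close> forces \<open>x\<close> to differ from \<open>\<gamma> n\<close>, so that a
  closer neighbour exists.\<close>

lemma ex1_parent: "\<exists>!y. E x y \<and> busemann y = busemann x - 1"
proof -
  have "\<forall>\<^sub>F n in sequentially. (\<forall>y\<in>{y. E x y}. bus n y = busemann y) \<and> bus n x = busemann x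
      \<and> int n > - busemann x"
    using eventually_ball_finite[OF fin[of x], of "\<lambda>n y. bus n y = busemann y"] eventually_busemann
    by (intro eventually_conj) (auto intro!: eventually_sequentiallyI[of "nat (- busemann x) + 1"])
  then obtain n where n: "\<And>y. E x y \<Longrightarrow> bus n y = busemann y" "bus n x = busemann x"
      "int n > - busemann x"
    by (auto simp: eventually_sequentially)
  have iff: "busemann y = busemann x - 1 \<longleftrightarrow> gd y (\<gamma> n) < gd x (\<gamma> n)" if "E x y" for y
    using graph_dist_adj_cases[OF that, of "\<gamma> n"] n(1)[OF that] n(2) by (auto simp: bus_def)
  have "gd x (\<gamma> n) \<noteq> 0" using n(2,3) by (auto simp: bus_def)
  then obtain k where k: "gd x (\<gamma> n) = Suc k" by (auto simp: gr0_conv_Suc)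
  obtain a where "E x a" "gd a (\<gamma> n) = k" by (rule graph_dist_closer[OF k])
  then show ?thesis using iff k by (intro ex1I[of _ a]) (auto intro: closer_neighbour_unique[of x _ _ "\<gamma> n"])
qed

definition parent :: "'a \<Rightarrow> 'a" where "parent x = (THE y. E x y \<and> busemann y = busemann x - 1)"

lemma parent: "E x (parent x)" "busemann (parent x) = busemann x - 1"
  using theI'[OF ex1_parent[of x]] by (auto simp: parent_def)

lemma parent_eqI: "E x y \<Longrightarrow> busemann y = busemann x - 1 \<Longrightarrow> parent x = y"
  using ex1_parent[of x] parent[of x] by blast

lemma adj_iff_parent: "E x y \<longleftrightarrow> y = parent x \<or> x = parent y"
  using parent busemann_adj[of x y] parent_eqI sym by (metis add_diff_cancel_right' sympD)

lemma ray_parent: "\<gamma> n = (parent ^^ n) (\<gamma> 0)"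
proof (induction n)
  case (Suc n)
  have "parent (\<gamma> n) = \<gamma> (Suc n)" by (rule parent_eqI) (auto simp: busemann_ray ray_adj)
  then show ?case using Suc by simp
qed simp

lemma parent_reaches_ray:
  "bus n x = busemann x \<Longrightarrow> gd x (\<gamma> n) = k \<Longrightarrow> (parent ^^ k) x = \<gamma> n"
proof (induction k arbitrary: x)
  case 0 then show ?case by (simp add: graph_dist_eq_0)
next
  case (Suc k)
  obtain y where y: "E x y" "gd y (\<gamma> n) = k" by (rule graph_dist_closer[OF Suc.prems(2)])
  have "bus n y = busemann x - 1" using y Suc.prems by (simp add: bus_def)
  moreover have "busemann y \<ge> busemann x - 1" using busemann_adj[OF y(1)] by auto
  ultimately have b: "busemann y = busemann x - 1" "bus n y = busemann y" using busemann_le[of y n] by auto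
  then have "parent x = y" using y parent_eqI by auto
  then show ?case using Suc.IH[OF b(2) y(2)] by (simp add: funpow_swap1)
qed

text \<open>Once \<open>bus n\<close> is stationary at both vertices, both climb straight into the
  same vertex \<open>\<gamma> n\<close>.\<close>

lemma parent_common: "\<exists>m n. (parent ^^ m) x = (parent ^^ n) y"
proof -
  have "\<forall>\<^sub>F n in sequentially. bus n x = busemann x \<and> bus n y = busemann y"
    using eventually_busemann eventually_busemann by (rule eventually_conj)
  then obtain n where "bus n x = busemann x" "bus n y = busemann y" by (auto simp: eventually_sequentially)
  then show ?thesis using parent_reaches_ray[of n x] parent_reaches_ray[of n y] by metis
qed

end

section \<open>Ancestor chains\<close>

definition anc :: "('a \<Rightarrow> 'a) \<Rightarrow> 'a \<Rightarrow> 'a set" where "anc par x = range (\<lambda>n. (par ^^ n) x)"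

definition children :: "('a \<Rightarrow> 'a) \<Rightarrow> 'a \<Rightarrow> 'a set" where "children par x = {y. par y = x}"

text \<open>The number of steps from \<open>x\<close> up to its confluent with \<open>y\<close> in
  the direction of the reference end. As the cardinality of a difference of sets, its triangle
  inequality and its additivity reduce to inclusions.\<close>

definition updist :: "('a \<Rightarrow> 'a) \<Rightarrow> 'a \<Rightarrow> 'a \<Rightarrow> nat" where "updist par x y = card (anc par x - anc par y)"

definition chain :: "('a \<Rightarrow> 'a) \<Rightarrow> 'a set \<Rightarrow> bool" where
  "chain par C \<longleftrightarrow> (\<forall>v\<in>C. par v \<in> C) \<and> (\<forall>v\<in>C. \<forall>w\<in>C. par v = par w \<longrightarrow> v = w)"

text \<open>The chains that correspond to the ends.\<close>

definition line :: "('a \<Rightarrow> 'a) \<Rightarrow> 'a set \<Rightarrow> bool" where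
  "line par C \<longleftrightarrow> chain par C \<and> (\<forall>v\<in>C. \<exists>w\<in>C. par w = v)"

text \<open>The tree as seen from its reference end: only the parent map and the level are kept.
  \<open>common\<close> expresses that the tree is connected and that all climbing rays belong to
  one end; cycles are excluded because the level drops along \<open>par\<close>.\<close>

locale horotree =
  fixes par :: "'a \<Rightarrow> 'a" and lev :: "'a \<Rightarrow> int" and p :: nat
  assumes p2: "p \<ge> 2"
    and card_children: "card (children par x) = p"
    and lev_par [simp]: "lev (par x) = lev x - 1"
    and common: "\<exists>m n. (par ^^ m) x = (par ^^ n) y"
begin

abbreviation "A \<equiv> anc par"
abbreviation "ch \<equiv> children par"
abbreviation "ud \<equiv> updist par"

lemma finite_children [simp]: "finite (ch x)"
  using card_children[of x] p2 card.infinite by fastforce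

lemma children_nonempty: "ch x \<noteq> {}"
  using card_children[of x] p2 by auto

lemma mem_children [simp]: "c \<in> ch x \<longleftrightarrow> par c = x" by (simp add: children_def)

lemma lev_pow [simp]: "lev ((par ^^ n) x) = lev x - int n"
  by (induction n) auto

lemma lev_child: "c \<in> ch x \<Longrightarrow> lev c = lev x + 1" by auto

lemma pow_diff: "k \<le> n \<Longrightarrow> (par ^^ (n - k)) ((par ^^ k) x) = (par ^^ n) x"
  using fun_cong[OF funpow_add[of "n - k" k par], of x] by simp

lemma pow_in_anc [simp]: "(par ^^ n) x \<in> A x" by (auto simp: anc_def)

lemma anc_self [simp]: "x \<in> A x" using pow_in_anc[of 0 x] by simp

lemma anc_unfold: "A x = insert x (A (par x))"
proof -
  have "(par ^^ n) x \<in> insert x (A (par x))" for n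
    by (cases n) (auto simp: anc_def funpow_swap1)
  moreover have "(par ^^ n) (par x) \<in> A x" for n using pow_in_anc[of "Suc n" x] by (simp add: funpow_swap1)
  ultimately show ?thesis using anc_self[of x] unfolding anc_def by blast
qed

lemma lev_anc: "v \<in> A x \<Longrightarrow> lev v \<le> lev x" by (auto simp: anc_def)

lemma anc_level: "v \<in> A x \<Longrightarrow> v = (par ^^ nat (lev x - lev v)) x" by (auto simp: anc_def)

lemma anc_par_mem: "v \<in> A x \<Longrightarrow> par v \<in> A x"
proof -
  assume "v \<in> A x"
  then obtain n where "v = (par ^^ n) x" by (auto simp: anc_def)
  then have "par v = (par ^^ Suc n) x" by simp
  then show ?thesis using pow_in_anc[of "Suc n" x] by simp
qed

lemma anc_level_unique: "v \<in> A x \<Longrightarrow> w \<in> A x \<Longrightarrow> lev v = lev w \<Longrightarrow> v = w"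
  using anc_level[of v x] anc_level[of w x] by presburger

lemma anc_chain: "chain par (A x)"
  unfolding chain_def
proof (intro conjI ballI impI)
  fix v w assume "v \<in> A x" "w \<in> A x" and eq: "par v = par w"
  moreover have "lev v = lev w" using lev_par[of v] lev_par[of w] unfolding eq by simp
  ultimately show "v = w" using anc_level_unique[of v x w] by blast
qed (rule anc_par_mem)

lemma not_in_anc_par [simp]: "x \<notin> A (par x)" using lev_anc[of x "par x"] by auto

lemma anc_par_iff: "v \<in> A (par x) \<longleftrightarrow> v \<in> A x \<and> v \<noteq> x"
  using anc_unfold[of x] by auto

lemma chain_pow: "chain par C \<Longrightarrow> v \<in> C \<Longrightarrow> (par ^^ n) v \<in> C"
proof (induction n)
  case (Suc n)
  then show ?case unfolding chain_def by simp
qed simp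

lemma chain_anc: "chain par C \<Longrightarrow> v \<in> C \<Longrightarrow> A v \<subseteq> C"
  using chain_pow by (auto simp: anc_def)

lemma anc_trans: "v \<in> A x \<Longrightarrow> A v \<subseteq> A x" using chain_anc[OF anc_chain] .

lemma anc_inj: "A x = A y \<longleftrightarrow> x = y"
proof
  assume eq: "A x = A y"
  have "x \<in> A y" "y \<in> A x" using eq anc_self[of x] anc_self[of y] by simp_all
  moreover then have "lev x = lev y" using lev_anc[of x y] lev_anc[of y x] by simp
  ultimately show "x = y" using anc_level_unique[of x y y] anc_self[of y] by simp
qed simp

lemma common_level:
  assumes "lev x = lev y" shows "\<exists>n. (par ^^ n) x = (par ^^ n) y"
proof -
  obtain m n where mn: "(par ^^ m) x = (par ^^ n) y" using common[of x y] by blast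
  then have "lev ((par ^^ m) x) = lev ((par ^^ n) y)" by (rule arg_cong)
  then have "m = n" using assms by simp
  then show ?thesis using mn by blast
qed

text \<open>Vertices of equal level reach a common ancestor after the same number of steps, and
  injectivity of \<open>par\<close> on the chain carries the equality back down.\<close>

lemma chain_level_unique:
  assumes C: "chain par C" and "v \<in> C" "w \<in> C" "lev v = lev w" shows "v = w"
proof -
  obtain n where n: "(par ^^ n) v = (par ^^ n) w" using common_level[OF assms(4)] by blast
  have "(par ^^ n) v = (par ^^ n) w \<Longrightarrow> v = w" for n
  proof (induction n)
    case (Suc n)
    then have "par ((par ^^ n) v) = par ((par ^^ n) w)" by simp
    then show ?case using Suc.IH chain_pow[OF C] assms(2,3) C unfolding chain_def by blast
  qed simp
  then show ?thesis using n by blast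
qed

lemma chain_anc_of_level:
  assumes C: "chain par C" "v \<in> C" "w \<in> C" "lev v \<le> lev w" shows "v \<in> A w"
proof -
  have "v = (par ^^ nat (lev w - lev v)) w"
    by (rule chain_level_unique[OF C(1)]) (use assms chain_pow in auto)
  then show ?thesis by (metis pow_in_anc)
qed

lemma chain_total: "chain par C \<Longrightarrow> v \<in> C \<Longrightarrow> w \<in> C \<Longrightarrow> v \<in> A w \<or> w \<in> A v"
  using chain_anc_of_level by (metis linear)

text \<open>A chain that is not a line has a vertex without a child in the chain; by totality all
  other members are ancestors of this vertex.\<close>

lemma chain_cases:
  assumes "chain par C" obtains "line par C" | x where "C = A x"
proof (cases "line par C")
  case False
  then obtain v where v: "v \<in> C" "\<forall>w\<in>C. par w \<noteq> v" using assms by (auto simp: line_def)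
  have "C \<subseteq> A v"
  proof
    fix w assume w: "w \<in> C"
    show "w \<in> A v"
    proof (rule ccontr)
      assume n: "w \<notin> A v"
      then have "v \<in> A w" using chain_total[OF assms w v(1)] by blast
      then obtain k where k: "v = (par ^^ k) w" by (auto simp: anc_def)
      with n obtain j where "k = Suc j" by (cases k) auto
      then have "par ((par ^^ j) w) = v" using k by simp
      then show False using v(2) chain_pow[OF assms w] by blast
    qed
  qed
  then have "C = A v" using chain_anc[OF assms v(1)] by blast
  then show ?thesis using that by blast
qed (use that in blast)

lemma line_not_anc: "\<not> line par (A x)"
proof
  assume "line par (A x)"
  then have "\<exists>w\<in>A x. par w = x" unfolding line_def using anc_self by blast
  then obtain w where "w \<in> A x" "par w = x" by blast
  then show False using lev_anc[of w x] lev_par[of w] by simp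
qed

lemma line_deep:
  assumes "line par C" "C \<noteq> {}" shows "\<exists>v\<in>C. lev v = k"
proof -
  obtain v0 where v0: "v0 \<in> C" using assms by blast
  have deep: "\<exists>v\<in>C. lev v = lev v0 + int n" for n
  proof (induction n)
    case (Suc n)
    then obtain v where "v \<in> C" "lev v = lev v0 + int n" by blast
    moreover then obtain w where "w \<in> C" "par w = v" using assms by (auto simp: line_def)
    ultimately show ?case using lev_par[of w] by (intro bexI[of _ w]) auto
  qed (use v0 in auto)
  show ?thesis
  proof (cases "k \<ge> lev v0")
    case True then show ?thesis using deep[of "nat (k - lev v0)"] by auto
  next
    case False
    then have "lev ((par ^^ nat (lev v0 - k)) v0) = k" by simp
    then show ?thesis using chain_pow[OF _ v0] assms unfolding line_def by blast
  qed
qed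

lemma anc_diff_image: "\<exists>m. A x - A y = (\<lambda>n. (par ^^ n) x) ` {..<m} \<and> (par ^^ m) x \<in> A y"
proof -
  define m where "m = (LEAST m. (par ^^ m) x \<in> A y)"
  have ex: "\<exists>m. (par ^^ m) x \<in> A y" using common[of x y] by (auto simp: anc_def)
  have m: "(par ^^ m) x \<in> A y" unfolding m_def using ex by (rule LeastI_ex)
  have l: "n < m \<Longrightarrow> (par ^^ n) x \<notin> A y" for n unfolding m_def by (rule not_less_Least)
  have g: "n \<ge> m \<Longrightarrow> (par ^^ n) x \<in> A y" for n
    using chain_pow[OF anc_chain m, of "n - m"] by (simp add: pow_diff)
  have "A x - A y = (\<lambda>n. (par ^^ n) x) ` {..<m}"
  proof (intro equalityI subsetI)
    fix v assume v: "v \<in> A x - A y"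
    then obtain n where n: "v = (par ^^ n) x" by (auto simp: anc_def)
    then have "n < m" using g[of n] v by (meson DiffD2 not_le)
    then show "v \<in> (\<lambda>n. (par ^^ n) x) ` {..<m}" using n by blast
  next
    fix v assume "v \<in> (\<lambda>n. (par ^^ n) x) ` {..<m}"
    then show "v \<in> A x - A y" using l by auto
  qed
  with m show ?thesis by blast
qed

lemma inj_pow: "inj_on (\<lambda>n. (par ^^ n) x) N"
proof (rule inj_onI)
  fix m n assume "(par ^^ m) x = (par ^^ n) x"
  then have "lev ((par ^^ m) x) = lev ((par ^^ n) x)" by (rule arg_cong)
  then show "m = n" by simp
qed

lemma anc_diff_eq: "A x - A y = (\<lambda>n. (par ^^ n) x) ` {..<ud x y}"
  and pow_updist_in: "(par ^^ ud x y) x \<in> A y"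
proof -
  obtain m where m: "A x - A y = (\<lambda>n. (par ^^ n) x) ` {..<m}" "(par ^^ m) x \<in> A y"
    using anc_diff_image by blast
  then have "ud x y = m" by (simp add: updist_def card_image inj_pow)
  with m show "A x - A y = (\<lambda>n. (par ^^ n) x) ` {..<ud x y}" "(par ^^ ud x y) x \<in> A y" by auto
qed

lemma finite_anc_diff [simp]: "finite (A x - A y)" by (simp add: anc_diff_eq)

lemma pow_in_anc_iff: "(par ^^ k) x \<in> A y \<longleftrightarrow> ud x y \<le> k"
proof
  have "k < ud x y \<Longrightarrow> (par ^^ k) x \<in> A x - A y" unfolding anc_diff_eq by blast
  then show "(par ^^ k) x \<in> A y \<Longrightarrow> ud x y \<le> k" by (auto simp: not_le[symmetric])
  assume "ud x y \<le> k"
  then show "(par ^^ k) x \<in> A y"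
    using chain_pow[OF anc_chain pow_updist_in, of "k - ud x y" x y]
    by (simp add: pow_diff)
qed

lemma updist_eq_0: "ud x y = 0 \<longleftrightarrow> x \<in> A y"
  using pow_in_anc_iff[of 0 x y] by simp

text \<open>Both sides are the level of the confluent of \<open>x\<close> and
  \<open>y\<close>.\<close>

lemma lev_updist: "lev x - int (ud x y) = lev y - int (ud y x)"
proof -
  have *: "lev x - int (ud x y) \<le> lev y - int (ud y x)" for x y
  proof -
    obtain n where n: "(par ^^ ud x y) x = (par ^^ n) y" using pow_updist_in by (auto simp: anc_def)
    then have "(par ^^ n) y \<in> A x" by (metis pow_in_anc)
    then have "ud y x \<le> n" by (simp add: pow_in_anc_iff)
    moreover have "lev ((par ^^ ud x y) x) = lev ((par ^^ n) y)" using n by (rule arg_cong)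
    ultimately show ?thesis by simp
  qed
  show ?thesis using *[of x y] *[of y x] by simp
qed

lemma meet_eq: "(par ^^ ud x y) x = (par ^^ ud y x) y"
proof -
  have "nat (lev y - lev ((par ^^ ud x y) x)) = ud y x" using lev_updist[of x y] by simp
  then show ?thesis using anc_level[OF pow_updist_in, of x y] by presburger
qed

lemma anc_Int: "A x \<inter> A y = A ((par ^^ ud x y) x)"
proof
  show "A ((par ^^ ud x y) x) \<subseteq> A x \<inter> A y" using anc_trans[OF pow_in_anc] anc_trans[OF pow_updist_in] by blast
  show "A x \<inter> A y \<subseteq> A ((par ^^ ud x y) x)"
  proof
    fix v assume v: "v \<in> A x \<inter> A y"
    then obtain k where k: "v = (par ^^ k) x" by (auto simp: anc_def)
    then have "ud x y \<le> k" using v pow_in_anc_iff by auto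
    then have "v = (par ^^ (k - ud x y)) ((par ^^ ud x y) x)"
      by (simp add: k pow_diff)
    then show "v \<in> A ((par ^^ ud x y) x)" by (metis pow_in_anc)
  qed
qed

lemma updist_self [simp]: "ud x x = 0" by (simp add: updist_eq_0)

lemma updist_par_left:
  assumes "x \<notin> A y" shows "ud x y = Suc (ud (par x) y)"
proof -
  have "A x - A y = insert x (A (par x) - A y)" using assms by (auto simp: anc_par_iff)
  moreover have "finite (A (par x) - A y)" "x \<notin> A (par x) - A y" by auto
  ultimately show ?thesis unfolding updist_def by (metis card_insert_disjoint)
qed

lemma updist_par_left': "x \<in> A y \<Longrightarrow> ud (par x) y = 0"
  by (simp add: updist_eq_0 anc_par_mem)

lemma updist_par_right:
  assumes "y \<in> A x" shows "ud x (par y) = Suc (ud x y)"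
proof -
  have "A x - A (par y) = insert y (A x - A y)" using assms by (auto simp: anc_par_iff)
  moreover have "finite (A x - A y)" "y \<notin> A x - A y" by auto
  ultimately show ?thesis unfolding updist_def by (metis card_insert_disjoint)
qed

lemma updist_par_right':
  assumes "y \<notin> A x" shows "ud x (par y) = ud x y"
proof -
  have "A x - A (par y) = A x - A y" using assms by (auto simp: anc_par_iff)
  then show ?thesis by (simp add: updist_def)
qed

text \<open>The hypotheses place \<open>c\<close> between \<open>x\<close> and \<open>y\<close>; the
  difference counted by \<open>ud x y\<close> then splits into two disjoint ones.\<close>

lemma updist_additive:
  assumes "A x \<inter> A y \<subseteq> A c" "A c \<subseteq> A x \<union> A y"
  shows "ud x y = ud x c + ud c y"
proof -
  have "A x - A y = (A x - A c) \<union> (A c - A y)" "(A x - A c) \<inter> (A c - A y) = {}" using assms by blast+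
  then show ?thesis unfolding updist_def by (metis card_Un_disjoint finite_anc_diff)
qed

lemma updist_triangle: "ud x z \<le> ud x y + ud y z"
proof -
  have "ud x z \<le> card ((A x - A y) \<union> (A y - A z))" unfolding updist_def by (rule card_mono) auto
  also have "\<dots> \<le> ud x y + ud y z" unfolding updist_def by (rule card_Un_le)
  finally show ?thesis .
qed

text \<open>The ternary median of the tree is the majority of three chains.\<close>

lemma majority_chain:
  assumes "chain par B" "chain par C" "chain par D"
  shows "chain par ((B \<inter> C) \<union> (B \<inter> D) \<union> (C \<inter> D))"
  using assms unfolding chain_def by blast

text \<open>Each of the three intersections involves \<open>A x\<close> or \<open>A y\<close>, so
  levels in the majority are bounded; it is therefore not a line and has a lowest vertex. With
  \<open>C\<close> the chain of an end and \<open>x\<close>, \<open>y\<close> the root and another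
  vertex, this vertex is the confluent.\<close>

lemma exists_median:
  assumes "chain par C"
  obtains c where "A c = (A x \<inter> A y) \<union> (A x \<inter> C) \<union> (A y \<inter> C)"
proof -
  let ?M = "(A x \<inter> A y) \<union> (A x \<inter> C) \<union> (A y \<inter> C)"
  have M: "chain par ?M" by (rule majority_chain[OF anc_chain anc_chain assms])
  have "\<not> line par ?M"
  proof
    assume l: "line par ?M"
    have "?M \<noteq> {}" using anc_Int[of x y] anc_self by blast
    from line_deep[OF l this, of "max (lev x) (lev y) + 1"] show False using lev_anc by force
  qed
  then obtain c where "?M = A c" using chain_cases[OF M] by blast
  then show ?thesis using that[of c] by simp
qed

lemma desc_exists: "\<exists>y. (par ^^ n) y = x"
proof (induction n arbitrary: x)
  case (Suc n)
  obtain z where "par z = x" using children_nonempty by fastforce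
  moreover obtain y where "(par ^^ n) y = z" using Suc by blast
  ultimately show ?case by auto
qed simp

lemma lev_surj: "\<exists>x. lev x = k"
proof -
  obtain x :: 'a where True by simp
  show ?thesis
  proof (cases "k \<le> lev x")
    case True
    then have "lev ((par ^^ nat (lev x - k)) x) = k" by simp
    then show ?thesis ..
  next
    case False
    obtain y where y: "(par ^^ nat (k - lev x)) y = x" using desc_exists by blast
    have "lev x = lev y - int (nat (k - lev x))" using lev_pow[of "nat (k - lev x)" y] unfolding y .
    then show ?thesis using False by (intro exI[of _ y]) simp
  qed
qed

lemma finite_desc: "finite {y. (par ^^ n) y = x}"
proof (induction n arbitrary: x)
  case (Suc n)
  have "{y. (par ^^ Suc n) y = x} = (\<Union>z\<in>ch x. {y. (par ^^ n) y = z})" by auto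
  then show ?case using Suc by simp
qed simp

lemma countable_vertices: "countable (UNIV :: 'a set)"
proof -
  obtain x :: 'a where True by simp
  have "y \<in> (\<Union>n m. {y. (par ^^ m) y = (par ^^ n) x})" for y using common[of y x] by auto
  then have "UNIV = (\<Union>n m. {y. (par ^^ m) y = (par ^^ n) x})" by blast
  moreover have "countable \<dots>" by (intro countable_UN countableI_type) (rule countable_finite, rule finite_desc)
  ultimately show ?thesis by simp
qed

lemma other_sibling: obtains v' where "v' \<noteq> v" "par v' = par v"
proof -
  have "card (ch (par v)) \<ge> 2" using card_children p2 by simp
  then have "\<not> ch (par v) \<subseteq> {v}" using card_mono[of "{v}" "ch (par v)"] by auto
  then obtain v' where "v' \<in> ch (par v)" "v' \<noteq> v" by blast
  then show ?thesis using that[of v'] by simp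
qed

end

section \<open>Ends as chains\<close>

context connected_graph begin

lemma relpowp_geodesic:
  assumes "(E ^^ gd x y) x y"
  obtains \<gamma> where "is_geodesic E {..gd x y} \<gamma>" "\<gamma> 0 = x" "\<gamma> (gd x y) = y"
proof -
  obtain \<gamma> where g: "\<gamma> 0 = x" "\<gamma> (gd x y) = y" "\<forall>i<gd x y. E (\<gamma> i) (\<gamma> (Suc i))"
    using assms unfolding relpowp_fun_conv by blast
  have le: "gd (\<gamma> i) (\<gamma> (i + k)) \<le> k" if "i + k \<le> gd x y" for i k
    using that
  proof (induction k)
    case (Suc k)
    have "gd (\<gamma> i) (\<gamma> (i + Suc k)) \<le> gd (\<gamma> i) (\<gamma> (i + k)) + gd (\<gamma> (i + k)) (\<gamma> (i + Suc k))"
      by (rule graph_dist_triangle)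
    also have "gd (\<gamma> (i + k)) (\<gamma> (i + Suc k)) \<le> 1" using g Suc.prems by (intro graph_dist_adj) auto
    finally show ?case using Suc by simp
  qed (simp add: graph_dist_eq_0)
  have eq: "gd (\<gamma> i) (\<gamma> (i + k)) = k" if "i + k \<le> gd x y" for i k
    using le[OF that] le[of 0 i] le[of "i + k" "gd x y - (i + k)"] that g
      graph_dist_triangle[of x y "\<gamma> i"] graph_dist_triangle[of "\<gamma> i" y "\<gamma> (i + k)"] by simp
  have "int (gd (\<gamma> i) (\<gamma> j)) = \<bar>int i - int j\<bar>" if "i \<le> gd x y" "j \<le> gd x y" for i j
    using eq[of i "j - i"] eq[of j "i - j"] that graph_dist_commute[of "\<gamma> i" "\<gamma> j"]
    by (cases "i \<le> j") auto
  then have "is_geodesic E {..gd x y} \<gamma>" by (auto simp: is_geodesic_def)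
  then show ?thesis by (rule that[OF _ g(1,2)])
qed

text \<open>Geodesics from \<open>x\<close> to \<open>v\<close> and from \<open>v\<close> to
  \<open>y\<close> can be concatenated: any shortcut between points on different pieces would
  contradict that their lengths add up to the distance of \<open>x\<close> and
  \<open>y\<close>.\<close>

lemma geod_Vertex_iff: "v \<in> geod E x (Vertex y) \<longleftrightarrow> gd x v + gd v y = gd x y"
proof
  assume "v \<in> geod E x (Vertex y)"
  then obtain \<gamma> n i where g: "is_geodesic E {..n} \<gamma>" "\<gamma> 0 = x" "\<gamma> n = y" "v = \<gamma> i" "i \<le> n" by auto
  have "int (gd (\<gamma> 0) (\<gamma> i)) = int i" "int (gd (\<gamma> i) (\<gamma> n)) = int n - int i" "int (gd (\<gamma> 0) (\<gamma> n)) = int n"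
    using g(1)[unfolded is_geodesic_def, rule_format, of 0 i] g(1)[unfolded is_geodesic_def, rule_format, of i n]
      g(1)[unfolded is_geodesic_def, rule_format, of 0 n] g(5) by simp_all
  then show "gd x v + gd v y = gd x y" using g by simp
next
  assume eq: "gd x v + gd v y = gd x y"
  let ?a = "gd x v"
  obtain \<gamma>1 where g1: "is_geodesic E {..?a} \<gamma>1" "\<gamma>1 0 = x" "\<gamma>1 ?a = v"
    using relpowp_geodesic[OF graph_dist_walk] .
  obtain \<gamma>2 where g2: "is_geodesic E {..gd v y} \<gamma>2" "\<gamma>2 0 = v" "\<gamma>2 (gd v y) = y"
    using relpowp_geodesic[OF graph_dist_walk] .
  define \<gamma> where "\<gamma> i = (if i \<le> ?a then \<gamma>1 i else \<gamma>2 (i - ?a))" for i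
  have d: "gd x (\<gamma>1 i) = i" "gd (\<gamma>1 i) v = ?a - i" if "i \<le> ?a" for i
  proof -
    have "int (gd (\<gamma>1 0) (\<gamma>1 i)) = int i" "int (gd (\<gamma>1 i) (\<gamma>1 ?a)) = int ?a - int i"
      using g1(1)[unfolded is_geodesic_def, rule_format, of 0 i]
        g1(1)[unfolded is_geodesic_def, rule_format, of i ?a] that by simp_all
    then show "gd x (\<gamma>1 i) = i" "gd (\<gamma>1 i) v = ?a - i" using g1 by simp_all
  qed
  have e: "gd v (\<gamma>2 i) = i" "gd (\<gamma>2 i) y = gd v y - i" if "i \<le> gd v y" for i
  proof -
    have "int (gd (\<gamma>2 0) (\<gamma>2 i)) = int i" "int (gd (\<gamma>2 i) (\<gamma>2 (gd v y))) = int (gd v y) - int i"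
      using g2(1)[unfolded is_geodesic_def, rule_format, of 0 i]
        g2(1)[unfolded is_geodesic_def, rule_format, of i "gd v y"] that by simp_all
    then show "gd v (\<gamma>2 i) = i" "gd (\<gamma>2 i) y = gd v y - i" using g2 by simp_all
  qed
  have c: "gd (\<gamma>1 i) (\<gamma>2 j) = (?a - i) + j" if "i \<le> ?a" "j \<le> gd v y" for i j
    using d[OF that(1)] e[OF that(2)] eq graph_dist_triangle[of "\<gamma>1 i" "\<gamma>2 j" v]
      graph_dist_triangle[of x y "\<gamma>1 i"] graph_dist_triangle[of "\<gamma>1 i" y "\<gamma>2 j"] that by simp
  have "int (gd (\<gamma> i) (\<gamma> j)) = \<bar>int i - int j\<bar>" if "i \<le> gd x y" "j \<le> gd x y" for i j
  proof -
    consider "i \<le> ?a" "j \<le> ?a" | "i \<le> ?a" "\<not> j \<le> ?a" | "\<not> i \<le> ?a" "j \<le> ?a" | "\<not> i \<le> ?a" "\<not> j \<le> ?a" by blast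
    then show ?thesis
    proof cases
      case 1 then show ?thesis using g1(1) by (simp add: \<gamma>_def is_geodesic_def)
    next
      case 2 then show ?thesis using c[of i "j - ?a"] that eq by (simp add: \<gamma>_def)
    next
      case 3 then show ?thesis using c[of j "i - ?a"] that eq
        by (simp add: \<gamma>_def graph_dist_commute[of "\<gamma>2 (i - ?a)" "\<gamma>1 j"])
    next
      case 4
      then have "int (gd (\<gamma>2 (i - ?a)) (\<gamma>2 (j - ?a))) = \<bar>int (i - ?a) - int (j - ?a)\<bar>"
        using g2(1) that eq unfolding is_geodesic_def by simp
      with 4 show ?thesis by (simp add: \<gamma>_def)
    qed
  qed
  then have "is_geodesic E {..gd x y} \<gamma>" by (auto simp: is_geodesic_def)
  moreover have "\<gamma> (gd x y) = y"
  proof (cases "v = y")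
    case True then show ?thesis using g1 by (simp add: \<gamma>_def)
  next
    case False
    then have "gd v y > 0" "\<not> gd x y \<le> ?a" "gd x y - ?a = gd v y" using graph_dist_eq_0[of v y] eq by simp_all
    then show ?thesis using g2 by (simp add: \<gamma>_def)
  qed
  moreover have "\<gamma> 0 = x" "v = \<gamma> ?a" using g1 by (simp_all add: \<gamma>_def)
  moreover have "?a \<in> {..gd x y}" using eq by simp
  ultimately have "is_geodesic E {..gd x y} \<gamma> \<and> \<gamma> 0 = x \<and> \<gamma> (gd x y) = y \<and> v \<in> \<gamma> ` {..gd x y}"
    by blast
  then show "v \<in> geod E x (Vertex y)" unfolding geod.simps by blast
qed

end

text \<open>The lower limit of the ancestor chains along the ray; it is empty for a ray that climbs
  forever.\<close>

definition limset :: "('a \<Rightarrow> 'a) \<Rightarrow> (nat \<Rightarrow> 'a) \<Rightarrow> 'a set" where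
  "limset par \<gamma> = {v. \<exists>N. \<forall>n\<ge>N. v \<in> anc par (\<gamma> n)}"

text \<open>Points of the completed tree are identified with chains: a vertex with the set of its
  ancestors, an end with the set of vertices that are eventually ancestors along its rays. The
  reference end becomes the empty chain.\<close>

fun chain_of :: "('a \<Rightarrow> 'a) \<Rightarrow> 'a tree_point \<Rightarrow> 'a set" where
  "chain_of par (Vertex x) = anc par x"
| "chain_of par (End \<xi>) = limset par (SOME \<gamma>. \<gamma> \<in> \<xi>)"

definition end_of :: "('a \<Rightarrow> 'a \<Rightarrow> bool) \<Rightarrow> ('a \<Rightarrow> 'a) \<Rightarrow> 'a set \<Rightarrow> (nat \<Rightarrow> 'a) set" where
  "end_of E par L = {\<gamma> \<in> rays E. limset par \<gamma> = L}"

locale horo_graph = horotree par lev p for par :: "'a \<Rightarrow> 'a" and lev p +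
  fixes E :: "'a \<Rightarrow> 'a \<Rightarrow> bool"
  assumes adj: "E x y \<longleftrightarrow> y = par x \<or> x = par y"
begin

abbreviation "S \<equiv> chain_of par"
abbreviation "lms \<equiv> limset par"

lemma walk_up: "(E ^^ n) x ((par ^^ n) x)"
  by (induction n) (auto simp: adj)

lemma symE: "symp E" by (auto simp: symp_def adj)

lemma walk_exists: "(E ^^ (ud x y + ud y x)) x y"
proof -
  have "(E ^^ ud x y) x ((par ^^ ud x y) x)" by (rule walk_up)
  moreover have "(E ^^ ud y x) ((par ^^ ud x y) x) y"
    unfolding meet_eq[of x y] by (rule relpowp_sym[OF symE walk_up])
  ultimately show ?thesis by (auto simp: relpowp_add)
qed

sublocale connected_graph E
proof
  show "E\<^sup>*\<^sup>* x y" for x y using walk_exists[of x y] by (rule relpowp_imp_rtranclp)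
qed (rule symE)

lemma updist_adj: "E x y \<Longrightarrow> ud x y + ud y x \<le> 1"
proof -
  have *: "ud x (par x) + ud (par x) x = 1" for x
    using updist_par_right[of x x] updist_par_left'[of x x] by simp
  assume "E x y" then show ?thesis using *[of x] *[of y] by (auto simp: adj)
qed

text \<open>The right-hand side satisfies the triangle inequality and is at most one across an edge,
  so no walk is shorter than the one through the confluent.\<close>

lemma graph_dist_eq: "gd x y = ud x y + ud y x"
proof (rule antisym)
  show "gd x y \<le> ud x y + ud y x" by (rule graph_dist_le[OF walk_exists])
  have "(E ^^ n) x y \<Longrightarrow> ud x y + ud y x \<le> n" for n
  proof (induction n arbitrary: y)
    case (Suc n)
    then obtain z where z: "(E ^^ n) x z" "E z y" by auto
    then show ?case using Suc.IH[OF z(1)] updist_adj[OF z(2)] updist_triangle[of x y z]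
      updist_triangle[of y x z] by simp
  qed simp
  then show "ud x y + ud y x \<le> gd x y" using graph_dist_walk by blast
qed

lemma updist_pow [simp]: "ud x ((par ^^ n) x) = n" "ud ((par ^^ n) x) x = 0"
proof -
  show "ud ((par ^^ n) x) x = 0" by (simp add: updist_eq_0)
  then show "ud x ((par ^^ n) x) = n" using lev_updist[of x "(par ^^ n) x"] by simp
qed

text \<open>Equality of distances forces equality in the triangle inequalities for both
  \<open>ud\<close> counts. For finite sets this turns the inclusion of \<open>A x - A y\<close> in
  the union of the two other differences into an equality, from which both inclusions can be read
  off.\<close>

lemma between_iff:
  "gd x v + gd v y = gd x y \<longleftrightarrow> A x \<inter> A y \<subseteq> A v \<and> A v \<subseteq> A x \<union> A y"
proof
  assume "A x \<inter> A y \<subseteq> A v \<and> A v \<subseteq> A x \<union> A y"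
  then show "gd x v + gd v y = gd x y"
    using updist_additive[of x y v] updist_additive[of y x v] by (simp add: graph_dist_eq Int_commute Un_commute)
next
  assume eq: "gd x v + gd v y = gd x y"
  have e: "ud x v + ud v y = ud x y"
    using eq updist_triangle[of x y v] updist_triangle[of y x v] by (simp add: graph_dist_eq)
  have sub: "A x - A y \<subseteq> (A x - A v) \<union> (A v - A y)" by blast
  have c: "card ((A x - A v) \<union> (A v - A y)) \<le> card (A x - A y)"
    using card_Un_le[of "A x - A v" "A v - A y"] e by (simp add: updist_def)
  have "A x - A y = (A x - A v) \<union> (A v - A y)"
    by (rule card_seteq[OF _ sub c]) simp
  then show "A x \<inter> A y \<subseteq> A v \<and> A v \<subseteq> A x \<union> A y" by auto
qed

text \<open>A point of a geodesic is determined by its distance from one end. The step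
  \<open>mix\<close> treats candidates on different sides of the confluent: equal distance is then
  possible only if both are the confluent.\<close>

lemma between_unique:
  assumes z: "A x \<inter> A y \<subseteq> A z" "A z \<subseteq> A x \<union> A y"
    and w: "A x \<inter> A y \<subseteq> A w" "A w \<subseteq> A x \<union> A y" and eq: "gd x z = gd x w"
  shows "z = w"
proof -
  have eqy: "gd z y = gd w y" using z w eq between_iff[of x z y] between_iff[of x w y] by simp
  have mix: "z = w" if *: "z \<in> A x" "w \<in> A y" "A x \<inter> A y \<subseteq> A z" "A x \<inter> A y \<subseteq> A w" "gd x z = gd x w"
      "gd z y = gd w y" for z w
  proof -
    let ?m = "(par ^^ ud x y) x"
    have m: "?m \<in> A z" "?m \<in> A w" using *(3,4) pow_updist_in by auto
    obtain i where i: "z = (par ^^ i) x" using *(1) by (auto simp: anc_def)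
    obtain j where j: "w = (par ^^ j) y" using *(2) by (auto simp: anc_def)
    have "gd x z = i" by (simp add: graph_dist_eq i)
    moreover have "gd w y = j" by (simp add: graph_dist_eq j)
    moreover have "lev ?m \<le> lev z" "lev ?m \<le> lev w" using m by (blast intro: lev_anc)+
    then have "i \<le> ud x y" "j \<le> ud y x" using lev_updist[of x y] by (auto simp: i j)
    moreover have "gd x w + gd w y = gd x y" using \<open>A x \<inter> A y \<subseteq> A w\<close> *(2)
      by (auto simp: between_iff dest: anc_trans)
    ultimately have "i = ud x y" "j = ud y x" using *(5) by (auto simp: graph_dist_eq[of x y])
    then show ?thesis using meet_eq by (simp add: i j)
  qed
  have same: "z = w" if "z \<in> A x" "w \<in> A x" "gd x z = gd x w" for z w x
    using that by (auto simp: anc_def graph_dist_eq)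
  have "z \<in> A x \<or> z \<in> A y" "w \<in> A x \<or> w \<in> A y" using z w anc_self[of z] anc_self[of w] by blast+
  then show ?thesis
    using mix[of z w] mix[of w z] same[of z x w] same[of z y w] z w eq eqy
      graph_dist_commute[of z y] graph_dist_commute[of w y] by metis
qed

section \<open>Shape of rays, and the correspondence between ends and lines\<close>

lemma ray_dist: "\<gamma> \<in> rays E \<Longrightarrow> int (gd (\<gamma> i) (\<gamma> j)) = \<bar>int i - int j\<bar>"
  by (simp add: rays_def is_geodesic_def)

lemma ray_dist0: "\<gamma> \<in> rays E \<Longrightarrow> gd (\<gamma> 0) (\<gamma> j) = j"
  using ray_dist[of \<gamma> 0 j] by simp

lemma ray_E: "\<gamma> \<in> rays E \<Longrightarrow> E (\<gamma> n) (\<gamma> (Suc n))"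
  using ray_dist[of \<gamma> n "Suc n"] graph_dist_walk[of "\<gamma> n" "\<gamma> (Suc n)"] by (simp add: eq_OO)

lemma ray_inj: "\<gamma> \<in> rays E \<Longrightarrow> inj \<gamma>"
proof (rule injI)
  fix i j assume "\<gamma> \<in> rays E" "\<gamma> i = \<gamma> j"
  then show "i = j" using ray_dist[of \<gamma> i j] graph_dist_eq_0[of "\<gamma> i" "\<gamma> j"] by simp
qed

lemma ray_between:
  assumes "\<gamma> \<in> rays E" "i \<le> n"
  shows "A (\<gamma> 0) \<inter> A (\<gamma> n) \<subseteq> A (\<gamma> i)" "A (\<gamma> i) \<subseteq> A (\<gamma> 0) \<union> A (\<gamma> n)"
proof -
  have "gd (\<gamma> 0) (\<gamma> i) + gd (\<gamma> i) (\<gamma> n) = gd (\<gamma> 0) (\<gamma> n)"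
    using ray_dist[OF assms(1), of i n] assms by (simp add: ray_dist0)
  then show "A (\<gamma> 0) \<inter> A (\<gamma> n) \<subseteq> A (\<gamma> i)" "A (\<gamma> i) \<subseteq> A (\<gamma> 0) \<union> A (\<gamma> n)"
    unfolding between_iff by auto
qed

text \<open>After the first step down a ray can never climb again, since the only parent available
  is the vertex it has just left. The number \<open>m\<close> counts the climbing steps.\<close>

lemma ray_cases:
  assumes r: "\<gamma> \<in> rays E"
  obtains (up) x where "\<And>n. \<gamma> n = (par ^^ n) x"
  | (down) m x where "\<And>n. n \<le> m \<Longrightarrow> \<gamma> n = (par ^^ n) x" "\<forall>n\<ge>m. par (\<gamma> (Suc n)) = \<gamma> n"
proof (cases "\<forall>n. \<gamma> (Suc n) = par (\<gamma> n)")
  case True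
  then have "\<gamma> n = (par ^^ n) (\<gamma> 0)" for n by (induction n) auto
  then show ?thesis by (rule up)
next
  case False
  define m where "m = (LEAST n. \<gamma> (Suc n) \<noteq> par (\<gamma> n))"
  have m: "\<gamma> (Suc m) \<noteq> par (\<gamma> m)" unfolding m_def using False by (metis (mono_tags, lifting) LeastI)
  have l: "\<gamma> (Suc n) = par (\<gamma> n)" if "n < m" for n using not_less_Least[of n] that unfolding m_def by blast
  have "\<gamma> n = (par ^^ n) (\<gamma> 0)" if "n \<le> m" for n using that by (induction n) (auto simp: l)
  moreover have "\<forall>n\<ge>m. par (\<gamma> (Suc n)) = \<gamma> n"
  proof (intro allI impI)
    fix n assume "n \<ge> m" then show "par (\<gamma> (Suc n)) = \<gamma> n"
  proof (induction n rule: dec_induct)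
    case base then show ?case using ray_E[OF r, of m] m by (auto simp: adj)
  next
    case (step n)
    have "\<gamma> (Suc (Suc n)) \<noteq> \<gamma> n" using ray_inj[OF r] by (auto dest: injD)
    then show ?case using ray_E[OF r, of "Suc n"] step by (auto simp: adj)
  qed
  qed
  ultimately show ?thesis using down[of m "\<gamma> 0"] by blast
qed

lemma up_ray: "(\<lambda>n. (par ^^ n) x) \<in> rays E"
proof -
  have *: "gd ((par ^^ i) x) ((par ^^ j) x) = j - i" if "i \<le> j" for i j
  proof -
    have e: "(par ^^ j) x = (par ^^ (j - i)) ((par ^^ i) x)" using pow_diff[OF that, of x] by simp
    show ?thesis unfolding e graph_dist_eq by simp
  qed
  have "int (gd ((par ^^ i) x) ((par ^^ j) x)) = \<bar>int i - int j\<bar>" for i j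
    using *[of i j] *[of j i] graph_dist_commute[of "(par ^^ i) x" "(par ^^ j) x"] by (cases "i \<le> j") auto
  then show ?thesis by (simp add: rays_def is_geodesic_def)
qed

lemma down_pow:
  assumes "\<forall>n\<ge>m. par (\<gamma> (Suc n)) = \<gamma> n" "m \<le> i"
  shows "(par ^^ k) (\<gamma> (i + k)) = \<gamma> i"
  using assms(2) by (induction k) (auto simp: funpow_swap1 assms(1)[rule_format])

text \<open>Condition \<open>ne\<close> forbids turning back at the highest vertex
  \<open>\<gamma> m\<close>: its neighbours on the ray are then different children, so the confluent
  of a point before and a point after it is \<open>\<gamma> m\<close> itself.\<close>

lemma down_ray:
  assumes up: "\<And>n. n \<le> m \<Longrightarrow> \<gamma> n = (par ^^ n) x" and dn: "\<forall>n\<ge>m. par (\<gamma> (Suc n)) = \<gamma> n"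
    and ne: "m > 0 \<Longrightarrow> \<gamma> (Suc m) \<noteq> \<gamma> (m - 1)"
  shows "\<gamma> \<in> rays E"
proof -
  have d: "gd (\<gamma> i) (\<gamma> j) = j - i" if ij: "i \<le> j" for i j
  proof -
    consider "j \<le> m" | "m \<le> i" | "i < m" "m < j" by linarith
    then show ?thesis
    proof cases
      case 1 then show ?thesis using up[of i] up[of j] ray_dist[OF up_ray[of x], of i j] ij by simp
    next
      case 2
      have e: "\<gamma> i = (par ^^ (j - i)) (\<gamma> j)" using down_pow[of m \<gamma> i "j - i", OF dn 2] ij by simp
      show ?thesis unfolding e graph_dist_eq by simp
    next
      case 3
      have mj: "\<gamma> m = (par ^^ (j - m)) (\<gamma> j)" using down_pow[of m \<gamma> m "j - m", OF dn] 3 by simp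
      have smj: "\<gamma> (Suc m) = (par ^^ (j - Suc m)) (\<gamma> j)" using down_pow[of m \<gamma> "Suc m" "j - Suc m", OF dn] 3 by simp
      have im: "(par ^^ k) (\<gamma> i) = \<gamma> (i + k)" if "i + k \<le> m" for k
        using up[of "i + k"] up[of i] that 3 by (simp add: funpow_add add.commute[of i k])
      have "(par ^^ (m - i)) (\<gamma> i) \<in> A (\<gamma> j)" using im[of "m - i"] 3 mj by simp
      then have 1: "ud (\<gamma> i) (\<gamma> j) \<le> m - i" by (simp add: pow_in_anc_iff)
      have "(par ^^ (m - 1 - i)) (\<gamma> i) \<notin> A (\<gamma> j)"
      proof
        assume "(par ^^ (m - 1 - i)) (\<gamma> i) \<in> A (\<gamma> j)"
        then have a: "\<gamma> (m - 1) \<in> A (\<gamma> j)" using im[of "m - 1 - i"] 3 by simp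
        have b: "\<gamma> (Suc m) \<in> A (\<gamma> j)" unfolding smj by simp
        have "lev (\<gamma> (m - 1)) = lev (\<gamma> m) + 1" using up[of "m - 1"] up[of m] 3 by simp
        also have "\<dots> = lev (\<gamma> (Suc m))" using dn lev_par[of "\<gamma> (Suc m)"] by simp
        finally show False using anc_level_unique[OF a b] ne 3 by simp
      qed
      then have 2: "ud (\<gamma> i) (\<gamma> j) = m - i" using 1 3 by (simp add: pow_in_anc_iff)
      have "lev (\<gamma> m) = lev (\<gamma> j) - int (j - m)" "lev (\<gamma> m) = lev (\<gamma> i) - int (m - i)"
        using mj im[of "m - i"] 3 lev_pow[of "m - i" "\<gamma> i"] by simp_all
      then show ?thesis using 2 lev_updist[of "\<gamma> i" "\<gamma> j"] 3 by (simp add: graph_dist_eq)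
    qed
  qed
  have "int (gd (\<gamma> i) (\<gamma> j)) = \<bar>int i - int j\<bar>" for i j
    using d[of i j] d[of j i] graph_dist_commute[of "\<gamma> i" "\<gamma> j"] by (cases "i \<le> j") auto
  then show ?thesis by (simp add: rays_def is_geodesic_def)
qed

lemma down_levels:
  assumes "\<forall>n\<ge>m. par (\<gamma> (Suc n)) = \<gamma> n" "n \<ge> m" shows "lev (\<gamma> n) = lev (\<gamma> m) + int (n - m)"
proof -
  have "(par ^^ (n - m)) (\<gamma> n) = \<gamma> m" using down_pow[of m \<gamma> m "n - m", OF assms(1)] assms(2) by simp
  then show ?thesis using lev_pow[of "n - m" "\<gamma> n"] by simp
qed

lemma limset_up: "(\<And>n. \<gamma> n = (par ^^ n) x) \<Longrightarrow> lms \<gamma> = {}"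
proof (rule ccontr)
  assume g: "\<And>n. \<gamma> n = (par ^^ n) x" and "lms \<gamma> \<noteq> {}"
  then obtain v N where v: "\<And>n. n \<ge> N \<Longrightarrow> v \<in> A ((par ^^ n) x)" by (auto simp: limset_def)
  let ?n = "max N (nat (lev x - lev v + 1))"
  have "lev v \<le> lev x - int ?n" using lev_anc[OF v[of ?n]] by simp
  then show False by linarith
qed

lemma down_mem_anc:
  assumes "\<forall>n\<ge>m. par (\<gamma> (Suc n)) = \<gamma> n" "m \<le> i" "i \<le> n" shows "A (\<gamma> i) \<subseteq> A (\<gamma> n)"
proof -
  have "\<gamma> i = (par ^^ (n - i)) (\<gamma> n)" using down_pow[of m \<gamma> i "n - i", OF assms(1,2)] assms(3) by simp
  then have "\<gamma> i \<in> A (\<gamma> n)" using pow_in_anc[of "n - i" "\<gamma> n"] by simp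
  then show ?thesis by (rule anc_trans)
qed

lemma limset_down:
  assumes dn: "\<forall>n\<ge>m. par (\<gamma> (Suc n)) = \<gamma> n"
  shows "lms \<gamma> = (\<Union>n\<in>{m..}. A (\<gamma> n))"
proof (intro equalityI subsetI)
  fix v assume "v \<in> lms \<gamma>"
  then obtain N where "\<And>n. n \<ge> N \<Longrightarrow> v \<in> A (\<gamma> n)" by (auto simp: limset_def)
  then show "v \<in> (\<Union>n\<in>{m..}. A (\<gamma> n))" by (intro UN_I[of "max m N"]) auto
next
  fix v assume "v \<in> (\<Union>n\<in>{m..}. A (\<gamma> n))"
  then obtain n where n: "n \<ge> m" "v \<in> A (\<gamma> n)" by auto
  then have "v \<in> A (\<gamma> k)" if "k \<ge> n" for k using down_mem_anc[OF dn n(1) that] by blast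
  then show "v \<in> lms \<gamma>" by (auto simp: limset_def)
qed

lemma limset_down_mem:
  assumes "\<forall>n\<ge>m. par (\<gamma> (Suc n)) = \<gamma> n" "n \<ge> m" shows "\<gamma> n \<in> lms \<gamma>"
  unfolding limset_down[OF assms(1)] using assms(2) anc_self by blast

lemma limset_line:
  assumes "\<gamma> \<in> rays E" shows "line par (lms \<gamma>)"
  using assms
proof (cases rule: ray_cases)
  case (up x) then show ?thesis using limset_up[of \<gamma> x] by (simp add: line_def chain_def)
next
  case (down m x)
  have c: "v \<in> lms \<gamma> \<Longrightarrow> par v \<in> lms \<gamma>" for v unfolding limset_def by (blast intro: anc_par_mem)
  have u: "v = w" if vw: "v \<in> lms \<gamma>" "w \<in> lms \<gamma>" "par v = par w" for v w
  proof -
    obtain N M where "\<And>n. n \<ge> N \<Longrightarrow> v \<in> A (\<gamma> n)" "\<And>n. n \<ge> M \<Longrightarrow> w \<in> A (\<gamma> n)"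
      using vw by (auto simp: limset_def)
    then have "v \<in> A (\<gamma> (max N M))" "w \<in> A (\<gamma> (max N M))" by simp_all
    moreover have "lev v = lev w" using lev_par[of v] lev_par[of w] vw(3) by simp
    ultimately show ?thesis using anc_level_unique[of v _ w] by blast
  qed
  have "\<exists>w\<in>lms \<gamma>. par w = v" if v: "v \<in> lms \<gamma>" for v
  proof -
    obtain N where N: "\<And>n. n \<ge> N \<Longrightarrow> v \<in> A (\<gamma> n)" using v by (auto simp: limset_def)
    let ?n = "max N m"
    define n' where "n' = ?n + 1 + nat (lev v - lev (\<gamma> ?n))"
    have nn: "n' \<ge> m" "n' \<ge> N" "?n \<ge> m" by (simp_all add: n'_def)
    have "lev (\<gamma> n') = lev (\<gamma> m) + int (n' - m)" "lev (\<gamma> ?n) = lev (\<gamma> m) + int (?n - m)"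
      by (rule down_levels[OF down(2)], fact)+
    then have "lev (\<gamma> n') = lev (\<gamma> ?n) + int (n' - ?n)" using nn by (simp add: n'_def)
    then have lv: "lev v < lev (\<gamma> n')" by (simp add: n'_def)
    have va: "v \<in> A (\<gamma> n')" by (rule N[OF nn(2)])
    obtain k where k: "v = (par ^^ k) (\<gamma> n')" using va by (auto simp: anc_def)
    then obtain j where j: "k = Suc j" using lv by (cases k) auto
    have "(par ^^ j) (\<gamma> n') \<in> lms \<gamma>" unfolding limset_down[of m \<gamma>, OF down(2)]
      using nn(1) pow_in_anc[of j "\<gamma> n'"] by blast
    moreover have "par ((par ^^ j) (\<gamma> n')) = v" using k j by simp
    ultimately show ?thesis by blast
  qed
  then show ?thesis using c u unfolding line_def chain_def by simp
qed

text \<open>Climb from \<open>x\<close> to the first vertex in \<open>L\<close>, then descend along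
  \<open>L\<close>, where \<open>f k\<close> is its vertex of level \<open>k\<close>. For empty
  \<open>L\<close> the ray climbs forever.\<close>

lemma line_ray:
  assumes "line par L" obtains \<gamma> where "\<gamma> \<in> rays E" "\<gamma> 0 = x" "lms \<gamma> = L"
proof (cases "L = {}")
  case True
  then show ?thesis using that[OF up_ray, of x] limset_up[of "\<lambda>n. (par ^^ n) x" x] by simp
next
  case False
  have C: "chain par L" using assms by (simp add: line_def)
  obtain v where v: "v \<in> L" using False by blast
  have ex: "\<exists>k. (par ^^ k) x \<in> L" using common[of x v] chain_pow[OF C v] by metis
  define m where "m = (LEAST k. (par ^^ k) x \<in> L)"
  have m: "(par ^^ m) x \<in> L" unfolding m_def using ex by (rule LeastI_ex)
  have ml: "k < m \<Longrightarrow> (par ^^ k) x \<notin> L" for k unfolding m_def by (rule not_less_Least)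
  define f where "f k = (SOME w. w \<in> L \<and> lev w = k)" for k
  have "\<exists>w. w \<in> L \<and> lev w = k" for k using line_deep[OF assms False, of k] by blast
  then have f: "f k \<in> L" "lev (f k) = k" for k unfolding f_def by (metis (mono_tags, lifting) someI_ex)+
  have fe: "w \<in> L \<Longrightarrow> f (lev w) = w" for w using chain_level_unique[OF C f(1)] f(2) by blast
  have fp: "par (f k) = f (k - 1)" for k
    using fe[of "par (f k)"] C f[of k] by (simp add: chain_def)
  define \<gamma> where "\<gamma> n = (if n \<le> m then (par ^^ n) x else f (lev x - int m + int (n - m)))" for n
  have gm: "\<gamma> n = f (lev x - int m + int (n - m))" if "n \<ge> m" for n
    using fe[OF m] that by (cases "n = m") (auto simp: \<gamma>_def)
  have dn: "\<forall>n\<ge>m. par (\<gamma> (Suc n)) = \<gamma> n" by (simp add: gm fp Suc_diff_le algebra_simps)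
  have r: "\<gamma> \<in> rays E"
  proof (rule down_ray[of m \<gamma> x])
    show "\<gamma> (Suc m) \<noteq> \<gamma> (m - 1)" if "m > 0" using ml[of "m - 1"] that f(1)[of "lev x - int m + 1"] by (auto simp: \<gamma>_def)
    show "\<forall>n\<ge>m. par (\<gamma> (Suc n)) = \<gamma> n" by (rule dn)
  qed (simp add: \<gamma>_def)
  have "lms \<gamma> = L"
  proof (intro equalityI subsetI)
    fix v assume "v \<in> lms \<gamma>"
    then obtain n where "n \<ge> m" "v \<in> A (\<gamma> n)" unfolding limset_down[of m \<gamma>, OF dn] by auto
    then show "v \<in> L" using gm[of n] chain_anc[OF C f(1)] by auto
  next
    fix v assume v: "v \<in> L"
    let ?n = "m + nat (lev v - lev x + int m)"
    have "v \<in> A (\<gamma> ?n)" unfolding gm[OF le_add1]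
      by (rule chain_anc_of_level[OF C v f(1)]) (auto simp: f(2))
    then show "v \<in> lms \<gamma>" unfolding limset_down[of m \<gamma>, OF dn] by auto
  qed
  then show ?thesis using that[OF r] by (simp add: \<gamma>_def)
qed

text \<open>Two climbing rays merge at a common ancestor. Two descending rays merge because their
  tails lie in one chain, which has only one vertex at each level. Mixed cases are excluded, since
  only climbing rays have an empty limit set.\<close>

lemma same_limset_tail:
  assumes r: "\<gamma> \<in> rays E" "\<gamma>' \<in> rays E" and eq: "lms \<gamma> = lms \<gamma>'"
  shows "finite (range \<gamma> - range \<gamma>')"
proof -
  have "\<exists>N. \<forall>n\<ge>N. \<gamma> n \<in> range \<gamma>'"
    using r(1)
  proof (cases rule: ray_cases)
 case (up x)
    have e: "lms \<gamma>' = {}" using limset_up[of \<gamma>, OF up] eq by simp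
    from r(2) show ?thesis
    proof (cases rule: ray_cases)
      case up': (up y)
      obtain a b where ab: "(par ^^ a) x = (par ^^ b) y" using common[of x y] by blast
      have "\<gamma> n = \<gamma>' (n - a + b)" if "n \<ge> a" for n
      proof -
        have "\<gamma> n = (par ^^ (n - a)) ((par ^^ a) x)" using up[of n] pow_diff[OF that] by simp
        also have "\<dots> = (par ^^ (n - a + b)) y" unfolding ab by (simp add: funpow_add)
        finally show ?thesis using up'[of "n - a + b"] by simp
      qed
      then show ?thesis by (metis rangeI)
    next
      case (down m y)
      then have "\<gamma>' m \<in> lms \<gamma>'" by (intro limset_down_mem[of m]) auto
      then show ?thesis using e by simp
    qed
  next
    case (down m x)
    note dm = down(2)
    have l: "\<gamma> n \<in> lms \<gamma>" if "n \<ge> m" for n using limset_down_mem[OF down(2) that] .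
    from r(2) show ?thesis
    proof (cases rule: ray_cases)
      case (up y)
      then show ?thesis using limset_up[of \<gamma>', OF up] eq l[of m] by simp
    next
      case (down m' x')
      have l': "\<gamma>' n \<in> lms \<gamma>" if "n \<ge> m'" for n using limset_down_mem[OF down(2) that] eq by simp
      have C: "chain par (lms \<gamma>)" using limset_line[OF r(1)] by (simp add: line_def)
      define N where "N = m + nat (lev (\<gamma>' m') - lev (\<gamma> m))"
      have "\<gamma> n \<in> range \<gamma>'" if n: "n \<ge> N" for n
      proof -
        have nm: "n \<ge> m" using n by (simp add: N_def)
        have lv: "lev (\<gamma> n) \<ge> lev (\<gamma>' m')"
          using down_levels[of m \<gamma> n, OF dm nm] n by (simp add: N_def)
        define j where "j = m' + nat (lev (\<gamma> n) - lev (\<gamma>' m'))"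
        have "lev (\<gamma>' j) = lev (\<gamma> n)" using down_levels[of m' \<gamma>' j, OF down(2)] lv by (simp add: j_def)
        then have "\<gamma>' j = \<gamma> n" by (intro chain_level_unique[OF C l' l[OF nm]]) (auto simp: j_def)
        then show ?thesis by (metis rangeI)
      qed
      then show ?thesis by blast
    qed
  qed
  then obtain N where N: "\<And>n. n \<ge> N \<Longrightarrow> \<gamma> n \<in> range \<gamma>'" by blast
  have "range \<gamma> - range \<gamma>' \<subseteq> \<gamma> ` {..<N}"
  proof (rule subsetI)
    fix v assume v: "v \<in> range \<gamma> - range \<gamma>'"
    then obtain n where n: "v = \<gamma> n" by blast
    have "\<not> N \<le> n" using v n N[of n] by (metis DiffD2)
    then show "v \<in> \<gamma> ` {..<N}" using n by simp
  qed
  then show ?thesis by (rule finite_subset) simp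
qed

lemma finite_diff_limset:
  assumes r: "\<gamma> \<in> rays E" "\<gamma>' \<in> rays E" and fin: "finite (range \<gamma> - range \<gamma>')"
  shows "lms \<gamma> \<subseteq> lms \<gamma>'"
proof
  fix v assume v: "v \<in> lms \<gamma>"
  then obtain N where N: "\<And>n. n \<ge> N \<Longrightarrow> v \<in> A (\<gamma> n)" by (auto simp: limset_def)
  from r(1) show "v \<in> lms \<gamma>'"
  proof (cases rule: ray_cases)
    case (up x) then show ?thesis using limset_up[of \<gamma>, OF up] v by simp
  next
    case (down m x)
    have "finite (\<gamma> -` (range \<gamma> - range \<gamma>'))" using fin ray_inj[OF r(1)] by (rule finite_vimageI)
    then obtain B where "\<forall>n\<in>\<gamma> -` (range \<gamma> - range \<gamma>'). n < B"
      unfolding finite_nat_set_iff_bounded by blast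
    then have B: "\<gamma> n \<notin> range \<gamma>' \<Longrightarrow> n < B" for n by simp
    define n where "n = max (max N m) B + nat (lev (\<gamma>' 0) - lev (\<gamma> m)) + 1"
    obtain j where j: "\<gamma> n = \<gamma>' j" using B[of n] by (fastforce simp: n_def)
    have vn: "v \<in> A (\<gamma>' j)" using N[of n] j by (simp add: n_def)
    have "lev (\<gamma> n) = lev (\<gamma> m) + int (n - m)" by (rule down_levels[OF down(2)]) (auto simp: n_def)
    moreover have "int (n - m) > lev (\<gamma>' 0) - lev (\<gamma> m)" unfolding n_def by linarith
    ultimately have lv: "lev (\<gamma>' j) > lev (\<gamma>' 0)" unfolding j by linarith
    from r(2) show ?thesis
    proof (cases rule: ray_cases)
      case (up y) then show ?thesis using lv lev_pow[of j y] by simp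
    next
      case (down m' x')
      have "j \<ge> m'" using lv down(1)[of j] down(1)[of 0] by (cases "j \<le> m'") simp_all
      then show ?thesis using vn limset_down[of m' \<gamma>', OF down(2)] by auto
    qed
  qed
qed

lemma ray_equiv_iff: "(\<gamma>, \<gamma>') \<in> ray_equiv E \<longleftrightarrow> \<gamma> \<in> rays E \<and> \<gamma>' \<in> rays E \<and> lms \<gamma> = lms \<gamma>'"
  using same_limset_tail[of \<gamma> \<gamma>'] same_limset_tail[of \<gamma>' \<gamma>] finite_diff_limset[of \<gamma> \<gamma>']
    finite_diff_limset[of \<gamma>' \<gamma>] unfolding ray_equiv_def by auto

lemma ends_eq: "ends E = end_of E par ` {L. line par L}"
proof -
  have c: "ray_equiv E `` {\<gamma>} = end_of E par (lms \<gamma>)" if "\<gamma> \<in> rays E" for \<gamma>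
    using that by (auto simp: end_of_def ray_equiv_iff)
  have "ends E = (\<lambda>\<gamma>. end_of E par (lms \<gamma>)) ` rays E"
    unfolding ends_def quotient_def using c by auto
  moreover have "{L. line par L} = lms ` rays E"
    using limset_line line_ray by (auto simp: image_iff) metis
  ultimately show ?thesis by (auto simp: image_image)
qed

lemma chain_of_end_of: "line par L \<Longrightarrow> S (End (end_of E par L)) = L"
proof -
  assume "line par L"
  then obtain \<gamma> where "\<gamma> \<in> end_of E par L" using line_ray by (metis (mono_tags, lifting) end_of_def mem_Collect_eq)
  then have "(SOME \<gamma>. \<gamma> \<in> end_of E par L) \<in> end_of E par L" by (rule someI[of "\<lambda>\<gamma>. \<gamma> \<in> end_of E par L"])
  then show ?thesis by (simp add: end_of_def)
qed

lemma tree_hat_cases: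
  assumes "w \<in> tree_hat E"
  obtains (Vertex) x where "w = Vertex x" "S w = A x"
    | (End) L where "line par L" "w = End (end_of E par L)" "S w = L"
  using assms chain_of_end_of unfolding tree_hat_def ends_eq by auto

lemma Vertex_in_hat [simp]: "Vertex x \<in> tree_hat E" by (simp add: tree_hat_def)

lemma End_in_hat: "line par L \<Longrightarrow> End (end_of E par L) \<in> tree_hat E" by (simp add: tree_hat_def ends_eq)

lemma chain_of_chain: "w \<in> tree_hat E \<Longrightarrow> chain par (S w)"
  by (erule tree_hat_cases) (auto simp: anc_chain line_def)

lemma chain_of_inj: "inj_on S (tree_hat E)"
proof (rule inj_onI)
  fix w z assume "w \<in> tree_hat E" "z \<in> tree_hat E" "S w = S z"
  then show "w = z" by (elim tree_hat_cases) (auto simp: anc_inj line_not_anc)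
qed

lemma chain_of_surj: "chain par C \<Longrightarrow> \<exists>w\<in>tree_hat E. S w = C"
  by (erule chain_cases) (metis chain_of_end_of End_in_hat, metis Vertex_in_hat chain_of.simps(1))

text \<open>Vertices and ends get one criterion in terms of chains. For an end, the converse
  compares \<open>z\<close> with the point of the ray at the same distance from \<open>x\<close>:
  for large \<open>n\<close> both lie between \<open>x\<close> and \<open>\<gamma> n\<close>, and
  \<open>between_unique\<close> applies.\<close>

lemma geod_iff:
  assumes "w \<in> tree_hat E"
  shows "z \<in> geod E x w \<longleftrightarrow> A x \<inter> S w \<subseteq> A z \<and> A z \<subseteq> A x \<union> S w"
  using assms
proof (cases rule: tree_hat_cases)
  case (Vertex y)
  then show ?thesis by (simp only: geod_Vertex_iff between_iff)
next
  case (End L)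
  have e: "z \<in> geod E x w \<longleftrightarrow> (\<exists>\<gamma>\<in>rays E. lms \<gamma> = L \<and> \<gamma> 0 = x \<and> z \<in> range \<gamma>)"
    unfolding End(2) by (auto simp: end_of_def)
  show ?thesis
  proof
    assume "z \<in> geod E x w"
    then obtain \<gamma> i where g: "\<gamma> \<in> rays E" "lms \<gamma> = L" "\<gamma> 0 = x" "z = \<gamma> i" unfolding e by blast
    have "v \<in> A z" if v: "v \<in> A x" "v \<in> L" for v
    proof -
      obtain N where "\<And>n. n \<ge> N \<Longrightarrow> v \<in> A (\<gamma> n)" using v g by (auto simp: limset_def)
      then have "v \<in> A (\<gamma> (max N i))" by simp
      then show ?thesis using ray_between(1)[OF g(1), of i "max N i"] v g by auto
    qed
    moreover have "v \<in> L" if v: "v \<in> A z" "v \<notin> A x" for v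
    proof -
      have "v \<in> A (\<gamma> n)" if "n \<ge> i" for n using ray_between(2)[OF g(1) that] v g by auto
      then show ?thesis using g(2) by (auto simp: limset_def)
    qed
    ultimately show "A x \<inter> S w \<subseteq> A z \<and> A z \<subseteq> A x \<union> S w" using End by auto
  next
    assume *: "A x \<inter> S w \<subseteq> A z \<and> A z \<subseteq> A x \<union> S w"
    obtain \<gamma> where g: "\<gamma> \<in> rays E" "\<gamma> 0 = x" "lms \<gamma> = L" using line_ray[OF End(1)] .
    have C: "chain par L" using End by (simp add: line_def)
    from g(1) have "z \<in> range \<gamma>"
    proof (cases rule: ray_cases)
      case (up y)
      have "L = {}" using limset_up[of \<gamma>, OF up] g by simp
      then have "z \<in> A x" using * End anc_self[of z] by auto
      then obtain k where "z = (par ^^ k) x" by (auto simp: anc_def)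
      then have "z = \<gamma> k" using up[of k] up[of 0] g(2) by simp
      then show ?thesis by blast
    next
      case (down m y)
      define n where "n = max m (gd x z) + nat (lev z - lev (\<gamma> m))"
      have gn: "\<gamma> n \<in> L" using limset_down_mem[OF down(2), of n] g by (simp add: n_def)
      have "lev (\<gamma> n) = lev (\<gamma> m) + int (n - m)" by (rule down_levels[OF down(2)]) (auto simp: n_def)
      moreover have "int (n - m) \<ge> lev z - lev (\<gamma> m)" unfolding n_def by linarith
      ultimately have lz: "lev z \<le> lev (\<gamma> n)" by linarith
      have 1: "A x \<inter> A (\<gamma> n) \<subseteq> A z" using * End chain_anc[OF C gn] by blast
      have 2: "A z \<subseteq> A x \<union> A (\<gamma> n)"
      proof
        fix v assume v: "v \<in> A z"
        show "v \<in> A x \<union> A (\<gamma> n)"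
        proof (cases "v \<in> A x")
          case False
          then have "v \<in> L" using v * End by blast
          then have "v \<in> A (\<gamma> n)" using lev_anc[OF v] lz by (intro chain_anc_of_level[OF C _ gn]) auto
          then show ?thesis by simp
        qed simp
      qed
      have "gd x (\<gamma> (gd x z)) = gd x z" using ray_dist0[OF g(1)] g(2) by simp
      then have "z = \<gamma> (gd x z)"
        using ray_between[OF g(1), of "gd x z" n] g(2) 1 2
        by (intro between_unique[of x "\<gamma> n" z]) (auto simp: n_def)
      then show ?thesis by (metis rangeI)
    qed
    then show "z \<in> geod E x w" unfolding e using g by blast
  qed
qed

lemma geod_ref: "geod E x (End (end_of E par {})) = A x"
proof -
  have l: "line par {}" by (simp add: line_def chain_def)
  have "z \<in> geod E x (End (end_of E par {})) \<longleftrightarrow> z \<in> A x" for z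
    unfolding geod_iff[OF End_in_hat[OF l]] chain_of_end_of[OF l] using anc_trans[of z x] anc_self[of z] by blast
  then show ?thesis by blast
qed

end

section \<open>The end topology\<close>

locale pointed_horotree = horo_graph "pred_vertex T" "height T" p "adj T"
  for T :: "'a pointed_tree" and p +
  assumes ref_end_eq: "ref_end T = end_of (adj T) (pred_vertex T) {}"
    and up_eq: "up T x y = updist (pred_vertex T) x y"
    and down_eq: "down T x y = updist (pred_vertex T) y x"

text \<open>Any ray representing the reference end provides a Busemann function. The function
  \<open>height\<close>, defined through confluents, turns out to be this function normalised at the
  root; hence the parent map of the ray is \<open>pred_vertex\<close>.\<close>

lemma pointed_horotreeI:
  fixes T :: "'a pointed_tree"
  assumes T: "homogeneous_tree p T" and p: "p \<ge> 2"
  shows "pointed_horotree T p"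
proof -
  let ?E = "adj T" and ?o = "base T"
  interpret G: tree_graph ?E using T by (simp add: homogeneous_tree_def tree_graph_iff)
  have deg: "card {y. ?E x y} = p + 1" for x using T by (simp add: homogeneous_tree_def)
  have fin: "finite {y. ?E x y}" for x using deg[of x] card.infinite by fastforce
  obtain \<gamma> where \<gamma>: "\<gamma> \<in> rays ?E" "ref_end T = ray_equiv ?E `` {\<gamma>}"
    using T by (auto simp: homogeneous_tree_def ends_def quotient_def)
  interpret R: tree_ray ?E \<gamma> by unfold_locales (use \<gamma> fin in auto)
  have card: "card (children R.parent x) = p" for x
  proof -
    have "R.parent x \<notin> children R.parent x"
    proof
      assume "R.parent x \<in> children R.parent x"
      then have "R.parent (R.parent x) = x" by (simp add: children_def)
      then show False using R.parent(2)[of x] R.parent(2)[of "R.parent x"] by simp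
    qed
    moreover have "{y. ?E x y} = insert (R.parent x) (children R.parent x)"
      using R.adj_iff_parent by (auto simp: children_def)
    moreover then have "finite (children R.parent x)" using fin[of x] by simp
    ultimately have "card {y. ?E x y} = Suc (card (children R.parent x))" by simp
    then show ?thesis using deg[of x] by simp
  qed
  interpret H: horo_graph R.parent R.busemann p ?E
    by unfold_locales (use p card R.parent(2) R.parent_common R.adj_iff_parent in auto)
  have "limset R.parent \<gamma> = {}" by (rule H.limset_up[of \<gamma> "\<gamma> 0"]) (rule R.ray_parent)
  then have ref: "ref_end T = end_of ?E R.parent {}"
    using \<gamma> by (auto simp: end_of_def H.ray_equiv_iff)
  have geod: "geod ?E x (End (ref_end T)) = anc R.parent x" for x
    unfolding ref by (rule H.geod_ref)
  have meet: "meet T x y = (R.parent ^^ updist R.parent x y) x" for x y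
    unfolding meet_def geod H.anc_Int H.anc_inj by simp
  have up: "up T x y = updist R.parent x y" for x y
    unfolding up_def meet H.graph_dist_eq by simp
  have down: "down T x y = updist R.parent y x" for x y
    unfolding down_def meet H.meet_eq[of x y] H.graph_dist_eq by simp
  have height: "height T x = R.busemann x - R.busemann ?o" for x
    unfolding height_def up down using H.lev_updist[of x ?o] by simp
  have pred: "pred_vertex T = R.parent"
    using R.parent_def by (simp add: fun_eq_iff pred_vertex_def height)
  show ?thesis
    by unfold_locales (use p card R.parent(2) R.parent_common R.adj_iff_parent in
        \<open>auto simp: pred ref up down height\<close>)
qed

context pointed_horotree begin

lemma lev_base: "height T (base T) = 0" by (simp add: height_def up_eq down_eq)

end

context horo_graph begin

abbreviation "hat \<equiv> tree_hat E"
abbreviation "top_hat \<equiv> end_topology E"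

text \<open>Together with \<open>cone_in\<close> this identifies cones with the sets that prescribe
  whether one fixed vertex belongs to \<open>S w\<close>, which makes the end topology pointwise
  convergence of chains. A chain that contains any vertex on the way from \<open>x\<close> up to the
  excluded one contains the excluded one too, being closed under \<open>par\<close>.\<close>

lemma cone_notin:
  "cone E x ((par ^^ Suc k) x) = {w \<in> hat. (par ^^ k) x \<notin> S w}"
proof -
  let ?y = "(par ^^ Suc k) x" and ?v = "(par ^^ k) x"
  have "A x \<inter> S w \<subseteq> A ?y \<and> A ?y \<subseteq> A x \<union> S w \<longleftrightarrow> ?v \<notin> S w" if w: "w \<in> hat" for w
  proof
    assume a: "A x \<inter> S w \<subseteq> A ?y \<and> A ?y \<subseteq> A x \<union> S w"
    have "?v \<notin> A ?y" using lev_anc[of ?v ?y] by auto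
    then show "?v \<notin> S w" using a pow_in_anc[of k x] by blast
  next
    assume n: "?v \<notin> S w"
    have "u \<in> A ?y" if "u \<in> A x" "u \<in> S w" for u
    proof -
      obtain j where j: "u = (par ^^ j) x" using \<open>u \<in> A x\<close> by (auto simp: anc_def)
      have "\<not> j \<le> k"
        using chain_pow[OF chain_of_chain[OF w] \<open>u \<in> S w\<close>, of "k - j"] n pow_diff[of j k x] unfolding j by auto
      then have "u = (par ^^ (j - Suc k)) ?y" using pow_diff[of "Suc k" j x] unfolding j by simp
      then show ?thesis using pow_in_anc[of "j - Suc k" ?y] by simp
    qed
    then show "A x \<inter> S w \<subseteq> A ?y \<and> A ?y \<subseteq> A x \<union> S w" using anc_trans[OF pow_in_anc[of "Suc k" x]] by blast
  qed
  then show ?thesis unfolding cone_def using geod_iff by blast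
qed

lemma cone_in:
  assumes "y \<notin> A x" shows "cone E x y = {w \<in> hat. y \<in> S w}"
proof -
  have "A x \<inter> S w \<subseteq> A y \<and> A y \<subseteq> A x \<union> S w \<longleftrightarrow> y \<in> S w" if w: "w \<in> hat" for w
  proof
    assume "A x \<inter> S w \<subseteq> A y \<and> A y \<subseteq> A x \<union> S w"
    then show "y \<in> S w" using assms anc_self[of y] by blast
  next
    assume y: "y \<in> S w"
    note C = chain_of_chain[OF w]
    have "u \<in> A y" if "u \<in> A x" "u \<in> S w" for u
      using chain_total[OF C that(2) y] anc_trans[OF that(1)] assms by blast
    then show "A x \<inter> S w \<subseteq> A y \<and> A y \<subseteq> A x \<union> S w" using chain_anc[OF C y] by blast
  qed
  then show ?thesis unfolding cone_def using geod_iff by blast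
qed

lemma cone_cases:
  assumes "x \<noteq> y"
  obtains v where "cone E x y = {w \<in> hat. v \<in> S w}" | v where "cone E x y = {w \<in> hat. v \<notin> S w}"
proof (cases "y \<in> A x")
  case True
  then obtain k where k: "y = (par ^^ k) x" by (auto simp: anc_def)
  then obtain j where "k = Suc j" using assms by (cases k) auto
  then show ?thesis using that(2) cone_notin[of x j] k by simp
next
  case False
  then show ?thesis using that(1) cone_in by blast
qed

lemma openin_mem: "openin top_hat {w \<in> hat. v \<in> S w}"
proof -
  have "cone E (par v) v = {w \<in> hat. v \<in> S w}" by (rule cone_in) simp
  moreover have "par v \<noteq> v" using not_in_anc_par[of v] anc_self[of v] by metis
  ultimately show ?thesis unfolding end_topology_def
    by (intro topology_generated_by_Basis) blast
qed

lemma openin_not_mem: "openin top_hat {w \<in> hat. v \<notin> S w}"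
proof -
  have "cone E v (par v) = {w \<in> hat. v \<notin> S w}" using cone_notin[of v 0] by simp
  moreover have "v \<noteq> par v" using not_in_anc_par[of v] anc_self[of v] by metis
  ultimately show ?thesis unfolding end_topology_def
    by (intro topology_generated_by_Basis) blast
qed

lemma topspace_hat: "topspace top_hat = hat"
proof
  show "topspace top_hat \<subseteq> hat" unfolding end_topology_def topology_generated_by_topspace cone_def by auto
  obtain v :: 'a where True by simp
  show "hat \<subseteq> topspace top_hat"
    using openin_mem[of v, THEN openin_subset] openin_not_mem[of v, THEN openin_subset] by blast
qed

lemma openin_eventually:
  assumes U: "openin top_hat U" "w \<in> U" and ev: "\<And>v. \<forall>\<^sub>F i in F. v \<in> S (f i) \<longleftrightarrow> v \<in> S w"
    and hat: "\<And>i. f i \<in> hat"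
  shows "\<forall>\<^sub>F i in F. f i \<in> U"
proof -
  have "generate_topology_on {cone E x y |x y. x \<noteq> y} U \<Longrightarrow> w \<in> U \<longrightarrow> (\<forall>\<^sub>F i in F. f i \<in> U)" for U
  proof (induction rule: generate_topology_on.induct)
    case (Int a b) then show ?case by (auto intro: eventually_conj)
  next
    case (UN K)
    show ?case
    proof
      assume "w \<in> \<Union> K"
      then obtain k where k: "k \<in> K" "w \<in> k" by blast
      then have "\<forall>\<^sub>F i in F. f i \<in> k" using UN by blast
      then show "\<forall>\<^sub>F i in F. f i \<in> \<Union> K" by eventually_elim (use k in blast)
    qed
  next
    case (Basis s)
    then obtain x y where s: "s = cone E x y" "x \<noteq> y" by blast
    from s(2) show ?case
    proof (cases rule: cone_cases)
      case (1 v) then show ?thesis using ev[of v] hat unfolding s by (auto elim: eventually_mono)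
    next
      case (2 v) then show ?thesis using ev[of v] hat unfolding s by (auto elim: eventually_mono)
    qed
  qed simp
  then show ?thesis using U unfolding end_topology_def openin_topology_generated_by_iff by blast
qed

text \<open>The chain of a vertex is the only chain containing it but none of its children; as there
  are finitely many children, this is an open condition.\<close>

lemma openin_Vertex: "openin top_hat {Vertex x}"
proof -
  have eq: "{Vertex x} = {w \<in> hat. x \<in> S w} \<inter> (\<Inter>c\<in>ch x. {w \<in> hat. c \<notin> S w})"
  proof (intro equalityI subsetI)
    fix w assume w: "w \<in> {w \<in> hat. x \<in> S w} \<inter> (\<Inter>c\<in>ch x. {w \<in> hat. c \<notin> S w})"
    then have h: "w \<in> hat" "x \<in> S w" "\<And>c. par c = x \<Longrightarrow> c \<notin> S w" by auto
    from h(1) show "w \<in> {Vertex x}"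
    proof (cases rule: tree_hat_cases)
      case (Vertex y)
      then obtain k where k: "x = (par ^^ k) y" using h by (auto simp: anc_def)
      have "k = 0"
      proof (rule ccontr)
        assume "k \<noteq> 0"
        then obtain j where j: "k = Suc j" by (cases k) auto
        then show False using h(3)[of "(par ^^ j) y"] k Vertex by simp
      qed
      then show ?thesis using k Vertex by simp
    next
      case (End L)
      then show ?thesis using h unfolding line_def by blast
    qed
  next
    fix w assume "w \<in> {Vertex x}"
    moreover have "c \<notin> A x" if "par c = x" for c using lev_anc[of c x] lev_par[of c] that by auto
    ultimately show "w \<in> {w \<in> hat. x \<in> S w} \<inter> (\<Inter>c\<in>ch x. {w \<in> hat. c \<notin> S w})" by auto
  qed
  show ?thesis unfolding eq
    by (intro openin_Int openin_Inter openin_mem) (use children_nonempty openin_not_mem in auto)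
qed

section \<open>Chains as a closed subset of a Cantor space\<close>

lemma
  shows openin_bool_coord: "openin (product_topology (\<lambda>_. discrete_topology (UNIV :: bool set)) UNIV) {f. P (f v)}"
    and closedin_bool_coord: "closedin (product_topology (\<lambda>_. discrete_topology (UNIV :: bool set)) UNIV) {f. P (f v)}"
  using openin_continuous_map_preimage[OF continuous_map_product_projection[of v UNIV "\<lambda>_. discrete_topology UNIV"], of "{b. P b}"]
    closedin_continuous_map_preimage[OF continuous_map_product_projection[of v UNIV "\<lambda>_. discrete_topology UNIV"], of "{b. P b}"]
  by simp_all

definition chains_top :: "('a \<Rightarrow> bool) topology" where
  "chains_top = subtopology (product_topology (\<lambda>_. discrete_topology UNIV) UNIV) {f. chain par {v. f v}}"

text \<open>Continuity of the inverse needs to be checked on cones only, and those are preimages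
  under single coordinates.\<close>

lemma homeomorphic_chains: "top_hat homeomorphic_space chains_top"
proof -
  let ?B = "product_topology (\<lambda>_::'a. discrete_topology (UNIV :: bool set)) UNIV"
  let ?f = "\<lambda>w v. v \<in> S w"
  let ?g = "\<lambda>f. inv_into hat S {v. f v}"
  have c1: "continuous_map top_hat chains_top ?f"
    unfolding chains_top_def continuous_map_in_subtopology
  proof
    have "continuous_map top_hat (discrete_topology UNIV) (\<lambda>w. v \<in> S w)" for v
      unfolding continuous_map_def
    proof (intro conjI allI impI)
      fix U :: "bool set"
      have "{w \<in> topspace top_hat. (v \<in> S w) \<in> U} =
          (if True \<in> U then {w \<in> hat. v \<in> S w} else {}) \<union> (if False \<in> U then {w \<in> hat. v \<notin> S w} else {})"
        (is "?L = ?R")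
      proof (rule set_eqI)
        fix w show "w \<in> ?L \<longleftrightarrow> w \<in> ?R" by (cases "v \<in> S w") (simp_all add: topspace_hat)
      qed
      then show "openin top_hat {w \<in> topspace top_hat. (v \<in> S w) \<in> U}"
        using openin_mem[of v] openin_not_mem[of v] by (auto intro: openin_Un)
    qed simp
    then show "continuous_map top_hat ?B ?f" by (simp add: continuous_map_componentwise_UNIV)
    show "?f \<in> topspace top_hat \<rightarrow> {f. chain par {v. f v}}"
      using chain_of_chain by (auto simp: topspace_hat)
  qed
  have tc: "topspace chains_top = {f. chain par {v. f v}}" by (simp add: chains_top_def)
  have g: "?g f \<in> hat" "S (?g f) = {v. f v}" if "f \<in> topspace chains_top" for f
  proof -
    have "{v. f v} \<in> S ` hat" using chain_of_surj that unfolding tc by blast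
    then show "?g f \<in> hat" "S (?g f) = {v. f v}" by (rule inv_into_into, rule f_inv_into_f)
  qed
  have c2: "continuous_map chains_top top_hat ?g"
    unfolding end_topology_def
  proof (rule continuous_on_generated_topo)
    have eq: "\<Union> {cone E x y |x y. x \<noteq> y} = hat"
      using topspace_hat unfolding end_topology_def topology_generated_by_topspace .
    show "?g ` topspace chains_top \<subseteq> \<Union> {cone E x y |x y. x \<noteq> y}"
      unfolding eq by (rule image_subsetI) (rule g(1))
    fix U assume "U \<in> {cone E x y |x y. x \<noteq> y}"
    then obtain x y where U: "U = cone E x y" "x \<noteq> y" by blast
    have o: "openin chains_top {f \<in> topspace chains_top. P (f v)}" for P v
    proof -
      have "{f \<in> topspace chains_top. P (f v)} = {f. P (f v)} \<inter> {f. chain par {v. f v}}"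
        unfolding tc by auto
      then show ?thesis unfolding chains_top_def
        using openin_subtopology_Int[OF openin_bool_coord[of P v], of "{f. chain par {v. f v}}"] by simp
    qed
    from U(2) show "openin chains_top (?g -` U \<inter> topspace chains_top)"
    proof (cases rule: cone_cases)
      case (1 v)
      have "?g -` U \<inter> topspace chains_top = {f \<in> topspace chains_top. f v}"
        using g unfolding U 1 by auto
      then show ?thesis using o[of "\<lambda>b. b" v] by simp
    next
      case (2 v)
      have "?g -` U \<inter> topspace chains_top = {f \<in> topspace chains_top. \<not> f v}"
        using g unfolding U 2 by auto
      then show ?thesis using o[of "\<lambda>b. \<not> b" v] by simp
    qed
  qed
  have "homeomorphic_maps top_hat chains_top ?f ?g"
    unfolding homeomorphic_maps_def
  proof (intro conjI ballI c1 c2)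
    fix w assume "w \<in> topspace top_hat"
    then show "?g (?f w) = w" using inv_into_f_f[OF chain_of_inj] by (simp add: topspace_hat)
  next
    fix f assume "f \<in> topspace chains_top"
    from g(2)[OF this] show "?f (?g f) = f" by blast
  qed
  then show ?thesis unfolding homeomorphic_space_def by blast
qed

text \<open>Each single requirement on a chain involves finitely many coordinates, so it defines a
  closed set.\<close>

lemma closedin_chains:
  "closedin (product_topology (\<lambda>_::'a. discrete_topology (UNIV :: bool set)) UNIV) {f. chain par {v. f v}}"
proof -
  let ?B = "product_topology (\<lambda>_::'a. discrete_topology (UNIV :: bool set)) UNIV"
  note c = closedin_bool_coord
  have eq: "{f. chain par {v. f v}} = (\<Inter>v. {f. \<not> f v} \<union> {f. f (par v)}) \<inter>
      (\<Inter>v. \<Inter>w. {f. \<not> f v} \<union> {f. \<not> f w} \<union> {f. par v = par w \<longrightarrow> v = w})"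
    (is "?L = ?R")
  proof (rule set_eqI)
    fix f :: "'a \<Rightarrow> bool"
    show "f \<in> ?L \<longleftrightarrow> f \<in> ?R" unfolding chain_def
      by (simp only: mem_Collect_eq Int_iff INT_iff Un_iff ball_UNIV Ball_def UNIV_I) blast
  qed
  have d: "closedin ?B {f. par v = par w \<longrightarrow> v = w}" for v w
  proof (cases "par v = par w \<longrightarrow> v = w")
    case True
    then show ?thesis using closedin_topspace[of ?B] by simp
  next
    case False
    then show ?thesis by simp
  qed
  show ?thesis unfolding eq
    by (intro closedin_Int closedin_INT closedin_Un c[of "\<lambda>b. \<not> b"] c[of "\<lambda>b. b"] d) simp_all
qed

lemma compact_hat: "compact_space top_hat"
proof -
  have "compact_space (product_topology (\<lambda>_::'a. discrete_topology (UNIV :: bool set)) UNIV)"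
    by (simp add: compact_space_product_topology compact_space_discrete_topology)
  then have "compact_space chains_top"
    unfolding chains_top_def by (intro compact_space_subtopology closedin_compact_space closedin_chains)
  then show ?thesis using homeomorphic_compact_space[OF homeomorphic_chains] by blast
qed

lemma metrizable_hat: "metrizable_space top_hat"
proof -
  have "metrizable_space (product_topology (\<lambda>_::'a. discrete_topology (UNIV :: bool set)) UNIV)"
    using countable_vertices
    by (auto simp: metrizable_space_product_topology metrizable_space_discrete_topology intro: countable_subset)
  then have "metrizable_space chains_top" unfolding chains_top_def by (rule metrizable_space_subtopology)
  then show ?thesis using homeomorphic_metrizable_space[OF homeomorphic_chains] by blast
qed

end

section \<open>Minimal harmonic functions\<close>

text \<open>A bounded convex sequence starting at a nonpositive value is nonpositive; here the sequence
  is the sequence of suprema of the sets \<open>R s\<close>.\<close>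

lemma bounded_convex_suprema:
  fixes R :: "nat \<Rightarrow> real set"
  assumes bd: "\<And>s a. a \<in> R s \<Longrightarrow> a \<le> M" and R0: "\<And>a. a \<in> R 0 \<Longrightarrow> a \<le> 0"
    and mono: "\<And>s. R s \<subseteq> R (Suc s)"
    and step: "\<And>s a D0 D2. a \<in> R (Suc s) \<Longrightarrow> 0 \<le> D0 \<Longrightarrow> D0 \<le> D2 \<Longrightarrow> (\<And>b. b \<in> R s \<Longrightarrow> b \<le> D0) \<Longrightarrow>
       (\<And>b. b \<in> R (Suc (Suc s)) \<Longrightarrow> b \<le> D2) \<Longrightarrow> a \<le> (D0 + D2) / 2"
    and a: "a \<in> R s"
  shows "a \<le> 0"
proof -
  \<comment> \<open>The inserted \<open>0\<close> gives a supremum also when \<open>R s\<close> is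
    empty, and makes \<open>D\<close> nonnegative.\<close>
  define D where "D s = Sup (insert 0 (R s))" for s
  have bdd: "bdd_above (insert 0 (R s))" for s
    by (rule bdd_aboveI[of _ "max 0 M"]) (use bd in \<open>force simp: le_max_iff_disj\<close>)
  have D_ge: "b \<le> D s" if "b \<in> R s" for b s unfolding D_def using that bdd by (intro cSup_upper) auto
  have D_nonneg: "0 \<le> D s" for s unfolding D_def using bdd by (intro cSup_upper) auto
  have D_least: "D s \<le> B" if "0 \<le> B" "\<And>b. b \<in> R s \<Longrightarrow> b \<le> B" for s B
    unfolding D_def by (rule cSup_least) (use that in auto)
  have D_mono: "D s \<le> D (Suc s)" for s
    by (rule D_least[OF D_nonneg]) (use mono[of s] in \<open>auto intro: D_ge\<close>)
  have D0: "D 0 = 0" using D_least[of 0 0] R0 D_nonneg[of 0] by simp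
  have DM: "D s \<le> max 0 M" for s by (rule D_least) (auto simp: le_max_iff_disj dest: bd)
  have conv: "D (Suc s) \<le> (D s + D (Suc (Suc s))) / 2" for s
  proof (rule D_least)
    show "0 \<le> (D s + D (Suc (Suc s))) / 2" using D_nonneg[of s] D_nonneg[of "Suc (Suc s)"] by simp
    show "b \<le> (D s + D (Suc (Suc s))) / 2" if "b \<in> R (Suc s)" for b
      by (rule step[OF that D_nonneg _ D_ge D_ge]) (use D_mono[of s] D_mono[of "Suc s"] in simp_all)
  qed
  have "D s \<le> 0" for s
  proof (rule ccontr)
    assume pos: "\<not> D s \<le> 0"
    have "\<exists>j. D j < D (Suc j)"
    proof (rule ccontr)
      assume "\<not> ?thesis"
      then have "D (Suc j) \<le> D j" for j by (auto simp: not_less)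
      then have "D n \<le> 0" for n by (induction n) (auto simp: D0 intro: order_trans)
      then show False using pos by simp
    qed
    then obtain j where j: "D j < D (Suc j)" by blast
    \<comment> \<open>By convexity all later increments are at least \<open>e\<close>, so
      \<open>D\<close> would grow linearly.\<close>
    define e where "e = D (Suc j) - D j"
    have inc: "D (Suc (j + n)) - D (j + n) \<ge> e" for n
    proof (induction n)
      case (Suc n) then show ?case using conv[of "j + n"] by simp
    qed (simp add: e_def)
    have lin: "D (j + n) \<ge> real n * e" for n
    proof (induction n)
      case (Suc n) then show ?case using inc[of n] by (simp add: algebra_simps)
    qed (simp add: D_nonneg)
    have "e > 0" using j by (simp add: e_def)
    then obtain n where "max 0 M < real n * e" using reals_Archimedean3[of e] by blast
    then show False using lin[of n] DM[of "j + n"] by linarith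
  qed
  then show ?thesis using D_ge[OF a] order_trans by blast
qed

text \<open>For a nonempty line these are the positive multiples of the Martin kernel of its end on
  one tree, for the empty line the positive constants, and for \<open>L = A v\<close> the multiples
  of the probability of hitting \<open>v\<close>. The weight is determined up to a factor, because
  any two vertices have a common ancestor.\<close>

definition line_weight :: "('a \<Rightarrow> 'a) \<Rightarrow> nat \<Rightarrow> 'a set \<Rightarrow> ('a \<Rightarrow> real) \<Rightarrow> bool" where
  "line_weight par p L \<kappa> \<longleftrightarrow> (\<forall>x. \<kappa> x > 0) \<and> (\<forall>x. x \<notin> L \<longrightarrow> \<kappa> (par x) = \<kappa> x) \<and>
     (\<forall>x\<in>L. \<kappa> x = real p * \<kappa> (par x))"

definition tree_op :: "('a \<Rightarrow> 'a) \<Rightarrow> nat \<Rightarrow> ('a \<Rightarrow> real) \<Rightarrow> 'a \<Rightarrow> real" where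
  "tree_op par p u x = (\<Sum>c\<in>children par x. u c) / (2 * real p) + u (par x) / 2"

text \<open>The probability that the walk started at \<open>x\<close> hits \<open>v\<close>, see
  \<open>hit_prob_eq\<close>: only the steps down from the confluent to \<open>v\<close> cost a
  factor \<open>p\<close> each.\<close>

definition power_weight :: "('a \<Rightarrow> 'a) \<Rightarrow> nat \<Rightarrow> 'a \<Rightarrow> 'a \<Rightarrow> real" where
  "power_weight par p v x = 1 / real p ^ updist par v x"

context horotree begin

lemma p_pos: "real p > 0" using p2 by simp

lemma line_weight_pos: "line_weight par p L \<kappa> \<Longrightarrow> \<kappa> x > 0" by (simp add: line_weight_def)

lemma line_weight_par_le: "line_weight par p L \<kappa> \<Longrightarrow> \<kappa> (par x) \<le> \<kappa> x"
proof (cases "x \<in> L")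
  case True
  assume w: "line_weight par p L \<kappa>"
  have "1 * \<kappa> (par x) \<le> real p * \<kappa> (par x)"
    by (rule mult_right_mono) (use p2 line_weight_pos[OF w, of "par x"] in auto)
  then show ?thesis using w True by (simp add: line_weight_def)
qed (simp add: line_weight_def)

lemma children_sum_on_line:
  assumes L: "chain par L" and w: "w \<in> L" "par w = v" and other: "\<And>c. par c = v \<Longrightarrow> c \<notin> L \<Longrightarrow> u c = a"
  shows "(\<Sum>c\<in>ch v. u c) = u w + (real p - 1) * a"
proof -
  have "(\<Sum>c\<in>ch v. u c) = u w + (\<Sum>c\<in>ch v - {w}. u c)"
    by (rule sum.remove) (use w in auto)
  also have "(\<Sum>c\<in>ch v - {w}. u c) = (\<Sum>c\<in>ch v - {w}. a)"
  proof (rule sum.cong[OF refl])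
    fix c assume c: "c \<in> ch v - {w}"
    then have "c \<notin> L" using L w unfolding chain_def by fastforce
    then show "u c = a" using other c by simp
  qed
  also have "\<dots> = (real p - 1) * a"
    using card_Diff_singleton[of w "ch v"] w p2 by (simp add: card_children of_nat_diff)
  finally show ?thesis .
qed

text \<open>On the line, one child has weight \<open>p * \<kappa> x\<close> and the
  \<open>p - 1\<close> others have weight \<open>\<kappa> x\<close>, while
  \<open>\<kappa> x = p * \<kappa> (par x)\<close>. The condition \<open>nc\<close> excludes the
  lowest vertex of a chain of the form \<open>A v\<close>, where harmonicity fails.\<close>

lemma line_weight_harmonic:
  assumes L: "chain par L" and \<kappa>: "line_weight par p L \<kappa>" and nc: "x \<in> L \<Longrightarrow> \<exists>w\<in>L. par w = x"
  shows "(\<Sum>c\<in>ch x. \<kappa> c) = real p * (2 * \<kappa> x - \<kappa> (par x))"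
proof (cases "x \<in> L")
  case True
  then obtain w where w: "w \<in> L" "par w = x" using nc by blast
  have "(\<Sum>c\<in>ch x. \<kappa> c) = \<kappa> w + (real p - 1) * \<kappa> x"
    by (rule children_sum_on_line[OF L w]) (use \<kappa> in \<open>auto simp: line_weight_def\<close>)
  moreover have "\<kappa> w = real p * \<kappa> x" "\<kappa> x = real p * \<kappa> (par x)" using \<kappa> w True by (auto simp: line_weight_def)
  ultimately show ?thesis by (simp add: algebra_simps)
next
  case False
  have "(\<Sum>c\<in>ch x. \<kappa> c) = (\<Sum>c\<in>ch x. \<kappa> x)"
    by (rule sum.cong[OF refl]) (use L \<kappa> False in \<open>auto simp: line_weight_def chain_def\<close>)
  then show ?thesis using False \<kappa> by (simp add: card_children line_weight_def)
qed

lemma tree_op_line_weight: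
  assumes "chain par L" "line_weight par p L \<kappa>" "x \<in> L \<Longrightarrow> \<exists>w\<in>L. par w = x"
  shows "tree_op par p \<kappa> x = \<kappa> x"
proof -
  have "(\<Sum>c\<in>ch x. \<kappa> c) = real p * (2 * \<kappa> x - \<kappa> (par x))" by (rule line_weight_harmonic[OF assms])
  then have "(\<Sum>c\<in>ch x. \<kappa> c) / (2 * real p) = (2 * \<kappa> x - \<kappa> (par x)) / 2" using p_pos by simp
  then show ?thesis unfolding tree_op_def by simp
qed

lemma power_weight_line_weight: "line_weight par p (A v) (power_weight par p v)"
  unfolding line_weight_def power_weight_def using p2
  by (auto simp: updist_par_right updist_par_right' p_pos)

text \<open>\<open>R s\<close> collects the deviations from \<open>u v\<close> down to depth
  \<open>s\<close> below \<open>v\<close>. Since half of the mean is taken one level up and half one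
  level down, their suprema are convex in \<open>s\<close>.\<close>

lemma branch_constant:
  assumes D_ch: "\<And>x c. x \<in> D \<Longrightarrow> par c = x \<Longrightarrow> c \<in> D"
    and D_par: "\<And>x. x \<in> D \<Longrightarrow> par x \<in> D \<or> par x = v"
    and D_anc: "\<And>x. x \<in> D \<Longrightarrow> v \<in> A x"
    and bd: "\<And>x. x \<in> D \<Longrightarrow> \<bar>u x\<bar> \<le> M"
    and harm: "\<And>x. x \<in> D \<Longrightarrow> tree_op par p u x = u x"
    and x: "x \<in> D"
  shows "u x = u v"
proof -
  define R where "R s = {\<bar>u x - u v\<bar> |x. x \<in> D \<and> (\<exists>k\<le>s. (par ^^ k) x = v)}" for s
  have RI: "\<bar>u x - u v\<bar> \<in> R s" if "x \<in> D" "k \<le> s" "(par ^^ k) x = v" for x k s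
    using that unfolding R_def by blast
  obtain k where k: "(par ^^ k) x = v" using D_anc[OF x] by (auto simp: anc_def)
  have "\<bar>u x - u v\<bar> \<le> 0"
  proof (rule bounded_convex_suprema[of R "M + \<bar>u v\<bar>"])
    show "a \<le> M + \<bar>u v\<bar>" if a: "a \<in> R s" for s a
    proof -
      obtain y where "a = \<bar>u y - u v\<bar>" "y \<in> D" using a unfolding R_def by blast
      then show ?thesis using bd[of y] by linarith
    qed
    show "a \<le> 0" if "a \<in> R 0" for a using that unfolding R_def by auto
    show "R s \<subseteq> R (Suc s)" for s unfolding R_def using le_SucI by blast
    show "\<bar>u x - u v\<bar> \<in> R k" by (rule RI[OF x order_refl k])
    fix s a D0 D2
    assume a: "a \<in> R (Suc s)" and D: "(0::real) \<le> D0" "D0 \<le> D2"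
      and R0: "\<And>b. b \<in> R s \<Longrightarrow> b \<le> D0" and R2: "\<And>b. b \<in> R (Suc (Suc s)) \<Longrightarrow> b \<le> D2"
    obtain y k where y: "a = \<bar>u y - u v\<bar>" "y \<in> D" "k \<le> Suc s" "(par ^^ k) y = v"
      using a unfolding R_def by blast
    show "a \<le> (D0 + D2) / 2"
    proof (cases k)
      case 0 then show ?thesis using y D by simp
    next
      case (Suc j)
      have c: "\<bar>u c - u v\<bar> \<le> D2" if "par c = y" for c
        by (rule R2, rule RI[of _ "Suc k"]) (use that y D_ch in \<open>auto simp: funpow_swap1\<close>)
      have pr: "\<bar>u (par y) - u v\<bar> \<le> D0"
      proof (cases "par y \<in> D")
        case True
        show ?thesis by (rule R0, rule RI[of _ j]) (use True Suc y in \<open>auto simp: funpow_swap1\<close>)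
      next
        case False then show ?thesis using D_par[OF y(2)] D by auto
      qed
      have "(\<Sum>c\<in>ch y. u c - u v) = (\<Sum>c\<in>ch y. u c) - real p * u v" by (simp add: sum_subtractf card_children)
      moreover have "\<bar>\<Sum>c\<in>ch y. u c - u v\<bar> \<le> (\<Sum>c\<in>ch y. D2)"
        by (rule order_trans[OF sum_abs]) (rule sum_mono, use c in simp)
      ultimately have s: "\<bar>(\<Sum>c\<in>ch y. u c) - real p * u v\<bar> \<le> real p * D2" by (simp add: card_children)
      have "u y - u v = ((\<Sum>c\<in>ch y. u c) - real p * u v) / (2 * real p) + (u (par y) - u v) / 2"
        using harm[OF y(2)] p_pos by (simp add: tree_op_def field_simps)
      moreover have "\<bar>((\<Sum>c\<in>ch y. u c) - real p * u v) / (2 * real p)\<bar> \<le> D2 / 2"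
        using s p_pos by (simp add: abs_div pos_divide_le_eq field_simps)
      moreover have "\<bar>(u (par y) - u v) / 2\<bar> \<le> D0 / 2" using pr by (simp add: abs_div)
      ultimately have "\<bar>u y - u v\<bar> \<le> D2 / 2 + D0 / 2"
        using abs_triangle_ineq[of "((\<Sum>c\<in>ch y. u c) - real p * u v) / (2 * real p)" "(u (par y) - u v) / 2"] by linarith
      then show ?thesis using y(1) by simp
    qed
  qed
  then show ?thesis by simp
qed

lemma off_line_constant:
  assumes L: "chain par L" "L \<noteq> {}" and \<kappa>: "line_weight par p L \<kappa>"
    and bd: "\<And>x. \<bar>u x\<bar> \<le> M * \<kappa> x"
    and harm: "\<And>x. x \<notin> L \<Longrightarrow> tree_op par p u x = u x"
    and x: "x \<notin> L"
  obtains j where "(par ^^ Suc j) x \<in> L" "(par ^^ j) x \<notin> L" "u x = u ((par ^^ Suc j) x)" "\<kappa> x = \<kappa> ((par ^^ Suc j) x)"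
proof -
  obtain v0 where "v0 \<in> L" using L by blast
  then have ex: "\<exists>k. (par ^^ k) x \<in> L" using common[of x v0] chain_pow[OF L(1)] by metis
  define m where "m = (LEAST k. (par ^^ k) x \<in> L)"
  have m: "(par ^^ m) x \<in> L" unfolding m_def using ex by (rule LeastI_ex)
  have ml: "k < m \<Longrightarrow> (par ^^ k) x \<notin> L" for k unfolding m_def by (rule not_less_Least)
  have "m \<noteq> 0" using m x by (metis funpow_0)
  then obtain j where j: "m = Suc j" by (cases m) auto
  let ?v = "(par ^^ Suc j) x"
  \<comment> \<open>All branches that leave the line at \<open>?v\<close>. As
    \<open>\<kappa>\<close> is constant there, the bound by \<open>\<kappa>\<close> becomes plain
    boundedness.\<close>
  define D where "D = {y. \<exists>i. (par ^^ Suc i) y = ?v \<and> (par ^^ i) y \<notin> L}"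
  have notL: "(par ^^ n) y \<notin> L" if "(par ^^ i) y \<notin> L" "n \<le> i" for y i n
    using chain_pow[OF L(1), of "(par ^^ n) y" "i - n"] pow_diff[OF that(2), of y] that(1) by auto
  have kD: "\<kappa> y = \<kappa> ?v" if y: "y \<in> D" for y
  proof -
    obtain i where i: "(par ^^ Suc i) y = ?v" "(par ^^ i) y \<notin> L" using y unfolding D_def by blast
    have "n \<le> Suc i \<Longrightarrow> \<kappa> ((par ^^ n) y) = \<kappa> y" for n
    proof (induction n)
      case (Suc n)
      then have "(par ^^ n) y \<notin> L" using notL[OF i(2)] by simp
      then show ?case using Suc \<kappa> by (simp add: line_weight_def)
    qed simp
    from this[of "Suc i"] show ?thesis using i(1) by simp
  qed
  have xD: "x \<in> D" unfolding D_def using ml[of j] j by blast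
  have "u x = u ?v"
  proof (rule branch_constant[of D _ u "M * \<kappa> ?v"])
    show "c \<in> D" if y: "y \<in> D" and c: "par c = y" for y c
    proof -
      obtain i where i: "(par ^^ Suc i) y = ?v" "(par ^^ i) y \<notin> L" using y unfolding D_def by blast
      have "(par ^^ Suc (Suc i)) c = ?v" "(par ^^ Suc i) c \<notin> L"
        using i c by (simp_all add: funpow_swap1)
      then show ?thesis unfolding D_def by blast
    qed
    show "par y \<in> D \<or> par y = ?v" if y: "y \<in> D" for y
    proof -
      obtain i where i: "(par ^^ Suc i) y = ?v" "(par ^^ i) y \<notin> L" using y unfolding D_def by blast
      show ?thesis
      proof (cases i)
        case 0 then show ?thesis using i(1) by simp
      next
        case (Suc n)
        then have "(par ^^ Suc n) (par y) = ?v" "(par ^^ n) (par y) \<notin> L" using i by (simp_all add: funpow_swap1)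
        then show ?thesis unfolding D_def by blast
      qed
    qed
    show "?v \<in> A y" if y: "y \<in> D" for y
    proof -
      obtain i where i: "(par ^^ Suc i) y = ?v" using y unfolding D_def by blast
      show ?thesis unfolding i[symmetric] by (rule pow_in_anc)
    qed
    show "\<bar>u y\<bar> \<le> M * \<kappa> ?v" if "y \<in> D" for y using bd[of y] kD[OF that] by simp
    show "tree_op par p u y = u y" if y: "y \<in> D" for y
    proof (rule harm)
      obtain i where i: "(par ^^ i) y \<notin> L" using y unfolding D_def by blast
      show "y \<notin> L" using notL[OF i, of 0] by simp
    qed
  qed (rule xD)
  then show ?thesis using that[of j] m ml[of j] j kD[OF xD] by simp
qed

text \<open>Along the line, \<open>u v - p u (par v)\<close> does not depend on \<open>v\<close>, and it tends to \<open>0\<close> towards the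
  reference end.\<close>

lemma multiple_of_line_weight:
  assumes L: "chain par L" "L \<noteq> {}" and \<kappa>: "line_weight par p L \<kappa>"
    and bd: "\<And>x. \<bar>u x\<bar> \<le> M * \<kappa> x"
    and harm: "\<And>x. x \<notin> L \<or> (\<exists>w\<in>L. par w = x) \<Longrightarrow> tree_op par p u x = u x"
  shows "\<exists>c. \<forall>x. u x = c * \<kappa> x"
proof -
  have harm1: "tree_op par p u x = u x" if "x \<notin> L" for x using harm that by blast
  have off: "u c = u v" if cv: "par c = v" "v \<in> L" "c \<notin> L" for c v
  proof -
    obtain j where j: "(par ^^ Suc j) c \<in> L" "(par ^^ j) c \<notin> L" "u c = u ((par ^^ Suc j) c)"
        "\<kappa> c = \<kappa> ((par ^^ Suc j) c)"
      by (rule off_line_constant[OF L \<kappa> bd harm1 cv(3)])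
    have in_L: "(par ^^ i) v \<in> L" for i by (rule chain_pow[OF L(1) cv(2)])
    have "j = 0"
    proof (rule ccontr)
      assume "j \<noteq> 0"
      then obtain i where "j = Suc i" by (cases j) auto
      then have "(par ^^ j) c = (par ^^ i) v" using cv(1) by (simp add: funpow_swap1)
      then show False using j(2) in_L[of i] by simp
    qed
    then show ?thesis using j(3) cv(1) by simp
  qed
  define f where "f v = u v - real p * u (par v)" for v
  have f_par: "f v = f (par v)" if v: "v \<in> L" for v
  proof -
    have pv: "par v \<in> L" using L v by (auto simp: chain_def)
    have "(\<Sum>c\<in>ch (par v). u c) = u v + (real p - 1) * u (par v)"
      by (rule children_sum_on_line[OF L(1) v refl]) (rule off[OF _ pv])
    moreover have "tree_op par p u (par v) = u (par v)" by (rule harm) (use v in blast)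
    ultimately show ?thesis using p_pos by (simp add: tree_op_def f_def field_simps)
  qed
  have f0: "f v = 0" if v: "v \<in> L" for v
  proof -
    have fn: "f v = f ((par ^^ n) v)" for n
    proof (induction n)
      case (Suc n) then show ?case using f_par[OF chain_pow[OF L(1) v, of n]] by simp
    qed simp
    have kn: "\<kappa> ((par ^^ n) v) = \<kappa> v * (1 / real p) ^ n" for n
    proof (induction n)
      case (Suc n)
      have "\<kappa> ((par ^^ n) v) = real p * \<kappa> (par ((par ^^ n) v))"
        using \<kappa> chain_pow[OF L(1) v, of n] unfolding line_weight_def by blast
      then show ?case using Suc p_pos by (simp add: field_simps)
    qed simp
    have bound: "\<bar>f v\<bar> \<le> 2 * M * \<kappa> v * (1 / real p) ^ n" for n
    proof -
      have b: "\<bar>u ((par ^^ n) v)\<bar> \<le> M * (\<kappa> v * (1 / real p) ^ n)" for n using bd[of "(par ^^ n) v"] unfolding kn .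
      have "\<bar>real p * u (par ((par ^^ n) v))\<bar> = real p * \<bar>u ((par ^^ Suc n) v)\<bar>" by (simp add: abs_mult)
      also have "\<dots> \<le> real p * (M * (\<kappa> v * (1 / real p) ^ Suc n))" using b[of "Suc n"] by (rule mult_left_mono) simp
      also have "\<dots> = M * (\<kappa> v * (1 / real p) ^ n)" using p_pos by simp
      finally have "\<bar>real p * u (par ((par ^^ n) v))\<bar> \<le> M * (\<kappa> v * (1 / real p) ^ n)" .
      moreover note b[of n]
      ultimately have "\<bar>f ((par ^^ n) v)\<bar> \<le> 2 * M * \<kappa> v * (1 / real p) ^ n" unfolding f_def by linarith
      then show ?thesis using fn[of n] by simp
    qed
    have "(\<lambda>n. 2 * M * \<kappa> v * (1 / real p) ^ n) \<longlonglongrightarrow> 2 * M * \<kappa> v * 0"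
      by (rule tendsto_mult_left[OF LIMSEQ_power_zero]) (use p2 in simp)
    then have "\<bar>f v\<bar> \<le> 2 * M * \<kappa> v * 0"
      by (rule LIMSEQ_le_const) (use bound in blast)
    then show ?thesis by simp
  qed
  have ratio: "u ((par ^^ n) v) / \<kappa> ((par ^^ n) v) = u v / \<kappa> v" if v: "v \<in> L" for v n
  proof (induction n)
    case (Suc n)
    let ?w = "(par ^^ n) v"
    have w: "?w \<in> L" by (rule chain_pow[OF L(1) v])
    have "\<kappa> ?w = real p * \<kappa> (par ?w)" using \<kappa> w unfolding line_weight_def by blast
    moreover have "u ?w = real p * u (par ?w)" using f0[OF w] unfolding f_def by simp
    ultimately have "u (par ?w) / \<kappa> (par ?w) = u ?w / \<kappa> ?w" using p_pos by simp
    then show ?case using Suc by simp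
  qed simp
  obtain v0 where v0: "v0 \<in> L" using L by blast
  have onL: "u v / \<kappa> v = u v0 / \<kappa> v0" if v: "v \<in> L" for v
  proof -
    obtain m n where "(par ^^ m) v = (par ^^ n) v0" using common[of v v0] by blast
    then show ?thesis using ratio[OF v, of m] ratio[OF v0, of n] by simp
  qed
  have all: "u x / \<kappa> x = u v0 / \<kappa> v0" for x
  proof (cases "x \<in> L")
    case False
    obtain j where j: "(par ^^ Suc j) x \<in> L" "(par ^^ j) x \<notin> L" "u x = u ((par ^^ Suc j) x)"
        "\<kappa> x = \<kappa> ((par ^^ Suc j) x)"
      by (rule off_line_constant[OF L \<kappa> bd harm1 False])
    show ?thesis unfolding j(3,4) by (rule onL[OF j(1)])
  qed (rule onL)
  have "u x = u v0 / \<kappa> v0 * \<kappa> x" for x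
    using all[of x] line_weight_pos[OF \<kappa>, of x] by (simp add: field_simps)
  then show ?thesis by blast
qed

end

section \<open>Harmonic functions on the horocyclic product\<close>

definition dl_op :: "nat \<Rightarrow> nat \<Rightarrow> ('a \<Rightarrow> 'a) \<Rightarrow> ('b \<Rightarrow> 'b) \<Rightarrow> ('a \<Rightarrow> 'b \<Rightarrow> real) \<Rightarrow> 'a \<Rightarrow> 'b \<Rightarrow> real" where
  "dl_op q r par1 par2 h x1 x2 =
     (\<Sum>c\<in>children par1 x1. h c (par2 x2)) / (2 * real q) + (\<Sum>c\<in>children par2 x2. h (par1 x1) c) / (2 * real r)"

lemma dl_op_swap: "dl_op r q par2 par1 (\<lambda>x2 x1. h x1 x2) x2 x1 = dl_op q r par1 par2 h x1 x2"
  by (simp add: dl_op_def add.commute)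

definition dl_harmonic where
  "dl_harmonic q r par1 (lev1 :: 'a \<Rightarrow> int) par2 (lev2 :: 'b \<Rightarrow> int) h \<longleftrightarrow>
     (\<forall>x1 x2. lev1 x1 + lev2 x2 = 0 \<longrightarrow> dl_op q r par1 par2 h x1 x2 = h x1 x2)"

lemma dl_harmonic_swap:
  "dl_harmonic q r par1 lev1 par2 lev2 h \<Longrightarrow> dl_harmonic r q par2 lev2 par1 lev1 (\<lambda>x2 x1. h x1 x2)"
  unfolding dl_harmonic_def by (intro allI impI, subst dl_op_swap) (simp add: add.commute)

locale horopair = T1: horotree par1 lev1 q + T2: horotree par2 lev2 r
  for par1 :: "'a \<Rightarrow> 'a" and lev1 q and par2 :: "'b \<Rightarrow> 'b" and lev2 r
begin

abbreviation "dlX x1 x2 \<equiv> lev1 x1 + lev2 x2 = 0"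

abbreviation "dl_harm \<equiv> dl_harmonic q r par1 lev1 par2 lev2"

lemma dl_harmD: "dl_harm h \<Longrightarrow> dlX x1 x2 \<Longrightarrow> dl_op q r par1 par2 h x1 x2 = h x1 x2"
  by (simp add: dl_harmonic_def)

text \<open>The second coordinates of two copies of the walk can be coupled until they meet; the first
  coordinate, reweighted by \<open>\<kappa>\<close>, has no drift towards the reference end.\<close>

lemma independent_of_second:
  assumes h: "dl_harm h" and L: "line par1 L" and \<kappa>: "line_weight par1 q L \<kappa>"
    and bd: "\<And>x1 x2. dlX x1 x2 \<Longrightarrow> \<bar>h x1 x2\<bar> \<le> M * \<kappa> x1"
    and x: "dlX x1 x2" "lev2 x2 = lev2 y2"
  shows "h x1 x2 = h x1 y2"
proof -
  have kpos: "\<kappa> x > 0" for x by (rule T1.line_weight_pos[OF \<kappa>])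
  have L': "chain par1 L" "\<And>x. x \<in> L \<Longrightarrow> \<exists>w\<in>L. par1 w = x" using L by (auto simp: line_def)
  define R where "R s = {\<bar>h x1 x2 - h x1 y2\<bar> / \<kappa> x1 | x1 x2 y2. dlX x1 x2 \<and> lev2 x2 = lev2 y2 \<and>
      (par2 ^^ s) x2 = (par2 ^^ s) y2}" for s
  have RI: "\<bar>h x1 x2 - h x1 y2\<bar> / \<kappa> x1 \<in> R s"
    if "dlX x1 x2" "lev2 x2 = lev2 y2" "(par2 ^^ s) x2 = (par2 ^^ s) y2" for x1 x2 y2 s
    using that unfolding R_def by blast
  have RE: "\<exists>x1 x2 y2. a = \<bar>h x1 x2 - h x1 y2\<bar> / \<kappa> x1 \<and> dlX x1 x2 \<and> lev2 x2 = lev2 y2 \<and>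
      (par2 ^^ s) x2 = (par2 ^^ s) y2" if "a \<in> R s" for a s
    using that unfolding R_def by blast
  obtain s where s: "(par2 ^^ s) x2 = (par2 ^^ s) y2" using T2.common_level[OF x(2)] by blast
  have "\<bar>h x1 x2 - h x1 y2\<bar> / \<kappa> x1 \<le> 0"
  proof (rule bounded_convex_suprema[of R "2 * M"])
    show "a \<le> 2 * M" if a: "a \<in> R s" for s a
    proof -
      obtain x1 x2 y2 where *: "a = \<bar>h x1 x2 - h x1 y2\<bar> / \<kappa> x1" "dlX x1 x2" "lev2 x2 = lev2 y2"
        using RE[OF a] by blast
      have "dlX x1 y2" using * by simp
      then have "\<bar>h x1 x2 - h x1 y2\<bar> \<le> 2 * M * \<kappa> x1" using bd[OF *(2)] bd[of x1 y2] by linarith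
      then show ?thesis unfolding *(1) using kpos[of x1] by (simp add: pos_divide_le_eq)
    qed
    show "a \<le> 0" if a: "a \<in> R 0" for a using RE[OF a] by auto
    show "R s \<subseteq> R (Suc s)" for s
    proof
      fix a assume a: "a \<in> R s"
      then obtain x1 x2 y2 where *: "a = \<bar>h x1 x2 - h x1 y2\<bar> / \<kappa> x1" "dlX x1 x2" "lev2 x2 = lev2 y2"
         "(par2 ^^ s) x2 = (par2 ^^ s) y2" using RE[OF a] by blast
      show "a \<in> R (Suc s)" unfolding *(1) by (rule RI) (use * in simp_all)
    qed
    show "\<bar>h x1 x2 - h x1 y2\<bar> / \<kappa> x1 \<in> R s" by (rule RI[OF x s])
    fix s a D0 D2
    assume a: "a \<in> R (Suc s)" and D: "(0::real) \<le> D0" "D0 \<le> D2"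
      and R0: "\<And>b. b \<in> R s \<Longrightarrow> b \<le> D0" and R2: "\<And>b. b \<in> R (Suc (Suc s)) \<Longrightarrow> b \<le> D2"
    obtain x1 x2 y2 where *: "a = \<bar>h x1 x2 - h x1 y2\<bar> / \<kappa> x1" "dlX x1 x2" "lev2 x2 = lev2 y2"
       "(par2 ^^ Suc s) x2 = (par2 ^^ Suc s) y2" using RE[OF a] by blast
    have xy: "dlX x1 y2" using * by simp
    \<comment> \<open>This bijection is the coupling of the second coordinates. When both move to
      their parents, the distance \<open>s\<close> to a common ancestor drops by one (bound
      \<open>D0\<close>); when both move to corresponding children, it grows by one (bound
      \<open>D2\<close>).\<close>
    obtain f where f: "bij_betw f (children par2 x2) (children par2 y2)"
      using finite_same_card_bij[of "children par2 x2" "children par2 y2"] T2.card_children by auto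
    have b0: "\<bar>h c (par2 x2) - h c (par2 y2)\<bar> \<le> \<kappa> c * D0" if "c \<in> children par1 x1" for c
    proof -
      have "\<bar>h c (par2 x2) - h c (par2 y2)\<bar> / \<kappa> c \<le> D0"
        by (rule R0, rule RI) (use * T1.lev_child[OF that] in \<open>simp_all add: funpow_swap1\<close>)
      then show ?thesis using kpos[of c] by (simp add: pos_divide_le_eq mult.commute)
    qed
    have b2: "\<bar>h (par1 x1) c - h (par1 x1) (f c)\<bar> \<le> \<kappa> (par1 x1) * D2" if c: "c \<in> children par2 x2" for c
    proof -
      have fc: "f c \<in> children par2 y2" using f c by (auto simp: bij_betw_def)
      then have p: "par2 (f c) = y2" "par2 c = x2" using c by simp_all
      have "(par2 ^^ Suc (Suc s)) c = (par2 ^^ Suc s) x2" "(par2 ^^ Suc (Suc s)) (f c) = (par2 ^^ Suc s) y2"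
        unfolding funpow_Suc_right[of "Suc s"] by (simp_all add: p)
      then have "\<bar>h (par1 x1) c - h (par1 x1) (f c)\<bar> / \<kappa> (par1 x1) \<le> D2"
        by (intro R2 RI) (use * T2.lev_child[OF c] T2.lev_child[OF fc] in simp_all)
      then show ?thesis using kpos[of "par1 x1"] by (simp add: pos_divide_le_eq mult.commute)
    qed
    have re: "(\<Sum>c\<in>children par2 y2. h (par1 x1) c) = (\<Sum>c\<in>children par2 x2. h (par1 x1) (f c))"
      using sum.reindex_bij_betw[OF f, of "h (par1 x1)"] by simp
    let ?I = "\<Sum>c\<in>children par1 x1. h c (par2 x2) - h c (par2 y2)"
    let ?J = "\<Sum>c\<in>children par2 x2. h (par1 x1) c - h (par1 x1) (f c)"
    have eq: "h x1 x2 - h x1 y2 = ?I / (2 * real q) + ?J / (2 * real r)"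
      using dl_harmD[OF h *(2)] dl_harmD[OF h xy] by (simp add: dl_op_def re sum_subtractf diff_divide_distrib)
    have "\<bar>?I\<bar> \<le> (\<Sum>c\<in>children par1 x1. \<kappa> c * D0)"
      by (rule order_trans[OF sum_abs]) (rule sum_mono, rule b0)
    also have "\<dots> = real q * (2 * \<kappa> x1 - \<kappa> (par1 x1)) * D0"
      unfolding sum_distrib_right[symmetric] by (simp add: T1.line_weight_harmonic[OF L'(1) \<kappa> L'(2)])
    finally have I: "\<bar>?I / (2 * real q)\<bar> \<le> (2 * \<kappa> x1 - \<kappa> (par1 x1)) * D0 / 2"
      using T1.p_pos by (simp add: pos_divide_le_eq mult.commute mult.left_commute)
    have "\<bar>?J\<bar> \<le> (\<Sum>c\<in>children par2 x2. \<kappa> (par1 x1) * D2)"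
      by (rule order_trans[OF sum_abs]) (rule sum_mono, rule b2)
    then have J: "\<bar>?J / (2 * real r)\<bar> \<le> \<kappa> (par1 x1) * D2 / 2"
      using T2.p_pos by (simp add: pos_divide_le_eq T2.card_children mult.commute mult.left_commute)
    \<comment> \<open>The bounds \<open>D0\<close> and \<open>D2\<close> carry the weights
      \<open>(2 * \<kappa> x1 - \<kappa> (par1 x1)) / 2\<close> and
      \<open>\<kappa> (par1 x1) / 2\<close>, with sum \<open>\<kappa> x1\<close>. As
      \<open>\<kappa>\<close> does not increase towards the parent, the larger bound gets at most
      half of the weight.\<close>
    have "(\<kappa> x1 - \<kappa> (par1 x1)) * (D2 - D0) \<ge> 0"
      using D T1.line_weight_par_le[OF \<kappa>, of x1] by (intro mult_nonneg_nonneg) simp_all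
    then have "\<bar>h x1 x2 - h x1 y2\<bar> \<le> (D0 + D2) / 2 * \<kappa> x1"
      using I J abs_triangle_ineq[of "?I / (2 * real q)" "?J / (2 * real r)"] unfolding eq
      by (simp add: algebra_simps)
    then show "a \<le> (D0 + D2) / 2" unfolding *(1) using kpos[of x1] by (simp add: pos_divide_le_eq)
  qed
  then show ?thesis using kpos[of x1] by (simp add: divide_le_0_iff)
qed

lemma second_exists: "\<exists>x2. dlX x1 x2"
proof -
  obtain x2 where "lev2 x2 = - lev1 x1" using T2.lev_surj by blast
  then show ?thesis by (intro exI[of _ x2]) simp
qed

lemma depends_on_first:
  assumes "\<And>x1 x2 y2. dlX x1 x2 \<Longrightarrow> lev2 x2 = lev2 y2 \<Longrightarrow> h x1 x2 = h x1 y2"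
  shows "\<exists>g. \<forall>x1 x2. dlX x1 x2 \<longrightarrow> h x1 x2 = g x1"
proof -
  define s where "s x1 = (SOME x2. dlX x1 x2)" for x1
  have s: "dlX x1 (s x1)" for x1 unfolding s_def using second_exists[of x1] by (rule someI_ex)
  have "h x1 x2 = h x1 (s x1)" if "dlX x1 x2" for x1 x2
    by (rule assms[OF that]) (use s[of x1] that in linarith)
  then show ?thesis by (intro exI[of _ "\<lambda>x1. h x1 (s x1)"] allI impI)
qed

lemma dl_op_first:
  assumes "\<And>x1 x2. dlX x1 x2 \<Longrightarrow> h x1 x2 = g x1" "dlX x1 x2"
  shows "dl_op q r par1 par2 h x1 x2 = tree_op par1 q g x1"
proof -
  have "(\<Sum>c\<in>children par1 x1. h c (par2 x2)) = (\<Sum>c\<in>children par1 x1. g c)"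
  proof (rule sum.cong[OF refl])
    fix c assume "c \<in> children par1 x1"
    then show "h c (par2 x2) = g c" using T1.lev_child[of c x1] assms(2) by (intro assms(1)) simp
  qed
  moreover have "(\<Sum>c\<in>children par2 x2. h (par1 x1) c) = (\<Sum>c\<in>children par2 x2. g (par1 x1))"
  proof (rule sum.cong[OF refl])
    fix c assume "c \<in> children par2 x2"
    then show "h (par1 x1) c = g (par1 x1)" using T2.lev_child[of c x2] assms(2) by (intro assms(1)) simp
  qed
  ultimately show ?thesis using T2.p_pos by (simp add: dl_op_def tree_op_def T2.card_children)
qed

lemma minimal_line_weight:
  assumes h: "dl_harm h" and L: "line par1 L" "L \<noteq> {}" and \<kappa>: "line_weight par1 q L \<kappa>"
    and bd: "\<And>x1 x2. dlX x1 x2 \<Longrightarrow> \<bar>h x1 x2\<bar> \<le> M * \<kappa> x1"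
  shows "\<exists>c. \<forall>x1 x2. dlX x1 x2 \<longrightarrow> h x1 x2 = c * \<kappa> x1"
proof -
  have "\<exists>g. \<forall>x1 x2. dlX x1 x2 \<longrightarrow> h x1 x2 = g x1"
    by (rule depends_on_first) (rule independent_of_second[OF h L(1) \<kappa> bd])
  then obtain g where "\<forall>x1 x2. dlX x1 x2 \<longrightarrow> h x1 x2 = g x1" ..
  then have g: "\<And>x1 x2. dlX x1 x2 \<Longrightarrow> h x1 x2 = g x1" by blast
  have "\<exists>c. \<forall>x. g x = c * \<kappa> x"
  proof (rule T1.multiple_of_line_weight[OF _ L(2) \<kappa>])
    show "chain par1 L" using L by (simp add: line_def)
    fix x1
    obtain x2 where x2: "dlX x1 x2" using second_exists by blast
    show "\<bar>g x1\<bar> \<le> M * \<kappa> x1" using bd[OF x2] g[OF x2] by simp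
    show "tree_op par1 q g x1 = g x1"
      using dl_op_first[OF g x2] dl_harmD[OF h x2] g[OF x2] by simp
  qed
  then obtain c where "g x = c * \<kappa> x" for x by blast
  then have "h x1 x2 = c * \<kappa> x1" if "dlX x1 x2" for x1 x2 using g[OF that] by simp
  then show ?thesis by blast
qed

text \<open>The coupling with constant weight, applied to each coordinate, leaves a function of the
  level alone. Harmonicity makes it affine in the level, and boundedness makes its slope
  zero.\<close>

lemma bounded_harmonic_constant:
  assumes h: "dl_harm h" and bd: "\<And>x1 x2. dlX x1 x2 \<Longrightarrow> \<bar>h x1 x2\<bar> \<le> M"
  shows "\<exists>c. \<forall>x1 x2. dlX x1 x2 \<longrightarrow> h x1 x2 = c"
proof -
  \<comment> \<open>The same product with its factors exchanged; statements on the second coordinate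
    are obtained from those on the first in this way throughout.\<close>
  interpret swap: horopair par2 lev2 r par1 lev1 q ..
  have l1: "line par1 {}" "line_weight par1 q {} (\<lambda>_. 1)"
    and l2: "line par2 {}" "line_weight par2 r {} (\<lambda>_. 1)"
    by (simp_all add: line_def chain_def line_weight_def)
  have i2: "h x1 x2 = h x1 y2" if "dlX x1 x2" "lev2 x2 = lev2 y2" for x1 x2 y2
    by (rule independent_of_second[OF h l1, of M]) (use bd that in simp_all)
  have i1: "h x1 x2 = h y1 x2" if "dlX x1 x2" "lev1 x1 = lev1 y1" for x1 x2 y1
    by (rule swap.independent_of_second[OF dl_harmonic_swap[OF h] l2, of M]) (use bd that in \<open>simp_all add: add.commute\<close>)
  have "\<exists>g. \<forall>x1 x2. dlX x1 x2 \<longrightarrow> h x1 x2 = g x1" by (rule depends_on_first) (rule i2)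
  then obtain g where "\<forall>x1 x2. dlX x1 x2 \<longrightarrow> h x1 x2 = g x1" ..
  then have g: "\<And>x1 x2. dlX x1 x2 \<Longrightarrow> h x1 x2 = g x1" by blast
  have glev: "g x1 = g y1" if "lev1 x1 = lev1 y1" for x1 y1
  proof -
    obtain x2 where x2: "dlX x1 x2" using second_exists by blast
    then show ?thesis using g[OF x2] g[of y1 x2] i1[OF x2 that] that by simp
  qed
  define s where "s k = (SOME x. lev1 x = k)" for k
  have s: "lev1 (s k) = k" for k unfolding s_def using T1.lev_surj[of k] by (rule someI_ex)
  define f where "f k = g (s k)" for k
  have gf: "g x = f (lev1 x)" for x unfolding f_def by (rule glev) (simp add: s)
  have conv: "f (k + 1) - f k = f k - f (k - 1)" for k
  proof -
    obtain x2 where x2: "dlX (s k) x2" using second_exists by blast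
    have "tree_op par1 q g (s k) = g (s k)" using dl_op_first[OF g x2] dl_harmD[OF h x2] g[OF x2] by simp
    moreover have "(\<Sum>c\<in>children par1 (s k). g c) = (\<Sum>c\<in>children par1 (s k). f (k + 1))"
    proof (rule sum.cong[OF refl])
      fix c assume "c \<in> children par1 (s k)"
      then show "g c = f (k + 1)" using T1.lev_child[of c "s k"] by (simp add: gf s)
    qed
    ultimately have "f (k + 1) / 2 + f (k - 1) / 2 = f k"
      using T1.p_pos by (simp add: tree_op_def T1.card_children gf s)
    then show ?thesis by simp
  qed
  define d where "d = f 1 - f 0"
  have dk: "f (k + 1) - f k = d" for k
  proof (induction k rule: int_induct[where k = 0])
    case (step1 i) then show ?case using conv[of "i + 1"] by simp
  next
    case (step2 i) then show ?case using conv[of i] by simp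
  qed (simp add: d_def)
  have fn: "f (int n) = f 0 + real n * d" for n
  proof (induction n)
    case (Suc n) then show ?case using dk[of "int n"] by (simp add: algebra_simps)
  qed simp
  have fb: "\<bar>f k\<bar> \<le> M" for k
  proof -
    obtain x2 where x2: "dlX (s k) x2" using second_exists by blast
    show ?thesis unfolding f_def using bd[OF x2] g[OF x2] by simp
  qed
  have "d = 0"
  proof (rule ccontr)
    assume "d \<noteq> 0"
    then obtain n where n: "2 * M < real n * \<bar>d\<bar>" using reals_Archimedean3[of "\<bar>d\<bar>"] by auto
    have "\<bar>real n * d\<bar> \<le> 2 * M" using fn[of n] fb[of "int n"] fb[of 0] by linarith
    then show False using n by (simp add: abs_mult)
  qed
  have "f k = f 0" for k
  proof (induction k rule: int_induct[where k = 0])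
    case (step1 i) then show ?case using dk[of i] \<open>d = 0\<close> by simp
  next
    case (step2 i) then show ?case using dk[of "i - 1"] \<open>d = 0\<close> by simp
  qed simp
  then have "h x1 x2 = f 0" if "dlX x1 x2" for x1 x2 using g[OF that] gf[of x1] by simp
  then show ?thesis by blast
qed

end

section \<open>The Green function\<close>

definition dsum :: "nat \<Rightarrow> nat \<Rightarrow> (nat \<Rightarrow> nat \<Rightarrow> real) \<Rightarrow> real" where
  "dsum q r F = (\<Sum>\<^sub>\<infinity>(i, j)\<in>UNIV. F i j / (real q ^ i * real r ^ j))"

lemma has_sum_times_nat:
  fixes f g :: "nat \<Rightarrow> real"
  assumes f: "(f has_sum a) UNIV" and g: "(g has_sum b) UNIV"
  shows "((\<lambda>(i, j). f i * g j) has_sum (a * b)) UNIV"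
proof -
  have fa: "(\<lambda>i. \<bar>f i\<bar>) summable_on UNIV" and ga: "(\<lambda>i. \<bar>g i\<bar>) summable_on UNIV"
    using f g has_sum_imp_summable summable_on_iff_abs_summable_on_real[of f UNIV]
      summable_on_iff_abs_summable_on_real[of g UNIV] by auto
  have "((\<lambda>j. \<bar>f i\<bar> * \<bar>g j\<bar>) has_sum (\<bar>f i\<bar> * infsum (\<lambda>j. \<bar>g j\<bar>) UNIV)) UNIV" for i
    using has_sum_cmult_right[OF has_sum_infsum[OF ga]] .
  then have "(\<lambda>(i, j). \<bar>f i\<bar> * \<bar>g j\<bar>) summable_on Sigma UNIV (\<lambda>_. UNIV)"
    by (intro summable_on_SigmaI[where g = "\<lambda>i. \<bar>f i\<bar> * infsum (\<lambda>j. \<bar>g j\<bar>) UNIV"] summable_on_cmult_left[OF fa]) auto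
  then have "(\<lambda>x. \<bar>case x of (i, j) \<Rightarrow> f i * g j\<bar>) summable_on UNIV"
    by (simp add: case_prod_unfold abs_mult)
  then have s: "(\<lambda>(i, j). f i * g j) summable_on Sigma UNIV (\<lambda>_. UNIV)"
    using summable_on_iff_abs_summable_on_real[of "\<lambda>(i, j). f i * g j" UNIV] by simp
  have "((\<lambda>(i, j). f i * g j) has_sum (a * b)) (Sigma UNIV (\<lambda>_. UNIV))"
    by (rule has_sum_SigmaI[where g = "\<lambda>i. f i * b", OF _ _ s])
       (simp_all add: has_sum_cmult_right[OF g] has_sum_cmult_left[OF f])
  then show ?thesis by simp
qed

lemma summable_linear_geometric:
  assumes "q \<ge> 2" shows "(\<lambda>i. (real i + 1) / real q ^ i) summable_on UNIV"
proof -
  have "summable (\<lambda>n. of_nat (Suc n) * (1 / real q) ^ n)"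
    using geometric_deriv_sums[of "1 / real q"] assms by (intro sums_summable) simp
  then have "summable (\<lambda>i. (real i + 1) / real q ^ i)" by (simp add: power_one_over add.commute divide_inverse power_inverse)
  then have "summable (\<lambda>i. norm ((real i + 1) / real q ^ i))" by simp
  then show ?thesis by (rule norm_summable_imp_summable_on)
qed

context
  fixes q r :: nat
  assumes q2: "q \<ge> 2" and r2: "r \<ge> 2"
begin

lemma dsum_bound_summable: "(\<lambda>(i, j). C * (real i + 1) * (real j + 1) / (real q ^ i * real r ^ j)) summable_on UNIV"
proof -
  have "((\<lambda>(i, j). (real i + 1) / real q ^ i * ((real j + 1) / real r ^ j)) has_sum
      (infsum (\<lambda>i. (real i + 1) / real q ^ i) UNIV * infsum (\<lambda>i. (real i + 1) / real r ^ i) UNIV)) UNIV"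
    by (intro has_sum_times_nat has_sum_infsum summable_linear_geometric q2 r2)
  from has_sum_cmult_right[OF this, of C]
  have "(\<lambda>x. C * (case x of (i, j) \<Rightarrow> (real i + 1) / real q ^ i * ((real j + 1) / real r ^ j))) summable_on UNIV"
    by (rule has_sum_imp_summable)
  then show ?thesis by (simp add: case_prod_unfold mult.assoc)
qed

text \<open>The growth permitted here is that of \<open>strip_green\<close> as a function of the two
  ends of the interval.\<close>

lemma dsum_has_sum:
  assumes "\<And>i j. \<bar>F i j\<bar> \<le> C * (real i + 1) * (real j + 1)"
  shows "((\<lambda>(i, j). F i j / (real q ^ i * real r ^ j)) has_sum dsum q r F) UNIV"
proof -
  have "(\<lambda>x. norm (case x of (i, j) \<Rightarrow> F i j / (real q ^ i * real r ^ j))) summable_on UNIV"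
    by (rule Infinite_Sum.abs_summable_on_comparison_test'[OF dsum_bound_summable[of C]])
       (use assms q2 r2 in \<open>auto simp: case_prod_unfold abs_mult intro!: divide_right_mono\<close>)
  then have "(\<lambda>(i, j). F i j / (real q ^ i * real r ^ j)) summable_on UNIV"
    using summable_on_iff_abs_summable_on_real by blast
  then show ?thesis unfolding dsum_def by (rule has_sum_infsum)
qed

lemma dsum_add:
  assumes F: "\<And>i j. \<bar>F i j\<bar> \<le> C * (real i + 1) * (real j + 1)"
    and G: "\<And>i j. \<bar>G i j\<bar> \<le> D * (real i + 1) * (real j + 1)"
  shows "dsum q r (\<lambda>i j. F i j + G i j) = dsum q r F + dsum q r G"
proof -
  have "((\<lambda>x. (case x of (i, j) \<Rightarrow> F i j / (real q ^ i * real r ^ j)) + (case x of (i, j) \<Rightarrow> G i j / (real q ^ i * real r ^ j)))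
      has_sum (dsum q r F + dsum q r G)) UNIV"
    by (rule has_sum_add[OF dsum_has_sum[OF F] dsum_has_sum[OF G]])
  from infsumI[OF this] show ?thesis unfolding dsum_def by (simp add: case_prod_unfold add_divide_distrib)
qed

lemma dsum_cmult: "dsum q r (\<lambda>i j. c * F i j) = c * dsum q r F"
proof -
  have "(\<lambda>(i, j). c * F i j / (real q ^ i * real r ^ j)) = (\<lambda>x. c * (case x of (i, j) \<Rightarrow> F i j / (real q ^ i * real r ^ j)))"
    by (auto simp: fun_eq_iff)
  then show ?thesis unfolding dsum_def by (simp add: infsum_cmult_right')
qed

lemma dsum_mono:
  assumes F: "\<And>i j. \<bar>F i j\<bar> \<le> C * (real i + 1) * (real j + 1)"
    and G: "\<And>i j. \<bar>G i j\<bar> \<le> D * (real i + 1) * (real j + 1)"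
    and le: "\<And>i j. F i j \<le> G i j"
  shows "dsum q r F \<le> dsum q r G"
  by (rule has_sum_mono[OF dsum_has_sum[OF F] dsum_has_sum[OF G]])
     (use le q2 r2 in \<open>auto intro!: divide_right_mono\<close>)

lemma dsum_nonneg: "(\<And>i j. F i j \<ge> 0) \<Longrightarrow> dsum q r F \<ge> 0"
  unfolding dsum_def by (rule infsum_nonneg) auto

lemma dsum_pos:
  assumes F: "\<And>i j. \<bar>F i j\<bar> \<le> C * (real i + 1) * (real j + 1)" and "\<And>i j. F i j \<ge> 0" "F 0 0 > 0"
  shows "dsum q r F > 0"
proof -
  have "(\<Sum>x\<in>{(0, 0)}. case x of (i, j) \<Rightarrow> F i j / (real q ^ i * real r ^ j)) \<le> dsum q r F"
    by (rule finite_sum_le_has_sum[OF dsum_has_sum[OF F]]) (use assms(2) in auto)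
  then show ?thesis using assms(3) by simp
qed

lemma dsum_shift:
  "dsum q r (\<lambda>i j. if i \<ge> d1 \<and> j \<ge> d2 then F i j else 0) =
     dsum q r (\<lambda>a b. F (d1 + a) (d2 + b)) / (real q ^ d1 * real r ^ d2)"
proof -
  let ?h = "\<lambda>(a, b). (d1 + a, d2 + b)"
  have inj: "inj_on ?h UNIV" by (auto simp: inj_on_def)
  have img: "(i, j) \<in> range ?h \<longleftrightarrow> i \<ge> d1 \<and> j \<ge> d2" for i j
    by (auto simp: image_iff le_iff_add)
  have "dsum q r (\<lambda>i j. if i \<ge> d1 \<and> j \<ge> d2 then F i j else 0) =
      infsum (\<lambda>(i, j). F i j / (real q ^ i * real r ^ j)) (range ?h)"
    unfolding dsum_def by (rule infsum_cong_neutral) (use img in auto)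
  also have "\<dots> = infsum ((\<lambda>(i, j). F i j / (real q ^ i * real r ^ j)) \<circ> ?h) UNIV"
    by (rule infsum_reindex[OF inj])
  also have "\<dots> = infsum (\<lambda>x. (case x of (a, b) \<Rightarrow> F (d1 + a) (d2 + b) / (real q ^ a * real r ^ b)) *
      (1 / (real q ^ d1 * real r ^ d2))) UNIV"
    by (rule infsum_cong) (auto simp: power_add)
  also have "\<dots> = dsum q r (\<lambda>a b. F (d1 + a) (d2 + b)) * (1 / (real q ^ d1 * real r ^ d2))"
    unfolding dsum_def by (rule infsum_cmult_left')
  finally show ?thesis by simp
qed

text \<open>The mechanism of summation by parts: the shift of the index absorbs one factor
  \<open>q\<close> or \<open>r\<close>, and the values at index \<open>0\<close> are the boundary
  terms.\<close>

lemma dsum_shift1: "(\<And>j. F 0 j = 0) \<Longrightarrow> dsum q r (\<lambda>i j. F (Suc i) j / real q) = dsum q r F"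
  and dsum_shift2: "(\<And>i. F i 0 = 0) \<Longrightarrow> dsum q r (\<lambda>i j. F i (Suc j) / real r) = dsum q r F"
proof -
  assume "\<And>j. F 0 j = 0"
  then have "F = (\<lambda>i j. if i \<ge> 1 \<and> j \<ge> 0 then F i j else 0)" by (auto simp: fun_eq_iff Suc_le_eq)
  then show "dsum q r (\<lambda>i j. F (Suc i) j / real q) = dsum q r F"
    using dsum_shift[of 1 0 F] dsum_cmult[of "1 / real q" "\<lambda>i j. F (Suc i) j"] by simp
next
  assume "\<And>i. F i 0 = 0"
  then have "F = (\<lambda>i j. if i \<ge> 0 \<and> j \<ge> 1 then F i j else 0)" by (auto simp: fun_eq_iff Suc_le_eq)
  then show "dsum q r (\<lambda>i j. F i (Suc j) / real r) = dsum q r F"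
    using dsum_shift[of 0 1 F] dsum_cmult[of "1 / real r" "\<lambda>i j. F i (Suc j)"] by simp
qed

lemma dsum_swap: "dsum r q (\<lambda>j i. F i j) = dsum q r F"
proof -
  have "dsum r q (\<lambda>j i. F i j) = infsum ((\<lambda>(i, j). F i j / (real q ^ i * real r ^ j)) \<circ> prod.swap) UNIV"
    unfolding dsum_def by (rule infsum_cong) (auto simp: mult.commute)
  also have "\<dots> = infsum (\<lambda>(i, j). F i j / (real q ^ i * real r ^ j)) (prod.swap ` UNIV)"
    by (rule infsum_reindex[symmetric]) simp
  finally show ?thesis by (simp add: dsum_def)
qed

text \<open>Dominated convergence for the counting measure, with the bilinear bound as
  majorant.\<close>

lemma dsum_tendsto:
  assumes lim: "\<And>i j. (\<lambda>n. F n i j) \<longlonglongrightarrow> G i j"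
    and bd: "\<And>n i j. \<bar>F n i j\<bar> \<le> C * (real i + 1) * (real j + 1)"
  shows "(\<lambda>n. dsum q r (F n)) \<longlonglongrightarrow> dsum q r G"
proof -
  have Gbd: "\<bar>G i j\<bar> \<le> C * (real i + 1) * (real j + 1)" for i j
    by (rule LIMSEQ_le_const2[OF tendsto_rabs[OF lim[of i j]]]) (use bd in blast)
  let ?w = "\<lambda>(i, j). C * (real i + 1) * (real j + 1) / (real q ^ i * real r ^ j)"
  have as: "(\<lambda>x. norm (case x of (i, j) \<Rightarrow> H i j / (real q ^ i * real r ^ j))) summable_on UNIV"
    if "\<And>i j. \<bar>H i j\<bar> \<le> C * (real i + 1) * (real j + 1)" for H
    using has_sum_imp_summable[OF dsum_has_sum[OF that]] summable_on_iff_abs_summable_on_real by blast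
  have ds: "dsum q r H = lebesgue_integral (count_space UNIV) (\<lambda>(i, j). H i j / (real q ^ i * real r ^ j))"
    if "\<And>i j. \<bar>H i j\<bar> \<le> C * (real i + 1) * (real j + 1)" for H
    unfolding dsum_def using infsetsum_infsum[OF as[OF that, unfolded abs_summable_equivalent]] unfolding infsetsum_def by simp
  have "(\<lambda>n. lebesgue_integral (count_space UNIV) (\<lambda>(i, j). F n i j / (real q ^ i * real r ^ j)))
      \<longlonglongrightarrow> lebesgue_integral (count_space UNIV) (\<lambda>(i, j). G i j / (real q ^ i * real r ^ j))"
  proof (rule integral_dominated_convergence[where w = ?w])
    show "integrable (count_space UNIV) ?w"
      using dsum_bound_summable[of C] summable_on_iff_abs_summable_on_real abs_summable_equivalent
      unfolding Infinite_Set_Sum.abs_summable_on_def by blast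
    show "AE x in count_space UNIV. (\<lambda>n. case x of (i, j) \<Rightarrow> F n i j / (real q ^ i * real r ^ j)) \<longlonglongrightarrow>
        (case x of (i, j) \<Rightarrow> G i j / (real q ^ i * real r ^ j))"
      using q2 r2 by (intro AE_I2) (auto intro!: tendsto_divide lim simp: case_prod_unfold)
    show "AE x in count_space UNIV. norm (case x of (i, j) \<Rightarrow> F n i j / (real q ^ i * real r ^ j)) \<le> ?w x" for n
      using bd[of n] by (intro AE_I2) (auto simp: case_prod_unfold abs_mult intro!: divide_right_mono)
  qed simp_all
  then show ?thesis using ds[OF bd] ds[OF Gbd] by simp
qed

end

section \<open>Simple random walk on intervals\<close>

text \<open>The double difference of the killed Green function in the two endpoints of the interval, see
  \<open>strip_green_diff\<close>. The first case avoids the pole of the formula.\<close>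

definition visits :: "real \<Rightarrow> real \<Rightarrow> real \<Rightarrow> real \<Rightarrow> real" where
  "visits U1 D1 U2 D2 = (if D1 + D2 = 2 then 1
     else 2 * (U1 * D2 + D1 * U2 - (D1 + D2)) / ((D1 + D2) * (D1 + D2 - 1) * (D1 + D2 - 2)))"

text \<open>The Green function of the simple random walk on an interval of length \<open>n + m\<close> killed at its
  endpoints, for a target at distance \<open>n\<close> from the lower endpoint and a start \<open>s\<close> steps above the
  target.\<close>

definition strip_green :: "real \<Rightarrow> real \<Rightarrow> real \<Rightarrow> real" where
  "strip_green n m s = 2 * (n + min s 0) * (m - max s 0) / (n + m)"

lemma visits_swap: "visits U1 D1 U2 D2 = visits U2 D2 U1 D1"
  by (simp add: visits_def algebra_simps)

text \<open>Inclusion and exclusion over both endpoints: the left-hand side counts the visits at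
  times when the path so far has reached exactly the lowest and the highest level the interval
  allows. The arguments of \<open>visits\<close> are the distances of start and target from the
  lower endpoint, then those from the upper one. In length two the smaller intervals are degenerate
  and contribute \<open>0\<close>.\<close>

lemma strip_green_diff:
  assumes "D1 \<ge> 1" "D2 \<ge> 1" "D1 + s \<ge> 1" "D2 - s \<ge> 1" "D1 + D2 = 2 \<or> D1 + D2 \<ge> 3"
  shows "strip_green D1 D2 s - strip_green (D1 - 1) D2 s - strip_green D1 (D2 - 1) s + strip_green (D1 - 1) (D2 - 1) s
     = visits (D1 + s) D1 (D2 - s) D2"
proof (cases "D1 + D2 = 2")
  case True
  then have "D1 = 1" "D2 = 1" using assms by simp_all
  moreover then have "s = 0" using assms by simp
  ultimately show ?thesis by (simp add: strip_green_def visits_def)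
next
  case False
  define L where "L = D1 + D2"
  have L: "L \<noteq> 0" "L - 1 \<noteq> 0" "L - 2 \<noteq> 0" using assms False by (simp_all add: L_def)
  have e: "D1 - 1 + D2 = L - 1" "D1 + (D2 - 1) = L - 1" "D1 - 1 + (D2 - 1) = L - 2" "D2 = L - D1" by (simp_all add: L_def)
  show ?thesis
  proof (cases "s \<ge> 0")
    case True
    have "strip_green D1 D2 s - strip_green (D1 - 1) D2 s - strip_green D1 (D2 - 1) s + strip_green (D1 - 1) (D2 - 1) s
      = 2 * D1 * (D2 - s) / L - 2 * (D1 - 1) * (D2 - s) / (L - 1) - 2 * D1 * (D2 - s - 1) / (L - 1) + 2 * (D1 - 1) * (D2 - s - 1) / (L - 2)"
      unfolding strip_green_def using True by (simp add: e L_def[symmetric] algebra_simps)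
    also have "\<dots> = 2 * ((D1 + s) * D2 + D1 * (D2 - s) - L) / (L * (L - 1) * (L - 2))"
      using L unfolding e(4) by (simp add: divide_simps) (simp add: algebra_simps)
    finally show ?thesis using False by (simp add: visits_def L_def)
  next
    case neg: False
    have "strip_green D1 D2 s - strip_green (D1 - 1) D2 s - strip_green D1 (D2 - 1) s + strip_green (D1 - 1) (D2 - 1) s
      = 2 * (D1 + s) * D2 / L - 2 * (D1 + s - 1) * D2 / (L - 1) - 2 * (D1 + s) * (D2 - 1) / (L - 1) + 2 * (D1 + s - 1) * (D2 - 1) / (L - 2)"
      unfolding strip_green_def using neg by (simp add: e L_def[symmetric] algebra_simps)
    also have "\<dots> = 2 * ((D1 + s) * D2 + D1 * (D2 - s) - L) / (L * (L - 1) * (L - 2))"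
      using L unfolding e(4) by (simp add: divide_simps) (simp add: algebra_simps)
    finally show ?thesis using False by (simp add: visits_def L_def)
  qed
qed

text \<open>With \<open>L = D1 + D2\<close>, the products \<open>(U1 - 1) * (D2 - 1)\<close> and
  \<open>(D1 - 1) * (U2 - 1)\<close> are nonnegative, so the bracket in the numerator is at least
  \<open>L - 2\<close>; it is also at most \<open>L * L\<close>. The constant \<open>3\<close> then
  comes from \<open>(3 * L - 2) * (L - 3) \<ge> 0\<close> for \<open>L \<ge> 3\<close>.\<close>

lemma visits_bounds:
  assumes "U1 \<ge> 1" "D1 \<ge> 1" "U2 \<ge> 1" "D2 \<ge> 1" "U1 + U2 = D1 + D2" "D1 + D2 = 2 \<or> D1 + D2 \<ge> 3"
  shows "visits U1 D1 U2 D2 > 0" "visits U1 D1 U2 D2 \<le> 3"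
proof -
  define L where "L = D1 + D2"
  have "visits U1 D1 U2 D2 > 0 \<and> visits U1 D1 U2 D2 \<le> 3"
  proof (cases "L = 2")
    case False
    then have L: "L \<ge> 3" using assms by (simp add: L_def)
    have a: "(U1 - 1) * (D2 - 1) \<ge> 0" "(D1 - 1) * (U2 - 1) \<ge> 0" using assms by simp_all
    then have lo: "U1 * D2 + D1 * U2 - L \<ge> L - 2" using assms(5) by (simp add: algebra_simps L_def)
    have "U1 * D2 \<le> U1 * L" "D1 * U2 \<le> L * U2" using assms by (simp_all add: L_def mult_left_mono mult_right_mono)
    then have "U1 * D2 + D1 * U2 \<le> L * (U1 + U2)" by (simp add: algebra_simps)
    then have "U1 * D2 + D1 * U2 - L \<le> L * L" using assms(5) L by (simp add: L_def)
    moreover have "2 * (L * L) \<le> 3 * (L * (L - 1) * (L - 2))"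
    proof -
      have "0 \<le> L * ((3 * L - 2) * (L - 3))" using L by simp
      also have "\<dots> = 3 * (L * (L - 1) * (L - 2)) - 2 * (L * L)" by (simp add: algebra_simps)
      finally show ?thesis by simp
    qed
    moreover have "L * (L - 1) * (L - 2) > 0" using L by simp
    ultimately have "2 * (U1 * D2 + D1 * U2 - L) / (L * (L - 1) * (L - 2)) \<le> 3"
      by (simp add: pos_divide_le_eq)
    moreover have "2 * (U1 * D2 + D1 * U2 - L) / (L * (L - 1) * (L - 2)) > 0"
      using lo L \<open>L * (L - 1) * (L - 2) > 0\<close> by simp
    ultimately show ?thesis using False by (simp add: visits_def L_def)
  qed (simp add: visits_def L_def)
  then show "visits U1 D1 U2 D2 > 0" "visits U1 D1 U2 D2 \<le> 3" by simp_all
qed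

text \<open>The Green function, decomposed by the extreme levels of the height path up to a visit:
  these lie \<open>updist par1 y1 x1 + a\<close> below and \<open>updist par2 y2 x2 + b\<close>
  above the height of \<open>y\<close>. The summand \<open>1\<close> leads from an extreme level to
  the killing endpoint next to it. Smaller distances cannot occur, because the path must reach the
  confluents in both trees.\<close>

definition gam :: "nat \<Rightarrow> nat \<Rightarrow> ('a \<Rightarrow> 'a) \<Rightarrow> ('b \<Rightarrow> 'b) \<Rightarrow> 'a \<Rightarrow> 'b \<Rightarrow> 'a \<Rightarrow> 'b \<Rightarrow> real" where
  "gam q r par1 par2 x1 x2 y1 y2 =
     dsum q r (\<lambda>a b. visits (real (updist par1 x1 y1 + 1 + a)) (real (updist par1 y1 x1 + 1 + a))
        (real (updist par2 x2 y2 + 1 + b)) (real (updist par2 y2 x2 + 1 + b))) /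
     (real q ^ updist par1 y1 x1 * real r ^ updist par2 y2 x2)"

section \<open>Centred indicators of descendants\<close>

definition below :: "('a \<Rightarrow> 'a) \<Rightarrow> 'a \<Rightarrow> nat \<Rightarrow> 'a \<Rightarrow> real" where
  "below par y i x = (if (par ^^ i) y \<in> anc par x then 1 else 0)"

text \<open>Up to a factor, \<open>shell par p y i\<close> is the indicator of the descendants of the \<open>i\<close>-th ancestor
  of \<open>y\<close> minus its average over the siblings of that ancestor.\<close>

definition shell :: "('a \<Rightarrow> 'a) \<Rightarrow> nat \<Rightarrow> 'a \<Rightarrow> nat \<Rightarrow> 'a \<Rightarrow> real" where
  "shell par p y i x = below par y i x - below par y (Suc i) x / real p"

context horotree begin

lemma below_child:
  assumes "lev y - int i \<le> lev x" "par c = x" shows "below par y i c = below par y i x"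
proof -
  have "lev c = lev x + 1" using assms(2) lev_par[of c] by simp
  then have "(par ^^ i) y \<noteq> c" using assms(1) lev_pow[of i y] by auto
  then show ?thesis using anc_par_iff[of "(par ^^ i) y" c] unfolding below_def assms(2) by simp
qed

lemma below_above: "lev y - int i > lev x \<Longrightarrow> below par y i x = 0"
  using lev_anc[of "(par ^^ i) y" x] by (auto simp: below_def)

lemma below_same_level: "lev y - int i = lev x \<Longrightarrow> below par y i x = (if x = (par ^^ i) y then 1 else 0)"
  using anc_level_unique[of "(par ^^ i) y" x x] by (auto simp: below_def)

lemma shell_child: "lev y - int i \<le> lev x \<Longrightarrow> par c = x \<Longrightarrow> shell par p y i c = shell par p y i x"
  by (simp add: shell_def below_child)

lemma shell_parent: "lev y - int i < lev x \<Longrightarrow> shell par p y i (par x) = shell par p y i x"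
  using shell_child[of y i "par x" x] by simp

lemma shell_above: "lev y - int i \<ge> lev x + 2 \<Longrightarrow> shell par p y i x = 0"
  by (simp add: shell_def below_above)

text \<open>This cancellation is the purpose of subtracting the average. It takes place at the
  killing level of the strip, where the indicator alone would leave a source.\<close>

lemma shell_children_sum:
  assumes "lev y - int i = lev x + 1" shows "(\<Sum>c\<in>ch x. shell par p y i c) = 0"
proof -
  let ?z = "(par ^^ i) y"
  have "shell par p y i c = (if c = ?z then 1 else 0) - (if x = par ?z then 1 else 0) / real p" if "c \<in> ch x" for c
  proof -
    have c: "par c = x" "lev c = lev x + 1" using that lev_child[OF that] by simp_all
    have "below par y i c = (if c = ?z then 1 else 0)" using assms c by (intro below_same_level) simp
    moreover have "below par y (Suc i) c = below par y (Suc i) x" using assms c by (intro below_child) simp_all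
    moreover have "below par y (Suc i) x = (if x = par ?z then 1 else 0)"
      using below_same_level[of y "Suc i" x] assms by simp
    ultimately show ?thesis by (simp add: shell_def)
  qed
  then have "(\<Sum>c\<in>ch x. shell par p y i c) = (\<Sum>c\<in>ch x. (if c = ?z then 1 else 0) - (if x = par ?z then 1 else 0) / real p)"
    by (rule sum.cong[OF refl])
  also have "\<dots> = (if ?z \<in> ch x then 1 else 0) - real p * ((if x = par ?z then 1 else 0) / real p)"
    by (simp add: sum_subtractf card_children)
  also have "\<dots> = 0" using p_pos by auto
  finally show ?thesis .
qed

lemma shell_sum_children:
  assumes "lev y - int i \<le> lev x" shows "(\<Sum>c\<in>ch x. shell par p y i c) = real p * shell par p y i x"
proof -
  have "(\<Sum>c\<in>ch x. shell par p y i c) = (\<Sum>c\<in>ch x. shell par p y i x)"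
    by (rule sum.cong[OF refl]) (use shell_child[OF assms] in simp)
  then show ?thesis by (simp add: card_children)
qed

lemma shell_bound: "\<bar>shell par p y i x\<bar> \<le> 1"
proof -
  have "0 \<le> below par y i x" "below par y i x \<le> 1" by (simp_all add: below_def)
  moreover have "0 \<le> below par y (Suc i) x / real p" "below par y (Suc i) x / real p \<le> 1"
    using p2 by (simp_all add: below_def)
  ultimately show ?thesis unfolding shell_def by linarith
qed

end

lemma strip_green_bound:
  assumes "0 \<le> n" "0 \<le> m" "n + m = 0 \<or> n + m \<ge> 1" "n \<le> i + 1" "m \<le> j + 1" "0 \<le> i" "0 \<le> j"
  shows "\<bar>strip_green n m s\<bar> \<le> 2 * (1 + \<bar>s\<bar>)\<^sup>2 * (i + 1) * (j + 1)"
proof (cases "n + m = 0")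
  case True
  then show ?thesis using assms by (simp add: strip_green_def)
next
  case False
  then have nm: "n + m \<ge> 1" using assms by simp
  have "i + 1 + \<bar>s\<bar> \<le> (1 + \<bar>s\<bar>) * (i + 1)" "j + 1 + \<bar>s\<bar> \<le> (1 + \<bar>s\<bar>) * (j + 1)"
    using assms by (simp_all add: algebra_simps)
  moreover have "\<bar>n + min s 0\<bar> \<le> i + 1 + \<bar>s\<bar>" "\<bar>m - max s 0\<bar> \<le> j + 1 + \<bar>s\<bar>" using assms by linarith+
  ultimately have 1: "\<bar>n + min s 0\<bar> \<le> (1 + \<bar>s\<bar>) * (i + 1)" and 2: "\<bar>m - max s 0\<bar> \<le> (1 + \<bar>s\<bar>) * (j + 1)" by linarith+
  have "\<bar>strip_green n m s\<bar> = 2 * (\<bar>n + min s 0\<bar> * \<bar>m - max s 0\<bar>) / (n + m)"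
  proof -
    have "\<bar>2 * X * Y / (n + m)\<bar> = 2 * (\<bar>X\<bar> * \<bar>Y\<bar>) / (n + m)" for X Y using nm by (simp add: abs_mult)
    then show ?thesis unfolding strip_green_def .
  qed
  also have "\<dots> \<le> 2 * (\<bar>n + min s 0\<bar> * \<bar>m - max s 0\<bar>) / 1"
    by (rule divide_left_mono) (use nm in simp_all)
  also have "\<dots> \<le> 2 * (((1 + \<bar>s\<bar>) * (i + 1)) * ((1 + \<bar>s\<bar>) * (j + 1)))"
    using mult_mono[OF 1 2] assms by simp
  finally show ?thesis by (simp add: power2_eq_square mult_ac)
qed

lemma strip_green_laplace:
  assumes "- n < s" "s < m" "n \<ge> 1" "m \<ge> 1" "s = 0 \<or> s \<ge> 1 \<or> s \<le> -1"
  shows "(strip_green n m (s + 1) + strip_green n m (s - 1)) / 2 = strip_green n m s - (if s = 0 then 1 else 0)"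
proof -
  have L: "n + m > 0" using assms by simp
  consider "s = 0" | "s \<ge> 1" | "s \<le> -1" using assms(5) by blast
  then show ?thesis
  proof cases
    case 1
    then show ?thesis using L by (simp add: strip_green_def divide_simps) (simp add: algebra_simps)
  next
    case 2
    then show ?thesis using L by (simp add: strip_green_def divide_simps) (simp add: algebra_simps)
  next
    case 3
    then show ?thesis using L by (simp add: strip_green_def divide_simps) (simp add: algebra_simps)
  qed
qed

lemma strip_green_boundary: "0 \<le> n \<Longrightarrow> strip_green n m (- n) = 0" "0 \<le> m \<Longrightarrow> strip_green n m m = 0"
  by (simp_all add: strip_green_def)

context horopair begin

definition piece :: "'a \<Rightarrow> 'b \<Rightarrow> nat \<Rightarrow> nat \<Rightarrow> 'a \<Rightarrow> 'b \<Rightarrow> real" where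
  "piece y1 y2 i j x1 x2 = shell par1 q y1 i x1 * shell par2 r y2 j x2 *
     strip_green (real i + 1) (real j + 1) (real_of_int (lev1 x1 - lev1 y1))"

lemma piece_bound:
  assumes "\<bar>real_of_int (lev1 x1 - lev1 y1)\<bar> \<le> S"
  shows "\<bar>piece y1 y2 i j x1 x2\<bar> \<le> 2 * (1 + S)\<^sup>2 * (real i + 1) * (real j + 1)"
proof -
  let ?g = "strip_green (real i + 1) (real j + 1) (real_of_int (lev1 x1 - lev1 y1))"
  have "\<bar>shell par1 q y1 i x1\<bar> * \<bar>shell par2 r y2 j x2\<bar> * \<bar>?g\<bar> \<le> 1 * 1 * \<bar>?g\<bar>"
    by (intro mult_mono T1.shell_bound T2.shell_bound) auto
  also have "\<dots> \<le> 2 * (1 + \<bar>real_of_int (lev1 x1 - lev1 y1)\<bar>)\<^sup>2 * (real i + 1) * (real j + 1)"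
    using strip_green_bound[of "real i + 1" "real j + 1" "real i" "real j"] by simp
  also have "\<dots> \<le> 2 * (1 + S)\<^sup>2 * (real i + 1) * (real j + 1)"
    using assms by (intro mult_right_mono mult_left_mono power_mono) auto
  finally show ?thesis by (simp add: piece_def abs_mult)
qed

text \<open>Strictly inside the strip the shells do not notice a step, and
  \<open>strip_green\<close> solves the equation in the height. From the outermost inner levels a
  shell may change, but only where \<open>strip_green\<close> is zero. On the two killing levels the
  shells sum to zero over the children, and beyond these levels they vanish.\<close>

lemma dl_op_piece:
  assumes x: "dlX x1 x2" and y: "dlX y1 y2"
  shows "dl_op q r par1 par2 (piece y1 y2 i j) x1 x2 = piece y1 y2 i j x1 x2 -
     (if lev1 x1 = lev1 y1 then shell par1 q y1 i x1 * shell par2 r y2 j x2 else 0)"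
proof -
  define s where "s = lev1 x1 - lev1 y1"
  define g where "g k = strip_green (real i + 1) (real j + 1) (real_of_int k)" for k
  have s2: "lev2 x2 - lev2 y2 = - s" using x y by (simp add: s_def)
  let ?a = "shell par1 q y1 i" and ?b = "shell par2 r y2 j"
  have "real_of_int (- int i - 1) = - (real i + 1)" "real_of_int (int j + 1) = real j + 1" by simp_all
  then have gi: "g (- int i - 1) = 0" and gj: "g (int j + 1) = 0"
    unfolding g_def using strip_green_boundary(1)[of "real i + 1"] strip_green_boundary(2)[of "real j + 1"] by (simp_all only:)
  have s1: "(\<Sum>c\<in>children par1 x1. piece y1 y2 i j c (par2 x2)) = (\<Sum>c\<in>children par1 x1. ?a c) * ?b (par2 x2) * g (s + 1)"
    unfolding sum_distrib_right
  proof (rule sum.cong[OF refl])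
    fix c assume "c \<in> children par1 x1"
    then have "lev1 c - lev1 y1 = s + 1" using T1.lev_child[of c x1] by (simp add: s_def)
    then show "piece y1 y2 i j c (par2 x2) = ?a c * ?b (par2 x2) * g (s + 1)" by (simp add: piece_def g_def)
  qed
  have e2: "(\<Sum>c\<in>children par2 x2. piece y1 y2 i j (par1 x1) c) = ?a (par1 x1) * (\<Sum>c\<in>children par2 x2. ?b c) * g (s - 1)"
    unfolding sum_distrib_right sum_distrib_left
    by (rule sum.cong[OF refl]) (simp add: piece_def g_def s_def algebra_simps)
  have op: "dl_op q r par1 par2 (piece y1 y2 i j) x1 x2 =
      (\<Sum>c\<in>children par1 x1. ?a c) * ?b (par2 x2) * g (s + 1) / (2 * real q) +
      ?a (par1 x1) * (\<Sum>c\<in>children par2 x2. ?b c) * g (s - 1) / (2 * real r)"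
    by (simp add: dl_op_def s1 e2)
  have tm: "piece y1 y2 i j x1 x2 = ?a x1 * ?b x2 * g s" by (simp add: piece_def g_def s_def)
  have eqs: "lev1 x1 = lev1 y1 \<longleftrightarrow> s = 0" by (auto simp: s_def)
  consider "- int i \<le> s" "s \<le> int j" | "s = - int i - 1" | "s \<le> - int i - 2" | "s = int j + 1" | "s \<ge> int j + 2"
    by linarith
  then show ?thesis
  proof cases
    case 1
    have A1: "(\<Sum>c\<in>children par1 x1. ?a c) = real q * ?a x1"
      by (rule T1.shell_sum_children) (use 1 in \<open>simp add: s_def\<close>)
    have B1: "(\<Sum>c\<in>children par2 x2. ?b c) = real r * ?b x2"
      by (rule T2.shell_sum_children) (use 1 s2 in simp)
    have B2: "?b (par2 x2) * g (s + 1) = ?b x2 * g (s + 1)"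
    proof (cases "s = int j")
      case False
      then have "?b (par2 x2) = ?b x2" using 1 s2 by (intro T2.shell_parent) simp
      then show ?thesis by simp
    qed (use gj in simp)
    have A2: "?a (par1 x1) * g (s - 1) = ?a x1 * g (s - 1)"
    proof (cases "s = - int i")
      case False
      then have "?a (par1 x1) = ?a x1" using 1 by (intro T1.shell_parent) (simp add: s_def)
      then show ?thesis by simp
    qed (use gi in simp)
    have "s = 0 \<or> s \<ge> 1 \<or> s \<le> -1" by linarith
    then have rs: "- (real i + 1) < real_of_int s" "real_of_int s < real j + 1" "real_of_int s = 0 \<or> real_of_int s \<ge> 1 \<or> real_of_int s \<le> -1"
      using 1 by (linarith, linarith, auto)
    have lap: "(g (s + 1) + g (s - 1)) / 2 = g s - (if s = 0 then 1 else 0)"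
      using strip_green_laplace[OF rs(1,2) _ _ rs(3)] unfolding g_def by simp
    have "dl_op q r par1 par2 (piece y1 y2 i j) x1 x2 =
       ?a x1 * (?b (par2 x2) * g (s + 1)) / 2 + (?a (par1 x1) * g (s - 1)) * ?b x2 / 2"
      unfolding op A1 B1 using T1.p_pos T2.p_pos by simp
    also have "\<dots> = ?a x1 * ?b x2 * ((g (s + 1) + g (s - 1)) / 2)"
      unfolding A2 B2 by (simp add: algebra_simps)
    finally show ?thesis unfolding tm eqs lap by (cases "s = 0") (simp_all add: algebra_simps)
  next
    case 2
    have "(\<Sum>c\<in>children par1 x1. ?a c) = 0" by (rule T1.shell_children_sum) (use 2 in \<open>simp add: s_def\<close>)
    moreover have "?a (par1 x1) = 0" by (rule T1.shell_above) (use 2 in \<open>simp add: s_def\<close>)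
    moreover have "g s = 0" using gi 2 by simp
    moreover have "s \<noteq> 0" using 2 by simp
    ultimately show ?thesis unfolding op tm eqs by simp
  next
    case 3
    have "(\<Sum>c\<in>children par1 x1. ?a c) * g (s + 1) = 0"
    proof (cases "s = - int i - 2")
      case True then have "s + 1 = - int i - 1" by simp
      then have "g (s + 1) = 0" using gi by (simp only:)
      then show ?thesis by simp
    next
      case False
      have "?a c = 0" if "c \<in> children par1 x1" for c
        by (rule T1.shell_above) (use 3 False T1.lev_child[OF that] in \<open>simp add: s_def\<close>)
      then show ?thesis by simp
    qed
    moreover have "?a (par1 x1) = 0" "?a x1 = 0" using 3 by (auto intro!: T1.shell_above simp: s_def)
    moreover have "s \<noteq> 0" using 3 by simp
    moreover have "(\<Sum>c\<in>children par1 x1. ?a c) * ?b (par2 x2) * g (s + 1) = ((\<Sum>c\<in>children par1 x1. ?a c) * g (s + 1)) * ?b (par2 x2)"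
      by (simp add: mult_ac)
    ultimately show ?thesis unfolding op tm eqs by auto
  next
    case 4
    have "(\<Sum>c\<in>children par2 x2. ?b c) = 0" by (rule T2.shell_children_sum) (use 4 s2 in simp)
    moreover have "?b (par2 x2) = 0" by (rule T2.shell_above) (use 4 s2 in simp)
    moreover have "g s = 0" using gj 4 by simp
    moreover have "s \<noteq> 0" using 4 by simp
    ultimately show ?thesis unfolding op tm eqs by simp
  next
    case 5
    have "(\<Sum>c\<in>children par2 x2. ?b c) * g (s - 1) = 0"
    proof (cases "s = int j + 2")
      case True then have "s - 1 = int j + 1" by simp
      then have "g (s - 1) = 0" using gj by (simp only:)
      then show ?thesis by simp
    next
      case False
      have "?b c = 0" if "c \<in> children par2 x2" for c
        by (rule T2.shell_above) (use 5 False T2.lev_child[OF that] s2 in simp)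
      then show ?thesis by simp
    qed
    moreover have "?b (par2 x2) = 0" "?b x2 = 0" using 5 s2 by (auto intro!: T2.shell_above)
    moreover have "s \<noteq> 0" using 5 by simp
    moreover have "?a (par1 x1) * (\<Sum>c\<in>children par2 x2. ?b c) * g (s - 1) = ?a (par1 x1) * ((\<Sum>c\<in>children par2 x2. ?b c) * g (s - 1))"
      by (simp add: mult_ac)
    ultimately show ?thesis unfolding op tm eqs by simp
  qed
qed

end

lemma gam_swap:
  assumes True: "q \<ge> 2" "r \<ge> 2"
  shows "gam q r par1 par2 x1 x2 y1 y2 = gam r q par2 par1 x2 x1 y2 y1"
proof -
  let ?F = "\<lambda>a b. visits (real (updist par1 x1 y1 + 1 + a)) (real (updist par1 y1 x1 + 1 + a))
        (real (updist par2 x2 y2 + 1 + b)) (real (updist par2 y2 x2 + 1 + b))"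
  have "dsum r q (\<lambda>b a. ?F a b) = dsum q r ?F" using True by (intro dsum_swap) auto
  moreover have "(\<lambda>b a. ?F a b) = (\<lambda>b a. visits (real (updist par2 x2 y2 + 1 + b)) (real (updist par2 y2 x2 + 1 + b))
        (real (updist par1 x1 y1 + 1 + a)) (real (updist par1 y1 x1 + 1 + a)))"
    by (intro ext) (rule visits_swap)
  ultimately show ?thesis unfolding gam_def by (simp only: mult.commute)
qed

section \<open>Equality of the two series, and the Poisson equation\<close>

context horopair begin

lemma q2: "q \<ge> 2" and r2: "r \<ge> 2" using T1.p2 T2.p2 .

abbreviation "ds \<equiv> dsum q r"

lemma ds_diff:
  assumes F: "\<And>i j. \<bar>F i j\<bar> \<le> C * (real i + 1) * (real j + 1)"
    and G: "\<And>i j. \<bar>G i j\<bar> \<le> C * (real i + 1) * (real j + 1)"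
  shows "ds (\<lambda>i j. F i j - G i j) = ds F - ds G"
proof -
  have "ds (\<lambda>i j. F i j + (-1) * G i j) = ds F + ds (\<lambda>i j. (-1) * G i j)"
    by (rule dsum_add[OF q2 r2 F]) (use G in simp)
  then show ?thesis using dsum_cmult[OF q2 r2, of "-1" G] by simp
qed

lemma ds_sum:
  assumes "finite B" and "\<And>b i j. b \<in> B \<Longrightarrow> \<bar>F b i j\<bar> \<le> C * (real i + 1) * (real j + 1)"
  shows "ds (\<lambda>i j. \<Sum>b\<in>B. F b i j) = (\<Sum>b\<in>B. ds (F b))"
  using assms
proof (induction B rule: finite_induct)
  case empty
  then show ?case using dsum_cmult[OF q2 r2, of 0 "\<lambda>_ _. 0"] by simp
next
  case (insert b B)
  have b: "\<bar>\<Sum>b\<in>B. F b i j\<bar> \<le> (real (card B) * C) * (real i + 1) * (real j + 1)" for i j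
  proof -
    have "\<bar>\<Sum>b\<in>B. F b i j\<bar> \<le> (\<Sum>b\<in>B. C * (real i + 1) * (real j + 1))"
      by (rule order_trans[OF sum_abs]) (rule sum_mono, use insert.prems in simp)
    then show ?thesis by (simp add: mult.assoc)
  qed
  have "ds (\<lambda>i j. \<Sum>b\<in>insert b B. F b i j) = ds (\<lambda>i j. F b i j + (\<Sum>b\<in>B. F b i j))"
    using insert.hyps by simp
  also have "\<dots> = ds (F b) + ds (\<lambda>i j. \<Sum>b\<in>B. F b i j)"
    by (rule dsum_add[OF q2 r2 _ b, where C = C]) (use insert.prems in simp)
  finally show ?case using insert by simp
qed

text \<open>Expanding both shells and summing by parts in \<open>i\<close> and \<open>j\<close>
  moves the differences from the indicators to \<open>strip_green\<close>, where
  \<open>strip_green_diff\<close> evaluates them. The indicators then restrict the sum to indices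
  from \<open>?d1\<close> and \<open>?d2\<close> on, and a shift removes this restriction.\<close>

lemma gam_eq_pieces:
  assumes x: "dlX x1 x2" and y: "dlX y1 y2"
  shows "gam q r par1 par2 x1 x2 y1 y2 = ds (\<lambda>i j. piece y1 y2 i j x1 x2)"
proof -
  let ?u1 = "updist par1 x1 y1" and ?d1 = "updist par1 y1 x1" and ?u2 = "updist par2 x2 y2" and ?d2 = "updist par2 y2 x2"
  define s where "s = real_of_int (lev1 x1 - lev1 y1)"
  have s1: "s = real ?u1 - real ?d1" using T1.lev_updist[of x1 y1] by (simp add: s_def)
  have s2: "s = real ?d2 - real ?u2" using T2.lev_updist[of x2 y2] x y by (simp add: s_def)
  define e where "e i = below par1 y1 i x1" for i
  define f where "f j = below par2 y2 j x2" for j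
  have e: "e i = (if ?d1 \<le> i then 1 else 0)" for i by (simp add: e_def below_def T1.pow_in_anc_iff)
  have f: "f j = (if ?d2 \<le> j then 1 else 0)" for j by (simp add: f_def below_def T2.pow_in_anc_iff)
  define T where "T n m = strip_green (real n) (real m) s" for n m :: nat
  \<comment> \<open>The boundary term: \<open>e 0\<close> is nonzero only if \<open>y1\<close> is an
    ancestor of \<open>x1\<close>. Then \<open>s\<close> is nonnegative, and the Green function of
    an interval whose lower endpoint is the target is zero.\<close>
  have T0: "e 0 * T 0 m = 0" for m
    using s1 by (cases "?d1 = 0") (auto simp: e T_def strip_green_def)
  have T0': "f 0 * T n 0 = 0" for n
    using s2 by (cases "?d2 = 0") (auto simp: f T_def strip_green_def)
  define K where "K = 2 * (1 + \<bar>s\<bar>)\<^sup>2"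
  have Tb: "\<bar>T n m\<bar> \<le> K * (real i + 1) * (real j + 1)" if "n \<le> Suc i" "m \<le> Suc j" for n m i j
    unfolding T_def K_def
  proof (rule strip_green_bound)
    show "real n + real m = 0 \<or> 1 \<le> real n + real m" unfolding of_nat_add[symmetric] by (cases "n + m = 0") (simp_all, linarith)
  qed (use that in auto)
  have eb: "0 \<le> e i" "e i \<le> 1" and fb: "0 \<le> f i" "f i \<le> 1" for i by (simp_all add: e f)
  have wb: "\<bar>a * b * T n m\<bar> \<le> K * (real i + 1) * (real j + 1)"
    if "\<bar>a\<bar> \<le> 1" "\<bar>b\<bar> \<le> 1" "n \<le> Suc i" "m \<le> Suc j" for a b n m i j
  proof -
    have "\<bar>a * b * T n m\<bar> \<le> 1 * 1 * \<bar>T n m\<bar>" unfolding abs_mult by (intro mult_mono that) auto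
    then show ?thesis using Tb[OF that(3,4)] by simp
  qed
  have eq: "\<bar>e i / real q\<bar> \<le> 1" and fr: "\<bar>f i / real r\<bar> \<le> 1" for i using q2 r2 by (simp_all add: e f)
  have e1: "\<bar>e i\<bar> \<le> 1" and f1: "\<bar>f i\<bar> \<le> 1" for i by (simp_all add: e f)
  let ?F11 = "\<lambda>i j. e i * f j * T (Suc i) (Suc j)"
  let ?F01 = "\<lambda>i j. (e (Suc i) / real q) * f j * T (Suc i) (Suc j)"
  let ?F10 = "\<lambda>i j. e i * (f (Suc j) / real r) * T (Suc i) (Suc j)"
  let ?F00 = "\<lambda>i j. (e (Suc i) / real q) * (f (Suc j) / real r) * T (Suc i) (Suc j)"
  let ?G01 = "\<lambda>i j. e i * f j * T i (Suc j)" and ?G10 = "\<lambda>i j. e i * f j * T (Suc i) j" and ?G00 = "\<lambda>i j. e i * f j * T i j"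
  have lin: "ds (\<lambda>i j. (A i j - B i j) - (C i j - D i j)) = (ds A - ds B) - (ds C - ds D)"
    if "\<And>i j. \<bar>A i j\<bar> \<le> K * (real i + 1) * (real j + 1)" "\<And>i j. \<bar>B i j\<bar> \<le> K * (real i + 1) * (real j + 1)"
      "\<And>i j. \<bar>C i j\<bar> \<le> K * (real i + 1) * (real j + 1)" "\<And>i j. \<bar>D i j\<bar> \<le> K * (real i + 1) * (real j + 1)" for A B C D
  proof -
    have "\<bar>A i j - B i j\<bar> \<le> (2 * K) * (real i + 1) * (real j + 1)" "\<bar>C i j - D i j\<bar> \<le> (2 * K) * (real i + 1) * (real j + 1)" for i j
      using that(1)[of i j] that(2)[of i j] that(3)[of i j] that(4)[of i j] by linarith+
    then have "ds (\<lambda>i j. (A i j - B i j) - (C i j - D i j)) = ds (\<lambda>i j. A i j - B i j) - ds (\<lambda>i j. C i j - D i j)"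
      by (rule ds_diff)
    then show ?thesis using ds_diff[OF that(1,2)] ds_diff[OF that(3,4)] by simp
  qed
  have sh01: "ds ?F01 = ds ?G01"
  proof -
    have "ds (\<lambda>i j. ?G01 (Suc i) j / real q) = ds ?G01" by (rule dsum_shift1[OF q2 r2]) (use T0 in auto)
    then show ?thesis by (simp add: mult.commute mult.left_commute)
  qed
  have sh10: "ds ?F10 = ds ?G10"
  proof -
    have "ds (\<lambda>i j. ?G10 i (Suc j) / real r) = ds ?G10" by (rule dsum_shift2[OF q2 r2]) (use T0' in auto)
    then show ?thesis by (simp add: mult.commute mult.left_commute)
  qed
  have sh00: "ds ?F00 = ds ?G00"
  proof -
    have "ds (\<lambda>i j. ?G00 (Suc i) j / real q) = ds ?G00" by (rule dsum_shift1[OF q2 r2]) (use T0 in auto)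
    moreover have "ds (\<lambda>i j. (\<lambda>i j. ?G00 (Suc i) j / real q) i (Suc j) / real r) = ds (\<lambda>i j. ?G00 (Suc i) j / real q)"
      by (rule dsum_shift2[OF q2 r2]) (use T0' in auto)
    ultimately show ?thesis by (simp add: mult.commute mult.left_commute)
  qed
  have pc: "piece y1 y2 i j x1 x2 = (e i - e (Suc i) / real q) * (f j - f (Suc j) / real r) * T (Suc i) (Suc j)" for i j
    unfolding piece_def shell_def e_def f_def T_def s_def by (simp add: add.commute)
  have c1: "ds (\<lambda>i j. piece y1 y2 i j x1 x2) = ds (\<lambda>i j. (?F11 i j - ?F01 i j) - (?F10 i j - ?F00 i j))"
    unfolding pc by (simp add: algebra_simps)
  have c2: "ds (\<lambda>i j. (?F11 i j - ?F01 i j) - (?F10 i j - ?F00 i j)) = (ds ?F11 - ds ?F01) - (ds ?F10 - ds ?F00)"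
    by (rule lin[of ?F11 ?F01 ?F10 ?F00]) (intro wb e1 f1 eq fr; simp)+
  have c3: "(ds ?F11 - ds ?F01) - (ds ?F10 - ds ?F00) = (ds ?F11 - ds ?G01) - (ds ?G10 - ds ?G00)" by (simp only: sh01 sh10 sh00)
  have c4: "(ds ?F11 - ds ?G01) - (ds ?G10 - ds ?G00) = ds (\<lambda>i j. (?F11 i j - ?G01 i j) - (?G10 i j - ?G00 i j))"
    by (rule lin[of ?F11 ?G01 ?G10 ?G00, symmetric]) (intro wb e1 f1; simp)+
  have c5: "ds (\<lambda>i j. (?F11 i j - ?G01 i j) - (?G10 i j - ?G00 i j)) = ds (\<lambda>i j. if ?d1 \<le> i \<and> ?d2 \<le> j then visits (real i + 1 + s) (real i + 1) (real j + 1 - s) (real j + 1) else 0)"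
  proof (rule arg_cong[where f = ds], rule ext, rule ext)
    fix i j
    show "(?F11 i j - ?G01 i j) - (?G10 i j - ?G00 i j) =
      (if ?d1 \<le> i \<and> ?d2 \<le> j then visits (real i + 1 + s) (real i + 1) (real j + 1 - s) (real j + 1) else 0)"
    proof (cases "?d1 \<le> i \<and> ?d2 \<le> j")
      case True
      have "strip_green (real i + 1) (real j + 1) s - strip_green (real i + 1 - 1) (real j + 1) s -
          strip_green (real i + 1) (real j + 1 - 1) s + strip_green (real i + 1 - 1) (real j + 1 - 1) s
        = visits (real i + 1 + s) (real i + 1) (real j + 1 - s) (real j + 1)"
      proof (rule strip_green_diff)
        have "real ?d1 \<le> real i" "real ?d2 \<le> real j" using True by simp_all
        then show "1 \<le> real i + 1 + s" "1 \<le> real j + 1 - s" using s1 s2 by linarith+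
        show "real i + 1 + (real j + 1) = 2 \<or> 3 \<le> real i + 1 + (real j + 1)"
        proof (cases "i + j = 0")
          case False
          then have "1 \<le> real i + real j" unfolding of_nat_add[symmetric] by linarith
          then show ?thesis by linarith
        qed simp
      qed auto
      then show ?thesis using True by (simp add: e f T_def add.commute)
    next
      case False
      then have "e i = 0 \<or> f j = 0" by (auto simp: e f)
      then show ?thesis using False by auto
    qed
  qed
  have c6: "ds (\<lambda>i j. if ?d1 \<le> i \<and> ?d2 \<le> j then visits (real i + 1 + s) (real i + 1) (real j + 1 - s) (real j + 1) else 0) = ds (\<lambda>a b. visits (real (?d1 + a) + 1 + s) (real (?d1 + a) + 1) (real (?d2 + b) + 1 - s) (real (?d2 + b) + 1)) /
     (real q ^ ?d1 * real r ^ ?d2)"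
    by (rule dsum_shift[OF q2 r2])
  have c7: "ds (\<lambda>a b. visits (real (?d1 + a) + 1 + s) (real (?d1 + a) + 1) (real (?d2 + b) + 1 - s) (real (?d2 + b) + 1)) /
     (real q ^ ?d1 * real r ^ ?d2) = gam q r par1 par2 x1 x2 y1 y2"
  proof -
    have e1: "real (?d1 + a) + 1 + s = real (?u1 + 1 + a)" and e2: "real (?d2 + b) + 1 - s = real (?u2 + 1 + b)"
      and e3: "real (?d1 + a) + 1 = real (?d1 + 1 + a)" and e4: "real (?d2 + b) + 1 = real (?d2 + 1 + b)" for a b
      using s1 s2 by simp_all
    show ?thesis unfolding gam_def e1 e2 unfolding e3 e4 by (rule refl)
  qed
  show ?thesis by (rule sym) (rule trans[OF c1 trans[OF c2 trans[OF c3 trans[OF c4 trans[OF c5 trans[OF c6 c7]]]]]])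
qed

definition walk_gam where "walk_gam y1 y2 x1 x2 = gam q r par1 par2 x1 x2 y1 y2"

definition ds_one :: real where "ds_one = ds (\<lambda>_ _. 1)"

lemma ds_one: "(1 - 1 / real q) * (1 - 1 / real r) * ds_one = 1"
proof -
  have g: "((\<lambda>i. (1 / real p) ^ i) has_sum (1 / (1 - 1 / real p))) UNIV" if "p \<ge> 2" for p :: nat
  proof (rule norm_summable_imp_has_sum)
    show "summable (\<lambda>n. norm ((1 / real p) ^ n))" using that by (simp add: norm_power summable_geometric)
    show "(\<lambda>n. (1 / real p) ^ n) sums (1 / (1 - 1 / real p))" using that by (intro geometric_sums) simp
  qed
  have "((\<lambda>(i, j). (1 / real q) ^ i * (1 / real r) ^ j) has_sum (1 / (1 - 1 / real q) * (1 / (1 - 1 / real r)))) UNIV"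
    by (rule has_sum_times_nat[OF g[OF q2] g[OF r2]])
  from infsumI[OF this] have "ds_one = 1 / (1 - 1 / real q) * (1 / (1 - 1 / real r))"
    unfolding ds_one_def dsum_def by (simp add: power_one_over case_prod_unfold divide_inverse power_inverse)
  moreover have "1 - 1 / real q \<noteq> 0" "1 - 1 / real r \<noteq> 0" using q2 r2 by simp_all
  ultimately show ?thesis by simp
qed

text \<open>For \<open>x = y\<close> all shells are constant and this is a product of two geometric
  series. Otherwise one of the indicators vanishes at index \<open>0\<close>, and the series over
  its index telescopes to zero.\<close>

lemma ds_shells:
  assumes x: "dlX x1 x2" and y: "dlX y1 y2" and lv: "lev1 x1 = lev1 y1"
  shows "ds (\<lambda>i j. shell par1 q y1 i x1 * shell par2 r y2 j x2) = (if x1 = y1 \<and> x2 = y2 then 1 else 0)"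
proof (cases "x1 = y1 \<and> x2 = y2")
  case True
  have "ds (\<lambda>i j. shell par1 q y1 i x1 * shell par2 r y2 j x2) = ds (\<lambda>i j. ((1 - 1 / real q) * (1 - 1 / real r)) * 1)"
    using True T1.pow_in_anc[of "Suc _"] T2.pow_in_anc[of "Suc _"] by (simp add: shell_def below_def)
  also have "\<dots> = (1 - 1 / real q) * (1 - 1 / real r) * ds_one" unfolding ds_one_def by (rule dsum_cmult[OF q2 r2])
  finally show ?thesis using ds_one True by simp
next
  case False
  have b1: "\<bar>below par1 y1 i x1\<bar> \<le> 1" "\<bar>below par1 y1 i x1 / real q\<bar> \<le> 1" for i using q2 by (auto simp: below_def)
  have b2: "\<bar>below par2 y2 i x2\<bar> \<le> 1" "\<bar>below par2 y2 i x2 / real r\<bar> \<le> 1" for i using r2 by (auto simp: below_def)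
  have bd: "\<bar>a * b\<bar> \<le> 1 * (real i + 1) * (real j + 1)" if "\<bar>a\<bar> \<le> 1" "\<bar>b\<bar> \<le> 1" for a b :: real and i j :: nat
  proof -
    have "\<bar>a * b\<bar> \<le> 1 * 1" unfolding abs_mult by (intro mult_mono that) auto
    also have "\<dots> \<le> (real i + 1) * (real j + 1)" by (intro mult_mono) auto
    finally show ?thesis by simp
  qed
  have "below par1 y1 0 x1 = 0 \<or> below par2 y2 0 x2 = 0"
  proof -
    have "lev2 x2 = lev2 y2" using x y lv by simp
    then show ?thesis using False T1.below_same_level[of y1 0 x1] T2.below_same_level[of y2 0 x2] lv by auto
  qed
  then show ?thesis
  proof
    assume 0: "below par1 y1 0 x1 = 0"
    have "ds (\<lambda>i j. shell par1 q y1 i x1 * shell par2 r y2 j x2) =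
        ds (\<lambda>i j. below par1 y1 i x1 * shell par2 r y2 j x2 - (below par1 y1 (Suc i) x1 / real q) * shell par2 r y2 j x2)"
      by (simp add: shell_def[of par1] algebra_simps)
    also have "\<dots> = ds (\<lambda>i j. below par1 y1 i x1 * shell par2 r y2 j x2) - ds (\<lambda>i j. (below par1 y1 (Suc i) x1 / real q) * shell par2 r y2 j x2)"
      by (rule ds_diff; rule bd[OF _ T2.shell_bound]) (rule b1)+
    also have "ds (\<lambda>i j. (below par1 y1 (Suc i) x1 / real q) * shell par2 r y2 j x2) = ds (\<lambda>i j. below par1 y1 i x1 * shell par2 r y2 j x2)"
      using dsum_shift1[OF q2 r2, of "\<lambda>i j. below par1 y1 i x1 * shell par2 r y2 j x2"] 0 by simp
    finally show ?thesis using False by simp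
  next
    assume 0: "below par2 y2 0 x2 = 0"
    have "ds (\<lambda>i j. shell par1 q y1 i x1 * shell par2 r y2 j x2) =
        ds (\<lambda>i j. shell par1 q y1 i x1 * below par2 y2 j x2 - shell par1 q y1 i x1 * (below par2 y2 (Suc j) x2 / real r))"
      by (simp add: shell_def[of par2] algebra_simps)
    also have "\<dots> = ds (\<lambda>i j. shell par1 q y1 i x1 * below par2 y2 j x2) - ds (\<lambda>i j. shell par1 q y1 i x1 * (below par2 y2 (Suc j) x2 / real r))"
      by (rule ds_diff; rule bd[OF T1.shell_bound]) (rule b2)+
    also have "ds (\<lambda>i j. shell par1 q y1 i x1 * (below par2 y2 (Suc j) x2 / real r)) = ds (\<lambda>i j. shell par1 q y1 i x1 * below par2 y2 j x2)"
      using dsum_shift2[OF q2 r2, of "\<lambda>i j. shell par1 q y1 i x1 * below par2 y2 j x2"] 0 by simp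
    finally show ?thesis using False by simp
  qed
qed

theorem gam_poisson:
  assumes x: "dlX x1 x2" and y: "dlX y1 y2"
  shows "walk_gam y1 y2 x1 x2 = (if x1 = y1 \<and> x2 = y2 then 1 else 0) + dl_op q r par1 par2 (walk_gam y1 y2) x1 x2"
proof -
  define S where "S = \<bar>real_of_int (lev1 x1 - lev1 y1)\<bar> + 1"
  define K where "K = 2 * (1 + S)\<^sup>2"
  have K0: "K \<ge> 0" by (simp add: K_def)
  have ch1: "dlX c (par2 x2)" "\<bar>real_of_int (lev1 c - lev1 y1)\<bar> \<le> S" if "c \<in> children par1 x1" for c
  proof -
    have "lev1 c = lev1 x1 + 1" by (rule T1.lev_child[OF that])
    then show "dlX c (par2 x2)" "\<bar>real_of_int (lev1 c - lev1 y1)\<bar> \<le> S" using x by (simp_all add: S_def)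
  qed
  have ch2: "dlX (par1 x1) c" "\<bar>real_of_int (lev1 (par1 x1) - lev1 y1)\<bar> \<le> S" if "c \<in> children par2 x2" for c
    using T2.lev_child[OF that] x by (simp_all add: S_def)
  have B1: "\<bar>piece y1 y2 i j c (par2 x2)\<bar> \<le> K * (real i + 1) * (real j + 1)" if "c \<in> children par1 x1" for c i j
    unfolding K_def by (rule piece_bound[OF ch1(2)[OF that]])
  have B2: "\<bar>piece y1 y2 i j (par1 x1) c\<bar> \<le> K * (real i + 1) * (real j + 1)" if "c \<in> children par2 x2" for c i j
    unfolding K_def by (rule piece_bound[OF ch2(2)[OF that]])
  have B: "\<bar>piece y1 y2 i j x1 x2\<bar> \<le> K * (real i + 1) * (real j + 1)" for i j
    unfolding K_def by (rule piece_bound) (simp add: S_def)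
  have 1: "(\<Sum>c\<in>children par1 x1. walk_gam y1 y2 c (par2 x2)) / (2 * real q) = ds (\<lambda>i j. (1 / (2 * real q)) * (\<Sum>c\<in>children par1 x1. piece y1 y2 i j c (par2 x2)))"
  proof -
    have "(\<Sum>c\<in>children par1 x1. walk_gam y1 y2 c (par2 x2)) = (\<Sum>c\<in>children par1 x1. ds (\<lambda>i j. piece y1 y2 i j c (par2 x2)))"
      unfolding walk_gam_def by (rule sum.cong[OF refl]) (rule gam_eq_pieces[OF ch1(1) y])
    also have "\<dots> = ds (\<lambda>i j. \<Sum>c\<in>children par1 x1. piece y1 y2 i j c (par2 x2))"
      by (rule ds_sum[symmetric, OF T1.finite_children B1])
    finally show ?thesis unfolding dsum_cmult[OF q2 r2] by simp
  qed
  have 2: "(\<Sum>c\<in>children par2 x2. walk_gam y1 y2 (par1 x1) c) / (2 * real r) = ds (\<lambda>i j. (1 / (2 * real r)) * (\<Sum>c\<in>children par2 x2. piece y1 y2 i j (par1 x1) c))"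
  proof -
    have "(\<Sum>c\<in>children par2 x2. walk_gam y1 y2 (par1 x1) c) = (\<Sum>c\<in>children par2 x2. ds (\<lambda>i j. piece y1 y2 i j (par1 x1) c))"
      unfolding walk_gam_def by (rule sum.cong[OF refl]) (rule gam_eq_pieces[OF ch2(1) y])
    also have "\<dots> = ds (\<lambda>i j. \<Sum>c\<in>children par2 x2. piece y1 y2 i j (par1 x1) c)"
      by (rule ds_sum[symmetric, OF T2.finite_children B2])
    finally show ?thesis unfolding dsum_cmult[OF q2 r2] by simp
  qed
  have S1: "\<bar>(1 / (2 * real q)) * (\<Sum>c\<in>children par1 x1. piece y1 y2 i j c (par2 x2))\<bar> \<le> K * (real i + 1) * (real j + 1)" for i j
  proof -
    have "\<bar>\<Sum>c\<in>children par1 x1. piece y1 y2 i j c (par2 x2)\<bar> \<le> (\<Sum>c\<in>children par1 x1. K * (real i + 1) * (real j + 1))"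
      by (rule order_trans[OF sum_abs]) (rule sum_mono, rule B1)
    moreover have "0 \<le> K * (real i + 1) * (real j + 1)" using K0 by simp
    ultimately show ?thesis using T1.p_pos by (simp add: T1.card_children abs_mult field_simps)
  qed
  have S2: "\<bar>(1 / (2 * real r)) * (\<Sum>c\<in>children par2 x2. piece y1 y2 i j (par1 x1) c)\<bar> \<le> K * (real i + 1) * (real j + 1)" for i j
  proof -
    have "\<bar>\<Sum>c\<in>children par2 x2. piece y1 y2 i j (par1 x1) c\<bar> \<le> (\<Sum>c\<in>children par2 x2. K * (real i + 1) * (real j + 1))"
      by (rule order_trans[OF sum_abs]) (rule sum_mono, rule B2)
    moreover have "0 \<le> K * (real i + 1) * (real j + 1)" using K0 by simp
    ultimately show ?thesis using T2.p_pos by (simp add: T2.card_children abs_mult field_simps)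
  qed
  have "dl_op q r par1 par2 (walk_gam y1 y2) x1 x2 = ds (\<lambda>i j. dl_op q r par1 par2 (piece y1 y2 i j) x1 x2)"
    unfolding dl_op_def 1 2 dsum_add[OF q2 r2 S1 S2, symmetric] by simp
  also have "\<dots> = ds (\<lambda>i j. piece y1 y2 i j x1 x2 -
     (if lev1 x1 = lev1 y1 then shell par1 q y1 i x1 * shell par2 r y2 j x2 else 0))"
    by (simp only: dl_op_piece[OF x y])
  also have "\<dots> = walk_gam y1 y2 x1 x2 - (if x1 = y1 \<and> x2 = y2 then 1 else 0)"
  proof (cases "lev1 x1 = lev1 y1")
    case True
    have "\<bar>shell par1 q y1 i x1 * shell par2 r y2 j x2\<bar> \<le> K * (real i + 1) * (real j + 1)" for i j
    proof -
      have "\<bar>shell par1 q y1 i x1 * shell par2 r y2 j x2\<bar> \<le> 1 * 1" unfolding abs_mult by (intro mult_mono T1.shell_bound T2.shell_bound) auto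
      also have "\<dots> \<le> (real i + 1) * (real j + 1)" by (intro mult_mono) auto
      also have "\<dots> \<le> K * ((real i + 1) * (real j + 1))"
      proof -
        have "1\<^sup>2 \<le> (1 + S)\<^sup>2" by (rule power_mono) (simp_all add: S_def)
        then have "1 \<le> K" by (simp add: K_def)
        from mult_right_mono[OF this, of "(real i + 1) * (real j + 1)"] show ?thesis by simp
      qed
      finally show ?thesis by (simp add: mult.assoc)
    qed
    then have "ds (\<lambda>i j. piece y1 y2 i j x1 x2 - shell par1 q y1 i x1 * shell par2 r y2 j x2) =
       ds (\<lambda>i j. piece y1 y2 i j x1 x2) - ds (\<lambda>i j. shell par1 q y1 i x1 * shell par2 r y2 j x2)"
      by (rule ds_diff[OF B])
    then show ?thesis unfolding walk_gam_def gam_eq_pieces[OF x y] using True ds_shells[OF x y True] by simp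
  next
    case False
    then show ?thesis unfolding walk_gam_def gam_eq_pieces[OF x y] by auto
  qed
  finally show ?thesis by simp
qed

abbreviation "vis x1 x2 y1 y2 a b \<equiv> visits (real (updist par1 x1 y1 + 1 + a)) (real (updist par1 y1 x1 + 1 + a))
  (real (updist par2 x2 y2 + 1 + b)) (real (updist par2 y2 x2 + 1 + b))"

lemma visits_nat_bounds:
  assumes x: "dlX x1 x2" and y: "dlX y1 y2"
  shows "0 < vis x1 x2 y1 y2 a b" "vis x1 x2 y1 y2 a b \<le> 3"
proof -
  have "int (updist par1 x1 y1) + int (updist par2 x2 y2) = int (updist par1 y1 x1) + int (updist par2 y2 x2)"
    using T1.lev_updist[of x1 y1] T2.lev_updist[of x2 y2] x y by linarith
  then have e: "updist par1 x1 y1 + updist par2 x2 y2 = updist par1 y1 x1 + updist par2 y2 x2" by linarith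
  have "real (updist par1 x1 y1 + 1 + a) + real (updist par2 x2 y2 + 1 + b) = real (updist par1 y1 x1 + 1 + a) + real (updist par2 y2 x2 + 1 + b)"
    unfolding of_nat_add[symmetric] using e by linarith
  moreover have "real (updist par1 y1 x1 + 1 + a) + real (updist par2 y2 x2 + 1 + b) = 2 \<or> real (updist par1 y1 x1 + 1 + a) + real (updist par2 y2 x2 + 1 + b) \<ge> 3"
    unfolding of_nat_add[symmetric] by (cases "updist par1 y1 x1 + a + updist par2 y2 x2 + b = 0") (simp, linarith)
  ultimately show "0 < vis x1 x2 y1 y2 a b" "vis x1 x2 y1 y2 a b \<le> 3" using visits_bounds by simp_all
qed

lemma bound3: "\<bar>v\<bar> \<le> 3 \<Longrightarrow> \<bar>v\<bar> \<le> 3 * (real i + 1) * (real j + 1)"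
proof -
  assume "\<bar>v\<bar> \<le> 3"
  moreover have "1 * 1 \<le> (real i + 1) * (real j + 1)" by (intro mult_mono) auto
  ultimately have "\<bar>v\<bar> \<le> 3 * ((real i + 1) * (real j + 1))" by linarith
  then show ?thesis by (simp only: mult.assoc)
qed

lemma vis_bound:
  assumes x: "dlX x1 x2" and y: "dlX y1 y2"
  shows "\<bar>vis x1 x2 y1 y2 i j\<bar> \<le> 3 * (real i + 1) * (real j + 1)"
  using visits_nat_bounds[OF x y, of i j] by (intro bound3) linarith

lemma gam_pos:
  assumes x: "dlX x1 x2" and y: "dlX y1 y2" shows "gam q r par1 par2 x1 x2 y1 y2 > 0"
proof -
  have "ds (vis x1 x2 y1 y2) > 0"
    using visits_nat_bounds[OF x y] vis_bound[OF x y] by (intro dsum_pos[OF q2 r2, where C = 3]) (auto simp only: less_imp_le)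
  then show ?thesis unfolding gam_def using q2 r2 by simp
qed

lemma gam_le:
  assumes x: "dlX x1 x2" and y: "dlX y1 y2"
  shows "gam q r par1 par2 x1 x2 y1 y2 \<le> 3 * ds_one / (real q ^ updist par1 y1 x1 * real r ^ updist par2 y2 x2)"
proof -
  have "ds (vis x1 x2 y1 y2) \<le> ds (\<lambda>_ _. 3 * 1)"
    by (rule dsum_mono[OF q2 r2 vis_bound[OF x y], where D = 3]) (rule bound3, simp, use visits_nat_bounds(2)[OF x y] in \<open>simp only: mult_1_right\<close>)
  also have "\<dots> = 3 * ds_one" unfolding ds_one_def by (rule dsum_cmult[OF q2 r2])
  finally show ?thesis unfolding gam_def using q2 r2 by (intro divide_right_mono) auto
qed

end

section \<open>The chain on the horocyclic product\<close>

text \<open>The matrix \<open>dl_step\<close> at parameter one half, written with the parent maps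
  alone; see \<open>step_eq\<close>.\<close>

definition dlP :: "nat \<Rightarrow> nat \<Rightarrow> ('a \<Rightarrow> 'a) \<Rightarrow> ('b \<Rightarrow> 'b) \<Rightarrow> 'a \<times> 'b \<Rightarrow> 'a \<times> 'b \<Rightarrow> real" where
  "dlP q r par1 par2 x y = (if par1 (fst y) = fst x \<and> snd y = par2 (snd x) then 1 / 2 / real q
     else if fst y = par1 (fst x) \<and> par2 (snd y) = snd x then (1 - 1 / 2) / real r else 0)"

context horopair begin

definition X :: "('a \<times> 'b) set" where "X = {(x1, x2). dlX x1 x2}"

abbreviation "P \<equiv> dlP q r par1 par2"
abbreviation "Op \<equiv> dl_op q r par1 par2"

lemma X_iff [simp]: "(x1, x2) \<in> X \<longleftrightarrow> dlX x1 x2" by (simp add: X_def)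

lemma neighbours_in_X:
  assumes "dlX x1 x2" shows "c \<in> children par1 x1 \<Longrightarrow> dlX c (par2 x2)" "c' \<in> children par2 x2 \<Longrightarrow> dlX (par1 x1) c'"
  using assms T1.lev_child[of c x1] T2.lev_child[of c' x2] by simp_all

lemma step_has_sum:
  assumes x: "dlX x1 x2"
  shows "((\<lambda>y. P (x1, x2) y * h y) has_sum Op (\<lambda>a b. h (a, b)) x1 x2) X"
proof -
  let ?N1 = "(\<lambda>c. (c, par2 x2)) ` children par1 x1" and ?N2 = "(\<lambda>c. (par1 x1, c)) ` children par2 x2"
  \<comment> \<open>This keeps the two kinds of neighbours apart, so that the order of the two cases
    in \<open>P\<close> does not matter.\<close>
  have c1: "par1 (par1 x1) \<noteq> x1"
  proof
    assume "par1 (par1 x1) = x1"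
    then have "lev1 (par1 (par1 x1)) = lev1 x1" by (rule arg_cong)
    then show False by simp
  qed
  have disj: "?N1 \<inter> ?N2 = {}" using c1 by auto
  have p1: "P (x1, x2) (c, par2 x2) = 1 / (2 * real q)" if "par1 c = x1" for c using that by (simp add: dlP_def)
  have p2: "P (x1, x2) (par1 x1, c) = 1 / (2 * real r)" if "par2 c = x2" for c using that c1 by (simp add: dlP_def)
  show ?thesis
  proof (rule has_sum_finite_neutralI[of "?N1 \<union> ?N2"])
    show "?N1 \<union> ?N2 \<subseteq> X" using neighbours_in_X[OF x] by (auto simp: X_def)
    show "P (x1, x2) y * h y = 0" if "y \<in> X - (?N1 \<union> ?N2)" for y
    proof -
      have "\<not> (par1 (fst y) = x1 \<and> snd y = par2 x2)" "\<not> (fst y = par1 x1 \<and> par2 (snd y) = x2)"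
        using that by (cases y; force)+
      then show ?thesis by (simp only: dlP_def fst_conv snd_conv if_False mult_zero_left)
    qed
    have "(\<Sum>y\<in>?N1 \<union> ?N2. P (x1, x2) y * h y) = (\<Sum>y\<in>?N1. P (x1, x2) y * h y) + (\<Sum>y\<in>?N2. P (x1, x2) y * h y)"
      by (rule sum.union_disjoint) (use disj in auto)
    also have "(\<Sum>y\<in>?N1. P (x1, x2) y * h y) = (\<Sum>c\<in>children par1 x1. 1 / (2 * real q) * h (c, par2 x2))"
      by (subst sum.reindex) (auto simp: inj_on_def p1 intro!: sum.cong)
    also have "(\<Sum>y\<in>?N2. P (x1, x2) y * h y) = (\<Sum>c\<in>children par2 x2. 1 / (2 * real r) * h (par1 x1, c))"
      by (subst sum.reindex) (auto simp: inj_on_def p2 intro!: sum.cong)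
    finally show "Op (\<lambda>a b. h (a, b)) x1 x2 = (\<Sum>y\<in>?N1 \<union> ?N2. P (x1, x2) y * h y)"
      by (simp add: dl_op_def sum_divide_distrib)
  qed auto
qed

lemma Op_cong:
  assumes "\<And>z1 z2. dlX z1 z2 \<Longrightarrow> h z1 z2 = h' z1 z2" "dlX x1 x2" shows "Op h x1 x2 = Op h' x1 x2"
  unfolding dl_op_def using assms(1) neighbours_in_X[OF assms(2)] by simp

lemma Op_mono:
  assumes "\<And>z1 z2. dlX z1 z2 \<Longrightarrow> h z1 z2 \<le> h' z1 z2" "dlX x1 x2" shows "Op h x1 x2 \<le> Op h' x1 x2"
  unfolding dl_op_def
  by (intro add_mono divide_right_mono sum_mono assms(1) neighbours_in_X[OF assms(2)]) simp_all

lemma Op_add: "Op (\<lambda>a b. h a b + h' a b) x1 x2 = Op h x1 x2 + Op h' x1 x2"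
  by (simp add: dl_op_def sum.distrib add_divide_distrib)

lemma Op_diff: "Op (\<lambda>a b. h a b - h' a b) x1 x2 = Op h x1 x2 - Op h' x1 x2"
  by (simp add: dl_op_def sum_subtractf diff_divide_distrib)

lemma Op_cmult: "Op (\<lambda>a b. k * h a b) x1 x2 = k * Op h x1 x2"
  by (simp add: dl_op_def sum_distrib_left[symmetric] distrib_left)

lemma Op_const: "Op (\<lambda>_ _. k) x1 x2 = k"
  using q2 r2 by (simp add: dl_op_def T1.card_children T2.card_children)

lemma Op_tendsto:
  assumes "\<And>z1 z2. dlX z1 z2 \<Longrightarrow> ((\<lambda>n. h n z1 z2) \<longlongrightarrow> h' z1 z2) F" "dlX x1 x2"
  shows "((\<lambda>n. Op (h n) x1 x2) \<longlongrightarrow> Op h' x1 x2) F"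
  unfolding dl_op_def using q2 r2
  by (intro tendsto_add tendsto_divide tendsto_sum tendsto_const assms(1) neighbours_in_X[OF assms(2)]) simp_all

lemma nstep_Suc: "dlX x1 x2 \<Longrightarrow> nstep X P (Suc n) (x1, x2) y = Op (\<lambda>a b. nstep X P n (a, b) y) x1 x2"
  using infsumI[OF step_has_sum[of x1 x2 "\<lambda>z. nstep X P n z y"]] by simp

lemma nstep_nonneg: "dlX x1 x2 \<Longrightarrow> nstep X P n (x1, x2) y \<ge> 0"
proof (induction n arbitrary: x1 x2)
  case (Suc n)
  have "Op (\<lambda>_ _. 0) x1 x2 \<le> Op (\<lambda>a b. nstep X P n (a, b) y) x1 x2"
    by (rule Op_mono) (use Suc in auto)
  then show ?case using nstep_Suc[OF Suc.prems] by (simp add: Op_const)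
qed simp

lemma transition_dlP: "transition_matrix X P"
  unfolding transition_matrix_def
proof (intro ballI conjI)
  fix x assume x: "x \<in> X"
  show "0 \<le> P x y" for y using q2 r2 by (simp add: dlP_def)
  obtain x1 x2 where [simp]: "x = (x1, x2)" by (cases x)
  show "(P x has_sum 1) X" using step_has_sum[of x1 x2 "\<lambda>_. 1"] x by (simp add: Op_const)
qed

lemma reach_first:
  assumes x: "dlX x1 x2" and c: "par1 c = x1" "nstep X P n (c, par2 x2) y > 0"
  shows "nstep X P (Suc n) (x1, x2) y > 0"
proof -
  let ?h = "\<lambda>a b. nstep X P n (a, b) y"
  have nn: "0 \<le> ?h a b" if "dlX a b" for a b using nstep_nonneg[OF that] .
  have "0 < (\<Sum>c\<in>children par1 x1. ?h c (par2 x2))"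
    by (rule sum_pos2[of _ c]) (use c nn neighbours_in_X[OF x] in auto)
  moreover have "0 \<le> (\<Sum>c\<in>children par2 x2. ?h (par1 x1) c)"
    by (rule sum_nonneg) (use nn neighbours_in_X[OF x] in auto)
  ultimately show ?thesis using q2 r2 unfolding nstep_Suc[OF x] dl_op_def by (intro add_pos_nonneg) auto
qed

lemma reach_second:
  assumes x: "dlX x1 x2" and c: "par2 c = x2" "nstep X P n (par1 x1, c) y > 0"
  shows "nstep X P (Suc n) (x1, x2) y > 0"
proof -
  let ?h = "\<lambda>a b. nstep X P n (a, b) y"
  have nn: "0 \<le> ?h a b" if "dlX a b" for a b using nstep_nonneg[OF that] .
  have "0 < (\<Sum>c\<in>children par2 x2. ?h (par1 x1) c)"
    by (rule sum_pos2[of _ c]) (use c nn neighbours_in_X[OF x] in auto)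
  moreover have "0 \<le> (\<Sum>c\<in>children par1 x1. ?h c (par2 x2))"
    by (rule sum_nonneg) (use nn neighbours_in_X[OF x] in auto)
  ultimately show ?thesis using q2 r2 unfolding nstep_Suc[OF x] dl_op_def by (intro add_nonneg_pos) auto
qed

definition leads where "leads x y \<longleftrightarrow> (\<exists>n. nstep X P n x y > 0)"

lemma leads_up_first:
  "dlX x1 x2 \<Longrightarrow> (par2 ^^ n) x2' = x2 \<Longrightarrow> leads ((par1 ^^ n) x1, x2') y \<Longrightarrow> leads (x1, x2) y"
proof (induction n arbitrary: x1 x2)
  case (Suc n)
  let ?c = "(par2 ^^ n) x2'"
  have c: "par2 ?c = x2" using Suc.prems(2) by simp
  have "dlX (par1 x1) ?c" using neighbours_in_X(2)[OF Suc.prems(1), of ?c] c unfolding T2.mem_children by blast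
  moreover have "leads ((par1 ^^ n) (par1 x1), x2') y" using Suc.prems(3) by (simp add: funpow_swap1)
  ultimately have "leads (par1 x1, ?c) y" using Suc.IH by blast
  then show ?case unfolding leads_def using reach_second[OF Suc.prems(1) c] by blast
qed (simp add: leads_def)

lemma leads_up_second:
  "dlX x1 x2 \<Longrightarrow> (par1 ^^ n) x1' = x1 \<Longrightarrow> leads (x1', (par2 ^^ n) x2) y \<Longrightarrow> leads (x1, x2) y"
proof (induction n arbitrary: x1 x2)
  case (Suc n)
  let ?c = "(par1 ^^ n) x1'"
  have c: "par1 ?c = x1" using Suc.prems(2) by simp
  have "dlX ?c (par2 x2)" using neighbours_in_X(1)[OF Suc.prems(1), of ?c] c unfolding T1.mem_children by blast
  moreover have "leads (x1', (par2 ^^ n) (par2 x2)) y" using Suc.prems(3) by (simp add: funpow_swap1)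
  ultimately have "leads (?c, par2 x2) y" using Suc.IH by blast
  then show ?case unfolding leads_def using reach_first[OF Suc.prems(1) c] by blast
qed (simp add: leads_def)

text \<open>A route from \<open>x\<close> to \<open>y\<close> in three stretches. The first
  coordinate climbs \<open>N\<close> steps to a common ancestor with \<open>y1\<close>, while the
  second descends to \<open>x2'\<close>. Then the second climbs \<open>N + k\<close> steps to a
  common ancestor with \<open>y2\<close>, while the first descends to a descendant
  \<open>y1'\<close> of \<open>y1\<close>. Finally the first climbs \<open>l\<close> steps to
  \<open>y1\<close> and the second descends to \<open>y2\<close>. The levels make these lengths fit,
  \<open>N + k = M + l\<close>.\<close>

lemma irreducible_dlP: "irreducible_chain X P"
proof -
  have "leads (x1, x2) (y1, y2)" if x: "dlX x1 x2" and y: "dlX y1 y2" for x1 x2 y1 y2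
  proof -
    obtain N M where N: "(par1 ^^ N) x1 = (par1 ^^ M) y1" using T1.common[of x1 y1] by blast
    obtain k l where k: "(par2 ^^ k) x2 = (par2 ^^ l) y2" using T2.common[of x2 y2] by blast
    obtain x2' where x2': "(par2 ^^ N) x2' = x2" using T2.desc_exists by blast
    obtain y1' where y1': "(par1 ^^ l) y1' = y1" using T1.desc_exists by blast
    have "lev1 ((par1 ^^ N) x1) = lev1 ((par1 ^^ M) y1)" using N by (rule arg_cong)
    moreover have "lev2 ((par2 ^^ k) x2) = lev2 ((par2 ^^ l) y2)" using k by (rule arg_cong)
    ultimately have "int (N + k) = int (M + l)" using x y by simp
    then have Nk: "N + k = M + l" by (simp only: of_nat_eq_iff)
    have ly: "lev1 y1 = lev1 y1' - int l" using T1.lev_pow[of l y1'] unfolding y1' .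
    have lx: "lev2 x2 = lev2 x2' - int N" using T2.lev_pow[of N x2'] unfolding x2' .
    have 1: "leads (y1', (par2 ^^ l) y2) (y1, y2)"
    proof (rule leads_up_first[of y1' _ l y2])
      show "dlX y1' ((par2 ^^ l) y2)" using y ly by simp
      have "nstep X P 0 (y1, y2) (y1, y2) > 0" by simp
      then show "leads ((par1 ^^ l) y1', y2) (y1, y2)" unfolding leads_def y1' by blast
    qed simp
    have e2: "(par2 ^^ (N + k)) x2' = (par2 ^^ l) y2"
      unfolding add.commute[of N k] funpow_add by (simp add: x2' k)
    have e1: "(par1 ^^ (N + k)) y1' = (par1 ^^ N) x1"
      unfolding Nk funpow_add by (simp add: y1' N)
    have 2: "leads ((par1 ^^ N) x1, x2') (y1, y2)"
      by (rule leads_up_second[of _ _ "N + k" y1']) (use x lx 1 in \<open>simp_all only: e1 e2 T1.lev_pow\<close>)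
    show ?thesis by (rule leads_up_first[OF x x2' 2])
  qed
  then show ?thesis unfolding irreducible_chain_def leads_def by (auto simp: X_def)
qed

text \<open>A nonnegative solution of the Poisson equation dominates every partial sum of the Green
  function, by induction on the number of terms.\<close>

lemma partial_green_le:
  assumes y: "dlX y1 y2"
  shows "dlX x1 x2 \<Longrightarrow> (\<Sum>k<n. nstep X P k (x1, x2) (y1, y2)) \<le> walk_gam y1 y2 x1 x2"
proof (induction n arbitrary: x1 x2)
  case 0 then show ?case using gam_pos[OF 0 y] by (simp add: walk_gam_def)
next
  case (Suc n)
  let ?S = "\<lambda>n a b. \<Sum>k<n. nstep X P k (a, b) (y1, y2)"
  have op: "(\<Sum>k<n. nstep X P (Suc k) (x1, x2) (y1, y2)) = Op (?S n) x1 x2" for n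
  proof (induction n)
    case (Suc n)
    have "Op (?S (Suc n)) x1 x2 = Op (?S n) x1 x2 + Op (\<lambda>a b. nstep X P n (a, b) (y1, y2)) x1 x2"
      using Op_add[of "?S n"] by simp
    then show ?case using Suc nstep_Suc[OF \<open>dlX x1 x2\<close>] by simp
  qed (simp add: Op_const)
  have "?S (Suc n) x1 x2 = (if x1 = y1 \<and> x2 = y2 then 1 else 0) + Op (?S n) x1 x2"
    unfolding sum.lessThan_Suc_shift op by simp
  also have "\<dots> \<le> (if x1 = y1 \<and> x2 = y2 then 1 else 0) + Op (walk_gam y1 y2) x1 x2"
    using Op_mono[OF Suc.IH Suc.prems] by simp
  also have "\<dots> = walk_gam y1 y2 x1 x2" by (rule gam_poisson[OF Suc.prems y, symmetric])
  finally show ?case .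
qed

lemma summable_nstep:
  assumes "dlX x1 x2" "dlX y1 y2" shows "summable (\<lambda>n. nstep X P n (x1, x2) (y1, y2))"
  by (rule summableI_nonneg_bounded[OF nstep_nonneg[OF assms(1)] partial_green_le[OF assms(2,1)]])

lemma transient_dlP: "transient_chain X P"
  unfolding transient_chain_def using summable_nstep by (auto simp: X_def)

text \<open>The test points have the \<open>n\<close>-th ancestor of \<open>y1\<close> as first
  coordinate and an \<open>n\<close>-th descendant of \<open>y2\<close> as second; there
  \<open>gam_le\<close> yields a bound with \<open>n\<close> factors \<open>1 / q\<close>.\<close>

lemma gam_tends_0:
  assumes y: "dlX y1 y2" and c: "\<And>x1 x2. dlX x1 x2 \<Longrightarrow> c \<le> walk_gam y1 y2 x1 x2" shows "c \<le> 0"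
proof -
  have "c \<le> 3 * ds_one * (1 / real q) ^ n" for n
  proof -
    obtain x2 where x2: "(par2 ^^ n) x2 = y2" using T2.desc_exists by blast
    have "lev2 y2 = lev2 x2 - int n" using T2.lev_pow[of n x2] unfolding x2 .
    then have x: "dlX ((par1 ^^ n) y1) x2" using y by simp
    have "y2 \<in> T2.A x2" unfolding x2[symmetric] by simp
    then have u2: "updist par2 y2 x2 = 0" by (simp add: T2.updist_eq_0)
    have "(par1 ^^ n) y1 \<in> T1.A y1" by simp
    then have "updist par1 ((par1 ^^ n) y1) y1 = 0" by (simp add: T1.updist_eq_0)
    then have u1: "updist par1 y1 ((par1 ^^ n) y1) = n" using T1.lev_updist[of y1 "(par1 ^^ n) y1"] by simp
    show ?thesis using c[OF x] gam_le[OF x y] unfolding walk_gam_def u1 u2 by (simp add: power_one_over divide_inverse power_inverse)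
  qed
  moreover have "(\<lambda>n. 3 * ds_one * (1 / real q) ^ n) \<longlonglongrightarrow> 3 * ds_one * 0"
    by (rule tendsto_mult_left[OF LIMSEQ_power_zero]) (use q2 in simp)
  ultimately show ?thesis using LIMSEQ_le_const[of _ "3 * ds_one * 0" c] by simp
qed

theorem green_eq_gam:
  assumes x: "dlX x1 x2" and y: "dlX y1 y2"
  shows "green X P (x1, x2) (y1, y2) = gam q r par1 par2 x1 x2 y1 y2"
proof -
  define G where "G a b = green X P (a, b) (y1, y2)" for a b
  let ?S = "\<lambda>n a b. \<Sum>k<n. nstep X P k (a, b) (y1, y2)"
  have lim: "(\<lambda>n. ?S n a b) \<longlonglongrightarrow> G a b" if "dlX a b" for a b
    unfolding G_def green_def by (rule summable_LIMSEQ[OF summable_nstep[OF that y]])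
  have G0: "0 \<le> G a b" and Gle: "G a b \<le> walk_gam y1 y2 a b" if "dlX a b" for a b
  proof -
    show "0 \<le> G a b" unfolding G_def green_def
      by (rule suminf_nonneg[OF summable_nstep[OF that y]]) (rule nstep_nonneg[OF that])
    show "G a b \<le> walk_gam y1 y2 a b"
      by (rule LIMSEQ_le_const2[OF lim[OF that]]) (use partial_green_le[OF y that] in blast)
  qed
  have Gp: "G a b = (if a = y1 \<and> b = y2 then 1 else 0) + Op G a b" if ab: "dlX a b" for a b
  proof -
    have op: "(\<Sum>k<n. nstep X P (Suc k) (a, b) (y1, y2)) = Op (?S n) a b" for n
    proof (induction n)
      case (Suc n)
      have "Op (?S (Suc n)) a b = Op (?S n) a b + Op (\<lambda>z w. nstep X P n (z, w) (y1, y2)) a b"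
        using Op_add[of "?S n"] by simp
      then show ?case using Suc nstep_Suc[OF ab] by simp
    qed (simp add: Op_const)
    have "?S (Suc n) a b = (if a = y1 \<and> b = y2 then 1 else 0) + Op (?S n) a b" for n
      unfolding sum.lessThan_Suc_shift op by simp
    moreover have "(\<lambda>n. (if a = y1 \<and> b = y2 then 1 else 0) + Op (?S n) a b) \<longlonglongrightarrow> (if a = y1 \<and> b = y2 then 1 else 0) + Op G a b"
      by (intro tendsto_add tendsto_const Op_tendsto lim ab)
    ultimately have "(\<lambda>n. ?S (Suc n) a b) \<longlonglongrightarrow> (if a = y1 \<and> b = y2 then 1 else 0) + Op G a b" by simp
    then show ?thesis using LIMSEQ_unique LIMSEQ_Suc[OF lim[OF ab]] by blast
  qed
  let ?H = "\<lambda>a b. walk_gam y1 y2 a b - G a b"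
  have "dl_harm ?H" unfolding dl_harmonic_def
  proof (intro allI impI)
    fix a b assume ab: "dlX a b"
    show "Op ?H a b = ?H a b" using Gp[OF ab] gam_poisson[OF ab y] unfolding Op_diff by linarith
  qed
  moreover have "\<bar>?H a b\<bar> \<le> 3 * ds_one" if ab: "dlX a b" for a b
  proof -
    have "0 < walk_gam y1 y2 a b" unfolding walk_gam_def by (rule gam_pos[OF ab y])
    moreover have "walk_gam y1 y2 a b \<le> 3 * ds_one"
    proof -
      have o: "0 \<le> ds_one" unfolding ds_one_def by (rule dsum_nonneg[OF q2 r2]) simp
      have "1 * 1 \<le> real q ^ updist par1 y1 a * real r ^ updist par2 y2 b"
        by (intro mult_mono one_le_power) (use q2 r2 in auto)
      then have "3 * ds_one / (real q ^ updist par1 y1 a * real r ^ updist par2 y2 b) \<le> 3 * ds_one / 1"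
        by (intro divide_left_mono) (use o in auto)
      then show ?thesis using gam_le[OF ab y] unfolding walk_gam_def by linarith
    qed
    ultimately show ?thesis using G0[OF ab] Gle[OF ab] by linarith
  qed
  ultimately obtain c where c: "\<forall>a b. dlX a b \<longrightarrow> ?H a b = c" using bounded_harmonic_constant by blast
  \<comment> \<open>As the Green function is nonnegative, the constant difference lies below the
    series at every point.\<close>
  have "c \<le> walk_gam y1 y2 a b" if "dlX a b" for a b using c G0[OF that] that by force
  then have "c \<le> 0" by (rule gam_tends_0[OF y])
  moreover have "?H x1 x2 = c" using c x by blast
  ultimately show ?thesis using Gle[OF x] unfolding G_def walk_gam_def by linarith
qed

end

section \<open>Hitting probabilities in the tree\<close>

text \<open>The law of a Markov chain on a countable type is the image of a product measure: attach an
  independent choice of the next state to every pair of a time and a state.\<close>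

context
  fixes K :: "'s \<Rightarrow> 's pmf"
  assumes cnt: "countable (UNIV :: 's set)"
begin

abbreviation "seqs \<equiv> (\<Pi>\<^sub>M i\<in>(UNIV :: nat set). count_space (UNIV :: 's set))"

definition choices :: "(nat \<times> 's \<Rightarrow> 's) measure" where
  "choices = (\<Pi>\<^sub>M k\<in>UNIV. measure_pmf (K (snd k)))"

primrec follow :: "'s \<Rightarrow> (nat \<times> 's \<Rightarrow> 's) \<Rightarrow> nat \<Rightarrow> 's" where
  "follow v \<epsilon> 0 = v"
| "follow v \<epsilon> (Suc n) = \<epsilon> (n, follow v \<epsilon> n)"

definition chain_law :: "'s \<Rightarrow> (nat \<Rightarrow> 's) measure" where
  "chain_law v = distr choices seqs (follow v)"

definition cylinder :: "nat \<Rightarrow> (nat \<Rightarrow> 's) \<Rightarrow> (nat \<Rightarrow> 's) set" where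
  "cylinder n s = {\<omega>. \<forall>i\<le>n. \<omega> i = s i}"

lemma space_seqs: "space seqs = UNIV" by (simp add: space_PiM)

lemma prob_space_choices: "prob_space choices"
  unfolding choices_def by (rule prob_space_PiM) (rule prob_space_measure_pmf)

lemma space_choices: "space choices = UNIV" by (simp add: choices_def space_PiM)

lemma measurable_coord: "(\<lambda>\<epsilon>. \<epsilon> k) \<in> measurable choices (count_space UNIV)"
proof -
  have "(\<lambda>\<epsilon>. \<epsilon> k) \<in> measurable choices (measure_pmf (K (snd k)))"
    unfolding choices_def by (rule measurable_component_singleton) simp
  then show ?thesis by simp
qed

lemma measurable_follow_at: "(\<lambda>\<epsilon>. follow v \<epsilon> n) \<in> measurable choices (count_space UNIV)"
proof (induction n)
  case (Suc n)
  show ?case unfolding follow.simps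
    by (rule measurable_compose_countable'[OF measurable_coord Suc cnt])
qed simp

lemma measurable_follow: "follow v \<in> measurable choices seqs"
  by (rule measurable_PiM_single') (auto simp: measurable_follow_at)

lemma cylinder_sets: "cylinder n s \<in> sets seqs"
proof -
  have "cylinder n s = (\<Inter>i\<in>{..n}. (\<lambda>\<omega>. \<omega> i) -` {s i} \<inter> space seqs)"
    by (auto simp: cylinder_def space_seqs)
  also have "\<dots> \<in> sets seqs"
    by (intro sets.finite_INT) (auto intro!: measurable_sets[OF measurable_component_singleton])
  finally show ?thesis .
qed

lemma prob_space_chain_law: "prob_space (chain_law v)"
  unfolding chain_law_def by (rule prob_space.prob_space_distr[OF prob_space_choices measurable_follow])

lemma sets_chain_law [simp]: "sets (chain_law v) = sets seqs" by (simp add: chain_law_def)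

lemma emeasure_chain_law_cylinder:
  "emeasure (chain_law v) (cylinder n s) = (if s 0 = v then ennreal (\<Prod>i<n. pmf (K (s i)) (s (Suc i))) else 0)"
proof -
  let ?J = "(\<lambda>i. (i, s i)) ` {..<n}" and ?B = "\<lambda>k. {s (Suc (fst k))}"
  have pre: "follow v -` cylinder n s \<inter> space choices =
      (if s 0 = v then prod_emb UNIV (\<lambda>k. measure_pmf (K (snd k))) ?J (Pi\<^sub>E ?J ?B) else {})"
  proof (cases "s 0 = v")
    case True
    have iff: "(\<forall>i\<le>n. follow v \<epsilon> i = s i) \<longleftrightarrow> (\<forall>i<n. \<epsilon> (i, s i) = s (Suc i))" for \<epsilon>
    proof
      assume a: "\<forall>i\<le>n. follow v \<epsilon> i = s i"
      show "\<forall>i<n. \<epsilon> (i, s i) = s (Suc i)"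
      proof (intro allI impI)
        fix i assume "i < n"
        then have f: "follow v \<epsilon> i = s i" "follow v \<epsilon> (Suc i) = s (Suc i)" using a less_imp_le Suc_leI by blast+
        show "\<epsilon> (i, s i) = s (Suc i)" using f(2) unfolding follow.simps f(1) .
      qed
    next
      assume a: "\<forall>i<n. \<epsilon> (i, s i) = s (Suc i)"
      have "i \<le> n \<Longrightarrow> follow v \<epsilon> i = s i" for i by (induction i) (use True a in auto)
      then show "\<forall>i\<le>n. follow v \<epsilon> i = s i" by blast
    qed
    show ?thesis using True
      by (auto simp: cylinder_def iff space_choices prod_emb_def space_PiM PiE_iff)
  next
    case False
    then have "follow v \<epsilon> \<notin> cylinder n s" for \<epsilon> by (auto simp: cylinder_def intro!: exI[of _ 0])
    then show ?thesis using False by auto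
  qed
  have "emeasure (chain_law v) (cylinder n s) = emeasure choices (follow v -` cylinder n s \<inter> space choices)"
    unfolding chain_law_def by (rule emeasure_distr[OF measurable_follow cylinder_sets])
  also have "\<dots> = (if s 0 = v then ennreal (\<Prod>i<n. pmf (K (s i)) (s (Suc i))) else 0)"
  proof (cases "s 0 = v")
    case True
    have "emeasure choices (prod_emb UNIV (\<lambda>k. measure_pmf (K (snd k))) ?J (Pi\<^sub>E ?J ?B)) =
        (\<Prod>k\<in>?J. emeasure (measure_pmf (K (snd k))) (?B k))"
      unfolding choices_def by (rule emeasure_PiM_emb) (auto intro: prob_space_measure_pmf)
    also have "\<dots> = (\<Prod>i<n. emeasure (measure_pmf (K (s i))) {s (Suc i)})"
      by (subst prod.reindex) (auto simp: inj_on_def)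
    also have "\<dots> = ennreal (\<Prod>i<n. pmf (K (s i)) (s (Suc i)))"
      by (simp add: emeasure_pmf_single prod_ennreal)
    finally show ?thesis unfolding pre using True by simp
  qed (simp add: pre)
  finally show ?thesis .
qed

text \<open>Cylinders and the empty set are closed under intersection. Countability of the state
  space enters twice: an event about one coordinate is a countable union of cylinders, and countably
  many cylinders cover the whole space.\<close>

lemma law_eqI:
  fixes M N :: "(nat \<Rightarrow> 's) measure"
  assumes M: "sets M = sets seqs" and N: "sets N = sets seqs"
    and eq: "\<And>n s. emeasure M (cylinder n s) = emeasure N (cylinder n s)"
    and fin: "\<And>n s. emeasure M (cylinder n s) \<noteq> \<infinity>"
  shows "M = N"
proof -
  let ?E = "insert {} (range (\<lambda>(n, s). cylinder n s))"
  have gen: "sets seqs = sigma_sets UNIV ?E"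
  proof
    have "?E \<subseteq> sets seqs" using cylinder_sets by auto
    from sets.sigma_sets_subset[OF this] show "sigma_sets UNIV ?E \<subseteq> sets seqs" by (simp only: space_seqs)
    have "sets seqs = sigma_sets UNIV {{f :: nat \<Rightarrow> 's. f i \<in> B} |i B. True}"
      unfolding sets_PiM_single by (simp add: PiE_UNIV_domain)
    also have "\<dots> \<subseteq> sigma_sets UNIV ?E"
    proof (rule sigma_sets_mono, rule subsetI)
      fix Z assume "Z \<in> {{f :: nat \<Rightarrow> 's. f i \<in> B} |i B. True}"
      then obtain i B where Z: "Z = {f :: nat \<Rightarrow> 's. f i \<in> B}" by auto
      \<comment> \<open>Initial segments are coded by lists to have countably many of them.\<close>
      let ?C = "\<lambda>l :: 's list. cylinder i (\<lambda>j. l ! j)"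
      let ?L = "{l :: 's list. length l = Suc i \<and> l ! i \<in> B}"
      have "Z = (\<Union>l\<in>?L. ?C l)"
      proof (intro equalityI subsetI)
        fix f assume "f \<in> Z"
        then have "map f [0..<Suc i] \<in> ?L" "f \<in> ?C (map f [0..<Suc i])"
          unfolding Z cylinder_def by (auto simp del: upt_Suc)
        then show "f \<in> (\<Union>l\<in>?L. ?C l)" by blast
      next
        fix f assume "f \<in> (\<Union>l\<in>?L. ?C l)"
        then show "f \<in> Z" unfolding Z cylinder_def by auto
      qed
      moreover have "countable ?L"
        by (rule countable_subset[OF _ countable_lists[OF cnt]]) auto
      moreover have "(\<Union>l\<in>?L. ?C l) \<in> sigma_sets UNIV ?E"
      proof -
        interpret S: sigma_algebra UNIV "sigma_sets UNIV ?E" by (rule sigma_algebra_sigma_sets) simp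
        show ?thesis by (rule S.countable_UN'') (use calculation(2) in \<open>auto intro!: sigma_sets.Basic\<close>)
      qed
      ultimately show "Z \<in> sigma_sets UNIV ?E" by simp
    qed
    finally show "sets seqs \<subseteq> sigma_sets UNIV ?E" .
  qed
  show ?thesis
  proof (rule measure_eqI_generator_eq_countable[where \<Omega> = UNIV and E = ?E and A = "range (\<lambda>v. cylinder 0 (\<lambda>_. v))"])
    show "Int_stable ?E"
    proof (rule Int_stableI)
      have c: "cylinder n s \<inter> cylinder m t \<in> ?E" if "n \<le> m" for n m s t
      proof (cases "\<forall>i\<le>n. s i = t i")
        case True
        then have "cylinder n s \<inter> cylinder m t = cylinder m t" using that by (auto simp: cylinder_def)
        then show ?thesis by auto
      next
        case False
        then have "cylinder n s \<inter> cylinder m t = {}" using that by (auto simp: cylinder_def)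
        then show ?thesis by simp
      qed
      have c': "cylinder n s \<inter> cylinder m t \<in> ?E" for n m s t
      proof (cases "n \<le> m")
        case False
        then have "cylinder m t \<inter> cylinder n s \<in> ?E" by (intro c) simp
        then show ?thesis by (simp only: Int_commute)
      qed (rule c)
      fix a b assume ab: "a \<in> ?E" "b \<in> ?E"
      show "a \<inter> b \<in> ?E"
      proof (cases "a = {} \<or> b = {}")
        case False
        then obtain n s m t where "a = cylinder n s" "b = cylinder m t" using ab by auto
        then show ?thesis using c' by simp
      qed auto
    qed
    show "emeasure M Z = emeasure N Z" if "Z \<in> ?E" for Z using that eq by auto
    show "(\<Union>(range (\<lambda>v. cylinder 0 (\<lambda>_. v)))) = UNIV" by (auto simp: cylinder_def)
    show "countable (range (\<lambda>v. cylinder 0 (\<lambda>_. v)))" using cnt by (rule countable_image)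
    show "emeasure M a \<noteq> \<infinity>" if "a \<in> range (\<lambda>v. cylinder 0 (\<lambda>_. v))" for a using that fin by auto
  qed (use gen M N in auto)
qed

lemma path_law_eq: "path_law (\<lambda>v w. pmf (K v) w) v = chain_law v"
proof -
  have m: "measure (chain_law v) {\<omega>. \<forall>i\<le>n. \<omega> i = s i} = (if s 0 = v then \<Prod>i<n. pmf (K (s i)) (s (Suc i)) else 0)" for n s
    using emeasure_chain_law_cylinder[of v n s] unfolding cylinder_def measure_def by (simp add: prod_nonneg)
  show ?thesis unfolding path_law_def
  proof (rule the_equality)
    show "prob_space (chain_law v) \<and> sets (chain_law v) = sets seqs \<and> (\<forall>n s. measure (chain_law v) {\<omega>. \<forall>i\<le>n. \<omega> i = s i} =
       (if s 0 = v then \<Prod>i<n. pmf (K (s i)) (s (Suc i)) else 0))"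
      using prob_space_chain_law m by simp
    fix M assume M: "prob_space M \<and> sets M = sets seqs \<and> (\<forall>n s. measure M {\<omega>. \<forall>i\<le>n. \<omega> i = s i} =
       (if s 0 = v then \<Prod>i<n. pmf (K (s i)) (s (Suc i)) else 0))"
    interpret M: prob_space M using M by blast
    interpret L: prob_space "chain_law v" by (rule prob_space_chain_law)
    show "M = chain_law v"
      by (rule law_eqI) (use M m in \<open>simp_all add: M.emeasure_eq_measure L.emeasure_eq_measure cylinder_def\<close>)
  qed
qed

lemma measurable_case_nat: "case_nat v \<in> measurable seqs seqs"
proof (rule measurable_PiM_single')
  show "(\<lambda>\<omega>. case_nat v \<omega> i) \<in> measurable seqs (count_space UNIV)" for i
    by (cases i) (auto intro: measurable_component_singleton)
qed auto

text \<open>The Markov property at time one. The right-hand side is the law obtained by drawing the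
  first step and putting \<open>v\<close> in front of a trajectory started there; it has the
  cylinder probabilities of \<open>chain_law v\<close>.\<close>

lemma chain_law_step:
  assumes A: "A \<in> sets seqs"
  shows "emeasure (chain_law v) A = (\<integral>\<^sup>+z. emeasure (chain_law z) (case_nat v -` A) \<partial>measure_pmf (K v))"
proof -
  let ?f = "\<lambda>z. distr (chain_law z) seqs (case_nat v)"
  let ?N = "measure_pmf (K v) \<bind> ?f"
  have mc: "case_nat v \<in> measurable (chain_law z) seqs" for z
    using measurable_case_nat by (simp cong: measurable_cong_sets)
  have ps: "prob_space (?f z)" for z by (rule prob_space.prob_space_distr[OF prob_space_chain_law mc])
  have f: "?f \<in> measurable (measure_pmf (K v)) (subprob_algebra seqs)"
    using ps by (auto simp: space_subprob_algebra prob_space_imp_subprob_space)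
  have sN: "sets ?N = sets seqs" by (rule sets_bind[where N = seqs]) auto
  have eN: "emeasure ?N B = (\<integral>\<^sup>+z. emeasure (chain_law z) (case_nat v -` B) \<partial>measure_pmf (K v))" if B: "B \<in> sets seqs" for B
  proof -
    have "emeasure ?N B = (\<integral>\<^sup>+z. emeasure (?f z) B \<partial>measure_pmf (K v))"
      by (rule emeasure_bind[OF _ f B]) simp
    then show ?thesis using emeasure_distr[OF mc B] sets_eq_imp_space_eq[OF sets_chain_law] by (simp add: space_seqs)
  qed
  have "chain_law v = ?N"
  proof (rule law_eqI[OF sets_chain_law sN])
    show "emeasure (chain_law v) (cylinder n s) \<noteq> \<infinity>" for n s
      unfolding emeasure_chain_law_cylinder by simp
    show "emeasure (chain_law v) (cylinder n s) = emeasure ?N (cylinder n s)" for n s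
    proof (cases n)
      case 0
      have pre: "case_nat v -` cylinder 0 s = (if s 0 = v then UNIV else {})" by (auto simp: cylinder_def)
      have "emeasure (chain_law z) UNIV = 1" for z
        using prob_space.emeasure_space_1[OF prob_space_chain_law[of z]]
          sets_eq_imp_space_eq[OF sets_chain_law[of z]] by (simp add: space_seqs)
      then show ?thesis unfolding eN[OF cylinder_sets] emeasure_chain_law_cylinder 0 pre
        using measure_pmf.emeasure_space_1[of "K v"] by simp
    next
      case (Suc m)
      have pre: "case_nat v -` cylinder (Suc m) s = (if s 0 = v then cylinder m (\<lambda>i. s (Suc i)) else {})"
        by (auto simp: cylinder_def split: nat.splits)
      have "(\<integral>\<^sup>+z. emeasure (chain_law z) (cylinder m (\<lambda>i. s (Suc i))) \<partial>measure_pmf (K v)) =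
         (\<integral>\<^sup>+z. ennreal (\<Prod>i<m. pmf (K (s (Suc i))) (s (Suc (Suc i)))) * indicator {s (Suc 0)} z \<partial>measure_pmf (K v))"
        by (rule nn_integral_cong) (auto simp: emeasure_chain_law_cylinder)
      also have "\<dots> = ennreal (\<Prod>i<m. pmf (K (s (Suc i))) (s (Suc (Suc i)))) * ennreal (pmf (K v) (s (Suc 0)))"
        by (simp add: nn_integral_cmult_indicator emeasure_pmf_single)
      also have "\<dots> = ennreal (pmf (K v) (s (Suc 0)) * (\<Prod>i<m. pmf (K (s (Suc i))) (s (Suc (Suc i)))))"
        by (simp add: ennreal_mult prod_nonneg mult.commute)
      finally have i: "(\<integral>\<^sup>+z. emeasure (chain_law z) (cylinder m (\<lambda>i. s (Suc i))) \<partial>measure_pmf (K v)) =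
         ennreal (pmf (K v) (s (Suc 0)) * (\<Prod>i<m. pmf (K (s (Suc i))) (s (Suc (Suc i)))))" .
      show ?thesis unfolding eN[OF cylinder_sets] emeasure_chain_law_cylinder[of v] Suc pre
        using i by (auto simp: prod.lessThan_Suc_shift simp del: prod.lessThan_Suc)
    qed
  qed
  then show ?thesis using eN[OF A] by simp
qed

end

section \<open>The walk on one tree that moves to the parent with probability one half\<close>

context horotree begin

definition step_pmf :: "'a \<Rightarrow> 'a pmf" where
  "step_pmf x = bind_pmf (bernoulli_pmf (1 / 2)) (\<lambda>b. if b then pmf_of_set (ch x) else return_pmf (par x))"

lemma par_not_child: "par x \<notin> ch x"
proof
  assume "par x \<in> ch x"
  then have "lev (par (par x)) = lev x" by simp
  then show False by simp
qed

lemma pmf_step: "pmf (step_pmf x) y = (if par y = x then 1 / 2 / real p else if y = par x then 1 - 1 / 2 else 0)"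
proof -
  have "pmf (step_pmf x) y = 1 / 2 * pmf (pmf_of_set (ch x)) y + 1 / 2 * pmf (return_pmf (par x)) y"
    unfolding step_pmf_def by (simp add: pmf_bind)
  also have "pmf (pmf_of_set (ch x)) y = (if y \<in> ch x then 1 / real p else 0)"
    using children_nonempty[of x] by (simp add: pmf_of_set card_children indicator_def)
  finally show ?thesis using par_not_child[of x] by (auto simp: indicator_def)
qed

lemma set_step: "set_pmf (step_pmf x) \<subseteq> insert (par x) (ch x)"
  by (auto simp: set_pmf_iff pmf_step split: if_splits)

lemma nn_integral_step:
  assumes "\<And>z. f z \<ge> 0" shows "(\<integral>\<^sup>+z. ennreal (f z) \<partial>measure_pmf (step_pmf x)) = ennreal (tree_op par p f x)"
proof -
  have "(\<integral>\<^sup>+z. ennreal (f z) \<partial>measure_pmf (step_pmf x)) = ennreal (\<integral>z. f z \<partial>measure_pmf (step_pmf x))"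
    by (rule nn_integral_eq_integral)
       (use assms set_step[of x] in \<open>auto intro!: integrable_measure_pmf_finite finite_subset[OF set_step]\<close>)
  also have "(\<integral>z. f z \<partial>measure_pmf (step_pmf x)) = (\<Sum>z\<in>insert (par x) (ch x). f z * pmf (step_pmf x) z)"
    by (rule integral_measure_pmf_real) (use set_step[of x] in auto)
  also have "\<dots> = f (par x) * pmf (step_pmf x) (par x) + (\<Sum>z\<in>ch x. f z * pmf (step_pmf x) z)"
    using par_not_child[of x] by simp
  also have "(\<Sum>z\<in>ch x. f z * pmf (step_pmf x) z) = (\<Sum>z\<in>ch x. f z * (1 / 2 / real p))"
    by (rule sum.cong) (auto simp: pmf_step)
  also have "pmf (step_pmf x) (par x) = 1 / 2" using par_not_child[of x] by (simp add: pmf_step)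
  finally show ?thesis by (simp add: tree_op_def sum_divide_distrib add.commute)
qed

abbreviation "law \<equiv> chain_law step_pmf"

lemma vimage_law_step:
  assumes B: "B \<in> sets seqs"
  shows "measure (law v) B = tree_op par p (\<lambda>z. measure (law z) (case_nat v -` B)) v"
proof -
  have e: "emeasure (law z) C = ennreal (measure (law z) C)" for z C
    using prob_space_chain_law[OF countable_vertices, of step_pmf z]
    by (intro finite_measure.emeasure_eq_measure) (simp add: prob_space_def)
  have "emeasure (law v) B = (\<integral>\<^sup>+z. ennreal (measure (law z) (case_nat v -` B)) \<partial>measure_pmf (step_pmf v))"
    using chain_law_step[OF countable_vertices B, of step_pmf v] by (simp only: e)
  also have "\<dots> = ennreal (tree_op par p (\<lambda>z. measure (law z) (case_nat v -` B)) v)"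
    by (rule nn_integral_step) simp
  finally have "ennreal (measure (law v) B) = ennreal (tree_op par p (\<lambda>z. measure (law z) (case_nat v -` B)) v)"
    by (simp only: e)
  moreover have "0 \<le> tree_op par p (\<lambda>z. measure (law z) (case_nat v -` B)) v" by (simp add: tree_op_def sum_nonneg)
  ultimately show ?thesis using ennreal_inj[OF measure_nonneg, of "tree_op par p (\<lambda>z. measure (law z) (case_nat v -` B)) v"] by blast
qed

lemma hit_sets:
  fixes w :: 'a
  shows "{\<omega> :: nat \<Rightarrow> 'a. \<exists>i<n. \<omega> i = w} \<in> sets seqs" "{\<omega> :: nat \<Rightarrow> 'a. \<exists>i. \<omega> i = w} \<in> sets seqs"
proof -
  have s: "{\<omega> :: nat \<Rightarrow> 'a. \<omega> i = w} \<in> sets seqs" for i :: nat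
  proof -
    have "(\<lambda>\<omega>. \<omega> i) -` {w} \<inter> space seqs \<in> sets seqs"
      by (rule measurable_sets[OF measurable_component_singleton]) auto
    then show ?thesis by (simp add: vimage_def space_PiM)
  qed
  have "{\<omega> :: nat \<Rightarrow> 'a. \<exists>i<n. \<omega> i = w} = (\<Union>i\<in>{..<n}. {\<omega> :: nat \<Rightarrow> 'a. \<omega> i = w})" by auto
  then show "{\<omega> :: nat \<Rightarrow> 'a. \<exists>i<n. \<omega> i = w} \<in> sets seqs" using s by auto
  have "{\<omega> :: nat \<Rightarrow> 'a. \<exists>i. \<omega> i = w} = (\<Union>i. {\<omega> :: nat \<Rightarrow> 'a. \<omega> i = w})" by auto
  moreover have "(\<Union>i. {\<omega> :: nat \<Rightarrow> 'a. \<omega> i = w}) \<in> sets seqs" using s by (intro sets.countable_UN) auto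
  ultimately show "{\<omega> :: nat \<Rightarrow> 'a. \<exists>i. \<omega> i = w} \<in> sets seqs" by (simp only:)
qed

text \<open>\<open>power_weight par p w\<close> is one at \<open>w\<close> and harmonic elsewhere,
  so a decomposition by the first step preserves the bound.\<close>

lemma hit_before_le: "measure (law v) {\<omega>. \<exists>i<n. \<omega> i = w} \<le> power_weight par p w v"
proof (induction n arbitrary: v)
  case 0
  show ?case by (simp add: power_weight_def)
next
  case (Suc n)
  show ?case
  proof (cases "v = w")
    case True
    interpret prob_space "law v" by (rule prob_space_chain_law[OF countable_vertices])
    show ?thesis using True prob_le_1 by (simp add: power_weight_def)
  next
    case False
    have pre: "case_nat v -` {\<omega>. \<exists>i<Suc n. \<omega> i = w} = {\<omega>. \<exists>i<n. \<omega> i = w}"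
    proof (intro set_eqI iffI)
      fix \<omega> :: "nat \<Rightarrow> 'a" assume "\<omega> \<in> case_nat v -` {\<omega>. \<exists>i<Suc n. \<omega> i = w}"
      then obtain i where i: "i < Suc n" "case_nat v \<omega> i = w" by auto
      then obtain j where "i = Suc j" using False by (cases i) auto
      then show "\<omega> \<in> {\<omega>. \<exists>i<n. \<omega> i = w}" using i by auto
    next
      fix \<omega> :: "nat \<Rightarrow> 'a" assume "\<omega> \<in> {\<omega>. \<exists>i<n. \<omega> i = w}"
      then obtain i where "i < n" "\<omega> i = w" by auto
      then have "Suc i < Suc n" "case_nat v \<omega> (Suc i) = w" by simp_all
      then show "\<omega> \<in> case_nat v -` {\<omega>. \<exists>i<Suc n. \<omega> i = w}" by blast
    qed
    have "measure (law v) {\<omega>. \<exists>i<Suc n. \<omega> i = w} = tree_op par p (\<lambda>z. measure (law z) {\<omega>. \<exists>i<n. \<omega> i = w}) v"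
      unfolding vimage_law_step[OF hit_sets(1)] pre ..
    also have "\<dots> \<le> tree_op par p (power_weight par p w) v"
      unfolding tree_op_def by (intro add_mono divide_right_mono sum_mono Suc.IH) auto
    also have "\<dots> = power_weight par p w v"
    proof (rule tree_op_line_weight[OF anc_chain power_weight_line_weight])
      assume "v \<in> A w"
      then obtain k where k: "v = (par ^^ k) w" by (auto simp: anc_def)
      then obtain j where "k = Suc j" using False by (cases k) auto
      then show "\<exists>u\<in>A w. par u = v" using k by (intro bexI[of _ "(par ^^ j) w"]) auto
    qed
    finally show ?thesis .
  qed
qed

text \<open>No paths are counted. The hitting probability is dominated by
  \<open>power_weight\<close> and harmonic off \<open>w\<close>, so the uniqueness result used for
  minimality, now for the chain \<open>A w\<close>, makes it a multiple of
  \<open>power_weight\<close>. The value one at \<open>w\<close> fixes the factor.\<close>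

lemma hit_prob_eq: "hit_prob (\<lambda>v w. pmf (step_pmf v) w) v w = power_weight par p w v"
proof -
  define F where "F v = measure (law v) {\<omega>. \<exists>i. \<omega> i = w}" for v
  have ps: "prob_space (law v)" for v by (rule prob_space_chain_law[OF countable_vertices])
  have Fle: "F v \<le> power_weight par p w v" for v
  proof -
    interpret prob_space "law v" by (rule ps)
    have "(\<lambda>n. measure (law v) {\<omega>. \<exists>i<n. \<omega> i = w}) \<longlonglongrightarrow> measure (law v) (\<Union>n. {\<omega>. \<exists>i<n. \<omega> i = w})"
    proof (rule finite_Lim_measure_incseq)
      show "range (\<lambda>n. {\<omega>. \<exists>i<n. \<omega> i = w}) \<subseteq> sets (law v)"
        unfolding sets_chain_law[OF countable_vertices] using hit_sets(1)[of _ w] by (intro image_subsetI)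
      show "incseq (\<lambda>n. {\<omega> :: nat \<Rightarrow> 'a. \<exists>i<n. \<omega> i = w})"
        unfolding incseq_def using order_less_le_trans by blast
    qed
    moreover have "(\<Union>n. {\<omega> :: nat \<Rightarrow> 'a. \<exists>i<n. \<omega> i = w}) = {\<omega>. \<exists>i. \<omega> i = w}" by auto
    ultimately show ?thesis unfolding F_def using hit_before_le by (intro LIMSEQ_le_const2) auto
  qed
  have harm: "tree_op par p F v = F v" if vw: "v \<noteq> w" for v
  proof -
    have pre: "case_nat v -` {\<omega>. \<exists>i. \<omega> i = w} = {\<omega>. \<exists>i. \<omega> i = w}"
    proof (intro set_eqI iffI)
      fix \<omega> :: "nat \<Rightarrow> 'a" assume "\<omega> \<in> case_nat v -` {\<omega>. \<exists>i. \<omega> i = w}"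
      then obtain i where i: "case_nat v \<omega> i = w" by auto
      then obtain j where "i = Suc j" using vw by (cases i) auto
      then show "\<omega> \<in> {\<omega>. \<exists>i. \<omega> i = w}" using i by auto
    next
      fix \<omega> :: "nat \<Rightarrow> 'a" assume "\<omega> \<in> {\<omega>. \<exists>i. \<omega> i = w}"
      then obtain i where "\<omega> i = w" by auto
      then have "case_nat v \<omega> (Suc i) = w" by simp
      then show "\<omega> \<in> case_nat v -` {\<omega>. \<exists>i. \<omega> i = w}" by blast
    qed
    show ?thesis unfolding F_def using vimage_law_step[OF hit_sets(2), of v w] unfolding pre ..
  qed
  have Fw: "F w = 1"
  proof -
    interpret prob_space "law w" by (rule ps)
    have "measure (law w) (cylinder 0 (\<lambda>_. w)) = 1"
      using emeasure_chain_law_cylinder[OF countable_vertices, of step_pmf w 0 "\<lambda>_. w"] by (simp add: emeasure_eq_measure)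
    moreover have "measure (law w) (cylinder 0 (\<lambda>_. w)) \<le> F w" unfolding F_def
      by (rule finite_measure_mono) (use hit_sets(2)[of w] sets_chain_law[OF countable_vertices] in \<open>auto simp: cylinder_def[OF countable_vertices]\<close>)
    ultimately show ?thesis using prob_le_1[of "{\<omega>. \<exists>i. \<omega> i = w}"] unfolding F_def by simp
  qed
  have "\<exists>c. \<forall>x. F x = c * power_weight par p w x"
  proof (rule multiple_of_line_weight[OF anc_chain _ power_weight_line_weight])
    show "A w \<noteq> {}" using anc_self by blast
    show "\<bar>F x\<bar> \<le> 1 * power_weight par p w x" for x using Fle[of x] by (simp add: F_def)
    show "tree_op par p F x = F x" if x: "x \<notin> A w \<or> (\<exists>u\<in>A w. par u = x)" for x
    proof (rule harm)
      show "x \<noteq> w"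
      proof
        assume "x = w"
        then obtain u where u: "u \<in> A w" "par u = w" using x anc_self[of w] by blast
        have "lev (par u) = lev w" using u(2) by (rule arg_cong)
        then show False using lev_anc[OF u(1)] by simp
      qed
    qed
  qed
  then obtain c where c: "\<And>x. F x = c * power_weight par p w x" by blast
  have "c = 1" using c[of w] Fw by (simp add: power_weight_def)
  then show ?thesis unfolding hit_prob_def path_law_eq[OF countable_vertices] using c[of v] by (simp add: F_def)
qed

end

section \<open>Limits of the Martin kernel\<close>

definition distortion :: "real \<Rightarrow> real \<Rightarrow> real" where
  "distortion k K = (1 + (2 * k\<^sup>2 + 4 * k) * inverse (K - 1)) * inverse (1 - (2 * k + 2) * inverse K) ^ 3"

lemma distortion_tendsto: "(distortion k \<longlongrightarrow> 1) at_top"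
proof -
  have i: "((\<lambda>K :: real. inverse K) \<longlongrightarrow> 0) at_top" by (rule tendsto_inverse_0_at_top) (rule filterlim_ident)
  have j: "((\<lambda>K :: real. inverse (K - 1)) \<longlongrightarrow> 0) at_top"
    using filterlim_tendsto_add_at_top[OF tendsto_const[of "-1 :: real"] filterlim_ident]
    by (intro tendsto_inverse_0_at_top) simp
  have "((\<lambda>K. (1 + (2 * k\<^sup>2 + 4 * k) * inverse (K - 1)) * inverse (1 - (2 * k + 2) * inverse K) ^ 3) \<longlongrightarrow>
      (1 + (2 * k\<^sup>2 + 4 * k) * 0) * inverse (1 - (2 * k + 2) * 0) ^ 3) at_top"
    by (intro tendsto_intros i j) simp
  then show ?thesis by (simp add: distortion_def[abs_def])
qed

text \<open>Changing all distances by at most \<open>k\<close> raises the numerator by a multiple of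
  \<open>L = D1 + D2\<close>, whereas \<open>big\<close> makes the numerator at least
  \<open>(K - 1) * L\<close>. Each factor of the denominator stays above
  \<open>L - (2 * k + 2)\<close>. The two factors of \<open>distortion\<close> record these losses;
  both tend to one for large \<open>K\<close>.\<close>

lemma visits_distortion:
  fixes k K :: real
  assumes k: "k \<ge> 0" and K: "K > 2 * k + 3"
    and pos: "U1 \<ge> 1" "D1 \<ge> 1" "U2 \<ge> 1" "D2 \<ge> 1" "U1' \<ge> 1" "D1' \<ge> 1" "U2' \<ge> 1" "D2' \<ge> 1"
    and L: "U1 + U2 = D1 + D2"
    and near: "\<bar>U1' - U1\<bar> \<le> k" "\<bar>D1' - D1\<bar> \<le> k" "\<bar>U2' - U2\<bar> \<le> k" "\<bar>D2' - D2\<bar> \<le> k"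
    and big: "K \<le> D1 + D2" "K * (D1 + D2) \<le> U1 * D2 + D1 * U2"
  shows "visits U1' D1' U2' D2' \<le> distortion k K * visits U1 D1 U2 D2"
proof -
  define L where "L = D1 + D2"
  define L' where "L' = D1' + D2'"
  define e where "e = U1 * D2 + D1 * U2 - L"
  define e' where "e' = U1' * D2' + D1' * U2' - L'"
  \<comment> \<open>The mixed terms of the two enlarged products add up to \<open>2 * k * L\<close>,
    because \<open>U1 + U2 = D1 + D2\<close>. The remaining \<open>2 * k\<^sup>2 + 2 * k\<close> is
    absorbed by the factor \<open>L \<ge> 1\<close>.\<close>
  define c where "c = 2 * k\<^sup>2 + 4 * k"
  have c0: "c \<ge> 0" using k by (simp add: c_def)
  have L1: "L \<ge> K" "L > 2 * k + 3" "L' \<ge> L - 2 * k" using big(1) K near by (simp_all add: L_def L'_def)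
  have e: "e \<ge> (K - 1) * L" using big(2) by (simp add: e_def L_def algebra_simps)
  have "U1' * D2' \<le> (U1 + k) * (D2 + k)" "D1' * U2' \<le> (D1 + k) * (U2 + k)"
    by (rule mult_mono; use near pos k in linarith)+
  then have "e' \<le> (U1 + k) * (D2 + k) + (D1 + k) * (U2 + k) - (L - 2 * k)" using L1(3) unfolding e'_def by linarith
  also have "\<dots> = e + 2 * k * L + (2 * k\<^sup>2 + 2 * k)"
  proof -
    have "k * (U1 + U2) = k * (D1 + D2)" using L by simp
    then show ?thesis by (simp add: e_def L_def algebra_simps power2_eq_square)
  qed
  also have "\<dots> \<le> e + 2 * k * L + (2 * k\<^sup>2 + 2 * k) * L"
    using mult_left_mono[of 1 L "2 * k\<^sup>2 + 2 * k"] L1 k by simp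
  also have "\<dots> = e + c * L" by (simp add: c_def algebra_simps)
  also have "c * L \<le> c * (inverse (K - 1) * e)"
  proof (rule mult_left_mono[OF _ c0])
    show "L \<le> inverse (K - 1) * e" using e K k by (simp add: field_simps)
  qed
  finally have e'e: "e' \<le> (1 + c * inverse (K - 1)) * e" by (simp add: algebra_simps)
  have e0: "e \<ge> 0" using e K k L1 by (intro order_trans[OF _ e]) simp
  let ?m = "L - (2 * k + 2)"
  have m0: "?m > 0" using L1 by simp
  have d1: "?m ^ 3 \<le> L' * (L' - 1) * (L' - 2)"
  proof -
    have "?m * ?m * ?m \<le> L' * (L' - 1) * (L' - 2)"
      using L1 m0 by (intro mult_mono mult_nonneg_nonneg) linarith+
    then show ?thesis by (simp add: power3_eq_cube)
  qed
  have L'pos: "0 < L' * (L' - 1) * (L' - 2)" by (rule less_le_trans[OF zero_less_power[OF m0] d1])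
  have d2: "L * (L - 1) * (L - 2) \<le> L ^ 3"
  proof -
    have "L * (L - 1) * (L - 2) \<le> L * L * L"
      using L1 k by (intro mult_mono mult_nonneg_nonneg) linarith+
    then show ?thesis by (simp add: power3_eq_cube)
  qed
  have Lpos: "L * (L - 1) * (L - 2) > 0" using L1 k by simp
  have ratio: "L / ?m \<le> inverse (1 - (2 * k + 2) * inverse K)"
  proof -
    have "(2 * k + 2) * inverse L \<le> (2 * k + 2) * inverse K" using L1 k K by (intro mult_left_mono le_imp_inverse_le) auto
    moreover have "1 - (2 * k + 2) * inverse K > 0" using K k by (simp add: field_simps)
    ultimately have "inverse (1 - (2 * k + 2) * inverse L) \<le> inverse (1 - (2 * k + 2) * inverse K)"
      by (intro le_imp_inverse_le) auto
    moreover have "inverse (1 - (2 * k + 2) * inverse L) = L / ?m" using L1 k by (simp add: field_simps)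
    ultimately show ?thesis by simp
  qed
  have "visits U1' D1' U2' D2' = 2 * e' / (L' * (L' - 1) * (L' - 2))"
    using L1 by (simp add: visits_def e'_def L'_def)
  also have "\<dots> \<le> 2 * ((1 + c * inverse (K - 1)) * e) / (L' * (L' - 1) * (L' - 2))"
    using e'e L'pos by (intro divide_right_mono) auto
  also have "\<dots> \<le> 2 * ((1 + c * inverse (K - 1)) * e) / ?m ^ 3"
    using d1 m0 e0 c0 K k L'pos by (intro divide_left_mono) auto
  also have "\<dots> = (1 + c * inverse (K - 1)) * (L / ?m) ^ 3 * (2 * e / L ^ 3)"
    using L1 k m0 by (simp add: power_divide)
  also have "\<dots> \<le> (1 + c * inverse (K - 1)) * inverse (1 - (2 * k + 2) * inverse K) ^ 3 * (2 * e / (L * (L - 1) * (L - 2)))"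
  proof (rule mult_mono)
    have m: "0 \<le> L / ?m" using m0 L1 k by simp
    have K1: "0 \<le> 1 + c * inverse (K - 1)" using c0 K k by simp
    show "(1 + c * inverse (K - 1)) * (L / ?m) ^ 3 \<le> (1 + c * inverse (K - 1)) * inverse (1 - (2 * k + 2) * inverse K) ^ 3"
      by (rule mult_left_mono[OF power_mono[OF ratio m] K1])
    show "2 * e / L ^ 3 \<le> 2 * e / (L * (L - 1) * (L - 2))"
      by (rule divide_left_mono[OF d2]) (use e0 Lpos d2 L1 k in auto)
    show "0 \<le> (1 + c * inverse (K - 1)) * inverse (1 - (2 * k + 2) * inverse K) ^ 3"
      using K1 order_trans[OF m ratio] by simp
    show "0 \<le> 2 * e / L ^ 3" using e0 L1 k by simp
  qed
  also have "\<dots> = distortion k K * visits U1 D1 U2 D2"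
    using L1 k by (simp add: distortion_def c_def visits_def e_def L_def)
  finally show ?thesis .
qed

text \<open>If \<open>U1\<close> is large, each product has a large factor. If \<open>D1\<close> is
  large, one of \<open>D1\<close>, \<open>D2\<close> and one of \<open>U1\<close>, \<open>U2\<close>
  is at least half of the total. The only case without a direct estimate has \<open>U1\<close> and
  \<open>D2\<close> dominant; there \<open>(?L / 2 - K)\<^sup>2 \<ge> 0\<close> supplies the
  bound.\<close>

lemma cross_sum_lower:
  fixes U1 D1 U2 D2 :: real
  assumes pos: "U1 \<ge> 1" "D1 \<ge> 1" "U2 \<ge> 1" "D2 \<ge> 1" and L: "U1 + U2 = D1 + D2"
    and K: "U2 \<ge> 2 * K" "U1 \<ge> 2 * K \<or> D1 \<ge> 2 * K" "K \<ge> 0"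
  shows "K * (D1 + D2) \<le> U1 * D2 + D1 * U2"
  using K(2)
proof
  assume U1: "U1 \<ge> 2 * K"
  have "K * D2 \<le> U1 * D2" "K * D1 \<le> U2 * D1" using U1 K pos by (intro mult_right_mono; linarith)+
  then show ?thesis by (simp add: algebra_simps)
next
  assume D1: "D1 \<ge> 2 * K"
  let ?L = "D1 + D2"
  have "D1 \<ge> ?L / 2 \<or> D2 \<ge> ?L / 2" by (cases "D1 \<ge> D2") simp_all
  moreover have "U1 \<ge> ?L / 2 \<or> U2 \<ge> ?L / 2" by (cases "U1 \<ge> U2") (simp_all flip: L)
  have h: "0 \<le> ?L / 2" using pos by simp
  note \<open>D1 \<ge> ?L / 2 \<or> D2 \<ge> ?L / 2\<close>
  with \<open>U1 \<ge> ?L / 2 \<or> U2 \<ge> ?L / 2\<close> consider "D1 \<ge> ?L / 2" | "D2 \<ge> ?L / 2" "U2 \<ge> ?L / 2" | "D2 \<ge> ?L / 2" "U1 \<ge> ?L / 2" by blast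
  then show ?thesis
  proof cases
    case 1
    have "?L / 2 * (2 * K) \<le> D1 * U2" using 1 K(1,3) pos h by (intro mult_mono) linarith+
    moreover have "0 \<le> U1 * D2" using pos by simp
    ultimately show ?thesis by (simp add: algebra_simps)
  next
    case 2
    have "(2 * K) * (?L / 2) \<le> D1 * U2" using 2 D1 K(1,3) pos h by (intro mult_mono) linarith+
    moreover have "0 \<le> U1 * D2" using pos by simp
    ultimately show ?thesis by (simp add: algebra_simps)
  next
    case 3
    have "?L / 2 * (?L / 2) \<le> U1 * D2" using 3 pos h by (intro mult_mono) linarith+
    moreover have "K * ?L \<le> (?L / 2) * (?L / 2) + D1 * U2"
    proof -
      have "D1 * 1 \<le> D1 * U2" using pos by (intro mult_left_mono) linarith+
      have "(2 * K) * (2 * K) \<le> D1 * U2" using D1 K(1,3) by (intro mult_mono) linarith+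
      moreover have "0 \<le> (?L / 2 - K)\<^sup>2" by simp
      moreover have "(?L / 2 - K)\<^sup>2 = ?L / 2 * (?L / 2) - K * ?L + K * K" by (simp add: power2_eq_square algebra_simps)
      moreover have "0 \<le> K * K" "(2 * K) * (2 * K) = 4 * (K * K)" by simp_all
      ultimately show ?thesis by linarith
    qed
    ultimately show ?thesis by linarith
  qed
qed

context horopair begin

definition Phi where "Phi x1 x2 y1 y2 = ds (vis x1 x2 y1 y2)"

lemma gam_Phi: "gam q r par1 par2 x1 x2 y1 y2 = Phi x1 x2 y1 y2 / (real q ^ updist par1 y1 x1 * real r ^ updist par2 y2 x2)"
  by (simp add: gam_def Phi_def)

lemma Phi_pos: "dlX x1 x2 \<Longrightarrow> dlX y1 y2 \<Longrightarrow> Phi x1 x2 y1 y2 > 0"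
proof -
  assume "dlX x1 x2" "dlX y1 y2"
  define c where "c = real q ^ updist par1 y1 x1 * real r ^ updist par2 y2 x2"
  have "c > 0" using q2 r2 by (simp add: c_def)
  moreover have "0 < Phi x1 x2 y1 y2 / c"
    using gam_pos[OF \<open>dlX x1 x2\<close> \<open>dlX y1 y2\<close>] unfolding gam_Phi c_def .
  ultimately show ?thesis by (simp add: zero_less_divide_iff)
qed

lemma level_sum:
  assumes "dlX x1 x2" "dlX y1 y2"
  shows "real (updist par1 x1 y1) + real (updist par2 x2 y2) = real (updist par1 y1 x1) + real (updist par2 y2 x2)"
  using T1.lev_updist[of x1 y1] T2.lev_updist[of x2 y2] assms by linarith

lemma Phi_distortion:
  assumes x: "dlX x1 x2" and z: "dlX z1 z2" and y: "dlX y1 y2"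
    and k: "updist par1 x1 z1 + updist par1 z1 x1 \<le> k" "updist par2 x2 z2 + updist par2 z2 x2 \<le> k"
    and K: "K > 2 * real k + 3"
    and big: "real (updist par2 x2 y2) \<ge> 2 * K" "real (updist par1 x1 y1) \<ge> 2 * K \<or> real (updist par1 y1 x1) \<ge> 2 * K"
  shows "Phi z1 z2 y1 y2 \<le> distortion (real k) K * Phi x1 x2 y1 y2"
proof -
  have le: "vis z1 z2 y1 y2 a b \<le> distortion (real k) K * vis x1 x2 y1 y2 a b" for a b
  proof (rule visits_distortion[OF _ K])
    have "\<bar>int (updist par1 z1 y1) - int (updist par1 x1 y1)\<bar> \<le> int k" "\<bar>int (updist par1 y1 z1) - int (updist par1 y1 x1)\<bar> \<le> int k"
      using T1.updist_triangle[of z1 y1 x1] T1.updist_triangle[of x1 y1 z1] T1.updist_triangle[of y1 z1 x1] T1.updist_triangle[of y1 x1 z1] k(1)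
      by linarith+
    then have n1: "\<bar>real (updist par1 z1 y1) - real (updist par1 x1 y1)\<bar> \<le> real k" "\<bar>real (updist par1 y1 z1) - real (updist par1 y1 x1)\<bar> \<le> real k"
      by linarith+
    have "\<bar>int (updist par2 z2 y2) - int (updist par2 x2 y2)\<bar> \<le> int k" "\<bar>int (updist par2 y2 z2) - int (updist par2 y2 x2)\<bar> \<le> int k"
      using T2.updist_triangle[of z2 y2 x2] T2.updist_triangle[of x2 y2 z2] T2.updist_triangle[of y2 z2 x2] T2.updist_triangle[of y2 x2 z2] k(2)
      by linarith+
    then have n2: "\<bar>real (updist par2 z2 y2) - real (updist par2 x2 y2)\<bar> \<le> real k" "\<bar>real (updist par2 y2 z2) - real (updist par2 y2 x2)\<bar> \<le> real k"
      by linarith+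
    show "\<bar>real (updist par1 z1 y1 + 1 + a) - real (updist par1 x1 y1 + 1 + a)\<bar> \<le> real k"
      "\<bar>real (updist par1 y1 z1 + 1 + a) - real (updist par1 y1 x1 + 1 + a)\<bar> \<le> real k"
      "\<bar>real (updist par2 z2 y2 + 1 + b) - real (updist par2 x2 y2 + 1 + b)\<bar> \<le> real k"
      "\<bar>real (updist par2 y2 z2 + 1 + b) - real (updist par2 y2 x2 + 1 + b)\<bar> \<le> real k"
      using n1 n2 by simp_all
    show L: "real (updist par1 x1 y1 + 1 + a) + real (updist par2 x2 y2 + 1 + b) = real (updist par1 y1 x1 + 1 + a) + real (updist par2 y2 x2 + 1 + b)"
      using level_sum[OF x y] by simp
    have K0: "K \<ge> 0" using K by simp
    show "K * (real (updist par1 y1 x1 + 1 + a) + real (updist par2 y2 x2 + 1 + b)) \<le>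
        real (updist par1 x1 y1 + 1 + a) * real (updist par2 y2 x2 + 1 + b) + real (updist par1 y1 x1 + 1 + a) * real (updist par2 x2 y2 + 1 + b)"
      by (rule cross_sum_lower[OF _ _ _ _ L]) (use big K0 in auto)
    show "K \<le> real (updist par1 y1 x1 + 1 + a) + real (updist par2 y2 x2 + 1 + b)"
      unfolding L[symmetric] using big(1) K0 by simp
  qed auto
  have "ds (vis z1 z2 y1 y2) \<le> ds (\<lambda>a b. distortion (real k) K * vis x1 x2 y1 y2 a b)"
  proof (rule dsum_mono[OF q2 r2 vis_bound[OF z y] _ le])
    show "\<bar>distortion (real k) K * vis x1 x2 y1 y2 i j\<bar> \<le> (\<bar>distortion (real k) K\<bar> * 3) * (real i + 1) * (real j + 1)" for i j
      using mult_left_mono[OF vis_bound[OF x y, of i j], of "\<bar>distortion (real k) K\<bar>"] by (simp add: abs_mult mult.assoc)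
  qed
  then show ?thesis unfolding dsum_cmult[OF q2 r2] Phi_def .
qed

text \<open>Moving the start from \<open>o\<close> to \<open>x\<close> changes all distances
  boundedly, so the quotient of the two \<open>Phi\<close> series tends to one and only the quotient
  of the powers survives. The disjunction in \<open>growth\<close> covers both kinds of limits in
  the first tree: climbing to the reference end and descending to another one.\<close>

theorem kernel_limit_end:
  assumes x: "dlX x1 x2" and o: "dlX o1 o2" and y: "\<forall>\<^sub>F i in F. dlX (y1 i) (y2 i)"
    and growth: "\<And>K. \<forall>\<^sub>F i in F. updist par2 o2 (y2 i) \<ge> K \<and> (updist par1 o1 (y1 i) \<ge> K \<or> updist par1 (y1 i) o1 \<ge> K)"
    and \<kappa>: "\<forall>\<^sub>F i in F. real q ^ updist par1 (y1 i) o1 / real q ^ updist par1 (y1 i) x1 = \<kappa>"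
    and same: "\<forall>\<^sub>F i in F. updist par2 (y2 i) x2 = updist par2 (y2 i) o2"
  shows "((\<lambda>i. gam q r par1 par2 x1 x2 (y1 i) (y2 i) / gam q r par1 par2 o1 o2 (y1 i) (y2 i)) \<longlongrightarrow> \<kappa>) F"
proof -
  define k where "k = updist par1 x1 o1 + updist par1 o1 x1 + updist par2 x2 o2 + updist par2 o2 x2"
  let ?R = "\<lambda>i. Phi x1 x2 (y1 i) (y2 i) / Phi o1 o2 (y1 i) (y2 i)"
  have R: "(?R \<longlongrightarrow> 1) F"
  proof (rule tendstoI)
    fix e :: real assume e: "e > 0"
    define d where "d = min (e / 2) (1 / 2)"
    have "\<forall>\<^sub>F K in at_top. distortion (real k) K < 1 + d"
      using order_tendstoD(2)[OF distortion_tendsto[of "real k"], of "1 + d"] e by (simp add: d_def)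
    moreover have "\<forall>\<^sub>F K in at_top. distortion (real k) K > 0"
      using order_tendstoD(1)[OF distortion_tendsto[of "real k"], of 0] by simp
    moreover have "\<forall>\<^sub>F K in at_top. K > 2 * real k + 3" by (rule eventually_gt_at_top)
    ultimately have "\<forall>\<^sub>F K in at_top. distortion (real k) K < 1 + d \<and> distortion (real k) K > 0 \<and> K > 2 * real k + 3"
      by eventually_elim simp
    then obtain K where K: "distortion (real k) K < 1 + d" "distortion (real k) K > 0" "K > 2 * real k + 3"
      by (auto simp: eventually_at_top_linorder)
    \<comment> \<open>The surplus \<open>k\<close> preserves the bound \<open>2 * K\<close> when
      distances are measured from \<open>x\<close> instead of \<open>o\<close>.\<close>
    define N where "N = nat \<lceil>2 * K\<rceil> + k"
    have N: "real N \<ge> 2 * K + real k" unfolding N_def by linarith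
    show "\<forall>\<^sub>F i in F. dist (?R i) 1 < e"
      using y growth[of N]
    proof eventually_elim
      case (elim i)
      have y: "dlX (y1 i) (y2 i)" using elim(1) .
      have bo: "real (updist par2 o2 (y2 i)) \<ge> 2 * K" "real (updist par1 o1 (y1 i)) \<ge> 2 * K \<or> real (updist par1 (y1 i) o1) \<ge> 2 * K"
        using elim(2) N by (auto simp: of_nat_le_iff[symmetric, where ?'a = real] simp del: of_nat_le_iff)
      have t: "updist par2 o2 (y2 i) \<le> updist par2 x2 (y2 i) + k" "updist par1 o1 (y1 i) \<le> updist par1 x1 (y1 i) + k"
          "updist par1 (y1 i) o1 \<le> updist par1 (y1 i) x1 + k"
        using T2.updist_triangle[of o2 "y2 i" x2] T1.updist_triangle[of o1 "y1 i" x1] T1.updist_triangle[of "y1 i" o1 x1] by (simp_all add: k_def)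
      have bx: "real (updist par2 x2 (y2 i)) \<ge> 2 * K" "real (updist par1 x1 (y1 i)) \<ge> 2 * K \<or> real (updist par1 (y1 i) x1) \<ge> 2 * K"
        using elim(2) N t by linarith+
      have kk: "updist par1 x1 o1 + updist par1 o1 x1 \<le> k" "updist par2 x2 o2 + updist par2 o2 x2 \<le> k"
        "updist par1 o1 x1 + updist par1 x1 o1 \<le> k" "updist par2 o2 x2 + updist par2 x2 o2 \<le> k" by (simp_all add: k_def)
      have 1: "Phi x1 x2 (y1 i) (y2 i) \<le> distortion (real k) K * Phi o1 o2 (y1 i) (y2 i)"
        by (rule Phi_distortion[OF o x y kk(3,4) K(3) bo])
      have 2: "Phi o1 o2 (y1 i) (y2 i) \<le> distortion (real k) K * Phi x1 x2 (y1 i) (y2 i)"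
        by (rule Phi_distortion[OF x o y kk(1,2) K(3) bx])
      have p: "Phi x1 x2 (y1 i) (y2 i) > 0" "Phi o1 o2 (y1 i) (y2 i) > 0" using Phi_pos x o y by blast+
      have u: "?R i < 1 + d" using 1 K p by (simp add: pos_divide_less_eq) (smt (verit) mult_strict_right_mono)
      have "1 < (1 + d) * ?R i" using 2 K p by (simp add: pos_less_divide_eq) (smt (verit) mult_strict_right_mono)
      moreover have "d > 0" using e by (simp add: d_def)
      ultimately have "?R i > 1 - d" using p
      proof -
        assume a: "1 < (1 + d) * ?R i" "d > 0"
        have "(1 + d) * (1 - d) \<le> 1" using a(2) by (simp add: algebra_simps)
        then have "(1 + d) * (1 - d) < (1 + d) * ?R i" using a(1) by linarith
        then show ?thesis using a(2) by (subst (asm) mult_less_cancel_left_pos) simp_all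
      qed
      then show ?case using u e by (auto simp: dist_real_def d_def abs_less_iff)
    qed
  qed
  have "((\<lambda>i. ?R i * \<kappa>) \<longlongrightarrow> 1 * \<kappa>) F" by (intro tendsto_mult R tendsto_const)
  moreover have "\<forall>\<^sub>F i in F. ?R i * \<kappa> = gam q r par1 par2 x1 x2 (y1 i) (y2 i) / gam q r par1 par2 o1 o2 (y1 i) (y2 i)"
    using \<kappa> same
  proof eventually_elim
    case (elim i)
    show ?case unfolding gam_Phi elim(1)[symmetric] elim(2) using q2 r2 by simp
  qed
  ultimately show ?thesis using tendsto_cong[of "\<lambda>i. ?R i * \<kappa>" _ F \<kappa>] by simp
qed

text \<open>Shifting the index gives \<open>s = (s + ds_one) / q\<close> for the series
  \<open>s\<close> with terms \<open>real i\<close>, the computation of a geometric mean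
  value.\<close>

lemma dsum_fst: "ds (\<lambda>i j. c + 2 * real i) = (c + 2 / (real q - 1)) * ds_one"
proof -
  define s where "s = ds (\<lambda>i j. real i)"
  have b: "\<bar>real i\<bar> \<le> 1 * (real i + 1) * (real j + 1)" "\<bar>1 :: real\<bar> \<le> 1 * (real i + 1) * (real j + 1)" for i j :: nat
  proof -
    show "\<bar>real i\<bar> \<le> 1 * (real i + 1) * (real j + 1)" by (simp add: algebra_simps)
    show "\<bar>1 :: real\<bar> \<le> 1 * (real i + 1) * (real j + 1)" by (simp add: algebra_simps)
  qed
  have "s = ds (\<lambda>i j. real (Suc i) / real q)" unfolding s_def using dsum_shift1[OF q2 r2, of "\<lambda>i j. real i"] by simp
  also have "\<dots> = ds (\<lambda>i j. (1 / real q) * (real i + 1))" by (simp add: add.commute)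
  also have "\<dots> = (1 / real q) * ds (\<lambda>i j. real i + 1)" by (rule dsum_cmult[OF q2 r2])
  also have "ds (\<lambda>i j. real i + 1) = s + ds_one" unfolding s_def ds_one_def by (rule dsum_add[OF q2 r2 b])
  finally have s: "s = ds_one / (real q - 1)" using q2 by (simp add: field_simps)
  have "ds (\<lambda>i j. c * 1 + 2 * real i) = ds (\<lambda>i j. c * 1) + ds (\<lambda>i j. 2 * real i)"
  proof (rule dsum_add[OF q2 r2])
    show "\<bar>c * 1\<bar> \<le> \<bar>c\<bar> * (real i + 1) * (real j + 1)" for i j :: nat
      using mult_left_mono[OF b(2)[of i j], of "\<bar>c\<bar>"] by (simp add: mult.assoc)
    show "\<bar>2 * real i\<bar> \<le> 2 * (real i + 1) * (real j + 1)" for i j :: nat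
      by (simp add: algebra_simps)
  qed
  also have "\<dots> = c * ds_one + 2 * s" unfolding s_def ds_one_def dsum_cmult[OF q2 r2] ..
  finally show ?thesis by (simp add: s algebra_simps)
qed

text \<open>The bracket in the numerator of \<open>visits\<close> is
  \<open>(U1 + D1 - 1) * L - 2 * U1 * D1\<close> with \<open>L = D1 + D2\<close>. For fixed
  \<open>U1\<close>, \<open>D1\<close> and \<open>L\<close> of order \<open>n\<close>, a term is
  therefore asymptotic to \<open>2 * (U1 + D1 - 1) / n\<^sup>2\<close>. Summing
  \<open>u + d + 1 + 2 * a\<close> geometrically yields \<open>u + d + 1 + 2 / (q - 1)\<close>,
  which is the origin of the constant \<open>(q + 1) / (q - 1)\<close> of the spherical function.
  For \<open>n < u\<close> the third argument could drop below one, hence the value \<open>0\<close>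
  there.\<close>

lemma Phi_vertex_limit:
  fixes u d :: nat
  defines "V \<equiv> \<lambda>n a b. visits (real (u + 1 + a)) (real (d + 1 + a)) (real d + real n - real u + 1 + real b) (real (n + 1 + b))"
  shows "(\<lambda>n. if n < u then 0 else (real n)\<^sup>2 * ds (V n)) \<longlonglongrightarrow> 2 * ((real u + real d + (real q + 1) / (real q - 1)) * ds_one)"
proof -
  define F where "F n i j = (if n < u then 0 else (real n)\<^sup>2 * V n i j)" for n i j
  have Vn: "V n i j = 2 * ((real u + real d + 1 + 2 * real i) - 2 * (real (u + 1 + i) * real (d + 1 + i)) / (real n + (real d + real i + real j + 2))) /
       ((real n + (real d + real i + real j + 1)) * (real n + (real d + real i + real j)))" if "n \<ge> 1" for n i j
  proof -
    define L where "L = real n + (real d + real i + real j + 2)"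
    have L3: "L \<ge> 3" using that by (simp add: L_def)
    have e1: "real (d + 1 + i) + real (n + 1 + j) = L" by (simp add: L_def)
    have e2: "real d + real n - real u + 1 + real j = L - real (u + 1 + i)" "real (n + 1 + j) = L - real (d + 1 + i)" by (simp_all add: L_def)
    have e3: "real n + (real d + real i + real j + 1) = L - 1" "real n + (real d + real i + real j) = L - 2" by (simp_all add: L_def)
    have e4: "real u + real d + 1 + 2 * real i = real (u + 1 + i) + real (d + 1 + i) - 1" by simp
    have "V n i j = 2 * (real (u + 1 + i) * (L - real (d + 1 + i)) + real (d + 1 + i) * (L - real (u + 1 + i)) - L) / (L * (L - 1) * (L - 2))"
      unfolding V_def visits_def e1 using L3 unfolding e2 by simp
    also have "\<dots> = 2 * ((real (u + 1 + i) + real (d + 1 + i) - 1) - 2 * (real (u + 1 + i) * real (d + 1 + i)) / L) / ((L - 1) * (L - 2))"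
    proof -
      have "2 * (U * (L - D) + D * (L - U) - L) / (L * (L - 1) * (L - 2)) = 2 * ((U + D - 1) - 2 * (U * D) / L) / ((L - 1) * (L - 2))" for U D
      proof -
        have "2 * (U * (L - D) + D * (L - U) - L) = L * (2 * ((U + D - 1) - 2 * (U * D) / L))" using L3 by (simp add: field_simps)
        then show ?thesis using L3 by (simp add: mult.assoc)
      qed
      then show ?thesis .
    qed
    finally show ?thesis unfolding e3 e4 L_def[symmetric] .
  qed
  have quot: "(\<lambda>n. real n / (real n + c)) \<longlonglongrightarrow> 1" if "c \<ge> 0" for c :: real
  proof -
    have "(\<lambda>n. 1 - c * (1 / (real n + c))) \<longlonglongrightarrow> 1 - c * 0"
    proof (intro tendsto_intros)
      have "filterlim (\<lambda>n. c + real n) at_top sequentially"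
        by (rule filterlim_tendsto_add_at_top[OF tendsto_const filterlim_real_sequentially])
      then show "(\<lambda>n. 1 / (real n + c)) \<longlonglongrightarrow> 0"
        by (intro tendsto_divide_0[OF tendsto_const] filterlim_at_top_imp_at_infinity) (simp add: add.commute)
    qed
    moreover have "\<forall>\<^sub>F n in sequentially. 1 - c * (1 / (real n + c)) = real n / (real n + c)"
      using eventually_gt_at_top[of 0] by eventually_elim (use that in \<open>simp add: field_simps\<close>)
    ultimately show ?thesis using tendsto_cong by force
  qed
  have pt: "(\<lambda>n. F n i j) \<longlonglongrightarrow> 2 * (real u + real d + 1 + 2 * real i)" for i j
  proof -
    define c where "c = real d + real i + real j"
    have c: "c \<ge> 0" by (simp add: c_def)
    let ?A = "real u + real d + 1 + 2 * real i" and ?B = "2 * (real (u + 1 + i) * real (d + 1 + i))"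
    have "filterlim (\<lambda>n. (c + 2) + real n) at_top sequentially"
      by (rule filterlim_tendsto_add_at_top[OF tendsto_const filterlim_real_sequentially])
    then have z: "(\<lambda>n. ?B / (real n + (c + 2))) \<longlonglongrightarrow> 0"
      by (intro tendsto_divide_0[OF tendsto_const] filterlim_at_top_imp_at_infinity) (simp add: add.commute add.left_commute)
    have "(\<lambda>n. 2 * (?A - ?B / (real n + (c + 2))) * (real n / (real n + (c + 1))) * (real n / (real n + c))) \<longlonglongrightarrow> 2 * (?A - 0) * 1 * 1"
      by (intro tendsto_mult tendsto_diff tendsto_const z quot) (use c in simp_all)
    moreover have "\<forall>\<^sub>F n in sequentially. 2 * (?A - ?B / (real n + (c + 2))) * (real n / (real n + (c + 1))) * (real n / (real n + c)) = F n i j"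
      using eventually_ge_at_top[of "max u 1"]
    proof eventually_elim
      case (elim n)
      then have "n \<ge> 1" "\<not> n < u" by simp_all
      then have "F n i j = (real n)\<^sup>2 * (2 * (?A - ?B / (real n + (c + 2))) / ((real n + (c + 1)) * (real n + c)))"
        using Vn[of n i j] by (simp add: F_def c_def)
      then show ?case by (simp add: power2_eq_square)
    qed
    ultimately show ?thesis using Lim_transform_eventually by fastforce
  qed
  have bd: "\<bar>F n i j\<bar> \<le> (4 * (real u + real d + 2)) * (real i + 1) * (real j + 1)" for n i j
  proof (cases "n < u \<or> n = 0")
    case True
    then show ?thesis by (auto simp: F_def)
  next
    case False
    let ?U = "real (u + 1 + i)" and ?D = "real (d + 1 + i)" and ?D2 = "real (n + 1 + j)"
    let ?U2 = "real d + real n - real u + 1 + real j"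
    have nu: "real n \<ge> real u" "real n \<ge> 1" using False by simp_all
    define L where "L = ?D + ?D2"
    have L: "?U + ?U2 = L" by (simp add: L_def)
    have U2: "?U2 \<ge> 1" using nu by linarith
    have L2: "L - 1 \<ge> real n" "L - 2 \<ge> real n" "L \<ge> 3" using nu by (simp_all add: L_def)
    have V0: "0 < V n i j" unfolding V_def using L U2 L2 by (intro visits_bounds(1)) (simp_all add: L_def)
    have "?U * ?D2 \<le> ?U * L" "?D * ?U2 \<le> ?D * L" using L U2 by (intro mult_left_mono; simp add: L_def)+
    then have E: "?U * ?D2 + ?D * ?U2 - L \<le> (?U + ?D) * L" using L2 by (simp add: distrib_right)
    have "V n i j = 2 * (?U * ?D2 + ?D * ?U2 - L) / (L * (L - 1) * (L - 2))"
      unfolding V_def visits_def L_def[symmetric] using L2 by simp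
    also have "\<dots> \<le> 2 * ((?U + ?D) * L) / (L * (L - 1) * (L - 2))"
      using E L2 by (intro divide_right_mono mult_left_mono) auto
    also have "\<dots> = 2 * (?U + ?D) / ((L - 1) * (L - 2))" using L2 by simp
    also have "\<dots> \<le> 2 * (?U + ?D) / (real n * real n)"
      using L2 nu by (intro divide_left_mono mult_mono mult_pos_pos) auto
    finally have "(real n)\<^sup>2 * V n i j \<le> 2 * (?U + ?D)" using nu by (simp add: field_simps power2_eq_square)
    also have "\<dots> \<le> (4 * (real u + real d + 2)) * (real i + 1)" by (simp add: algebra_simps)
    also have "\<dots> * 1 \<le> (4 * (real u + real d + 2)) * (real i + 1) * (real j + 1)" by (rule mult_left_mono) auto
    finally show ?thesis using V0 False by (simp add: F_def)
  qed
  have "(\<lambda>n. ds (F n)) \<longlonglongrightarrow> ds (\<lambda>i j. 2 * (real u + real d + 1 + 2 * real i))"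
    by (rule dsum_tendsto[OF q2 r2 pt bd])
  moreover have "ds (F n) = (if n < u then 0 else (real n)\<^sup>2 * ds (V n))" for n
    using dsum_cmult[OF q2 r2, of "(real n)\<^sup>2" "V n"] dsum_cmult[OF q2 r2, of 0 "\<lambda>_ _. 0"] by (auto simp: F_def[abs_def])
  moreover have "ds (\<lambda>i j. 2 * (real u + real d + 1 + 2 * real i)) = 2 * ((real u + real d + 1 + 2 / (real q - 1)) * ds_one)"
    unfolding dsum_cmult[OF q2 r2] dsum_fst ..
  moreover have "real u + real d + 1 + 2 / (real q - 1) = real u + real d + (real q + 1) / (real q - 1)"
    using q2 by (simp add: field_simps)
  ultimately show ?thesis by simp
qed

theorem kernel_limit_vertex:
  assumes x: "dlX x1 x2" and o: "dlX o1 o2" and y: "\<forall>\<^sub>F i in F. dlX (y1 i) (y2 i)"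
    and const: "\<forall>\<^sub>F i in F. y1 i = v"
    and growth: "filterlim (\<lambda>i. updist par2 (y2 i) o2) at_top F"
    and same: "\<forall>\<^sub>F i in F. updist par2 (y2 i) x2 = updist par2 (y2 i) o2"
  shows "((\<lambda>i. gam q r par1 par2 x1 x2 (y1 i) (y2 i) / gam q r par1 par2 o1 o2 (y1 i) (y2 i)) \<longlongrightarrow>
     ((real q + 1) / (real q - 1) + (real (updist par1 x1 v) + real (updist par1 v x1))) / real q ^ updist par1 v x1 /
     (((real q + 1) / (real q - 1) + (real (updist par1 o1 v) + real (updist par1 v o1))) / real q ^ updist par1 v o1)) F"
proof -
  let ?n = "\<lambda>i. updist par2 (y2 i) o2"
  have lim: "((\<lambda>i. (real (?n i))\<^sup>2 * Phi z1 z2 (y1 i) (y2 i)) \<longlongrightarrow>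
      2 * ((real (updist par1 z1 v) + real (updist par1 v z1) + (real q + 1) / (real q - 1)) * ds_one)) F"
    if z: "dlX z1 z2" and sz: "\<forall>\<^sub>F i in F. updist par2 (y2 i) z2 = ?n i" for z1 z2
  proof -
    let ?u = "updist par1 z1 v" and ?d = "updist par1 v z1"
    have "((\<lambda>i. if ?n i < ?u then 0 else (real (?n i))\<^sup>2 * ds (\<lambda>a b. visits (real (?u + 1 + a)) (real (?d + 1 + a))
        (real ?d + real (?n i) - real ?u + 1 + real b) (real (?n i + 1 + b)))) \<longlongrightarrow>
        2 * ((real ?u + real ?d + (real q + 1) / (real q - 1)) * ds_one)) F"
      using filterlim_compose[OF Phi_vertex_limit[of ?u ?d] growth] by simp
    moreover have "\<forall>\<^sub>F i in F. (if ?n i < ?u then 0 else (real (?n i))\<^sup>2 * ds (\<lambda>a b. visits (real (?u + 1 + a)) (real (?d + 1 + a))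
        (real ?d + real (?n i) - real ?u + 1 + real b) (real (?n i + 1 + b)))) = (real (?n i))\<^sup>2 * Phi z1 z2 (y1 i) (y2 i)"
      using y const sz filterlim_at_top[THEN iffD1, OF growth, rule_format, of ?u]
    proof eventually_elim
      case (elim i)
      have "real ?u + real (updist par2 z2 (y2 i)) = real ?d + real (?n i)"
        using level_sum[OF z elim(1)] elim(2,3) by simp
      then have e: "real ?d + real (?n i) - real ?u + 1 + real b = real (updist par2 z2 (y2 i) + 1 + b)" for b by simp
      show ?case unfolding e Phi_def elim(2,3) using elim(4) by simp
    qed
    ultimately show ?thesis by (rule Lim_transform_eventually)
  qed
  define C where "C = (real q + 1) / (real q - 1)"
  define a where "a = real (updist par1 x1 v) + real (updist par1 v x1)"
  define b where "b = real (updist par1 o1 v) + real (updist par1 v o1)"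
  have Cpos: "C > 0" using q2 by (simp add: C_def)
  have ds1: "ds_one > 0" unfolding ds_one_def by (rule dsum_pos[OF q2 r2, where C = 1]) (auto simp: distrib_left distrib_right)
  have "((\<lambda>i. ((real (?n i))\<^sup>2 * Phi x1 x2 (y1 i) (y2 i)) / ((real (?n i))\<^sup>2 * Phi o1 o2 (y1 i) (y2 i)) *
      (real q ^ updist par1 v o1 / real q ^ updist par1 v x1)) \<longlongrightarrow>
      (2 * ((a + C) * ds_one)) / (2 * ((b + C) * ds_one)) * (real q ^ updist par1 v o1 / real q ^ updist par1 v x1)) F"
    unfolding a_def b_def C_def
    by (intro tendsto_mult tendsto_divide tendsto_const lim x o same)
       (use Cpos ds1 in \<open>auto simp: C_def add_nonneg_eq_0_iff intro!: always_eventually\<close>)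
  moreover have "\<forall>\<^sub>F i in F. ((real (?n i))\<^sup>2 * Phi x1 x2 (y1 i) (y2 i)) / ((real (?n i))\<^sup>2 * Phi o1 o2 (y1 i) (y2 i)) *
      (real q ^ updist par1 v o1 / real q ^ updist par1 v x1) =
      gam q r par1 par2 x1 x2 (y1 i) (y2 i) / gam q r par1 par2 o1 o2 (y1 i) (y2 i)"
    using const same filterlim_at_top[THEN iffD1, OF growth, rule_format, of 1]
  proof eventually_elim
    case (elim i)
    then show ?case unfolding gam_Phi elim(1,2) using q2 r2 by simp
  qed
  ultimately have "((\<lambda>i. gam q r par1 par2 x1 x2 (y1 i) (y2 i) / gam q r par1 par2 o1 o2 (y1 i) (y2 i)) \<longlongrightarrow>
      (2 * ((a + C) * ds_one)) / (2 * ((b + C) * ds_one)) * (real q ^ updist par1 v o1 / real q ^ updist par1 v x1)) F"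
    by (rule Lim_transform_eventually)
  moreover have "(2 * ((a + C) * ds_one)) / (2 * ((b + C) * ds_one)) * (real q ^ updist par1 v o1 / real q ^ updist par1 v x1) =
     (C + a) / real q ^ updist par1 v x1 / ((C + b) / real q ^ updist par1 v o1)"
    using ds1 by (simp add: add.commute)
  ultimately show ?thesis unfolding a_def b_def C_def by simp
qed

end

section \<open>Compactifications that separate kernels\<close>

text \<open>The trace on \<open>X\<close> of the neighbourhood filter of \<open>z\<close>.\<close>

definition near :: "'s set \<Rightarrow> 'z topology \<Rightarrow> ('s \<Rightarrow> 'z) \<Rightarrow> 'z \<Rightarrow> 's filter" where
  "near X Z \<iota> z = (INF U\<in>{U. openin Z U \<and> z \<in> U}. principal {y \<in> X. \<iota> y \<in> U})"

lemma eventually_near: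
  assumes "z \<in> topspace Z"
  shows "eventually Q (near X Z \<iota> z) \<longleftrightarrow> (\<exists>U. openin Z U \<and> z \<in> U \<and> (\<forall>y\<in>X. \<iota> y \<in> U \<longrightarrow> Q y))"
  unfolding near_def
proof (subst eventually_INF_base)
  show "{U. openin Z U \<and> z \<in> U} \<noteq> {}" using assms by auto
  show "\<exists>U\<in>{U. openin Z U \<and> z \<in> U}. principal {y \<in> X. \<iota> y \<in> U} \<le>
          inf (principal {y \<in> X. \<iota> y \<in> V}) (principal {y \<in> X. \<iota> y \<in> W})"
    if "V \<in> {U. openin Z U \<and> z \<in> U}" "W \<in> {U. openin Z U \<and> z \<in> U}" for V W
    using that by (intro bexI[of _ "V \<inter> W"]) auto
qed (auto simp: eventually_principal)

lemma near_not_bot: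
  assumes z: "z \<in> topspace Z" and dense: "Z closure_of (\<iota> ` X) = topspace Z"
  shows "near X Z \<iota> z \<noteq> bot"
proof
  assume "near X Z \<iota> z = bot"
  then have "eventually (\<lambda>_. False) (near X Z \<iota> z)" by simp
  then obtain U where "openin Z U" "z \<in> U" "\<forall>y\<in>X. \<iota> y \<notin> U" unfolding eventually_near[OF z] by auto
  moreover have "z \<in> Z closure_of (\<iota> ` X)" using z dense by simp
  ultimately show False unfolding in_closure_of by blast
qed

lemma eventually_near_domain: "z \<in> topspace Z \<Longrightarrow> \<forall>\<^sub>F y in near X Z \<iota> z. y \<in> X"
  unfolding eventually_near by (intro exI[of _ "topspace Z"]) auto

text \<open>If the values of \<open>m\<close> are within \<open>e / 2\<close> of \<open>g z\<close>
  on the trace of an open set \<open>U\<close>, then the limits at all other points of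
  \<open>U\<close> are within \<open>e\<close>, because every point of \<open>U\<close> is
  approached from \<open>X\<close> inside \<open>U\<close>.\<close>

lemma continuous_map_limits:
  fixes g :: "'z \<Rightarrow> real"
  assumes dense: "Z closure_of (\<iota> ` X) = topspace Z"
    and lim: "\<And>z. z \<in> topspace Z \<Longrightarrow> (m \<longlongrightarrow> g z) (near X Z \<iota> z)"
  shows "continuous_map Z euclideanreal g"
  unfolding continuous_map_atin
proof
  fix z assume z: "z \<in> topspace Z"
  show "limitin euclideanreal g (g z) (atin Z z)"
    unfolding limitin_canonical_iff
  proof (rule tendstoI)
    fix e :: real assume "e > 0"
    then have "\<forall>\<^sub>F y in near X Z \<iota> z. dist (m y) (g z) < e / 2" using tendstoD[OF lim[OF z]] half_gt_zero by blast
    then obtain U where U: "openin Z U" "z \<in> U" "\<And>y. y \<in> X \<Longrightarrow> \<iota> y \<in> U \<Longrightarrow> dist (m y) (g z) < e / 2"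
      unfolding eventually_near[OF z] by auto
    have "dist (g w) (g z) < e" if w: "w \<in> U" for w
    proof -
      have wZ: "w \<in> topspace Z" using w U(1) openin_subset by blast
      have "\<forall>\<^sub>F y in near X Z \<iota> w. dist (m y) (g w) < e / 2" using tendstoD[OF lim[OF wZ]] \<open>e > 0\<close> half_gt_zero by blast
      moreover have "\<forall>\<^sub>F y in near X Z \<iota> w. dist (m y) (g z) < e / 2"
        unfolding eventually_near[OF wZ] using U(1,3) w by blast
      ultimately have "\<forall>\<^sub>F y in near X Z \<iota> w. dist (g w) (g z) < e"
        by eventually_elim (use dist_triangle_half_r in blast)
      then show ?thesis using near_not_bot[OF wZ dense] eventually_const by blast
    qed
    then show "\<forall>\<^sub>F w in atin Z z. dist (g w) (g z) < e"
      unfolding eventually_atin using U(1,2) by blast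
  qed
qed

text \<open>Two continuous extensions agree on the closure of the dense image; extensionality fixes
  the values elsewhere, so the description is unique.\<close>

lemma extended_kernel_eq:
  assumes Z: "metrizable_compactification X Z \<iota>" and g: "kernel_extension X P ref Z \<iota> x g"
    and z: "z \<in> topspace Z"
  shows "extended_kernel X P ref Z \<iota> x z = g z"
proof -
  have "extended_kernel X P ref Z \<iota> x = restrict g (topspace Z)"
    unfolding extended_kernel_def
  proof (rule the_equality)
    show "restrict g (topspace Z) \<in> extensional (topspace Z) \<and> kernel_extension X P ref Z \<iota> x (restrict g (topspace Z))"
      using g Z unfolding kernel_extension_def metrizable_compactification_def
      by (auto intro: continuous_map_eq)
    fix h assume h: "h \<in> extensional (topspace Z) \<and> kernel_extension X P ref Z \<iota> x h"
    have "h w = g w" if "w \<in> topspace Z" for w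
    proof (rule forall_in_closure_of_eq[where f = h and g = g and X = Z and Y = euclideanreal and S = "\<iota> ` X"])
      show "w \<in> Z closure_of (\<iota> ` X)" using Z that unfolding metrizable_compactification_def by simp
      show "Hausdorff_space euclideanreal" by simp
      show "continuous_map Z euclideanreal h" "continuous_map Z euclideanreal g"
        using h g unfolding kernel_extension_def by auto
    qed (use h g in \<open>auto simp: kernel_extension_def\<close>)
    then show "h = restrict g (topspace Z)" using h by (intro extensionalityI[of _ "topspace Z"]) auto
  qed
  then show ?thesis using z by simp
qed

text \<open>Discreteness only provides an open \<open>U\<close> whose trace is the point. A further
  element of \<open>U\<close> would lie in the open set \<open>U - {\<iota> x}\<close>, which by
  density would contain another image point.\<close>

lemma openin_point:
  assumes Z: "metrizable_compactification X Z \<iota>" and x: "x \<in> X" shows "openin Z {\<iota> x}"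
proof -
  have sub: "\<iota> ` X \<subseteq> topspace Z" and dense: "Z closure_of (\<iota> ` X) = topspace Z"
    and disc: "subtopology Z (\<iota> ` X) = discrete_topology (\<iota> ` X)" and met: "metrizable_space Z"
    using Z unfolding metrizable_compactification_def by auto
  have "openin (subtopology Z (\<iota> ` X)) {\<iota> x}" unfolding disc using x by simp
  then obtain U where U: "openin Z U" "{\<iota> x} = U \<inter> \<iota> ` X" unfolding openin_subtopology by auto
  have "U = {\<iota> x}"
  proof (intro equalityI subsetI)
    fix w assume w: "w \<in> U"
    show "w \<in> {\<iota> x}"
    proof (rule ccontr)
      assume "w \<notin> {\<iota> x}"
      moreover have "closedin Z {\<iota> x}" using metrizable_imp_Hausdorff_space[OF met] sub x
        by (intro closedin_Hausdorff_singleton) auto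
      ultimately have o: "openin Z (U - {\<iota> x})" using U(1) by (simp add: openin_diff)
      have "w \<in> Z closure_of (\<iota> ` X)" using dense w openin_subset[OF U(1)] by blast
      moreover have "w \<in> U - {\<iota> x}" using w \<open>w \<notin> {\<iota> x}\<close> by simp
      ultimately have "\<exists>y. y \<in> \<iota> ` X \<and> y \<in> U - {\<iota> x}"
        unfolding in_closure_of using o by (elim conjE allE[of _ "U - {\<iota> x}"]) auto
      then obtain y where y: "y \<in> \<iota> ` X" "y \<in> U - {\<iota> x}" by (elim exE conjE)
      then have "y \<in> {\<iota> x}" unfolding U(2) by simp
      then show False using y(2) by simp
    qed
  next
    fix w assume "w \<in> {\<iota> x}" then show "w \<in> U" unfolding U(2) by simp
  qed
  then show ?thesis using U(1) by simp
qed

lemma continuous_indicator_point: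
  assumes Z: "metrizable_compactification X Z \<iota>" and x: "x \<in> X"
  shows "continuous_map Z euclideanreal (\<lambda>z. if z = \<iota> x then 1 else 0)"
proof (rule continuous_map_openin_preimage_eq[THEN iffD2], intro conjI allI impI)
  fix V :: "real set"
  have c: "closedin Z {\<iota> x}"
    using metrizable_imp_Hausdorff_space openin_subset[OF openin_point[OF Z x]] Z
    unfolding metrizable_compactification_def by (intro closedin_Hausdorff_singleton) auto
  have "openin Z (topspace Z - {\<iota> x})" using c by blast
  moreover have "topspace Z \<inter> (\<lambda>z. if z = \<iota> x then 1 else 0) -` V =
     (if 1 \<in> V then {\<iota> x} else {}) \<union> (if 0 \<in> V then topspace Z - {\<iota> x} else {})"
    using openin_subset[OF openin_point[OF Z x]] by (cases "1 \<in> V"; cases "0 \<in> V") (auto split: if_split_asm)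
  ultimately show "openin Z (topspace Z \<inter> (\<lambda>z. if z = \<iota> x then 1 else 0) -` V)"
    using openin_point[OF Z x] by (simp add: openin_Un)
qed auto

text \<open>Both families map into a power of the real line. By compactness \<open>Z\<close> becomes
  a closed subspace there; it contains the image of the dense part of \<open>Y\<close>, hence that
  of all of \<open>Y\<close>, and the inverse of the embedding gives the map.\<close>

lemma factor_through_separating:
  fixes gZ :: "'i \<Rightarrow> 'z \<Rightarrow> real" and gY :: "'i \<Rightarrow> 'y \<Rightarrow> real"
  assumes Z: "compact_space Z" and \<iota>: "\<iota> ` X \<subseteq> topspace Z" and dense: "Y closure_of (j ` X) = topspace Y"
    and gZ: "\<And>i. i \<in> I \<Longrightarrow> continuous_map Z euclideanreal (gZ i)"
    and gY: "\<And>i. i \<in> I \<Longrightarrow> continuous_map Y euclideanreal (gY i)"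
    and agree: "\<And>i x. i \<in> I \<Longrightarrow> x \<in> X \<Longrightarrow> gZ i (\<iota> x) = gY i (j x)"
    and sep: "\<And>z w. z \<in> topspace Z \<Longrightarrow> w \<in> topspace Z \<Longrightarrow> (\<And>i. i \<in> I \<Longrightarrow> gZ i z = gZ i w) \<Longrightarrow> z = w"
  shows "\<exists>f. continuous_map Y Z f \<and> (\<forall>x\<in>X. f (j x) = \<iota> x)"
proof -
  let ?R = "product_topology (\<lambda>_. euclideanreal) I"
  define eZ where "eZ z = (\<lambda>i\<in>I. gZ i z)" for z
  define eY where "eY z = (\<lambda>i\<in>I. gY i z)" for z
  have hR: "Hausdorff_space ?R" by (simp add: Hausdorff_space_product_topology)
  have cZ: "continuous_map Z ?R eZ" unfolding eZ_def by (auto simp: continuous_map_componentwise gZ intro: continuous_map_eq[OF gZ])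
  have cY: "continuous_map Y ?R eY" unfolding eY_def by (auto simp: continuous_map_componentwise gY intro: continuous_map_eq[OF gY])
  have inj: "inj_on eZ (topspace Z)"
  proof (rule inj_onI, rule sep)
    fix z w i assume "eZ z = eZ w" "i \<in> I" then show "gZ i z = gZ i w" unfolding eZ_def by (metis restrict_apply')
  qed auto
  have emb: "embedding_map Z ?R eZ" by (rule continuous_imp_embedding_map[OF cZ Z hR inj])
  then obtain g where g: "homeomorphic_maps Z (subtopology ?R (eZ ` topspace Z)) eZ g"
    unfolding embedding_map_def homeomorphic_map_maps by auto
  have cl: "closedin ?R (eZ ` topspace Z)"
    using image_compactin[OF _ cZ, of "topspace Z"] Z hR unfolding compact_space_def by (simp add: compactin_imp_closedin)
  have ag: "eY (j x) = eZ (\<iota> x)" if "x \<in> X" for x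
    using agree that unfolding eZ_def eY_def by auto
  have "eY ` (Y closure_of (j ` X)) \<subseteq> ?R closure_of (eY ` (j ` X))"
    using cY by (rule continuous_map_image_closure_subset)
  also have "\<dots> \<subseteq> eZ ` topspace Z"
    by (rule closure_of_minimal[OF _ cl]) (use \<iota> ag in auto)
  finally have "continuous_map Y (subtopology ?R (eZ ` topspace Z)) eY"
    using cY dense by (simp add: continuous_map_into_subtopology image_subset_iff_funcset)
  then have "continuous_map Y Z (g \<circ> eY)"
    using g unfolding homeomorphic_maps_def by (blast intro: continuous_map_compose)
  moreover have "(g \<circ> eY) (j x) = \<iota> x" if "x \<in> X" for x
    using g ag[OF that] \<iota> that unfolding homeomorphic_maps_def by auto
  ultimately show ?thesis by blast
qed

section \<open>Kernels at the boundary\<close>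

text \<open>The quotient does not depend on the choice of \<open>v\<close>; the empty line is the reference end.\<close>

definition line_kernel :: "('a \<Rightarrow> 'a) \<Rightarrow> nat \<Rightarrow> 'a \<Rightarrow> 'a set \<Rightarrow> 'a \<Rightarrow> real" where
  "line_kernel par p o' L x = (if L = {} then 1 else
     (let v = SOME v. v \<in> L \<and> v \<notin> anc par x \<and> v \<notin> anc par o'
      in power_weight par p v x / power_weight par p v o'))"

text \<open>The spherical function as a function of the start \<open>x\<close>; the two-variable
  \<open>spherical_half\<close> takes \<open>x\<close> first and the centre \<open>a\<close>
  second.\<close>

definition spherical :: "('a \<Rightarrow> 'a) \<Rightarrow> nat \<Rightarrow> 'a \<Rightarrow> 'a \<Rightarrow> real" where
  "spherical par p a x = ((real p + 1) / (real p - 1) + (real (updist par x a) + real (updist par a x))) / real p ^ updist par a x"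

fun boundary_kernel :: "('a \<Rightarrow> 'a) \<Rightarrow> nat \<Rightarrow> 'a \<Rightarrow> 'a tree_point \<Rightarrow> 'a \<Rightarrow> real" where
  "boundary_kernel par p o' (Vertex a) x = spherical par p a x / spherical par p a o'"
| "boundary_kernel par p o' (End \<xi>) x = line_kernel par p o' (chain_of par (End \<xi>)) x"

context horotree begin

lemma line_vertex_off:
  assumes "line par L" "L \<noteq> {}" obtains v where "v \<in> L" "v \<notin> A x" "v \<notin> A y"
proof -
  obtain v where v: "v \<in> L" "lev v = max (lev x) (lev y) + 1" using line_deep[OF assms] by blast
  then have "v \<notin> A x" "v \<notin> A y" using lev_anc[of v x] lev_anc[of v y] by auto
  then show thesis using v(1) that by blast
qed

lemma updist_through:
  assumes v: "v \<in> A y" "v \<notin> A x" shows "ud y x = ud y v + ud v x"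
proof (rule updist_additive)
  show "A y \<inter> A x \<subseteq> A v"
  proof
    fix w assume w: "w \<in> A y \<inter> A x"
    then have "w \<in> A v \<or> v \<in> A w" using chain_total[OF anc_chain, of w y v] v(1) by blast
    moreover have "v \<notin> A w" using w v(2) chain_anc[OF anc_chain, of w x] by blast
    ultimately show "w \<in> A v" by blast
  qed
  show "A v \<subseteq> A y \<union> A x" using chain_anc[OF anc_chain v(1)] by blast
qed

text \<open>Two admissible vertices lie one above the other on the line, and passing between them
  multiplies numerator and denominator by the same power of \<open>p\<close>.\<close>

lemma line_kernel_eq:
  assumes L: "line par L" and v: "v \<in> L" "v \<notin> A x" "v \<notin> A o'"
  shows "line_kernel par p o' L x = power_weight par p v x / power_weight par p v o'"
proof -
  define w where "w = (SOME v. v \<in> L \<and> v \<notin> A x \<and> v \<notin> A o')"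
  have w: "w \<in> L" "w \<notin> A x" "w \<notin> A o'" unfolding w_def using someI[of "\<lambda>v. v \<in> L \<and> v \<notin> A x \<and> v \<notin> A o'" v] v by blast+
  have *: "power_weight par p a x / power_weight par p a o' = power_weight par p b x / power_weight par p b o'"
    if "b \<in> A a" "b \<notin> A x" "b \<notin> A o'" for a b
    using updist_through[OF that(1,2)] updist_through[OF that(1,3)] p2
    unfolding power_weight_def by (simp add: power_add field_simps)
  have "v \<in> A w \<or> w \<in> A v" using chain_total L v(1) w(1) unfolding line_def by blast
  then have "power_weight par p w x / power_weight par p w o' = power_weight par p v x / power_weight par p v o'"
    using *[of v w] *[of w v] v w by metis
  then show ?thesis using v(1) unfolding line_kernel_def w_def[symmetric] Let_def by auto
qed

lemma power_weight_pos: "power_weight par p v x > 0" unfolding power_weight_def using p2 by simp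

lemma line_kernel_base:
  assumes "line par L" shows "line_kernel par p o' L o' = 1"
proof (cases "L = {}")
  case False
  obtain v where "v \<in> L" "v \<notin> A o'" using line_vertex_off[OF assms False, of o' o'] by blast
  then show ?thesis using line_kernel_eq[OF assms] power_weight_pos[of v o'] by simp
qed (simp add: line_kernel_def)

lemma line_kernel_weight:
  assumes L: "line par L" shows "line_weight par p L (line_kernel par p o' L)"
proof (cases "L = {}")
  case True then show ?thesis by (simp add: line_weight_def line_kernel_def)
next
  case False
  have C: "chain par L" using L unfolding line_def by blast
  have "line_kernel par p o' L x > 0 \<and> (x \<notin> L \<longrightarrow> line_kernel par p o' L (par x) = line_kernel par p o' L x) \<and>
     (x \<in> L \<longrightarrow> line_kernel par p o' L x = real p * line_kernel par p o' L (par x))" for x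
  proof -
    obtain v where v: "v \<in> L" "v \<notin> A x" "v \<notin> A o'" using line_vertex_off[OF L False, of x o'] by blast
    then have vp: "v \<notin> A (par x)" using anc_unfold[of x] by blast
    have e: "line_kernel par p o' L x = power_weight par p v x / power_weight par p v o'"
      "line_kernel par p o' L (par x) = power_weight par p v (par x) / power_weight par p v o'"
      using line_kernel_eq[OF L v(1) _ v(3)] v(2) vp by blast+
    have i: "x \<in> A v \<longleftrightarrow> x \<in> L" using chain_anc[OF C v(1)] chain_total[OF C v(1)] v(2) by blast
    have w: "line_weight par p (A v) (power_weight par p v)" by (rule power_weight_line_weight)
    show ?thesis unfolding e using w power_weight_pos[of v] i unfolding line_weight_def by auto
  qed
  then show ?thesis unfolding line_weight_def by blast
qed

lemma spherical_const_ge_1: "(real p + 1) / (real p - 1) \<ge> 1" using p2 by (simp add: field_simps)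

lemma spherical_pos: "spherical par p a x > 0"
  unfolding spherical_def using spherical_const_ge_1 p2 by (intro divide_pos_pos add_pos_nonneg) auto

text \<open>Passing to the sibling adds \<open>2\<close> to the distance and one power of
  \<open>p\<close> to the denominator. This is a loss because
  \<open>p * (C + n) - (C + n + 2) = (p - 1) * (n + 1)\<close>, by
  \<open>(p - 1) * C = p + 1\<close>.\<close>

lemma spherical_sibling_less:
  assumes s: "par v' = par v" "v' \<noteq> v" and v: "v \<in> A a" shows "spherical par p a v' < spherical par p a v"
proof -
  have v': "v' \<notin> A a" using s v anc_chain[of a] unfolding chain_def by blast
  have av: "a \<notin> A v'"
  proof
    assume "a \<in> A v'"
    then have "v \<in> A v'" using v chain_anc[OF anc_chain] by blast
    moreover have "lev v = lev v'" using s(1) lev_par[of v] lev_par[of v'] by simp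
    ultimately show False using anc_level_unique[of v v' v'] anc_self s(2) by blast
  qed
  have 1: "ud v a = 0" using v updist_eq_0 by blast
  have 2: "ud v' a = Suc 0"
    using updist_par_left[OF v'] updist_par_left'[OF v] s(1) by simp
  have "lev v' = lev v" using s(1) lev_par[of v] lev_par[of v'] by simp
  then have 3: "ud a v' = Suc (ud a v)" using lev_updist[of a v] lev_updist[of a v'] 1 2 by linarith
  define n where "n = ud a v"
  define C where "C = (real p + 1) / (real p - 1)"
  have C: "(real p - 1) * C = real p + 1" unfolding C_def using p2 by simp
  have "real p * (C + real n) - (C + real n + 2) = (real p - 1) * C + (real p - 1) * real n - 2" by (simp add: algebra_simps)
  also have "\<dots> = (real p - 1) + (real p - 1) * real n" unfolding C by simp
  also have "\<dots> > 0" using p2 by (intro add_pos_nonneg) auto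
  finally have "C + real n + 2 < real p * (C + real n)" by simp
  then have "(C + real n + 2) / real p ^ Suc n < real p * (C + real n) / real p ^ Suc n"
    using p2 by (intro divide_strict_right_mono) auto
  also have "\<dots> = (C + real n) / real p ^ n" using p2 by simp
  finally have "(C + real n + 2) / real p ^ Suc n < (C + real n) / real p ^ n" .
  then show ?thesis unfolding spherical_def 1 2 3 n_def[symmetric] C_def[symmetric] by (simp add: add.commute add.left_commute)
qed

lemma spherical_sibling_eq:
  assumes s: "par v' = par v" and v: "v \<notin> A a" "v' \<notin> A a" shows "spherical par p a v' = spherical par p a v"
proof -
  have 1: "ud v' a = ud v a" using updist_par_left[OF v(1)] updist_par_left[OF v(2)] s by simp
  have "lev v' = lev v" using s(1) lev_par[of v] lev_par[of v'] by simp
  then have "ud a v' = ud a v" using lev_updist[of a v] lev_updist[of a v'] 1 by linarith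
  with 1 show ?thesis unfolding spherical_def by simp
qed

text \<open>The exponent drops by at most one, which costs \<open>p\<close>; the distance grows by
  at most one, which costs \<open>2\<close> because the additive constant is at least one. This
  domination refutes minimality of the vertex kernels.\<close>

lemma spherical_par_le: "spherical par p (par a) x \<le> 2 * real p * spherical par p a x"
proof -
  define C where "C = (real p + 1) / (real p - 1)"
  have arith: "C + (a + b) \<le> 2 * (C + (a' + b'))" if "b \<le> b'" "a \<le> a' + 1" "0 \<le> a'" "0 \<le> b'" "1 \<le> C"
    for a b a' b' C :: real using that by simp
  have C: "C \<ge> 1" unfolding C_def by (rule spherical_const_ge_1)
  have d1: "ud a x \<le> Suc (ud (par a) x)"
    using updist_par_left[of a x] updist_eq_0[of a x] by (cases "a \<in> A x") auto
  have "ud (par a) x \<le> ud a x" using updist_par_left[of a x] updist_par_left'[of a x] by (cases "a \<in> A x") auto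
  then have "real (ud (par a) x) \<le> real (ud a x)" by simp
  moreover have "ud x (par a) \<le> Suc (ud x a)" using updist_par_right[of a x] updist_par_right'[of a x] by (cases "a \<in> A x") auto
  then have "real (ud x (par a)) \<le> real (ud x a) + 1" by linarith
  moreover have "0 \<le> real (ud x a)" "0 \<le> real (ud a x)" by simp_all
  ultimately have n: "C + (real (ud x (par a)) + real (ud (par a) x)) \<le> 2 * (C + (real (ud x a) + real (ud a x)))"
    using C arith by blast
  have "real p ^ ud a x \<le> real p ^ Suc (ud (par a) x)" using d1 p2 by (intro power_increasing) auto
  then have "1 / real p ^ ud (par a) x \<le> real p / real p ^ ud a x" using p2 by (simp add: field_simps)
  from mult_mono[OF n this] C p2 show ?thesis unfolding spherical_def C_def[symmetric] by (simp add: field_simps)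
qed

text \<open>On one level, the \<open>n\<close>-th term is taken below a sibling of the
  \<open>n\<close>-th ancestor of a fixed vertex. Its confluents with any given vertex climb without
  bound, so the sequence tends to the reference end.\<close>

lemma escaping_sequence: "\<exists>s. \<forall>n. lev (s n) = k \<and> (\<forall>v. \<forall>\<^sub>F n in sequentially. v \<notin> A (s n))"
proof -
  obtain x where x: "lev x = k" using lev_surj by blast
  have "\<exists>y. lev y = k \<and> (par ^^ n) x \<notin> A y" for n
  proof -
    obtain c where c: "c \<noteq> (par ^^ n) x" "par c = par ((par ^^ n) x)" using other_sibling by blast
    obtain y where y: "(par ^^ n) y = c" using desc_exists by blast
    have l: "lev c = lev ((par ^^ n) x)" using c(2) lev_par[of c] lev_par[of "(par ^^ n) x"] by simp
    have "lev y = k" using x l y lev_pow[of n y] lev_pow[of n x] by simp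
    moreover have "(par ^^ n) x \<notin> A y"
    proof
      assume "(par ^^ n) x \<in> A y"
      moreover have "c \<in> A y" using y pow_in_anc[of n y] by simp
      ultimately show False using anc_level_unique[of c y] l c(1) by metis
    qed
    ultimately show ?thesis by blast
  qed
  then obtain s where s: "\<And>n. lev (s n) = k" "\<And>n. (par ^^ n) x \<notin> A (s n)" by metis
  have "\<forall>\<^sub>F n in sequentially. v \<notin> A (s n)" for v
  proof -
    have "\<forall>n\<ge>ud x v. v \<notin> A (s n)"
    proof (intro allI impI notI)
      fix n assume "ud x v \<le> n" "v \<in> A (s n)"
      then have "(par ^^ n) x \<in> A v" "A v \<subseteq> A (s n)" using pow_in_anc_iff chain_anc[OF anc_chain] by blast+
      then show False using s(2) by blast
    qed
    then show ?thesis unfolding eventually_sequentially by blast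
  qed
  then show ?thesis using s(1) by blast
qed

lemma line_kernel_sibling:
  assumes L: "line par L" and s: "par v' = par v" "v' \<noteq> v"
  shows "line_kernel par p o' L v' < line_kernel par p o' L v \<longleftrightarrow> v \<in> L"
proof -
  note w = line_kernel_weight[OF L, of o', unfolded line_weight_def]
  have n: "v' \<notin> L \<or> v \<notin> L" using L s unfolding line_def chain_def by blast
  have pos: "line_kernel par p o' L (par v) > 0" using w by blast
  have m: "line_kernel par p o' L (par v) < real p * line_kernel par p o' L (par v)" using pos p2 by simp
  have 1: "line_kernel par p o' L v = (if v \<in> L then real p else 1) * line_kernel par p o' L (par v)"
    using w by (cases "v \<in> L") auto
  have 2: "line_kernel par p o' L v' = (if v' \<in> L then real p else 1) * line_kernel par p o' L (par v)"
    using w s(1) by (cases "v' \<in> L") auto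
  show ?thesis unfolding 1 2 using n m by auto
qed

end

context horo_graph begin

lemma boundary_kernel_pos:
  assumes "w \<in> tree_hat E" shows "boundary_kernel par p o' w x > 0"
  using assms
proof (cases rule: tree_hat_cases)
  case (End L)
  then show ?thesis using line_kernel_weight[of L o'] unfolding line_weight_def by simp
qed (auto intro: divide_pos_pos spherical_pos)

lemma boundary_kernel_base:
  assumes "w \<in> tree_hat E" shows "boundary_kernel par p o' w o' = 1"
  using assms
proof (cases rule: tree_hat_cases)
  case (End L)
  then show ?thesis using line_kernel_base[of L o'] by simp
next
  case (Vertex a) then show ?thesis using spherical_pos[of a o'] by simp
qed

lemma boundary_kernel_sibling:
  assumes "w \<in> tree_hat E" and s: "par v' = par v" "v' \<noteq> v"
  shows "boundary_kernel par p o' w v' < boundary_kernel par p o' w v \<longleftrightarrow> v \<in> S w"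
  using assms(1)
proof (cases rule: tree_hat_cases)
  case (End L)
  then show ?thesis using line_kernel_sibling[OF _ s] by simp
next
  case (Vertex a)
  have "spherical par p a v' < spherical par p a v \<longleftrightarrow> v \<in> A a"
  proof (cases "v \<in> A a")
    case True then show ?thesis using spherical_sibling_less[OF s] by blast
  next
    case False
    show ?thesis
    proof (cases "v' \<in> A a")
      case True then show ?thesis using False spherical_sibling_less[of v v' a] s by simp
    next
      case f: False then show ?thesis using False spherical_sibling_eq[OF s(1) False f] by simp
    qed
  qed
  then show ?thesis unfolding Vertex using spherical_pos[of a o'] by (simp add: divide_less_cancel)
qed

end

context horotree begin

lemma updist_far:
  assumes c: "c \<in> A x" "c \<in> A z" "c \<notin> A y" shows "ud y x = ud y z"
proof -
  have *: "A y \<inter> A a \<subseteq> A b" if "c \<in> A a" "c \<in> A b" for a b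
  proof
    fix v assume v: "v \<in> A y \<inter> A a"
    then have "v \<in> A c \<or> c \<in> A v" using chain_total[OF anc_chain] that(1) by blast
    moreover have "c \<notin> A v" using v c(3) chain_anc[OF anc_chain, of v y] by blast
    ultimately show "v \<in> A b" using chain_anc[OF anc_chain that(2)] by blast
  qed
  have "A y - A x = A y - A z" using *[OF c(1,2)] *[OF c(2,1)] by blast
  then show ?thesis unfolding updist_def by simp
qed

lemma updist_escape:
  assumes "\<And>v. \<forall>\<^sub>F i in F. v \<notin> A (y i)"
  shows "\<forall>\<^sub>F i in F. ud x (y i) \<ge> K" "\<forall>\<^sub>F i in F. ud (y i) x = ud (y i) z"
proof -
  show "\<forall>\<^sub>F i in F. ud x (y i) \<ge> K"
    using assms[of "(par ^^ K) x"] by eventually_elim (simp add: pow_in_anc_iff)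
  obtain m n where "(par ^^ m) x = (par ^^ n) z" using common by blast
  then have c: "(par ^^ m) x \<in> A z" by simp
  show "\<forall>\<^sub>F i in F. ud (y i) x = ud (y i) z"
    using assms[of "(par ^^ m) x"] by eventually_elim (rule updist_far[OF pow_in_anc c])
qed

end

context horopair begin

text \<open>Convergence of points of the product to the pair of points coded by \<open>C1\<close>
  and \<open>C2\<close>.\<close>

definition approaches :: "('a \<times> 'b) filter \<Rightarrow> 'a set \<Rightarrow> 'b set \<Rightarrow> bool" where
  "approaches F C1 C2 \<longleftrightarrow> (\<forall>\<^sub>F y in F. y \<in> X) \<and> (\<forall>v. \<forall>\<^sub>F y in F. v \<in> anc par1 (fst y) \<longleftrightarrow> v \<in> C1) \<and>
     (\<forall>v. \<forall>\<^sub>F y in F. v \<in> anc par2 (snd y) \<longleftrightarrow> v \<in> C2)"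

abbreviation "kernel_ratio x1 x2 o1 o2 y \<equiv> gam q r par1 par2 x1 x2 (fst y) (snd y) / gam q r par1 par2 o1 o2 (fst y) (snd y)"

context
  fixes F :: "('a \<times> 'b) filter" and x1 x2 o1 o2
  assumes x: "dlX x1 x2" and o: "dlX o1 o2"
begin

lemma kernel_limit_line:
  assumes F: "approaches F L {}" and L: "line par1 L"
  shows "(kernel_ratio x1 x2 o1 o2 \<longlongrightarrow> line_kernel par1 q o1 L x1) F"
proof (rule kernel_limit_end[OF x o])
  have F2: "\<And>v. \<forall>\<^sub>F y in F. v \<notin> anc par2 (snd y)" and F1: "\<And>v. \<forall>\<^sub>F y in F. v \<in> anc par1 (fst y) \<longleftrightarrow> v \<in> L"
    and FX: "\<forall>\<^sub>F y in F. y \<in> X" using F unfolding approaches_def by auto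
  show "\<forall>\<^sub>F y in F. dlX (fst y) (snd y)" using FX by eventually_elim (auto simp: X_def)
  show "\<forall>\<^sub>F y in F. updist par2 (snd y) x2 = updist par2 (snd y) o2" by (rule T2.updist_escape(2)[OF F2])
  show "\<forall>\<^sub>F y in F. real q ^ updist par1 (fst y) o1 / real q ^ updist par1 (fst y) x1 = line_kernel par1 q o1 L x1"
  proof (cases "L = {}")
    case True
    then have "\<And>v. \<forall>\<^sub>F y in F. v \<notin> anc par1 (fst y)" using F1 by simp
    from T1.updist_escape(2)[OF this, of o1 x1] show ?thesis
      by eventually_elim (use T1.p2 True in \<open>simp add: line_kernel_def\<close>)
  next
    case False
    obtain v where v: "v \<in> L" "v \<notin> anc par1 x1" "v \<notin> anc par1 o1" using T1.line_vertex_off[OF L False, of x1 o1] by blast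
    show ?thesis using F1[of v]
    proof eventually_elim
      case (elim y)
      then have "v \<in> anc par1 (fst y)" using v(1) by simp
      from T1.updist_through[OF this v(2)] T1.updist_through[OF this v(3)] T1.line_kernel_eq[OF L v] T1.p2
      show ?case by (simp add: power_add power_weight_def)
    qed
  qed
  fix K
  have "\<forall>\<^sub>F y in F. K \<le> updist par1 o1 (fst y) \<or> K \<le> updist par1 (fst y) o1"
  proof (cases "L = {}")
    case True
    then have "\<And>v. \<forall>\<^sub>F y in F. v \<notin> anc par1 (fst y)" using F1 by simp
    from T1.updist_escape(1)[OF this, of K o1] show ?thesis by eventually_elim simp
  next
    case False
    obtain v where v: "v \<in> L" "lev1 v = lev1 o1 + int K" using T1.line_deep[OF L False] by blast
    show ?thesis using F1[of v]
    proof eventually_elim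
      case (elim y)
      then have "lev1 v \<le> lev1 (fst y)" using v(1) T1.lev_anc by blast
      then show ?case using T1.lev_updist[of "fst y" o1] v(2) by linarith
    qed
  qed
  with T2.updist_escape(1)[OF F2, of K o2]
  show "\<forall>\<^sub>F y in F. K \<le> updist par2 o2 (snd y) \<and> (K \<le> updist par1 o1 (fst y) \<or> K \<le> updist par1 (fst y) o1)"
    by eventually_elim simp
qed

text \<open>Vertices are isolated: finitely many conditions, on \<open>a\<close> and on its
  children, already determine the chain of \<open>a\<close>.\<close>

lemma approaches_vertex:
  assumes F: "approaches F (anc par1 a) C2" shows "\<forall>\<^sub>F y in F. fst y = a"
proof -
  have F1: "\<And>v. \<forall>\<^sub>F y in F. v \<in> anc par1 (fst y) \<longleftrightarrow> v \<in> anc par1 a" using F unfolding approaches_def by blast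
  have "\<forall>\<^sub>F y in F. \<forall>c\<in>children par1 a. c \<in> anc par1 (fst y) \<longleftrightarrow> c \<in> anc par1 a"
    using F1 T1.finite_children by (simp add: eventually_ball_finite_distrib)
  with F1[of a] show ?thesis
  proof eventually_elim
    case (elim y)
    show ?case
    proof (rule ccontr)
      assume n: "fst y \<noteq> a"
      have "a \<in> anc par1 (fst y)" using elim(1) T1.anc_self by blast
      then obtain n where "(par1 ^^ n) (fst y) = a" unfolding anc_def by blast
      with n obtain m where m: "(par1 ^^ Suc m) (fst y) = a" by (cases n) auto
      let ?c = "(par1 ^^ m) (fst y)"
      have "?c \<in> children par1 a" using m by (simp add: children_def)
      moreover have "?c \<in> anc par1 (fst y)" by simp
      ultimately have "?c \<in> anc par1 a" using elim(2) by blast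
      then have "lev1 ?c \<le> lev1 a" by (rule T1.lev_anc)
      moreover have "lev1 a = lev1 ?c - 1" using m T1.lev_par[of ?c] by simp
      ultimately show False by simp
    qed
  qed
qed

lemma kernel_limit_point:
  assumes F: "approaches F (anc par1 a) {}"
  shows "(kernel_ratio x1 x2 o1 o2 \<longlongrightarrow> spherical par1 q a x1 / spherical par1 q a o1) F"
  unfolding spherical_def
proof (rule kernel_limit_vertex[OF x o])
  have F2: "\<And>v. \<forall>\<^sub>F y in F. v \<notin> anc par2 (snd y)" and FX: "\<forall>\<^sub>F y in F. y \<in> X" using F unfolding approaches_def by auto
  show dl: "\<forall>\<^sub>F y in F. dlX (fst y) (snd y)" using FX by eventually_elim (auto simp: X_def)
  show "\<forall>\<^sub>F y in F. updist par2 (snd y) x2 = updist par2 (snd y) o2" by (rule T2.updist_escape(2)[OF F2])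
  show a: "\<forall>\<^sub>F y in F. fst y = a" by (rule approaches_vertex[OF F])
  show "filterlim (\<lambda>y. updist par2 (snd y) o2) at_top F"
    unfolding filterlim_at_top
  proof
    fix K
    define K' where "K' = K + nat \<bar>lev2 o2 + lev1 a\<bar>"
    show "\<forall>\<^sub>F y in F. K \<le> updist par2 (snd y) o2"
      using T2.updist_escape(1)[OF F2, of K' o2] a dl
    proof eventually_elim
      case (elim y)
      have "lev1 a + lev2 (snd y) = 0" using elim(2,3) by simp
      then show ?case using elim(1) T2.lev_updist[of "snd y" o2] unfolding K'_def by linarith
    qed
  qed
qed

end

lemma approaches_swap:
  assumes "approaches F C1 C2"
  shows "horopair.approaches par2 lev2 par1 lev1 (filtermap prod.swap F) C2 C1"
proof -
  interpret swap: horopair par2 lev2 r par1 lev1 q ..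
  show ?thesis using assms unfolding approaches_def swap.approaches_def eventually_filtermap X_def swap.X_def
    by (auto simp: add.commute elim: eventually_mono)
qed

text \<open>One of the coordinates escapes to its reference end, so \<open>y\<close> eventually
  differs from the given start and the Poisson equation there has no source. The operator is a
  finite sum and passes to the limit.\<close>

lemma boundary_harmonic:
  assumes F: "approaches F C1 C2" "F \<noteq> bot" and C: "C1 = {} \<or> C2 = {}" and o: "dlX o1 o2"
    and lim: "\<And>x1 x2. dlX x1 x2 \<Longrightarrow> (kernel_ratio x1 x2 o1 o2 \<longlongrightarrow> h x1 x2) F"
  shows "dl_harm h"
  unfolding dl_harmonic_def
proof (intro allI impI)
  fix x1 x2 assume x: "dlX x1 x2"
  have "((\<lambda>y. Op (\<lambda>a b. kernel_ratio a b o1 o2 y) x1 x2) \<longlongrightarrow> Op h x1 x2) F"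
    by (rule Op_tendsto[OF lim x])
  moreover have "\<forall>\<^sub>F y in F. Op (\<lambda>a b. kernel_ratio a b o1 o2 y) x1 x2 = kernel_ratio x1 x2 o1 o2 y"
  proof -
    have "\<forall>\<^sub>F y in F. y \<noteq> (x1, x2)"
      using C
    proof
      assume "C1 = {}"
      then have "\<forall>\<^sub>F y in F. x1 \<notin> anc par1 (fst y)" using F(1) unfolding approaches_def by simp
      then show ?thesis by eventually_elim (use T1.anc_self in auto)
    next
      assume "C2 = {}"
      then have "\<forall>\<^sub>F y in F. x2 \<notin> anc par2 (snd y)" using F(1) unfolding approaches_def by simp
      then show ?thesis by eventually_elim (use T2.anc_self in auto)
    qed
    moreover have "\<forall>\<^sub>F y in F. y \<in> X" using F(1) unfolding approaches_def by blast
    ultimately show ?thesis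
    proof eventually_elim
      case (elim y)
      then have y: "dlX (fst y) (snd y)" "fst y \<noteq> x1 \<or> snd y \<noteq> x2" by (auto simp: X_def)
      let ?g = "gam q r par1 par2 o1 o2 (fst y) (snd y)"
      have "Op (\<lambda>a b. kernel_ratio a b o1 o2 y) x1 x2 = Op (\<lambda>a b. (1 / ?g) * walk_gam (fst y) (snd y) a b) x1 x2"
        by (rule Op_cong[OF _ x]) (simp add: walk_gam_def)
      also have "\<dots> = (1 / ?g) * Op (walk_gam (fst y) (snd y)) x1 x2" by (rule Op_cmult)
      also have "Op (walk_gam (fst y) (snd y)) x1 x2 = walk_gam (fst y) (snd y) x1 x2"
        using gam_poisson[OF x y(1)] y(2) by auto
      finally show ?case by (simp add: walk_gam_def)
    qed
  qed
  ultimately have "(kernel_ratio x1 x2 o1 o2 \<longlongrightarrow> Op h x1 x2) F" using tendsto_cong by fastforce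
  with lim[OF x] show "Op h x1 x2 = h x1 x2" using tendsto_unique[OF F(2)] by blast
qed

lemma positive_harmonicI:
  assumes "dl_harm h" "\<And>x1 x2. dlX x1 x2 \<Longrightarrow> h x1 x2 > 0"
  shows "positive_harmonic X P (\<lambda>x. h (fst x) (snd x))"
  unfolding positive_harmonic_def
proof
  fix x assume "x \<in> X"
  then obtain x1 x2 where x: "x = (x1, x2)" "dlX x1 x2" by (auto simp: X_def)
  have "Op (\<lambda>a b. h (fst (a, b)) (snd (a, b))) x1 x2 = h x1 x2" using dl_harmD[OF assms(1) x(2)] by simp
  with step_has_sum[OF x(2), of "\<lambda>x. h (fst x) (snd x)"] assms(2)[OF x(2)]
  show "h (fst x) (snd x) > 0 \<and> ((\<lambda>y. P x y * h (fst y) (snd y)) has_sum h (fst x) (snd x)) X"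
    by (simp add: x)
qed

lemma positive_harmonicD:
  assumes "positive_harmonic X P h" shows "dl_harm (\<lambda>a b. h (a, b))" "\<And>a b. dlX a b \<Longrightarrow> h (a, b) > 0"
proof -
  show "dl_harm (\<lambda>a b. h (a, b))"
    unfolding dl_harmonic_def
  proof (intro allI impI)
    fix a b assume x: "dlX a b"
    then have "((\<lambda>y. P (a, b) y * h y) has_sum h (a, b)) X" using assms unfolding positive_harmonic_def by (auto simp: X_def)
    with step_has_sum[OF x, of h] show "Op (\<lambda>a b. h (a, b)) a b = h (a, b)" using has_sum_unique by blast
  qed
  show "\<And>a b. dlX a b \<Longrightarrow> h (a, b) > 0" using assms unfolding positive_harmonic_def by (auto simp: X_def)
qed

end

section \<open>The geometric compactification\<close>

text \<open>In each case the second coordinate escapes while the levels stay opposite. For a vertex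
  the first coordinate is constant and for the reference end both escape on level \<open>0\<close>.
  Along a nonempty line the first descends to level \<open>n\<close>, which pushes the second to
  level \<open>-n\<close>.\<close>

lemma (in horopair) approaching_filter_first:
  assumes C: "chain par1 C" shows "\<exists>F. F \<noteq> bot \<and> approaches F C {}"
proof -
  have *: ?thesis if y: "\<And>n. y n \<in> X" "\<And>v. \<forall>\<^sub>F n in sequentially. v \<in> anc par1 (fst (y n)) \<longleftrightarrow> v \<in> C"
    "\<And>v. \<forall>\<^sub>F n in sequentially. v \<notin> anc par2 (snd (y n))" for y
    by (rule exI[of _ "filtermap y sequentially"])
       (use y in \<open>auto simp: approaches_def filtermap_bot_iff eventually_filtermap\<close>)
  obtain t where t: "\<And>n. lev1 (t n) = 0" "\<And>v. \<forall>\<^sub>F n in sequentially. v \<notin> anc par1 (t n)"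
    using T1.escaping_sequence[of 0] by blast
  from C show ?thesis
  proof (cases rule: T1.chain_cases)
    case (2 a)
    obtain s where s: "\<And>n. lev2 (s n) = - lev1 a" "\<And>v. \<forall>\<^sub>F n in sequentially. v \<notin> anc par2 (s n)"
      using T2.escaping_sequence[of "- lev1 a"] by blast
    show ?thesis by (rule *[of "\<lambda>n. (a, s n)"]) (use s 2 in \<open>auto simp: X_def\<close>)
  next
    case 1
    show ?thesis
    proof (cases "C = {}")
      case True
      obtain s where s: "\<And>n. lev2 (s n) = 0" "\<And>v. \<forall>\<^sub>F n in sequentially. v \<notin> anc par2 (s n)"
        using T2.escaping_sequence[of 0] by blast
      show ?thesis by (rule *[of "\<lambda>n. (t n, s n)"]) (use s t True in \<open>auto simp: X_def\<close>)
    next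
      case False
      have "\<forall>n::nat. \<exists>v. v \<in> C \<and> lev1 v = int n" using T1.line_deep[OF 1 False] by blast
      then obtain f where f: "\<And>n. f n \<in> C" "\<And>n. lev1 (f n) = int n" by metis
      have "\<forall>n::nat. \<exists>v. lev2 v = - int n" using T2.lev_surj by blast
      then obtain g where g: "\<And>n. lev2 (g n) = - int n" by metis
      show ?thesis
      proof (rule *[of "\<lambda>n. (f n, g n)"])
        fix v
        have "v \<in> anc par1 (f n) \<longleftrightarrow> v \<in> C" if "n \<ge> nat (lev1 v)" for n
        proof
          assume "v \<in> C"
          then show "v \<in> anc par1 (f n)" using T1.chain_anc_of_level[OF C _ f(1)[of n]] f(2)[of n] that by simp
        qed (use T1.chain_anc[OF C f(1)] in blast)
        then show "\<forall>\<^sub>F n in sequentially. v \<in> anc par1 (fst (f n, g n)) \<longleftrightarrow> v \<in> C"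
          unfolding eventually_sequentially by auto
      next
        fix v
        have "v \<notin> anc par2 (g n)" if "n \<ge> nat (1 - lev2 v)" for n
          using T2.lev_anc[of v "g n"] g[of n] that by auto
        then show "\<forall>\<^sub>F n in sequentially. v \<notin> anc par2 (snd (f n, g n))"
          unfolding eventually_sequentially by auto
      qed (auto simp: X_def f g)
    qed
  qed
qed

lemma (in horopair) approaching_filter_second:
  assumes C: "chain par2 C" shows "\<exists>F. F \<noteq> bot \<and> approaches F {} C"
proof -
  interpret swap: horopair par2 lev2 r par1 lev1 q ..
  obtain F where F: "F \<noteq> bot" "swap.approaches F C {}" using swap.approaching_filter_first[OF C] by blast
  then show ?thesis using swap.approaches_swap[OF F(2)]
    by (intro exI[of _ "filtermap prod.swap F"] conjI) (simp_all add: filtermap_bot_iff)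
qed

locale dl_setup = t1: pointed_horotree T1 q + t2: pointed_horotree T2 r +
  hp: horopair "pred_vertex T1" "height T1" q "pred_vertex T2" "height T2" r
  for T1 :: "'a pointed_tree" and T2 :: "'b pointed_tree" and q r
begin

abbreviation "X \<equiv> DL T1 T2"
abbreviation "H \<equiv> DL_hat T1 T2"
abbreviation "Z \<equiv> prod_topology t1.top_hat t2.top_hat"
abbreviation "\<omega>1 \<equiv> End (ref_end T1)"
abbreviation "\<omega>2 \<equiv> End (ref_end T2)"

lemma X_eq: "hp.X = X" unfolding hp.X_def DL_def ..

lemma chain_ref: "t1.S \<omega>1 = {}" "t2.S \<omega>2 = {}"
  unfolding t1.ref_end_eq t2.ref_end_eq
  by (rule t1.chain_of_end_of t2.chain_of_end_of, simp add: line_def chain_def)+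

lemma ref_in_hat: "\<omega>1 \<in> t1.hat" "\<omega>2 \<in> t2.hat"
  unfolding t1.ref_end_eq t2.ref_end_eq
  by (rule t1.End_in_hat t2.End_in_hat, simp add: line_def chain_def)+

lemma eq_ref: "w \<in> t1.hat \<Longrightarrow> t1.S w = {} \<Longrightarrow> w = \<omega>1" "z \<in> t2.hat \<Longrightarrow> t2.S z = {} \<Longrightarrow> z = \<omega>2"
  using inj_onD[OF t1.chain_of_inj, of w \<omega>1] inj_onD[OF t2.chain_of_inj, of z \<omega>2] chain_ref ref_in_hat by auto

lemma topspace_Z: "topspace Z = t1.hat \<times> t2.hat" by (simp add: t1.topspace_hat t2.topspace_hat)

lemma dl_embed_hat: "dl_embed x \<in> t1.hat \<times> t2.hat"
  unfolding dl_embed_def using t1.Vertex_in_hat t2.Vertex_in_hat by simp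

lemma topspace_H_closure: "topspace H = Z closure_of (dl_embed ` X)"
  unfolding DL_hat_def Let_def topspace_subtopology using closure_of_subset_topspace[of Z] by blast

lemma openin_Z:
  "openin Z ({w \<in> t1.hat. v \<in> t1.S w} \<times> t2.hat)" "openin Z ({w \<in> t1.hat. v \<notin> t1.S w} \<times> t2.hat)"
  "openin Z (t1.hat \<times> {w \<in> t2.hat. u \<in> t2.S w})" "openin Z (t1.hat \<times> {w \<in> t2.hat. u \<notin> t2.S w})"
  "openin Z {dl_embed x}"
proof -
  have h: "openin t1.top_hat t1.hat" "openin t2.top_hat t2.hat"
    using openin_topspace[of t1.top_hat] openin_topspace[of t2.top_hat] unfolding t1.topspace_hat t2.topspace_hat .
  show "openin Z ({w \<in> t1.hat. v \<in> t1.S w} \<times> t2.hat)" "openin Z ({w \<in> t1.hat. v \<notin> t1.S w} \<times> t2.hat)"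
    "openin Z (t1.hat \<times> {w \<in> t2.hat. u \<in> t2.S w})" "openin Z (t1.hat \<times> {w \<in> t2.hat. u \<notin> t2.S w})"
    by (intro openin_prod_Times_iff[THEN iffD2] disjI2 conjI h t1.openin_mem t1.openin_not_mem t2.openin_mem t2.openin_not_mem)+
  have "openin Z ({Vertex (fst x)} \<times> {Vertex (snd x)})"
    by (intro openin_prod_Times_iff[THEN iffD2] disjI2 conjI t1.openin_Vertex t2.openin_Vertex)
  then show "openin Z {dl_embed x}" unfolding dl_embed_def by simp
qed

lemma in_closure:
  assumes w: "w1 \<in> t1.hat" "w2 \<in> t2.hat" and F: "F \<noteq> bot" "hp.approaches F (t1.S w1) (t2.S w2)"
  shows "(w1, w2) \<in> Z closure_of (dl_embed ` X)"
  unfolding in_closure_of topspace_Z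
proof (intro conjI allI impI)
  show "(w1, w2) \<in> t1.hat \<times> t2.hat" using w by simp
  fix U assume "(w1, w2) \<in> U \<and> openin Z U"
  then obtain V W where V: "openin t1.top_hat V" "w1 \<in> V" and W: "openin t2.top_hat W" "w2 \<in> W" and sub: "V \<times> W \<subseteq> U"
    unfolding openin_prod_topology_alt by blast
  have "\<forall>\<^sub>F y in F. Vertex (fst y) \<in> V"
    by (rule t1.openin_eventually[OF V]) (use F(2) t1.Vertex_in_hat in \<open>auto simp: hp.approaches_def\<close>)
  moreover have "\<forall>\<^sub>F y in F. Vertex (snd y) \<in> W"
    by (rule t2.openin_eventually[OF W]) (use F(2) t2.Vertex_in_hat in \<open>auto simp: hp.approaches_def\<close>)
  moreover have "\<forall>\<^sub>F y in F. y \<in> X" using F(2) unfolding hp.approaches_def X_eq by blast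
  ultimately have "\<forall>\<^sub>F y in F. y \<in> X \<and> dl_embed y \<in> U"
    by eventually_elim (use sub in \<open>auto simp: dl_embed_def\<close>)
  then obtain y where "y \<in> X" "dl_embed y \<in> U" using eventually_happens'[OF F(1)] by blast
  then show "\<exists>y. y \<in> dl_embed ` X \<and> y \<in> U" by blast
qed

text \<open>If neither coordinate is a reference end, both chains are nonempty and each bounds the
  levels in the other. So both points are vertices, and their pair, being open, must be a point of
  the product.\<close>

lemma topspace_H: "topspace H = dl_embed ` X \<union> {z \<in> t1.hat \<times> t2.hat. fst z = \<omega>1 \<or> snd z = \<omega>2}"
proof (intro equalityI subsetI)
  fix z assume z: "z \<in> topspace H"
  then have cl: "z \<in> Z closure_of (dl_embed ` X)" unfolding topspace_H_closure .
  have hat: "z \<in> t1.hat \<times> t2.hat" using cl closure_of_subset_topspace[of Z] unfolding topspace_Z by blast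
  have hit: "\<exists>y\<in>X. dl_embed y \<in> U" if "openin Z U" "z \<in> U" for U
  proof -
    have "\<exists>y. y \<in> dl_embed ` X \<and> y \<in> U" using cl that unfolding in_closure_of by (elim conjE allE[of _ U]) auto
    then show ?thesis by blast
  qed
  have "z \<in> dl_embed ` X" if ne: "fst z \<noteq> \<omega>1" "snd z \<noteq> \<omega>2"
  proof -
    have C: "chain (pred_vertex T1) (t1.S (fst z))" "chain (pred_vertex T2) (t2.S (snd z))"
      using t1.chain_of_chain t2.chain_of_chain hat by auto
    have nonempty: "t1.S (fst z) \<noteq> {}" "t2.S (snd z) \<noteq> {}" using ne eq_ref hat by auto
    \<comment> \<open>Having \<open>v\<close> and \<open>u\<close> on the chains is an open
      condition, so it holds for some pair of vertices in \<open>X\<close>; their heights add up to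
      zero and are at least those of \<open>v\<close> and \<open>u\<close>.\<close>
    have low: "height T1 v + height T2 u \<le> 0" if "v \<in> t1.S (fst z)" "u \<in> t2.S (snd z)" for v u
    proof -
      have "openin Z (({w \<in> t1.hat. v \<in> t1.S w} \<times> t2.hat) \<inter> (t1.hat \<times> {w \<in> t2.hat. u \<in> t2.S w}))"
        by (intro openin_Int openin_Z)
      from hit[OF this] that hat obtain y where "y \<in> X" "v \<in> t1.S (Vertex (fst y))" "u \<in> t2.S (Vertex (snd y))"
        unfolding dl_embed_def by auto
      then show ?thesis using t1.lev_anc[of v "fst y"] t2.lev_anc[of u "snd y"] by (auto simp: DL_def)
    qed
    have "\<not> line (pred_vertex T1) (t1.S (fst z))"
    proof
      assume l: "line (pred_vertex T1) (t1.S (fst z))"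
      obtain u where u: "u \<in> t2.S (snd z)" using nonempty by blast
      obtain v where "v \<in> t1.S (fst z)" "height T1 v = 1 - height T2 u" using t1.line_deep[OF l nonempty(1)] by blast
      then show False using low[OF _ u] by force
    qed
    then obtain a where a: "fst z = Vertex a" using t1.tree_hat_cases[of "fst z"] hat by (metis mem_Times_iff)
    have "\<not> line (pred_vertex T2) (t2.S (snd z))"
    proof
      assume l: "line (pred_vertex T2) (t2.S (snd z))"
      obtain u where u: "u \<in> t1.S (fst z)" using nonempty by blast
      obtain v where "v \<in> t2.S (snd z)" "height T2 v = 1 - height T1 u" using t2.line_deep[OF l nonempty(2)] by blast
      then show False using low[OF u] by force
    qed
    then obtain b where b: "snd z = Vertex b" using t2.tree_hat_cases[of "snd z"] hat by (metis mem_Times_iff)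
    have zab: "z = dl_embed (a, b)" using a b unfolding dl_embed_def by (simp add: prod_eq_iff)
    have "openin Z {dl_embed (a, b)}" by (rule openin_Z)
    with hit[of "{dl_embed (a, b)}"] zab obtain y where "y \<in> X" "dl_embed y = z" by blast
    then show ?thesis by blast
  qed
  then show "z \<in> dl_embed ` X \<union> {z \<in> t1.hat \<times> t2.hat. fst z = \<omega>1 \<or> snd z = \<omega>2}" using hat by blast
next
  fix z assume z: "z \<in> dl_embed ` X \<union> {z \<in> t1.hat \<times> t2.hat. fst z = \<omega>1 \<or> snd z = \<omega>2}"
  show "z \<in> topspace H"
    unfolding topspace_H_closure
  proof (cases "z \<in> dl_embed ` X")
    case True
    have "dl_embed ` X \<subseteq> topspace Z" unfolding topspace_Z using dl_embed_hat by blast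
    then show "z \<in> Z closure_of (dl_embed ` X)" using closure_of_subset True by blast
  next
    case False
    obtain w1 w2 where zw: "z = (w1, w2)" by (cases z) blast
    have w: "w1 \<in> t1.hat" "w2 \<in> t2.hat" "w1 = \<omega>1 \<or> w2 = \<omega>2" using z False zw by auto
    from w(3) show "z \<in> Z closure_of (dl_embed ` X)"
      unfolding zw
    proof
      assume e: "w1 = \<omega>1"
      obtain F where F: "F \<noteq> bot" "hp.approaches F {} (t2.S w2)"
        using hp.approaching_filter_second[OF t2.chain_of_chain[OF w(2)]] by (elim exE conjE)
      have "t1.S w1 = {}" unfolding e by (rule chain_ref)
      then show "(w1, w2) \<in> Z closure_of (dl_embed ` X)" using in_closure[OF w(1,2) F(1)] F(2) by simp
    next
      assume e: "w2 = \<omega>2"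
      obtain F where F: "F \<noteq> bot" "hp.approaches F (t1.S w1) {}"
        using hp.approaching_filter_first[OF t1.chain_of_chain[OF w(1)]] by (elim exE conjE)
      have "t2.S w2 = {}" unfolding e by (rule chain_ref)
      then show "(w1, w2) \<in> Z closure_of (dl_embed ` X)" using in_closure[OF w(1,2) F(1)] F(2) by simp
    qed
  qed
qed

lemma inj_dl_embed: "inj dl_embed" by (rule injI) (simp add: dl_embed_def prod_eq_iff)

lemma openin_H: "openin Z U \<Longrightarrow> openin H (U \<inter> topspace H)"
  unfolding topspace_H_closure unfolding DL_hat_def Let_def by (rule openin_subtopology_Int)

lemma compactification: "metrizable_compactification X H dl_embed"
  unfolding metrizable_compactification_def
proof (intro conjI)
  have "compact_space Z" by (simp add: compact_space_prod_topology t1.compact_hat t2.compact_hat)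
  then show "compact_space H" unfolding DL_hat_def Let_def
    by (intro compact_space_subtopology closedin_compact_space closedin_closure_of)
  have "metrizable_space Z" by (simp add: metrizable_space_prod_topology t1.metrizable_hat t2.metrizable_hat)
  then show "metrizable_space H" unfolding DL_hat_def Let_def by (rule metrizable_space_subtopology)
  show "inj_on dl_embed X" using inj_dl_embed by (rule inj_on_subset) simp
  show sub: "dl_embed ` X \<subseteq> topspace H" unfolding topspace_H by (rule Un_upper1)
  have "openin (subtopology H (dl_embed ` X)) {z}" if z: "z \<in> dl_embed ` X" for z
  proof -
    have "openin Z {z}" using z openin_Z(5) by blast
    moreover have "{z} \<inter> topspace H = {z}" using z sub by blast
    ultimately have "openin H {z}" using openin_H[of "{z}"] by simp
    then show ?thesis unfolding openin_subtopology using z by (intro exI[of _ "{z}"]) simp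
  qed
  then show "subtopology H (dl_embed ` X) = discrete_topology (dl_embed ` X)"
    using sub by (intro sym[OF discrete_topology_unique[THEN iffD2]]) auto
  show "H closure_of (dl_embed ` X) = topspace H"
    unfolding topspace_H_closure unfolding DL_hat_def Let_def using sub[unfolded topspace_H_closure]
    by (simp add: closure_of_subtopology Int_absorb1)
qed

abbreviation "nearH \<equiv> near X H dl_embed"

lemma nearH_not_bot:
  assumes "z \<in> topspace H" shows "nearH z \<noteq> bot"
proof (rule near_not_bot[OF assms])
  show "H closure_of (dl_embed ` X) = topspace H"
    using compactification unfolding metrizable_compactification_def by (elim conjE)
qed

lemma nearH_eventually:
  assumes z: "z \<in> topspace H" and U: "openin Z U" "z \<in> U" shows "\<forall>\<^sub>F y in nearH z. dl_embed y \<in> U"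
  unfolding eventually_near[OF z] using openin_H[OF U(1)] U(2) z by (intro exI[of _ "U \<inter> topspace H"]) simp

lemma nearH_approaches:
  assumes z: "z \<in> topspace H" shows "hp.approaches (nearH z) (t1.S (fst z)) (t2.S (snd z))"
  unfolding hp.approaches_def X_eq
proof (intro conjI allI)
  have "z \<in> t1.hat \<times> t2.hat"
    using z unfolding topspace_H by (elim UnE imageE CollectE conjE) (simp_all only: dl_embed_hat)
  then have hat: "fst z \<in> t1.hat" "snd z \<in> t2.hat" by (simp_all add: mem_Times_iff)
  show "\<forall>\<^sub>F y in nearH z. y \<in> X" by (rule eventually_near_domain[OF z])
  show "\<forall>\<^sub>F y in nearH z. v \<in> anc (pred_vertex T1) (fst y) \<longleftrightarrow> v \<in> t1.S (fst z)" for v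
  proof (cases "v \<in> t1.S (fst z)")
    case True
    then have "z \<in> {w \<in> t1.hat. v \<in> t1.S w} \<times> t2.hat" using hat by (simp add: mem_Times_iff)
    from nearH_eventually[OF z openin_Z(1) this] show ?thesis by eventually_elim (simp add: dl_embed_def True)
  next
    case False
    then have "z \<in> {w \<in> t1.hat. v \<notin> t1.S w} \<times> t2.hat" using hat by (simp add: mem_Times_iff)
    from nearH_eventually[OF z openin_Z(2) this] show ?thesis by eventually_elim (simp add: dl_embed_def False)
  qed
  show "\<forall>\<^sub>F y in nearH z. v \<in> anc (pred_vertex T2) (snd y) \<longleftrightarrow> v \<in> t2.S (snd z)" for v
  proof (cases "v \<in> t2.S (snd z)")
    case True
    then have "z \<in> t1.hat \<times> {w \<in> t2.hat. v \<in> t2.S w}" using hat by (simp add: mem_Times_iff)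
    from nearH_eventually[OF z openin_Z(3) this] show ?thesis by eventually_elim (simp add: dl_embed_def True)
  next
    case False
    then have "z \<in> t1.hat \<times> {w \<in> t2.hat. v \<notin> t2.S w}" using hat by (simp add: mem_Times_iff)
    from nearH_eventually[OF z openin_Z(4) this] show ?thesis by eventually_elim (simp add: dl_embed_def False)
  qed
qed

end

context horo_graph begin

lemma boundary_kernel_par_le:
  "\<exists>M>0. \<forall>x. boundary_kernel par p o' (Vertex (par a)) x \<le> M * boundary_kernel par p o' (Vertex a) x"
proof (intro exI conjI allI)
  show "2 * real p * spherical par p a o' / spherical par p (par a) o' > 0" using spherical_pos p2 by simp
  fix x
  have "boundary_kernel par p o' (Vertex (par a)) x \<le> 2 * real p * spherical par p a x / spherical par p (par a) o'"
    using divide_right_mono[OF spherical_par_le[of a x], of "spherical par p (par a) o'"] spherical_pos[of "par a" o'] by simp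
  also have "\<dots> = 2 * real p * spherical par p a o' / spherical par p (par a) o' * boundary_kernel par p o' (Vertex a) x"
    using spherical_pos[of a o'] by simp
  finally show "boundary_kernel par p o' (Vertex (par a)) x \<le>
    2 * real p * spherical par p a o' / spherical par p (par a) o' * boundary_kernel par p o' (Vertex a) x" .
qed

text \<open>The normalisation at \<open>o'\<close> would make the two kernels equal. But comparing
  \<open>a\<close> with a sibling detects whether \<open>a\<close> is on the chain, which holds for
  \<open>a\<close> and fails for its parent.\<close>

lemma boundary_kernel_par_not_multiple:
  assumes "\<And>x. boundary_kernel par p o' (Vertex (par a)) x = c * boundary_kernel par p o' (Vertex a) x" shows False
proof -
  have "c = 1" using assms[of o'] boundary_kernel_base[OF Vertex_in_hat, of o' "par a"] boundary_kernel_base[OF Vertex_in_hat, of o' a] by simp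
  then have e: "boundary_kernel par p o' (Vertex (par a)) x = boundary_kernel par p o' (Vertex a) x" for x using assms by simp
  obtain a' where a': "a' \<noteq> a" "par a' = par a" using other_sibling by blast
  have "a \<in> S (Vertex (par a)) \<longleftrightarrow> a \<in> S (Vertex a)"
    using boundary_kernel_sibling[OF Vertex_in_hat a'(2,1), of o' "par a"] boundary_kernel_sibling[OF Vertex_in_hat a'(2,1), of o' a]
    unfolding e by blast
  then have "a \<in> A (par a)" using anc_self by simp
  then have "lev a \<le> lev (par a)" by (rule lev_anc)
  then show False by simp
qed

end

context pointed_horotree begin

lemma spherical_half_eq: "spherical_half p T x y = spherical (pred_vertex T) p y x"
  unfolding spherical_half_def spherical_def down_eq graph_dist_eq using p2 by (simp add: power_int_minus divide_inverse)

text \<open>The geodesics from the root to \<open>x\<close> and to \<open>w\<close> separate at the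
  median of the three points, which in terms of chains is their majority.\<close>

lemma confluent_eq:
  assumes w: "w \<in> hat" and c: "A c = (A (base T) \<inter> A x) \<union> (A (base T) \<inter> S w) \<union> (A x \<inter> S w)"
  shows "confluent T (Vertex x) w = c"
  unfolding confluent_def
proof (rule the_equality)
  note g = geod_iff[OF w] geod_iff[OF Vertex_in_hat]
  show "geod (adj T) (base T) (Vertex x) \<inter> geod (adj T) (base T) w = geod (adj T) (base T) (Vertex c)"
    unfolding set_eq_iff Int_iff g chain_of.simps c by blast
  then have e: "geod (adj T) (base T) (Vertex c) = geod (adj T) (base T) (Vertex b)"
    if "geod (adj T) (base T) (Vertex x) \<inter> geod (adj T) (base T) w = geod (adj T) (base T) (Vertex b)" for b
    using that by simp
  fix b assume "geod (adj T) (base T) (Vertex x) \<inter> geod (adj T) (base T) w = geod (adj T) (base T) (Vertex b)"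
  from e[OF this] have s: "z \<in> geod (adj T) (base T) (Vertex c) \<longleftrightarrow> z \<in> geod (adj T) (base T) (Vertex b)" for z by simp
  have "A c = A b" using s[of c] s[of b] unfolding g chain_of.simps by blast
  then show "b = c" using anc_inj by metis
qed

text \<open>The confluent \<open>c\<close> lies between a far vertex \<open>v\<close> of the line
  and each of \<open>x\<close> and the root. Both weights seen from \<open>v\<close> are thus those
  seen from \<open>c\<close> times the same power, which cancels in the quotient.\<close>

lemma tree_end_kernel_eq:
  assumes \<xi>: "\<xi> \<in> proper_ends T"
  shows "tree_end_kernel T (tree_step (1 / 2) p T) x \<xi> = boundary_kernel (pred_vertex T) p (base T) (End \<xi>) x"
proof -
  let ?o = "base T" and ?pr = "pred_vertex T"
  obtain L where L: "line ?pr L" "\<xi> = end_of (adj T) ?pr L" using \<xi> unfolding proper_ends_def ends_eq by auto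
  have ne: "L \<noteq> {}" using \<xi> L(2) ref_end_eq unfolding proper_ends_def by auto
  have hat: "End \<xi> \<in> hat" unfolding L(2) by (rule End_in_hat[OF L(1)])
  have SL: "S (End \<xi>) = L" unfolding L(2) by (rule chain_of_end_of[OF L(1)])
  have C: "chain ?pr L" using L(1) unfolding line_def by blast
  obtain c where c: "A c = (A ?o \<inter> A x) \<union> (A ?o \<inter> L) \<union> (A x \<inter> L)" using exists_median[OF C] by blast
  have conf: "confluent T (Vertex x) (End \<xi>) = c" using confluent_eq[OF hat] c SL by simp
  have "tree_step (1 / 2) p T = (\<lambda>v w. pmf (step_pmf v) w)"
    by (intro ext) (simp add: tree_step_def pmf_step)
  then have h: "hit_prob (tree_step (1 / 2) p T) a b = power_weight ?pr p b a" for a b by (simp add: hit_prob_eq)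
  obtain v where v: "v \<in> L" "v \<notin> A x" "v \<notin> A ?o" using line_vertex_off[OF L(1) ne, of x ?o] by blast
  have vL: "A v \<subseteq> L" by (rule chain_anc[OF C v(1)])
  have off: "A y \<inter> L \<subseteq> A v" if "v \<notin> A y" for y
  proof
    fix z assume z: "z \<in> A y \<inter> L"
    have "z \<in> A v \<or> v \<in> A z" using chain_total[OF C _ v(1)] z by blast
    moreover have "v \<notin> A z" using z that chain_anc[OF anc_chain, of z y] by blast
    ultimately show "z \<in> A v" by blast
  qed
  have "ud v x = ud v c + ud c x"
    by (rule updist_additive) (use c vL off[OF v(2)] off[OF v(3)] in blast)+
  moreover have "ud v ?o = ud v c + ud c ?o"
    by (rule updist_additive) (use c vL off[OF v(2)] off[OF v(3)] in blast)+
  ultimately have "power_weight ?pr p v x / power_weight ?pr p v ?o = power_weight ?pr p c x / power_weight ?pr p c ?o"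
    unfolding power_weight_def using p2 by (simp add: power_add)
  then show ?thesis unfolding tree_end_kernel_def conf Let_def h
    using line_kernel_eq[OF L(1) v] SL by simp
qed

end

context horopair begin

lemma kernel_limit_first:
  assumes x: "dlX x1 x2" and o: "dlX o1 o2" and F: "approaches F (chain_of par1 w) {}"
    and w: "(\<exists>a. w = Vertex a) \<or> (\<exists>\<xi>. w = End \<xi> \<and> line par1 (chain_of par1 w))"
  shows "(kernel_ratio x1 x2 o1 o2 \<longlongrightarrow> boundary_kernel par1 q o1 w x1) F"
  using w
proof (elim disjE exE conjE)
  fix a assume "w = Vertex a"
  then show ?thesis using kernel_limit_point[OF x o, of F a] F by simp
next
  fix \<xi> assume "w = End \<xi>" "line par1 (chain_of par1 w)"
  then show ?thesis using kernel_limit_line[OF x o F] by simp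
qed

lemma kernel_limit_second:
  assumes x: "dlX x1 x2" and o: "dlX o1 o2" and F: "approaches F {} (chain_of par2 w)"
    and w: "(\<exists>a. w = Vertex a) \<or> (\<exists>\<xi>. w = End \<xi> \<and> line par2 (chain_of par2 w))"
  shows "(kernel_ratio x1 x2 o1 o2 \<longlongrightarrow> boundary_kernel par2 r o2 w x2) F"
proof -
  interpret swap: horopair par2 lev2 r par1 lev1 q ..
  have x': "lev2 x2 + lev1 x1 = 0" and o': "lev2 o2 + lev1 o1 = 0" using x o by simp_all
  have "((\<lambda>y. swap.kernel_ratio x2 x1 o2 o1 (prod.swap y)) \<longlongrightarrow> boundary_kernel par2 r o2 w x2) F"
    using swap.kernel_limit_first[OF x' o' approaches_swap[OF F] w]
    by (simp add: filterlim_filtermap)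
  moreover have "swap.kernel_ratio x2 x1 o2 o1 (prod.swap y) = kernel_ratio x1 x2 o1 o2 y" for y
    using gam_swap[OF T1.p2 T2.p2, of par1 par2] by simp
  ultimately show ?thesis by simp
qed

text \<open>For the empty line the weight is constant, and the claim is the constancy of bounded
  harmonic functions.\<close>

lemma minimal_first:
  assumes h: "positive_harmonic X P h" and L: "line par1 L" and \<kappa>: "line_weight par1 q L \<kappa>"
    and le: "\<And>x. x \<in> X \<Longrightarrow> h x \<le> \<kappa> (fst x)"
  shows "\<exists>c. \<forall>x\<in>X. h x = c * \<kappa> (fst x)"
proof (cases "L = {}")
  case True
  obtain z where z: "\<And>x. \<kappa> x = z"
  proof -
    have "\<kappa> (par1 x) = \<kappa> x" for x using \<kappa> True unfolding line_weight_def by simp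
    then have pow: "\<kappa> ((par1 ^^ n) x) = \<kappa> x" for n x by (induction n) auto
    have "\<kappa> x = \<kappa> y" for x y using T1.common[of x y] pow by metis
    then show thesis using that by blast
  qed
  have zp: "z > 0" using \<kappa> z unfolding line_weight_def by simp
  have "\<exists>c. \<forall>x1 x2. dlX x1 x2 \<longrightarrow> h (x1, x2) = c"
  proof (rule bounded_harmonic_constant[OF positive_harmonicD(1)[OF h]])
    fix x1 x2 assume d: "dlX x1 x2"
    show "\<bar>h (x1, x2)\<bar> \<le> z" using positive_harmonicD(2)[OF h d] le[of "(x1, x2)"] d z by simp
  qed
  then obtain c where "\<And>x1 x2. dlX x1 x2 \<Longrightarrow> h (x1, x2) = c" by blast
  then show ?thesis using z zp by (intro exI[of _ "c / z"]) (auto simp: X_def)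
next
  case False
  have "\<exists>c. \<forall>x1 x2. dlX x1 x2 \<longrightarrow> h (x1, x2) = c * \<kappa> x1"
  proof (rule minimal_line_weight[OF positive_harmonicD(1)[OF h] L False \<kappa>])
    fix x1 x2 assume d: "dlX x1 x2"
    show "\<bar>h (x1, x2)\<bar> \<le> 1 * \<kappa> x1" using positive_harmonicD(2)[OF h d] le[of "(x1, x2)"] d by simp
  qed
  then show ?thesis by (auto simp: X_def)
qed

lemma positive_harmonic_swap:
  assumes "positive_harmonic X P h"
  shows "positive_harmonic (horopair.X lev2 lev1) (dlP r q par2 par1) (\<lambda>x. h (snd x, fst x))"
proof -
  interpret swap: horopair par2 lev2 r par1 lev1 q ..
  note h = positive_harmonicD[OF assms]
  have "swap.dl_harm (\<lambda>b a. h (a, b))" using dl_harmonic_swap[OF h(1)] .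
  then show ?thesis using swap.positive_harmonicI[of "\<lambda>b a. h (a, b)"] h(2) by (simp add: add.commute)
qed

lemma minimal_second:
  assumes h: "positive_harmonic X P h" and L: "line par2 L" and \<kappa>: "line_weight par2 r L \<kappa>"
    and le: "\<And>x. x \<in> X \<Longrightarrow> h x \<le> \<kappa> (snd x)"
  shows "\<exists>c. \<forall>x\<in>X. h x = c * \<kappa> (snd x)"
proof -
  interpret swap: horopair par2 lev2 r par1 lev1 q ..
  have "\<exists>c. \<forall>x\<in>swap.X. h (snd x, fst x) = c * \<kappa> (fst x)"
    by (rule swap.minimal_first[OF positive_harmonic_swap[OF h] L \<kappa>])
       (use le in \<open>auto simp: X_def swap.X_def add.commute\<close>)
  then show ?thesis by (auto simp: X_def swap.X_def add.commute)
qed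

end

lemma positive_harmonic_cong:
  assumes "\<And>x. x \<in> X \<Longrightarrow> h x = h' x" shows "positive_harmonic X P h \<longleftrightarrow> positive_harmonic X P h'"
proof -
  have "((\<lambda>y. P x y * h y) has_sum s) X \<longleftrightarrow> ((\<lambda>y. P x y * h' y) has_sum s) X" for x s
    by (rule has_sum_cong) (simp add: assms)
  then show ?thesis unfolding positive_harmonic_def using assms by auto
qed

lemma positive_harmonic_divide:
  assumes "positive_harmonic X P h" "M > 0" shows "positive_harmonic X P (\<lambda>x. h x / M)"
  unfolding positive_harmonic_def
proof (intro ballI conjI)
  fix x assume x: "x \<in> X"
  show "h x / M > 0" using assms x unfolding positive_harmonic_def by simp
  have "((\<lambda>y. P x y * h y) has_sum h x) X" using assms(1) x unfolding positive_harmonic_def by blast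
  from has_sum_cmult_right[OF this, of "1 / M"] show "((\<lambda>y. P x y * (h y / M)) has_sum h x / M) X" by simp
qed

section \<open>The extended kernel on the geometric compactification\<close>

context dl_setup begin

abbreviation "ref \<equiv> (base T1, base T2)"
abbreviation "K \<equiv> extended_kernel X hp.P ref H dl_embed"
abbreviation "bk1 \<equiv> boundary_kernel (pred_vertex T1) q (base T1)"
abbreviation "bk2 \<equiv> boundary_kernel (pred_vertex T2) r (base T2)"

text \<open>At the common point \<open>(\<omega>1, \<omega>2)\<close> both branches give
  \<open>1\<close>, so the choice made there is harmless.\<close>

definition limit_kernel :: "'a \<times> 'b \<Rightarrow> 'a tree_point \<times> 'b tree_point \<Rightarrow> real" where
  "limit_kernel x z = (if snd z = \<omega>2 then bk1 (fst z) (fst x) else bk2 (snd z) (snd x))"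

lemma base_level: "height T1 (base T1) + height T2 (base T2) = 0" by (simp add: t1.lev_base t2.lev_base)

lemma ref_in_X: "ref \<in> X" using base_level by (simp add: DL_def)

lemma in_X: "x \<in> X \<longleftrightarrow> height T1 (fst x) + height T2 (snd x) = 0" by (auto simp: DL_def)

lemma bk_ref: "bk1 \<omega>1 v = 1" "bk2 \<omega>2 u = 1"
proof -
  have "bk1 \<omega>1 v = line_kernel (pred_vertex T1) q (base T1) (t1.S \<omega>1) v" by simp
  then show "bk1 \<omega>1 v = 1" unfolding chain_ref line_kernel_def by simp
  have "bk2 \<omega>2 u = line_kernel (pred_vertex T2) r (base T2) (t2.S \<omega>2) u" by simp
  then show "bk2 \<omega>2 u = 1" unfolding chain_ref line_kernel_def by simp
qed

lemma limit_kernel_first: "limit_kernel x (w, \<omega>2) = bk1 w (fst x)" by (simp add: limit_kernel_def)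

lemma limit_kernel_second: "limit_kernel x (\<omega>1, w) = bk2 w (snd x)"
  by (cases "w = \<omega>2") (simp_all add: limit_kernel_def bk_ref del: boundary_kernel.simps)

lemma kernel_eq_ratio:
  assumes "x \<in> X" "y \<in> X"
  shows "martin_kernel X hp.P ref x y = hp.kernel_ratio (fst x) (snd x) (base T1) (base T2) y"
proof -
  have g: "green X hp.P (a, b) (fst y, snd y) = gam q r (pred_vertex T1) (pred_vertex T2) a b (fst y) (snd y)"
    if "height T1 a + height T2 b = 0" for a b
    using hp.green_eq_gam[OF that, of "fst y" "snd y"] assms(2) unfolding X_eq in_X by blast
  show ?thesis unfolding martin_kernel_def
    using g[of "fst x" "snd x"] g[OF base_level] assms(1) unfolding in_X by simp
qed

lemma hat_kinds1: "w \<in> t1.hat \<Longrightarrow> (\<exists>a. w = Vertex a) \<or> (\<exists>\<xi>. w = End \<xi> \<and> line (pred_vertex T1) (t1.S w))"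
  by (erule t1.tree_hat_cases) auto

lemma hat_kinds2: "w \<in> t2.hat \<Longrightarrow> (\<exists>a. w = Vertex a) \<or> (\<exists>\<xi>. w = End \<xi> \<and> line (pred_vertex T2) (t2.S w))"
  by (erule t2.tree_hat_cases) auto

lemma first_in_H: "w \<in> t1.hat \<Longrightarrow> (w, \<omega>2) \<in> topspace H"
  and second_in_H: "u \<in> t2.hat \<Longrightarrow> (\<omega>1, u) \<in> topspace H"
  unfolding topspace_H using ref_in_hat by auto

lemma not_vertex: "(w, \<omega>2) \<notin> dl_embed ` X" "(\<omega>1, u) \<notin> dl_embed ` X"
  unfolding dl_embed_def by auto

lemma boundary_cases:
  assumes "z \<in> topspace H" "z \<notin> dl_embed ` X"
  obtains (first) w where "w \<in> t1.hat" "z = (w, \<omega>2)" | (second) w where "w \<in> t2.hat" "z = (\<omega>1, w)"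
proof -
  have "z \<in> t1.hat \<times> t2.hat" "fst z = \<omega>1 \<or> snd z = \<omega>2" using assms unfolding topspace_H by blast+
  then show thesis using first[of "fst z"] second[of "snd z"] by (metis mem_Times_iff prod.collapse)
qed

lemma ratio_limit_first:
  assumes w: "w \<in> t1.hat" and x: "x \<in> X"
  shows "(hp.kernel_ratio (fst x) (snd x) (base T1) (base T2) \<longlongrightarrow> bk1 w (fst x)) (nearH (w, \<omega>2))"
proof -
  have "hp.approaches (nearH (w, \<omega>2)) (t1.S w) {}" using nearH_approaches[OF first_in_H[OF w]] by (simp add: chain_ref del: chain_of.simps)
  then show ?thesis using hp.kernel_limit_first[OF _ base_level _ hat_kinds1[OF w]] x unfolding in_X by blast
qed

lemma ratio_limit_second:
  assumes w: "w \<in> t2.hat" and x: "x \<in> X"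
  shows "(hp.kernel_ratio (fst x) (snd x) (base T1) (base T2) \<longlongrightarrow> bk2 w (snd x)) (nearH (\<omega>1, w))"
proof -
  have "hp.approaches (nearH (\<omega>1, w)) {} (t2.S w)" using nearH_approaches[OF second_in_H[OF w]] by (simp add: chain_ref del: chain_of.simps)
  then show ?thesis using hp.kernel_limit_second[OF _ base_level _ hat_kinds2[OF w]] x unfolding in_X by blast
qed

lemma kernel_limit:
  assumes z: "z \<in> topspace H" "z \<notin> dl_embed ` X" and x: "x \<in> X"
  shows "(martin_kernel X hp.P ref x \<longlongrightarrow> limit_kernel x z) (nearH z)"
proof -
  have "(hp.kernel_ratio (fst x) (snd x) (base T1) (base T2) \<longlongrightarrow> limit_kernel x z) (nearH z)"
    using z
  proof (cases rule: boundary_cases)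
    case (first w)
    show ?thesis unfolding first limit_kernel_first by (rule ratio_limit_first[OF first(1) x])
  next
    case (second w)
    show ?thesis unfolding second limit_kernel_second by (rule ratio_limit_second[OF second(1) x])
  qed
  moreover have "\<forall>\<^sub>F y in nearH z. martin_kernel X hp.P ref x y = hp.kernel_ratio (fst x) (snd x) (base T1) (base T2) y"
    using eventually_near_domain[OF z(1)] by eventually_elim (rule kernel_eq_ratio[OF x])
  ultimately show ?thesis by (subst tendsto_cong)
qed

definition ext_kernel :: "'a \<times> 'b \<Rightarrow> 'a tree_point \<times> 'b tree_point \<Rightarrow> real" where
  "ext_kernel x z = (if z \<in> dl_embed ` X then martin_kernel X hp.P ref x (inv dl_embed z) else limit_kernel x z)"

lemma kernel_extension_ext:
  assumes x: "x \<in> X" shows "kernel_extension X hp.P ref H dl_embed x (ext_kernel x)"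
  unfolding kernel_extension_def
proof
  have dense: "H closure_of (dl_embed ` X) = topspace H"
    using compactification unfolding metrizable_compactification_def by (elim conjE)
  show v: "\<forall>y\<in>X. ext_kernel x (dl_embed y) = martin_kernel X hp.P ref x y"
    by (simp add: ext_kernel_def inv_f_f[OF inj_dl_embed])
  show "continuous_map H euclideanreal (ext_kernel x)"
  proof (rule continuous_map_limits[OF dense])
    fix z assume z: "z \<in> topspace H"
    show "(martin_kernel X hp.P ref x \<longlongrightarrow> ext_kernel x z) (nearH z)"
    proof (cases "z \<in> dl_embed ` X")
      case True
      then obtain y where y: "y \<in> X" "z = dl_embed y" by blast
      have "openin Z {z}" unfolding y by (rule openin_Z)
      from nearH_eventually[OF z this] have "\<forall>\<^sub>F y' in nearH z. dl_embed y' = dl_embed y" unfolding y(2) by simp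
      then have "\<forall>\<^sub>F y' in nearH z. martin_kernel X hp.P ref x y' = ext_kernel x z"
        by eventually_elim (use v y injD[OF inj_dl_embed] in metis)
      then show ?thesis by (rule tendsto_eventually)
    next
      case False
      then show ?thesis using kernel_limit[OF z False x] by (simp add: ext_kernel_def)
    qed
  qed
qed

lemma K_eq:
  assumes "z \<in> topspace H" "z \<notin> dl_embed ` X" "x \<in> X" shows "K x z = limit_kernel x z"
  using extended_kernel_eq[OF compactification kernel_extension_ext[OF assms(3)] assms(1)] assms(2)
  by (simp add: ext_kernel_def)

lemma K_first: "w \<in> t1.hat \<Longrightarrow> x \<in> X \<Longrightarrow> K x (w, \<omega>2) = bk1 w (fst x)"
  using K_eq[OF first_in_H not_vertex(1)] limit_kernel_first by simp

lemma K_second: "w \<in> t2.hat \<Longrightarrow> x \<in> X \<Longrightarrow> K x (\<omega>1, w) = bk2 w (snd x)"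
  using K_eq[OF second_in_H not_vertex(2)] limit_kernel_second by simp

text \<open>At points \<open>(\<omega>1, w)\<close> both sides are false: the kernel does not see
  the first coordinate, and the chain of \<open>\<omega>1\<close> is empty.\<close>

lemma limit_kernel_mem1:
  assumes z: "z \<in> topspace H" "z \<notin> dl_embed ` X" and v: "pred_vertex T1 v' = pred_vertex T1 v" "v' \<noteq> v"
  shows "limit_kernel (v', u) z < limit_kernel (v, u) z \<longleftrightarrow> v \<in> t1.S (fst z)"
  using z
proof (cases rule: boundary_cases)
  case (first w)
  show ?thesis unfolding first limit_kernel_first using t1.boundary_kernel_sibling[OF first(1) v] by simp
next
  case (second w)
  show ?thesis unfolding second limit_kernel_second using chain_ref by (simp del: chain_of.simps)
qed

lemma limit_kernel_mem2:
  assumes z: "z \<in> topspace H" "z \<notin> dl_embed ` X" and v: "pred_vertex T2 v' = pred_vertex T2 v" "v' \<noteq> v"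
  shows "limit_kernel (u, v') z < limit_kernel (u, v) z \<longleftrightarrow> v \<in> t2.S (snd z)"
  using z
proof (cases rule: boundary_cases)
  case (second w)
  show ?thesis unfolding second limit_kernel_second using t2.boundary_kernel_sibling[OF second(1) v] by simp
next
  case (first w)
  show ?thesis unfolding first limit_kernel_first using chain_ref by (simp del: chain_of.simps)
qed

lemma limit_kernel_separates:
  assumes z: "z \<in> topspace H" "z \<notin> dl_embed ` X" and y: "y \<in> topspace H" "y \<notin> dl_embed ` X"
    and eq: "\<And>x. x \<in> X \<Longrightarrow> limit_kernel x z = limit_kernel x y"
  shows "z = y"
proof -
  have "v \<in> t1.S (fst z) \<longleftrightarrow> v \<in> t1.S (fst y)" for v
  proof -
    obtain v' where v: "v' \<noteq> v" "pred_vertex T1 v' = pred_vertex T1 v" using t1.other_sibling by blast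
    obtain u where u: "height T1 v + height T2 u = 0" using hp.second_exists by blast
    have "height T1 v' = height T1 v" using v(2) t1.lev_par[of v] t1.lev_par[of v'] by simp
    then have "(v, u) \<in> X" "(v', u) \<in> X" using u unfolding in_X by simp_all
    from eq[OF this(1)] eq[OF this(2)] show ?thesis
      using limit_kernel_mem1[OF z v(2,1), of u] limit_kernel_mem1[OF y v(2,1), of u] by simp
  qed
  moreover have "v \<in> t2.S (snd z) \<longleftrightarrow> v \<in> t2.S (snd y)" for v
  proof -
    obtain v' where v: "v' \<noteq> v" "pred_vertex T2 v' = pred_vertex T2 v" using t2.other_sibling by blast
    obtain u where u: "height T1 u = - height T2 v" using t1.lev_surj by blast
    have "height T2 v' = height T2 v" using v(2) t2.lev_par[of v] t2.lev_par[of v'] by simp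
    then have "(u, v) \<in> X" "(u, v') \<in> X" using u unfolding in_X by simp_all
    from eq[OF this(1)] eq[OF this(2)] show ?thesis
      using limit_kernel_mem2[OF z v(2,1), of u] limit_kernel_mem2[OF y v(2,1), of u] by simp
  qed
  moreover have "fst z \<in> t1.hat" "snd z \<in> t2.hat" "fst y \<in> t1.hat" "snd y \<in> t2.hat"
    using z y unfolding topspace_H by auto
  ultimately show ?thesis using inj_onD[OF t1.chain_of_inj] inj_onD[OF t2.chain_of_inj] by (simp add: set_eq_iff prod_eq_iff)
qed

lemma martin_compactification:
  "is_martin_compactification TYPE('y) X hp.P ref H dl_embed"
  unfolding is_martin_compactification_def
proof (intro conjI allI impI)
  show "transition_matrix X hp.P" "irreducible_chain X hp.P" "transient_chain X hp.P"
    using hp.transition_dlP hp.irreducible_dlP hp.transient_dlP unfolding X_eq .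
  show "kernel_compactification X hp.P ref H dl_embed"
    unfolding kernel_compactification_def using compactification kernel_extension_ext by blast
  fix Y :: "'y topology" and j
  assume "kernel_compactification X hp.P ref Y j"
  then have Y: "metrizable_compactification X Y j" and ex: "\<forall>x\<in>X. \<exists>g. kernel_extension X hp.P ref Y j x g"
    unfolding kernel_compactification_def by auto
  obtain g where g: "\<And>x. x \<in> X \<Longrightarrow> kernel_extension X hp.P ref Y j x (g x)" using bchoice[OF ex] by blast
  \<comment> \<open>The Boolean selects between the kernel with start \<open>fst i\<close> and the
    indicator of that point.\<close>
  define gZ :: "('a \<times> 'b) \<times> bool \<Rightarrow> 'a tree_point \<times> 'b tree_point \<Rightarrow> real" where
    "gZ i = (if snd i then ext_kernel (fst i) else (\<lambda>z. if z = dl_embed (fst i) then 1 else 0))" for i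
  define gY :: "('a \<times> 'b) \<times> bool \<Rightarrow> 'y \<Rightarrow> real" where
    "gY i = (if snd i then g (fst i) else (\<lambda>z. if z = j (fst i) then 1 else 0))" for i
  note mc = metrizable_compactification_def
  show "\<exists>f. continuous_map Y H f \<and> (\<forall>x\<in>X. f (j x) = dl_embed x)"
  proof (rule factor_through_separating[where gZ = gZ and gY = gY and I = "X \<times> UNIV"])
    show "compact_space H" "dl_embed ` X \<subseteq> topspace H" using compactification unfolding mc by auto
    show "Y closure_of (j ` X) = topspace Y" using Y unfolding mc by (elim conjE)
    fix i :: "('a \<times> 'b) \<times> bool" assume i: "i \<in> X \<times> UNIV"
    then have iX: "fst i \<in> X" by auto
    show "continuous_map H euclideanreal (gZ i)"
      using kernel_extension_ext[OF iX] continuous_indicator_point[OF compactification iX]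
      unfolding gZ_def kernel_extension_def by (cases "snd i") simp_all
    show "continuous_map Y euclideanreal (gY i)"
      using g[OF iX] continuous_indicator_point[OF Y iX]
      unfolding gY_def kernel_extension_def by (cases "snd i") simp_all
    fix x assume x: "x \<in> X"
    have "inj_on j X" using Y unfolding mc by (elim conjE)
    then have "dl_embed x = dl_embed (fst i) \<longleftrightarrow> j x = j (fst i)"
      using inj_onD[of j X x "fst i"] injD[OF inj_dl_embed, of x "fst i"] x iX by auto
    then show "gZ i (dl_embed x) = gY i (j x)"
      using kernel_extension_ext[OF iX] g[OF iX] x unfolding gZ_def gY_def kernel_extension_def by (cases "snd i") simp_all
  next
    fix z w assume z: "z \<in> topspace H" and w: "w \<in> topspace H" and eq: "\<And>i. i \<in> X \<times> UNIV \<Longrightarrow> gZ i z = gZ i w"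
    have ind: "z = dl_embed x \<longleftrightarrow> w = dl_embed x" if "x \<in> X" for x
      using eq[of "(x, False)"] that unfolding gZ_def by (auto split: if_splits)
    show "z = w"
    proof (cases "z \<in> dl_embed ` X \<or> w \<in> dl_embed ` X")
      case True then show ?thesis using ind by auto
    next
      case False
      have "limit_kernel x z = limit_kernel x w" if "x \<in> X" for x
        using eq[of "(x, True)"] that False unfolding gZ_def ext_kernel_def by simp
      then show ?thesis using limit_kernel_separates[OF z _ w] False by blast
    qed
  qed
qed

lemma positive_first:
  assumes w: "w \<in> t1.hat" shows "positive_harmonic X hp.P (\<lambda>x. bk1 w (fst x))"
proof -
  have z: "(w, \<omega>2) \<in> topspace H" by (rule first_in_H[OF w])
  have ap: "hp.approaches (nearH (w, \<omega>2)) (t1.S w) {}" using nearH_approaches[OF z] by (simp add: chain_ref del: chain_of.simps)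
  have "hp.dl_harm (\<lambda>a b. bk1 w a)"
  proof (rule hp.boundary_harmonic[OF ap nearH_not_bot[OF z] _ base_level])
    fix a b assume "height T1 a + height T2 b = 0"
    then show "(hp.kernel_ratio a b (base T1) (base T2) \<longlongrightarrow> bk1 w a) (nearH (w, \<omega>2))"
      using ratio_limit_first[OF w, of "(a, b)"] unfolding in_X by simp
  qed simp
  then show ?thesis using hp.positive_harmonicI[of "\<lambda>a b. bk1 w a"] t1.boundary_kernel_pos[OF w] unfolding X_eq by blast
qed

lemma positive_second:
  assumes w: "w \<in> t2.hat" shows "positive_harmonic X hp.P (\<lambda>x. bk2 w (snd x))"
proof -
  have z: "(\<omega>1, w) \<in> topspace H" by (rule second_in_H[OF w])
  have ap: "hp.approaches (nearH (\<omega>1, w)) {} (t2.S w)" using nearH_approaches[OF z] by (simp add: chain_ref del: chain_of.simps)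
  have "hp.dl_harm (\<lambda>a b. bk2 w b)"
  proof (rule hp.boundary_harmonic[OF ap nearH_not_bot[OF z] _ base_level])
    fix a b assume "height T1 a + height T2 b = 0"
    then show "(hp.kernel_ratio a b (base T1) (base T2) \<longlongrightarrow> bk2 w b) (nearH (\<omega>1, w))"
      using ratio_limit_second[OF w, of "(a, b)"] unfolding in_X by simp
  qed simp
  then show ?thesis using hp.positive_harmonicI[of "\<lambda>a b. bk2 w b"] t2.boundary_kernel_pos[OF w] unfolding X_eq by blast
qed

lemma K_positive_first: "w \<in> t1.hat \<Longrightarrow> positive_harmonic X hp.P (\<lambda>x. K x (w, \<omega>2))"
  using positive_harmonic_cong[of X "\<lambda>x. K x (w, \<omega>2)" "\<lambda>x. bk1 w (fst x)"] K_first positive_first by metis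

lemma K_positive_second: "w \<in> t2.hat \<Longrightarrow> positive_harmonic X hp.P (\<lambda>x. K x (\<omega>1, w))"
  using positive_harmonic_cong[of X "\<lambda>x. K x (\<omega>1, w)" "\<lambda>x. bk2 w (snd x)"] K_second positive_second by metis

lemma K_minimal_first:
  assumes w: "End \<xi> \<in> t1.hat" shows "minimal_harmonic X hp.P ref (\<lambda>x. K x (End \<xi>, \<omega>2))"
  unfolding minimal_harmonic_def
proof (intro conjI allI impI)
  show "positive_harmonic X hp.P (\<lambda>x. K x (End \<xi>, \<omega>2))" by (rule K_positive_first[OF w])
  show "K ref (End \<xi>, \<omega>2) = 1" using K_first[OF w ref_in_X] t1.boundary_kernel_base[OF w] by simp
  fix h1 assume h1: "positive_harmonic X hp.P h1 \<and> (\<forall>x\<in>X. h1 x \<le> K x (End \<xi>, \<omega>2))"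
  have L: "line (pred_vertex T1) (t1.S (End \<xi>))" using hat_kinds1[OF w] by blast
  have "\<exists>c. \<forall>x\<in>hp.X. h1 x = c * line_kernel (pred_vertex T1) q (base T1) (t1.S (End \<xi>)) (fst x)"
    by (rule hp.minimal_first[OF _ L t1.line_kernel_weight[OF L]]) (use h1 K_first[OF w] X_eq in auto)
  then show "\<exists>c. \<forall>x\<in>X. h1 x = c * K x (End \<xi>, \<omega>2)" unfolding X_eq using K_first[OF w] by auto
qed

lemma K_minimal_second:
  assumes w: "End \<xi> \<in> t2.hat" shows "minimal_harmonic X hp.P ref (\<lambda>x. K x (\<omega>1, End \<xi>))"
  unfolding minimal_harmonic_def
proof (intro conjI allI impI)
  show "positive_harmonic X hp.P (\<lambda>x. K x (\<omega>1, End \<xi>))" by (rule K_positive_second[OF w])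
  show "K ref (\<omega>1, End \<xi>) = 1" using K_second[OF w ref_in_X] t2.boundary_kernel_base[OF w] by simp
  fix h1 assume h1: "positive_harmonic X hp.P h1 \<and> (\<forall>x\<in>X. h1 x \<le> K x (\<omega>1, End \<xi>))"
  have L: "line (pred_vertex T2) (t2.S (End \<xi>))" using hat_kinds2[OF w] by blast
  have "\<exists>c. \<forall>x\<in>hp.X. h1 x = c * line_kernel (pred_vertex T2) r (base T2) (t2.S (End \<xi>)) (snd x)"
    by (rule hp.minimal_second[OF _ L t2.line_kernel_weight[OF L]]) (use h1 K_second[OF w] X_eq in auto)
  then show "\<exists>c. \<forall>x\<in>X. h1 x = c * K x (\<omega>1, End \<xi>)" unfolding X_eq using K_second[OF w] by auto
qed

lemma K_not_minimal_first: "\<not> minimal_harmonic X hp.P ref (\<lambda>x. K x (Vertex a, \<omega>2))"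
proof
  assume m: "minimal_harmonic X hp.P ref (\<lambda>x. K x (Vertex a, \<omega>2))"
  let ?b = "pred_vertex T1 a"
  obtain M where M: "M > 0" "\<And>x. bk1 (Vertex ?b) x \<le> M * bk1 (Vertex a) x" using t1.boundary_kernel_par_le by blast
  have "positive_harmonic X hp.P (\<lambda>x. bk1 (Vertex ?b) (fst x) / M)"
    by (rule positive_harmonic_divide[OF positive_first[OF t1.Vertex_in_hat] M(1)])
  moreover have "\<forall>x\<in>X. bk1 (Vertex ?b) (fst x) / M \<le> K x (Vertex a, \<omega>2)"
    using M K_first[OF t1.Vertex_in_hat] by (simp add: divide_le_eq mult.commute del: boundary_kernel.simps)
  ultimately obtain c where c: "\<And>x. x \<in> X \<Longrightarrow> bk1 (Vertex ?b) (fst x) / M = c * K x (Vertex a, \<omega>2)"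
    using m unfolding minimal_harmonic_def by blast
  show False
  proof (rule t1.boundary_kernel_par_not_multiple)
    fix v
    obtain u where "height T1 v + height T2 u = 0" using hp.second_exists by blast
    then have "(v, u) \<in> X" unfolding in_X by simp
    from c[OF this] K_first[OF t1.Vertex_in_hat this, of a] M(1)
    show "bk1 (Vertex ?b) v = (c * M) * bk1 (Vertex a) v" by (simp add: divide_eq_eq mult.commute mult.left_commute del: boundary_kernel.simps)
  qed
qed

lemma K_not_minimal_second: "\<not> minimal_harmonic X hp.P ref (\<lambda>x. K x (\<omega>1, Vertex a))"
proof
  assume m: "minimal_harmonic X hp.P ref (\<lambda>x. K x (\<omega>1, Vertex a))"
  let ?b = "pred_vertex T2 a"
  obtain M where M: "M > 0" "\<And>x. bk2 (Vertex ?b) x \<le> M * bk2 (Vertex a) x" using t2.boundary_kernel_par_le by blast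
  have "positive_harmonic X hp.P (\<lambda>x. bk2 (Vertex ?b) (snd x) / M)"
    by (rule positive_harmonic_divide[OF positive_second[OF t2.Vertex_in_hat] M(1)])
  moreover have "\<forall>x\<in>X. bk2 (Vertex ?b) (snd x) / M \<le> K x (\<omega>1, Vertex a)"
    using M K_second[OF t2.Vertex_in_hat] by (simp add: divide_le_eq mult.commute del: boundary_kernel.simps)
  ultimately obtain c where c: "\<And>x. x \<in> X \<Longrightarrow> bk2 (Vertex ?b) (snd x) / M = c * K x (\<omega>1, Vertex a)"
    using m unfolding minimal_harmonic_def by blast
  show False
  proof (rule t2.boundary_kernel_par_not_multiple)
    fix v
    obtain u where "height T1 u = - height T2 v" using t1.lev_surj by blast
    then have "(u, v) \<in> X" unfolding in_X by simp
    from c[OF this] K_second[OF t2.Vertex_in_hat this, of a] M(1)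
    show "bk2 (Vertex ?b) v = (c * M) * bk2 (Vertex a) v" by (simp add: divide_eq_eq mult.commute mult.left_commute del: boundary_kernel.simps)
  qed
qed

lemma proper_end_in_hat: "\<xi> \<in> proper_ends T1 \<Longrightarrow> End \<xi> \<in> t1.hat" "\<zeta> \<in> proper_ends T2 \<Longrightarrow> End \<zeta> \<in> t2.hat"
  unfolding proper_ends_def tree_hat_def by auto

lemma boundary_eq:
  "topspace H - dl_embed ` X =
     (End ` proper_ends T1 \<times> {\<omega>2}) \<union> ({\<omega>1} \<times> End ` proper_ends T2) \<union> {(\<omega>1, \<omega>2)} \<union>
     (range Vertex \<times> {\<omega>2}) \<union> ({\<omega>1} \<times> range Vertex)" (is "_ = ?R")
proof (intro equalityI subsetI)
  fix z assume "z \<in> topspace H - dl_embed ` X"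
  then have "z \<in> topspace H" "z \<notin> dl_embed ` X" by auto
  then show "z \<in> ?R"
  proof (cases rule: boundary_cases)
    case (first w)
    then have "w \<in> range Vertex \<or> w = \<omega>1 \<or> w \<in> End ` proper_ends T1" unfolding tree_hat_def proper_ends_def by blast
    then show ?thesis unfolding first(2) by blast
  next
    case (second w)
    then have "w \<in> range Vertex \<or> w = \<omega>2 \<or> w \<in> End ` proper_ends T2" unfolding tree_hat_def proper_ends_def by blast
    then show ?thesis unfolding second(2) by blast
  qed
next
  fix z assume "z \<in> ?R"
  then have "(\<exists>w\<in>t1.hat. z = (w, \<omega>2)) \<or> (\<exists>w\<in>t2.hat. z = (\<omega>1, w))"
    using proper_end_in_hat t1.Vertex_in_hat t2.Vertex_in_hat ref_in_hat by blast
  then show "z \<in> topspace H - dl_embed ` X"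
    by (elim disjE bexE) (simp_all only: DiffI first_in_H second_in_H not_vertex not_False_eq_True)
qed

lemma step_eq: "dl_step (1 / 2) q r T1 T2 = hp.P"
  by (intro ext) (simp add: dl_step_def dlP_def)

end

theorem theorem5p4:
  fixes T1 :: "'a pointed_tree" and T2 :: "'b pointed_tree" and q r :: nat and \<alpha> :: real
  assumes "q \<ge> 2" and "r \<ge> 2"
    and "homogeneous_tree q T1" and "homogeneous_tree r T2"
    and "\<alpha> = 1 / 2"
  shows
    "let X = DL T1 T2;
         P = dl_step \<alpha> q r T1 T2;
         ref = (base T1, base T2);
         \<omega>1 = End (ref_end T1);
         \<omega>2 = End (ref_end T2);
         K = extended_kernel X P ref (DL_hat T1 T2) dl_embed;
         K1 = tree_end_kernel T1 (tree_step \<alpha> q T1);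
         K2 = tree_end_kernel T2 (tree_step (1 - \<alpha>) r T2)
     in
       is_martin_compactification TYPE('y) X P ref (DL_hat T1 T2) dl_embed \<and>
       topspace (DL_hat T1 T2) - dl_embed ` X =
         (End ` proper_ends T1 \<times> {\<omega>2}) \<union> ({\<omega>1} \<times> End ` proper_ends T2) \<union> {(\<omega>1, \<omega>2)} \<union>
         (range Vertex \<times> {\<omega>2}) \<union> ({\<omega>1} \<times> range Vertex) \<and>
       (\<forall>(x1, x2)\<in>X.
          (\<forall>\<xi>1\<in>proper_ends T1. K (x1, x2) (End \<xi>1, \<omega>2) = K1 x1 \<xi>1) \<and>
          (\<forall>\<xi>2\<in>proper_ends T2. K (x1, x2) (\<omega>1, End \<xi>2) = K2 x2 \<xi>2) \<and>
          K (x1, x2) (\<omega>1, \<omega>2) = 1 \<and>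
          (\<forall>y1. K (x1, x2) (Vertex y1, \<omega>2) =
             spherical_half q T1 x1 y1 / spherical_half q T1 (base T1) y1) \<and>
          (\<forall>y2. K (x1, x2) (\<omega>1, Vertex y2) =
             spherical_half r T2 x2 y2 / spherical_half r T2 (base T2) y2)) \<and>
       (\<forall>\<xi>1\<in>proper_ends T1. minimal_harmonic X P ref (\<lambda>x. K x (End \<xi>1, \<omega>2))) \<and>
       (\<forall>\<xi>2\<in>proper_ends T2. minimal_harmonic X P ref (\<lambda>x. K x (\<omega>1, End \<xi>2))) \<and>
       minimal_harmonic X P ref (\<lambda>x. K x (\<omega>1, \<omega>2)) \<and>
       (\<forall>y1. positive_harmonic X P (\<lambda>x. K x (Vertex y1, \<omega>2)) \<and>
             \<not> minimal_harmonic X P ref (\<lambda>x. K x (Vertex y1, \<omega>2))) \<and>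
       (\<forall>y2. positive_harmonic X P (\<lambda>x. K x (\<omega>1, Vertex y2)) \<and>
             \<not> minimal_harmonic X P ref (\<lambda>x. K x (\<omega>1, Vertex y2)))"
proof -
  interpret t1: pointed_horotree T1 q by (rule pointed_horotreeI[OF assms(3,1)])
  interpret t2: pointed_horotree T2 r by (rule pointed_horotreeI[OF assms(4,2)])
  interpret dl_setup T1 T2 q r ..
  \<comment> \<open>Both projections have the same parameter, so one analysis of the tree walk
    serves for both.\<close>
  have half: "1 - 1 / 2 = (1 / 2 :: real)" by simp
  show ?thesis
    unfolding Let_def assms(5) half step_eq
  proof (intro conjI ballI allI)
    show "is_martin_compactification TYPE('y) X hp.P ref H dl_embed" by (rule martin_compactification)
    show "topspace H - dl_embed ` X =
         (End ` proper_ends T1 \<times> {\<omega>2}) \<union> ({\<omega>1} \<times> End ` proper_ends T2) \<union> {(\<omega>1, \<omega>2)} \<union>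
         (range Vertex \<times> {\<omega>2}) \<union> ({\<omega>1} \<times> range Vertex)" by (rule boundary_eq)
    fix x assume x: "x \<in> X"
    obtain x1 x2 where x12: "x = (x1, x2)" by (cases x) blast
    have K1: "K (x1, x2) (w, \<omega>2) = bk1 w x1" if "w \<in> t1.hat" for w using K_first[OF that x] x12 by simp
    have K2: "K (x1, x2) (\<omega>1, w) = bk2 w x2" if "w \<in> t2.hat" for w using K_second[OF that x] x12 by simp
    show "case x of (x1, x2) \<Rightarrow>
          (\<forall>\<xi>1\<in>proper_ends T1. K (x1, x2) (End \<xi>1, \<omega>2) = tree_end_kernel T1 (tree_step (1 / 2) q T1) x1 \<xi>1) \<and>
          (\<forall>\<xi>2\<in>proper_ends T2. K (x1, x2) (\<omega>1, End \<xi>2) = tree_end_kernel T2 (tree_step (1 / 2) r T2) x2 \<xi>2) \<and>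
          K (x1, x2) (\<omega>1, \<omega>2) = 1 \<and>
          (\<forall>y1. K (x1, x2) (Vertex y1, \<omega>2) =
             spherical_half q T1 x1 y1 / spherical_half q T1 (base T1) y1) \<and>
          (\<forall>y2. K (x1, x2) (\<omega>1, Vertex y2) =
             spherical_half r T2 x2 y2 / spherical_half r T2 (base T2) y2)"
      unfolding x12 prod.case
    proof (intro conjI ballI allI)
      show "K (x1, x2) (\<omega>1, \<omega>2) = 1" using K1[OF ref_in_hat(1)] bk_ref(1) by simp
    next
      fix \<xi> assume \<xi>: "\<xi> \<in> proper_ends T1"
      show "K (x1, x2) (End \<xi>, \<omega>2) = tree_end_kernel T1 (tree_step (1 / 2) q T1) x1 \<xi>"
        unfolding K1[OF proper_end_in_hat(1)[OF \<xi>]] t1.tree_end_kernel_eq[OF \<xi>] ..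
    next
      fix \<xi> assume \<xi>: "\<xi> \<in> proper_ends T2"
      show "K (x1, x2) (\<omega>1, End \<xi>) = tree_end_kernel T2 (tree_step (1 / 2) r T2) x2 \<xi>"
        unfolding K2[OF proper_end_in_hat(2)[OF \<xi>]] t2.tree_end_kernel_eq[OF \<xi>] ..
    next
      fix y1 show "K (x1, x2) (Vertex y1, \<omega>2) = spherical_half q T1 x1 y1 / spherical_half q T1 (base T1) y1"
        unfolding K1[OF t1.Vertex_in_hat] t1.spherical_half_eq by simp
    next
      fix y2 show "K (x1, x2) (\<omega>1, Vertex y2) = spherical_half r T2 x2 y2 / spherical_half r T2 (base T2) y2"
        unfolding K2[OF t2.Vertex_in_hat] t2.spherical_half_eq by simp
    qed
  next
    \<comment> \<open>The reference end is itself an end, with empty line, so the constant kernel is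
      a special case.\<close>
    show "minimal_harmonic X hp.P ref (\<lambda>x. K x (\<omega>1, \<omega>2))" by (rule K_minimal_first[OF ref_in_hat(1)])
    show "minimal_harmonic X hp.P ref (\<lambda>x. K x (End \<xi>, \<omega>2))" if "\<xi> \<in> proper_ends T1" for \<xi>
      by (rule K_minimal_first[OF proper_end_in_hat(1)[OF that]])
    show "minimal_harmonic X hp.P ref (\<lambda>x. K x (\<omega>1, End \<xi>))" if "\<xi> \<in> proper_ends T2" for \<xi>
      by (rule K_minimal_second[OF proper_end_in_hat(2)[OF that]])
    show "positive_harmonic X hp.P (\<lambda>x. K x (Vertex y, \<omega>2))" for y by (rule K_positive_first[OF t1.Vertex_in_hat])
    show "positive_harmonic X hp.P (\<lambda>x. K x (\<omega>1, Vertex y))" for y by (rule K_positive_second[OF t2.Vertex_in_hat])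
    show "\<not> minimal_harmonic X hp.P ref (\<lambda>x. K x (Vertex y, \<omega>2))" for y by (rule K_not_minimal_first)
    show "\<not> minimal_harmonic X hp.P ref (\<lambda>x. K x (\<omega>1, Vertex y))" for y by (rule K_not_minimal_second)
  qed
qed

end
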